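(* Let $T>0$, let $f:\mathbb{R}\to\mathbb{R}$ be Lipschitz with $f(0)=0$ and such that the derivative $f'(0)$ exists, and let $u_0\in BV(\mathbb{R})\cap L^1(\mathbb{R})$ be nonnegative. Let $N\ge 1$ and let $x_0^1<x_0^2<\dots<x_0^N$ be arbitrary real numbers (initial particle positions). Then the particle path scheme with data $f$, $u_0$, $(x_0^i)_{i=1}^N$ (see context) generates a unique approximation $v$ on $\mathbb{R}\times[0,T]$, and this approximation satisfies $$\|v(T)-u(T)\|_{L^1(\mathbb{R})}\le \|v_0-u_0\|_{L^1(\mathbb{R})}+2\sqrt{2\,|u_0|_{BV(\mathbb{R})}\,\|Av-f(v)\|_{L^1(\mathbb{R}\times(0,T))}},$$ where $u$ is the entropy solution of $\partial_t u+\partial_x f(u)=0$, $u(0)=u_0$, and $v_0$ and $A$ are the piecewise constant initial approximation and the interpolated velocity field of the scheme (see context).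
   Context: $|\cdot|_{BV(\mathbb{R})}$ is the total variation on $\mathbb{R}$; $\chi_I$ is the indicator function of $I$; $\operatorname{sgn}(0)=0$. Entropy solution: a function $u\in L^\infty(\mathbb{R}\times(0,T))$ which is a weak solution, i.e. $\int_0^T\int_{\mathbb{R}} u\,\partial_t\varphi+f(u)\,\partial_x\varphi\,dx\,dt+\int_{\mathbb{R}}u_0\,\varphi(x,0)\,dx=0$ for all $\varphi\in C_c^\infty(\mathbb{R}\times[0,T))$, and satisfies $\int_0^T\int_{\mathbb{R}}\eta(u)\,\partial_t\varphi+q(u)\,\partial_x\varphi\,dx\,dt+\int_{\mathbb{R}}\eta(u_0)\,\varphi(x,0)\,dx\ge0$ for all $0\le\varphi\in C_c^\infty(\mathbb{R}\times[0,T))$ and all pairs $(\eta,q)$ with $\eta$ convex and $q'=\eta'f'$; it is enough to take $\eta_k(u)=|u-k|$, $q_k(u)=\operatorname{sgn}(u-k)(f(u)-f(k))$ for all $k\in\mathbb{R}$. The entropy solution is unique, and $u(T)$ is the value of its $L^1$-continuous-in-time representative. Velocity function: $a(v)=f(v)/v$ for $v\ne0$, $a(0)=f'(0)$; $V(v_l,v_r)=\min_{v\in[v_l,v_r]}a(v)$ if $0\le v_l\le v_r$, and $V(v_l,v_r)=\max_{v\in[v_r,v_l]}a(v)$ if $0\le v_r\le v_l$. Particle path scheme. Initialization: set $x_0^0=-\infty$, $x_0^{N+1}=+\infty$, $v_0^i=\frac{1}{x_0^{i+1}-x_0^i}\int_{x_0^i}^{x_0^{i+1}}u_0\,dx$ for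 $1\le i\le N-1$, $v_0^0=v_0^N=0$, and $v_0(x)=\sum_{i=0}^N v_0^i\chi_{(x_0^i,x_0^{i+1})}(x)$. For all $t$ put $x_t^0=-\infty$, $x_t^{N+1}=+\infty$, $v_t^0=v_t^N=0$. Stages: $t_0=0$, $\mathcal{I}_0=\{1,\dots,N\}$. At stage $j$, with time $t_j<T$, remaining index set $\mathcal{I}_j\ni N$, $N_j=|\mathcal{I}_j|$, let $\pi_j:\{1,\dots,N_j\}\to\mathcal{I}_j$ be the increasing bijection, extended by $\pi_j(0)=0$, $\pi_j(N_j+1)=N+1$. On $(t_j,t_{j+1})$ the positions $x_t^{\pi_j(i)}$, $1\le i\le N_j$, are $C^1$, strictly increasing in $i$, and solve $\dot x_t^{\pi_j(i)}=V(v_t^{\pi_j(i-1)},v_t^{\pi_j(i)})$ with the values at $t_j$ as initial data, where for $1\le i\le N_j-1$ $$v_t^{\pi_j(i)}=\frac{x_{t_j}^{\pi_j(i+1)}-x_{t_j}^{\pi_j(i)}}{x_t^{\pi_j(i+1)}-x_t^{\pi_j(i)}}\,v_{t_j}^{\pi_j(i)}.$$ Here $t_{j+1}\in(t_j,T]$ is the first time at which two or more particles meet, or $T$ if there is no such time before $T$. Values at $t_{j+1}$ are limits as $t\uparrow t_{j+1}$. Put $\mathcal{I}_{j+1}=\{\pi_j(i): 1\le i\le N_j,\ x_{t_{j+1}}^{\pi_j(i)}\ne x_{t_{j+1}}^{\pi_j(i+1)}\}$ (the leftmost particles of each collision and their densities are deleted), define $N_{j+1},\pi_{j+1}$ accordingly,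 and continue from $t_{j+1}$ with the remaining particles and densities; stop when $t_{j+1}=T$. There are finitely many stages. Approximation: $v(x,t)=\sum_{i=0}^{N_j}v_t^{\pi_j(i)}\chi_{(x_t^{\pi_j(i)},x_t^{\pi_j(i+1)})}(x)$ for $t\in[t_j,t_{j+1})$, and with the final index set at $t=T$. Velocity field: for $t\in[t_j,t_{j+1})$ (and at $t=T$ with the final index set), $$A(x,t)=\frac{x_t^{\pi_j(i+1)}-x}{x_t^{\pi_j(i+1)}-x_t^{\pi_j(i)}}V(v_t^{\pi_j(i-1)},v_t^{\pi_j(i)})+\frac{x-x_t^{\pi_j(i)}}{x_t^{\pi_j(i+1)}-x_t^{\pi_j(i)}}V(v_t^{\pi_j(i)},v_t^{\pi_j(i+1)})$$ for $x\in[x_t^{\pi_j(i)},x_t^{\pi_j(i+1)}]$, $1\le i\le N_j-1$, and $A(\cdot,t)$ is constant to the left of the first and to the right of the last remaining particle, with the value of $V$ at that particle. *)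

theory Defs
  imports "HOL-Analysis.Analysis"
begin

section \<open>Total variation\<close>

text \<open>
  The total variation of the measure \<open>Dg\<close>, by duality. It depends only on the almost-everywhere
  class of \<open>g\<close>. For integrable \<open>g\<close>, all integrals below exist.
\<close>

definition variation_pairings :: "(real \<Rightarrow> real) \<Rightarrow> real set" where
  "variation_pairings g =
     {LINT x|lborel. g x * deriv \<phi> x | \<phi>.
        \<phi> C1_differentiable_on UNIV \<and> compact (closure {x. \<phi> x \<noteq> 0}) \<and> (\<forall>x. \<bar>\<phi> x\<bar> \<le> 1)}"

definition finite_BV :: "(real \<Rightarrow> real) \<Rightarrow> bool" where
  "finite_BV g \<longleftrightarrow> bdd_above (variation_pairings g)"

definition total_var :: "(real \<Rightarrow> real) \<Rightarrow> real" where
  "total_var g = Sup (variation_pairings g)"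


section \<open>Entropy solutions\<close>

text \<open>Points of the plane are pairs \<open>(x, t)\<close>.\<close>

primrec Ck_plane :: "nat \<Rightarrow> (real \<times> real \<Rightarrow> real) \<Rightarrow> bool" where
  "Ck_plane 0 \<phi> \<longleftrightarrow> continuous_on UNIV \<phi>"
| "Ck_plane (Suc k) \<phi> \<longleftrightarrow>
     (\<exists>p q. (\<forall>z. (\<phi> has_derivative (\<lambda>h. p z * fst h + q z * snd h)) (at z)) \<and>
            Ck_plane k p \<and> Ck_plane k q)"

text \<open>
  Elements of \<open>C\<^sub>c\<^sup>\<infinity>(\<real> \<times> [0,T))\<close> are the restrictions to \<open>t \<ge> 0\<close> of smooth functions on the plane
  with compact support in \<open>\<real> \<times> (-\<infinity>,T)\<close>. Only values at \<open>t \<ge> 0\<close> are used below.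
\<close>

definition test_function :: "real \<Rightarrow> (real \<times> real \<Rightarrow> real) \<Rightarrow> bool" where
  "test_function T \<phi> \<longleftrightarrow>
     (\<forall>k. Ck_plane k \<phi>) \<and>
     compact (closure {z. \<phi> z \<noteq> 0}) \<and> closure {z. \<phi> z \<noteq> 0} \<subseteq> UNIV \<times> {..<T}"

definition dx :: "(real \<times> real \<Rightarrow> real) \<Rightarrow> real \<times> real \<Rightarrow> real" where
  "dx \<phi> z = deriv (\<lambda>y. \<phi> (y, snd z)) (fst z)"

definition dt :: "(real \<times> real \<Rightarrow> real) \<Rightarrow> real \<times> real \<Rightarrow> real" where
  "dt \<phi> z = deriv (\<lambda>s. \<phi> (fst z, s)) (snd z)"

definition balance ::
    "(real \<Rightarrow> real) \<Rightarrow> (real \<Rightarrow> real) \<Rightarrow> (real \<Rightarrow> real) \<Rightarrow> real \<Rightarrow> (real \<Rightarrow> real \<Rightarrow> real)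
      \<Rightarrow> (real \<times> real \<Rightarrow> real) \<Rightarrow> real" where
  "balance \<eta> q u0 T u \<phi> =
     (LINT z:UNIV \<times> {0<..<T}|lborel.
        \<eta> (u (fst z) (snd z)) * dt \<phi> z + q (u (fst z) (snd z)) * dx \<phi> z)
     + (LINT x|lborel. \<eta> (u0 x) * \<phi> (x, 0))"

text \<open>
  A convex \<open>\<eta>\<close> and a Lipschitz \<open>f\<close> are differentiable almost everywhere only, so \<open>q' = \<eta>' f'\<close> is
  required at almost every point (where both derivatives exist); local Lipschitz continuity of
  \<open>q\<close> makes this determine \<open>q\<close> up to a constant.
\<close>

definition entropy_pair :: "(real \<Rightarrow> real) \<Rightarrow> (real \<Rightarrow> real) \<Rightarrow> (real \<Rightarrow> real) \<Rightarrow> bool" where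
  "entropy_pair f \<eta> q \<longleftrightarrow>
     convex_on UNIV \<eta> \<and>
     (\<forall>a b. \<exists>L. L-lipschitz_on {a..b} q) \<and>
     (AE s in lborel. \<forall>d e. (\<eta> has_real_derivative d) (at s) \<and> (f has_real_derivative e) (at s)
        \<longrightarrow> (q has_real_derivative d * e) (at s))"

definition entropy_solution ::
    "(real \<Rightarrow> real) \<Rightarrow> (real \<Rightarrow> real) \<Rightarrow> real \<Rightarrow> (real \<Rightarrow> real \<Rightarrow> real) \<Rightarrow> bool" where
  "entropy_solution f u0 T u \<longleftrightarrow>
     set_borel_measurable lborel (UNIV \<times> {0<..<T}) (\<lambda>z. u (fst z) (snd z)) \<and>
     (\<exists>M. AE z in lborel. snd z \<in> {0<..<T} \<longrightarrow> \<bar>u (fst z) (snd z)\<bar> \<le> M) \<and>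
     (\<forall>\<phi>. test_function T \<phi> \<longrightarrow> balance (\<lambda>s. s) f u0 T u \<phi> = 0) \<and>
     (\<forall>\<eta> q \<phi>. entropy_pair f \<eta> q \<and> test_function T \<phi> \<and> (\<forall>x t. 0 \<le> t \<longrightarrow> 0 \<le> \<phi> (x, t))
        \<longrightarrow> 0 \<le> balance \<eta> q u0 T u \<phi>)"

definition L1_continuous_representative ::
    "real \<Rightarrow> (real \<Rightarrow> real \<Rightarrow> real) \<Rightarrow> (real \<Rightarrow> real \<Rightarrow> real) \<Rightarrow> bool" where
  "L1_continuous_representative T u w \<longleftrightarrow>
     (AE z in lborel. snd z \<in> {0<..<T} \<longrightarrow> w (fst z) (snd z) = u (fst z) (snd z)) \<and>
     (\<forall>t\<in>{0..T}. integrable lborel (\<lambda>x. w x t)) \<and>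
     (\<forall>s\<in>{0..T}. ((\<lambda>t. LINT x|lborel. \<bar>w x t - w x s\<bar>) \<longlongrightarrow> 0) (at s within {0..T}))"


section \<open>The particle path scheme\<close>

definition vel :: "(real \<Rightarrow> real) \<Rightarrow> real \<Rightarrow> real" where
  "vel f v = (if v = 0 then deriv f 0 else f v / v)"

text \<open>
  For continuous \<open>f\<close> with \<open>f 0 = 0\<close>, differentiable at \<open>0\<close>, the function \<open>vel f\<close> is continuous, so
  the infimum and supremum are attained.
\<close>

definition Vel :: "(real \<Rightarrow> real) \<Rightarrow> real \<Rightarrow> real \<Rightarrow> real" where
  "Vel f vl vr = (if vl \<le> vr then Inf (vel f ` {vl..vr}) else Sup (vel f ` {vr..vl}))"

text \<open>The increasing enumeration \<open>\<pi>\<close> of an index set \<open>S \<subseteq> {1..N}\<close>, with \<open>\<pi>(0) = 0\<close> and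
  \<open>\<pi>(|S| + 1) = N + 1\<close>.\<close>

definition enum :: "nat \<Rightarrow> nat set \<Rightarrow> nat \<Rightarrow> nat" where
  "enum N S i =
     (if i = 0 then 0 else if i \<le> card S then sorted_list_of_set S ! (i - 1) else N + 1)"

definition pos :: "nat \<Rightarrow> (nat \<Rightarrow> real) \<Rightarrow> nat \<Rightarrow> ereal" where
  "pos N y i = (if i = 0 then -\<infinity> else if i = N + 1 then \<infinity> else ereal (y i))"

definition step_profile :: "nat \<Rightarrow> nat set \<Rightarrow> (nat \<Rightarrow> real) \<Rightarrow> (nat \<Rightarrow> real) \<Rightarrow> real \<Rightarrow> real" where
  "step_profile N S y d x =
     (\<Sum>i=0..card S. d (enum N S i) *
        indicator {pos N y (enum N S i)<..<pos N y (enum N S (i + 1))} (ereal x))"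

definition interpolated_field ::
    "(real \<Rightarrow> real) \<Rightarrow> nat \<Rightarrow> nat set \<Rightarrow> (nat \<Rightarrow> real) \<Rightarrow> (nat \<Rightarrow> real) \<Rightarrow> (real \<Rightarrow> real) \<Rightarrow> bool" where
  "interpolated_field f N S y d A \<longleftrightarrow>
     (let n = card S; p = enum N S in
       (\<forall>i\<in>{1..<n}. \<forall>x\<in>{y (p i)..y (p (i + 1))}.
          A x = (y (p (i + 1)) - x) / (y (p (i + 1)) - y (p i)) * Vel f (d (p (i - 1))) (d (p i))
              + (x - y (p i)) / (y (p (i + 1)) - y (p i)) * Vel f (d (p i)) (d (p (i + 1)))) \<and>
       (\<forall>x\<le>y (p 1). A x = Vel f (d (p 0)) (d (p 1))) \<and>
       (\<forall>x\<ge>y (p n). A x = Vel f (d (p (n - 1))) (d (p n))))"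

definition initial_density :: "(real \<Rightarrow> real) \<Rightarrow> nat \<Rightarrow> (nat \<Rightarrow> real) \<Rightarrow> nat \<Rightarrow> real" where
  "initial_density u0 N x0 i =
     (if 1 \<le> i \<and> i \<le> N - 1
      then 1 / (x0 (i + 1) - x0 i) * (LINT x:{x0 i<..<x0 (i + 1)}|lborel. u0 x) else 0)"

definition initial_profile :: "(real \<Rightarrow> real) \<Rightarrow> nat \<Rightarrow> (nat \<Rightarrow> real) \<Rightarrow> real \<Rightarrow> real" where
  "initial_profile u0 N x0 x =
     (\<Sum>i=0..N. initial_density u0 N x0 i * indicator {pos N x0 i<..<pos N x0 (i + 1)} (ereal x))"

text \<open>
  \<open>\<tau> 0, \<dots>, \<tau> J\<close> are the stage times, \<open>I j\<close> is the set of particles present in stage \<open>j\<close>, and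
  \<open>X i t\<close>, \<open>D i t\<close> are the position and the density of particle \<open>i\<close> at time \<open>t\<close>. They are
  meaningful as long as particle \<open>i\<close> is present; a particle deleted at \<open>\<tau> (Suc j)\<close> still has the
  position \<open>X i (\<tau> (Suc j))\<close>, the limit from the left, which decides about its deletion.
  Positions stay ordered in the limit, so particles meet iff two neighbours meet.
\<close>

definition particle_stage ::
    "(real \<Rightarrow> real) \<Rightarrow> real \<Rightarrow> nat \<Rightarrow> (nat \<Rightarrow> real \<Rightarrow> real) \<Rightarrow> (nat \<Rightarrow> real \<Rightarrow> real)
      \<Rightarrow> real \<Rightarrow> real \<Rightarrow> nat set \<Rightarrow> nat set \<Rightarrow> bool" where
  "particle_stage f T N X D a b S S' \<longleftrightarrow>
     (let n = card S; p = enum N S in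
       a < b \<and> b \<le> T \<and>
       (\<forall>i\<in>{1..n}. continuous_on {a..b} (X (p i)) \<and> X (p i) C1_differentiable_on {a<..<b}) \<and>
       (\<forall>t\<in>{a<..<b}. strict_mono_on {1..n} (\<lambda>i. X (p i) t)) \<and>
       (\<forall>i\<in>{1..n}. \<forall>t\<in>{a<..<b}.
          (X (p i) has_real_derivative Vel f (D (p (i - 1)) t) (D (p i) t)) (at t)) \<and>
       (\<forall>i\<in>{1..<n}. \<forall>t\<in>{a<..<b}.
          D (p i) t = (X (p (i + 1)) a - X (p i) a) / (X (p (i + 1)) t - X (p i) t) * D (p i) a) \<and>
       (b = T \<or> (\<exists>i\<in>{1..<n}. X (p i) b = X (p (i + 1)) b)) \<and>
       S' = {p i | i. 1 \<le> i \<and> i \<le> n \<and>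
               pos N (\<lambda>k. X k b) (p i) \<noteq> pos N (\<lambda>k. X k b) (p (i + 1))} \<and>
       (\<forall>i\<in>S'. (D i \<longlongrightarrow> D i b) (at_left b)))"

definition particle_run ::
    "(real \<Rightarrow> real) \<Rightarrow> (real \<Rightarrow> real) \<Rightarrow> real \<Rightarrow> nat \<Rightarrow> (nat \<Rightarrow> real) \<Rightarrow> nat \<Rightarrow> (nat \<Rightarrow> real)
      \<Rightarrow> (nat \<Rightarrow> nat set) \<Rightarrow> (nat \<Rightarrow> real \<Rightarrow> real) \<Rightarrow> (nat \<Rightarrow> real \<Rightarrow> real) \<Rightarrow> bool" where
  "particle_run f u0 T N x0 J \<tau> I X D \<longleftrightarrow>
     \<tau> 0 = 0 \<and> \<tau> J = T \<and> I 0 = {1..N} \<and>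
     (\<forall>i\<in>{1..N}. X i 0 = x0 i \<and> D i 0 = initial_density u0 N x0 i) \<and>
     (\<forall>t. D 0 t = 0 \<and> D N t = 0) \<and>
     (\<forall>j<J. particle_stage f T N X D (\<tau> j) (\<tau> (Suc j)) (I j) (I (Suc j)))"

text \<open>\<open>v\<close> and \<open>A\<close> are constrained on \<open>\<real> \<times> [0,T]\<close> only.\<close>

definition particle_scheme ::
    "(real \<Rightarrow> real) \<Rightarrow> (real \<Rightarrow> real) \<Rightarrow> real \<Rightarrow> nat \<Rightarrow> (nat \<Rightarrow> real)
      \<Rightarrow> (real \<Rightarrow> real \<Rightarrow> real) \<Rightarrow> (real \<Rightarrow> real \<Rightarrow> real) \<Rightarrow> bool" where
  "particle_scheme f u0 T N x0 v A \<longleftrightarrow>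
     (\<exists>J \<tau> I X D. particle_run f u0 T N x0 J \<tau> I X D \<and>
        (\<forall>j\<le>J. \<forall>t. (if j < J then \<tau> j \<le> t \<and> t < \<tau> (Suc j) else t = T) \<longrightarrow>
           (\<forall>x. v x t = step_profile N (I j) (\<lambda>i. X i t) (\<lambda>i. D i t) x) \<and>
           interpolated_field f N (I j) (\<lambda>i. X i t) (\<lambda>i. D i t) (\<lambda>x. A x t)))"

end

theory Submission
  imports Defs
begin

text \<open>
  The distance of the particle approximation to the entropy solution is measured by
  \<open>\<Sum>i. \<integral> (W (\<xi> (i + 1) - y) - W (\<xi> i - y)) |\<nu> i - u(y,t)| dy\<close>, where \<open>\<xi>\<close> are the particle positions,
  \<open>\<nu>\<close> the densities and \<open>W\<close> is a smoothed Heaviside function of width \<open>e\<close>. For frozen particles the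
  weights are Kruzkov test functions, so the entropy inequality controls the change of \<open>u\<close>. When the
  particles move, the one-sided choice of the velocities makes all remaining terms have a sign, except
  for \<open>\<integral>|W''| \<le> 1/e\<close> times the \<open>L\<^sup>1\<close> norm of \<open>A v - f(v)\<close>. Collisions do not matter, because cells of
  width zero have weight zero. The total variation of the densities does not increase, hence replacing
  the regularised distance by the \<open>L\<^sup>1\<close> distance costs at most \<open>e |u0|\<close> at either end. It remains to
  optimise in \<open>e\<close>.
\<close>

text \<open>No doubling of variables is used: within a frozen cell the density is a single number,
  so it can serve as the Kruzkov constant, with a test weight that is spatial up to a cut-off in
  time. The obstacle is time. \<open>w\<close> is only continuous into L^1, so the regularised
  distance need not be differentiable along the motion, and its growth is read off from backward
  difference quotients. Going from \<open>s\<close> to \<open>t\<close>, the particles move against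
  a fixed \<open>w\<close> and \<open>w\<close> evolves against fixed particles; the two flux
  pairings have opposite signs and cancel up to a small multiple of \<open>t - s\<close>. Backward
  quotients suit the modulus, because convexity bounds its increments from above by the subgradient
  at the later time.

  The second obstacle is vacuum: \<open>f v / v\<close> need not be Lipschitz near 0, so neither
  need be the particle equations. A cell of mass zero keeps density zero, and a cell of positive
  mass keeps its density away from zero in bounded time; treating the two kinds separately restores
  a Lipschitz field.

  The constant comes from minimising 2 e V + E / e. This needs a kernel for which \<integral>|W''|
  times the L^1 distance of W to the Heaviside function is at most 1.\<close>

hide_fact (open) Henstock_Kurzweil_Integration.integrable_add Henstock_Kurzweil_Integration.integrable_bound
  Henstock_Kurzweil_Integration.integrable_diff Henstock_Kurzweil_Integration.integrable_sum
  Henstock_Kurzweil_Integration.integral_add Henstock_Kurzweil_Integration.integral_cong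
  Henstock_Kurzweil_Integration.integral_diff Henstock_Kurzweil_Integration.integral_nonneg
  Henstock_Kurzweil_Integration.integral_sum

text \<open>Real induction from the right: for fixed \<open>e\<close> the times \<open>t\<close>
  with \<open>g b \<le> g t + e * (b - t)\<close> form a closed set containing \<open>b\<close>, and
  the hypothesis at its infimum would push it further left. One-sided rates suffice, which is all
  that the merely continuous distance along the flow offers.\<close>

lemma left_dini_nonincreasing:
  fixes g :: "real \<Rightarrow> real"
  assumes ab: "a \<le> b" and cont: "continuous_on {a..b} g"
    and dini: "\<And>t e. \<lbrakk>a < t; t \<le> b; 0 < e\<rbrakk> \<Longrightarrow> eventually (\<lambda>s. g t - g s \<le> e * (t - s)) (at_left t)"
  shows "g b \<le> g a"
proof -
  have key: "g b \<le> g a + e * (b - a)" if e: "e > 0" for e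
  proof -
    define S where "S = {t\<in>{a..b}. g b - (g t + e * (b - t)) \<le> 0}"
    have cl: "closed S" unfolding S_def
      by (intro continuous_on_closed_Collect_le continuous_intros cont closed_atLeastAtMost)
    have bS: "b \<in> S" using ab by (auto simp: S_def)
    have bdd: "bdd_below S" by (auto simp: S_def intro!: bdd_belowI[of _ a])
    define m where "m = Inf S"
    have mS: "m \<in> S" unfolding m_def using closed_contains_Inf[OF _ bdd cl] bS by auto
    have "m = a"
    proof (rule ccontr)
      assume "m \<noteq> a"
      with mS have m: "a < m" "m \<le> b" by (auto simp: S_def)
      have "eventually (\<lambda>s. a < s \<and> s < m) (at_left m)"
        using eventually_at_left_real[OF m(1)] by (auto simp: eventually_at_filter elim: eventually_mono)
      from eventually_conj[OF this dini[OF m e]]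
      have "\<exists>s. (a < s \<and> s < m) \<and> g m - g s \<le> e * (m - s)" by (intro eventually_happens'[of "at_left m"]) auto
      then obtain s where s: "a < s" "s < m" "g m - g s \<le> e * (m - s)" by auto
      have "g b - (g m + e * (b - m)) \<le> 0" using mS by (auto simp: S_def)
      hence "s \<in> S" using s m by (auto simp: S_def algebra_simps)
      hence "m \<le> s" unfolding m_def using bdd by (rule cInf_lower)
      with s show False by simp
    qed
    with mS show ?thesis by (auto simp: S_def)
  qed
  show ?thesis
  proof (rule field_le_epsilon)
    fix d :: real assume d: "d > 0"
    have "g b \<le> g a + d / (b - a + 1) * (b - a)" using ab d by (intro key) auto
    also have "d / (b - a + 1) * (b - a) \<le> d" using ab d by (simp add: divide_simps)
    finally show "g b \<le> g a + d" by simp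
  qed
qed

section \<open>Smooth functions\<close>

text \<open>The recursion imitates \<open>Ck_plane\<close>, so that products of one-variable
  functions become test functions of the plane by a single induction.\<close>

primrec Ck_real :: "nat \<Rightarrow> (real \<Rightarrow> real) \<Rightarrow> bool" where "Ck_real 0 f \<longleftrightarrow> continuous_on UNIV f"
| "Ck_real (Suc k) f \<longleftrightarrow> (\<exists>g. (\<forall>x. DERIV f x :> g x) \<and> Ck_real k g)"

definition smooth :: "(real \<Rightarrow> real) \<Rightarrow> bool" where "smooth f \<longleftrightarrow> (\<forall>k. Ck_real k f)"

lemma continuous_on_UNIV_if_deriv: "(\<And>x. DERIV f x :> g x) \<Longrightarrow> continuous_on A f"
  by (meson DERIV_isCont continuous_at_imp_continuous_on)

lemma Ck_real_Suc_D: "Ck_real (Suc k) f \<Longrightarrow> Ck_real k f"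
proof (induction k arbitrary: f)
  case 0 then show ?case by (auto intro: continuous_on_UNIV_if_deriv)
next
  case (Suc k)
  then obtain g where "\<forall>x. DERIV f x :> g x" "Ck_real (Suc k) g" by auto
  with Suc.IH[of g] show ?case by auto
qed

lemma Ck_real_const: "Ck_real k (\<lambda>x. c)"
  by (induction k arbitrary: c) (auto intro!: exI[of _ "\<lambda>x. 0"] derivative_eq_intros)

lemma Ck_real_add: "Ck_real k f \<Longrightarrow> Ck_real k g \<Longrightarrow> Ck_real k (\<lambda>x. f x + g x)"
proof (induction k arbitrary: f g)
  case 0 then show ?case by (auto intro!: continuous_intros)
next
  case (Suc k)
  then obtain f' g' where d: "\<forall>x. DERIV f x :> f' x" "Ck_real k f'" "\<forall>x. DERIV g x :> g' x" "Ck_real k g'" by auto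
  with Suc.IH[of f' g'] show ?case by (auto intro!: exI[of _ "\<lambda>x. f' x + g' x"] DERIV_add)
qed

lemma Ck_real_mult: "Ck_real k f \<Longrightarrow> Ck_real k g \<Longrightarrow> Ck_real k (\<lambda>x. f x * g x)"
proof (induction k arbitrary: f g)
  case 0 then show ?case by (auto intro!: continuous_intros)
next
  case (Suc k)
  then obtain f' g' where d: "\<forall>x. DERIV f x :> f' x" "Ck_real k f'" "\<forall>x. DERIV g x :> g' x" "Ck_real k g'" by auto
  have "Ck_real k (\<lambda>x. f' x * g x + g' x * f x)"
    using Suc.IH d Ck_real_Suc_D Suc.prems by (intro Ck_real_add) blast+
  with d show ?case by (auto intro!: exI[of _ "\<lambda>x. f' x * g x + g' x * f x"] DERIV_mult)
qed

lemma Ck_real_affine: "Ck_real k f \<Longrightarrow> Ck_real k (\<lambda>x. f (c * x + d))"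
proof (induction k arbitrary: f)
  case 0 then show ?case by (auto intro!: continuous_intros continuous_on_compose2[of UNIV f])
next
  case (Suc k)
  then obtain f' where d: "\<forall>x. DERIV f x :> f' x" "Ck_real k f'" by auto
  have "DERIV (\<lambda>x. f (c * x + d)) x :> f' (c * x + d) * c" for x
    by (rule DERIV_chain2[OF d(1)[rule_format]]) (auto intro!: derivative_eq_intros)
  moreover have "Ck_real k (\<lambda>x. f' (c * x + d) * c)" using Suc.IH d by (intro Ck_real_mult Ck_real_const) blast
  ultimately show ?case by (auto intro!: exI[of _ "\<lambda>x. f' (c * x + d) * c"])
qed

lemma smooth_const: "smooth (\<lambda>x. c)" and smooth_add: "smooth f \<Longrightarrow> smooth g \<Longrightarrow> smooth (\<lambda>x. f x + g x)"
  and smooth_mult: "smooth f \<Longrightarrow> smooth g \<Longrightarrow> smooth (\<lambda>x. f x * g x)"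
  and smooth_affine: "smooth f \<Longrightarrow> smooth (\<lambda>x. f (c * x + d))"
  by (auto simp: smooth_def Ck_real_const Ck_real_add Ck_real_mult Ck_real_affine)

lemma smooth_diff: "smooth f \<Longrightarrow> smooth g \<Longrightarrow> smooth (\<lambda>x. f x - g x)"
  using smooth_add[of f "\<lambda>x. (-1) * g x"] smooth_mult[OF smooth_const[of "-1"]] by simp

lemma smooth_reflect: "smooth f \<Longrightarrow> smooth (\<lambda>y. f (c - y))"
  using smooth_affine[of f "-1" c] by (simp add: algebra_simps)

lemma smooth_antideriv:
  assumes "\<And>x. DERIV f x :> g x" "smooth g"
  shows "smooth f"
proof -
  have "Ck_real k f" for k using assms by (cases k) (auto simp: smooth_def intro: continuous_on_UNIV_if_deriv)
  then show ?thesis by (simp add: smooth_def)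
qed

lemma smooth_deriv:
  assumes "\<And>x. DERIV f x :> g x" "smooth f"
  shows "smooth g" unfolding smooth_def
proof
  fix k
  have "Ck_real (Suc k) f" using assms by (simp only: smooth_def)
  then obtain g' where g': "\<forall>x. DERIV f x :> g' x" "Ck_real k g'" by auto
  have "g = g'" using assms(1) g'(1) by (auto intro!: ext DERIV_unique)
  with g' show "Ck_real k g" by simp
qed

lemma smooth_continuous: "smooth f \<Longrightarrow> continuous_on A f"
  unfolding smooth_def using continuous_on_subset Ck_real.simps(1) by blast

text \<open>The functions \<open>x\<^sup>-\<^sup>n exp (-1/x)\<close> are closed under differentiation up to linear combinations,
  so a single induction gives smoothness of all of them.\<close>

definition flat_exp :: "nat \<Rightarrow> real \<Rightarrow> real" where
  "flat_exp n x = (if 0 < x then inverse x ^ n * exp (- inverse x) else 0)"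

lemma flat_exp_tendsto_0: "(flat_exp n \<longlongrightarrow> 0) (at 0)"
proof -
  have "((\<lambda>x::real. inverse x ^ n / exp (inverse x)) \<longlongrightarrow> 0) (at_right 0)"
    by (rule filterlim_compose[OF tendsto_power_div_exp_0 filterlim_inverse_at_top_right])
  then have "(flat_exp n \<longlongrightarrow> 0) (at_right 0)"
    by (rule Lim_transform_eventually) (auto simp: eventually_at_filter flat_exp_def exp_minus field_simps)
  moreover have "(flat_exp n \<longlongrightarrow> 0) (at_left 0)"
    by (rule Lim_transform_eventually[of "\<lambda>x. 0"]) (auto simp: eventually_at_filter flat_exp_def)
  ultimately show ?thesis by (simp add: filterlim_split_at)
qed

lemma flat_exp_deriv: "DERIV (flat_exp n) x :> flat_exp (n + 2) x - real n * flat_exp (n + 1) x"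
proof -
  consider "x < 0" | "x = 0" | "0 < x" by linarith
  then show ?thesis
  proof cases
    case 1 have "DERIV (\<lambda>x. 0) x :> 0" by simp
    then have "DERIV (flat_exp n) x :> 0"
      by (rule has_field_derivative_transform_within_open[of _ _ _ "{..<0}"]) (use 1 in \<open>auto simp: flat_exp_def\<close>)
    with 1 show ?thesis by (simp add: flat_exp_def)
  next
    \<comment> \<open>Dividing by \<open>h\<close> raises the exponent by one, so the quotient at 0
      is \<open>flat_exp (n + 1) h\<close>.\<close>
    case 2 have "((\<lambda>h. (flat_exp n (0 + h) - flat_exp n 0) / h) \<longlongrightarrow> 0) (at 0)"
      by (rule Lim_transform_eventually[OF flat_exp_tendsto_0[of "n + 1"]])
         (auto simp: eventually_at_filter flat_exp_def field_simps)
    with 2 show ?thesis by (simp add: DERIV_def flat_exp_def)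
  next
    case 3 have "((\<lambda>x. inverse x ^ n * exp (- inverse x)) has_real_derivative
        inverse x ^ (n + 2) * exp (- inverse x) - real n * (inverse x ^ (n + 1) * exp (- inverse x))) (at x)"
      using 3 by (auto intro!: derivative_eq_intros)
        (cases n; simp add: field_simps power2_eq_square)
    then have "(flat_exp n has_real_derivative
        inverse x ^ (n + 2) * exp (- inverse x) - real n * (inverse x ^ (n + 1) * exp (- inverse x))) (at x)"
      by (rule has_field_derivative_transform_within_open[of _ _ _ "{0<..}"]) (use 3 in \<open>auto simp: flat_exp_def\<close>)
    with 3 show ?thesis by (simp add: flat_exp_def)
  qed
qed

lemma smooth_flat_exp: "smooth (flat_exp n)"
proof -
  have "Ck_real k (flat_exp n)" for k
  proof (induction k arbitrary: n)
    case 0 show ?case using continuous_on_UNIV_if_deriv[OF flat_exp_deriv] by simp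
  next
    case (Suc k) have "Ck_real k (\<lambda>x. flat_exp (n + 2) x + (- real n) * flat_exp (n + 1) x)"
      by (intro Ck_real_add Ck_real_mult Ck_real_const Suc)
    with flat_exp_deriv[of n] show ?case
      by (auto intro!: exI[of _ "\<lambda>x. flat_exp (n + 2) x - real n * flat_exp (n + 1) x"])
  qed
  then show ?thesis by (simp add: smooth_def)
qed

section \<open>Antiderivatives and a smooth step function\<close>

lemma continuous_antiderivative:
  fixes f :: "real \<Rightarrow> real"
  assumes "continuous_on UNIV f"
  obtains F where "\<And>x. DERIV F x :> f x"
proof -
  have "\<exists>F. \<forall>x::real. -\<infinity> < ereal x \<longrightarrow> ereal x < \<infinity> \<longrightarrow> (F has_vector_derivative f x) (at x)"
    by (rule einterval_antiderivative) (use assms in \<open>auto simp: continuous_on_eq_continuous_at\<close>)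
  then show ?thesis using that by (auto simp: has_real_derivative_iff_has_vector_derivative)
qed

lemma deriv_zero_const:
  fixes f :: "real \<Rightarrow> real"
  assumes "\<And>x. u \<le> x \<Longrightarrow> x \<le> v \<Longrightarrow> DERIV f x :> 0" "u \<le> v"
  shows "f u = f v"
proof -
  have "f u \<le> f v" by (rule DERIV_nonneg_imp_nondecreasing) (use assms in auto)
  moreover have "f v \<le> f u" by (rule DERIV_nonpos_imp_nonincreasing) (use assms in auto)
  ultimately show ?thesis by simp
qed

lemma smooth_step:
  obtains B b :: "real \<Rightarrow> real" where "smooth B" "smooth b" "\<And>x. DERIV B x :> b x" "\<And>x. 0 \<le> b x"
    "\<And>x. x \<le> 0 \<Longrightarrow> B x = 0" "\<And>x. 1 \<le> x \<Longrightarrow> B x = 1" "\<And>x. x \<le> 0 \<or> 1 \<le> x \<Longrightarrow> b x = 0" "\<And>x. 0 \<le> B x" "\<And>x. B x \<le> 1"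
proof -
  \<comment> \<open>Positive exactly on the open unit interval; \<open>B\<close> is its
    antiderivative, normalised to climb from 0 to 1.\<close>
  define b0 where "b0 = (\<lambda>x. flat_exp 0 x * flat_exp 0 (1 - x))"
  have sm: "smooth b0" unfolding b0_def by (intro smooth_mult smooth_flat_exp smooth_reflect)
  have nn: "0 \<le> b0 x" for x by (simp add: b0_def flat_exp_def)
  have pos: "0 < b0 x" if "0 < x" "x < 1" for x using that by (simp add: b0_def flat_exp_def)
  have z: "b0 x = 0" if "x \<le> 0 \<or> 1 \<le> x" for x using that by (auto simp: b0_def flat_exp_def)
  obtain F where F: "\<And>x. DERIV F x :> b0 x" using continuous_antiderivative smooth_continuous[OF sm] by blast
  have F01: "F 0 < F 1"
    by (rule DERIV_pos_imp_increasing_open) (use F pos in \<open>auto intro!: continuous_on_UNIV_if_deriv[OF F]\<close>)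
  have mono: "F x \<le> F y" if "x \<le> y" for x y by (rule DERIV_nonneg_imp_nondecreasing[OF that]) (use F nn in blast)
  have F0: "F x = F 0" if "x \<le> 0" for x by (rule deriv_zero_const) (use that F z in \<open>auto, metis\<close>)
  have F1: "F x = F 1" if "1 \<le> x" for x by (rule deriv_zero_const[symmetric]) (use that F z in \<open>auto, metis\<close>)
  define B where "B = (\<lambda>x. (F x - F 0) / (F 1 - F 0))"
  define b where "b = (\<lambda>x. b0 x * (1 / (F 1 - F 0)))"
  have d: "DERIV B x :> b x" for x unfolding B_def b_def using F01 by (auto intro!: derivative_eq_intros F)
  have sb: "smooth b" unfolding b_def by (intro smooth_mult sm smooth_const)
  show ?thesis
  proof (rule that[of B b])
    show "smooth B" by (rule smooth_antideriv[OF d sb])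
    show "0 \<le> B x" for x using mono[of 0 x] F0[of x] F01 by (cases "x \<le> 0") (auto simp: B_def)
    show "B x \<le> 1" for x using mono[of x 1] F1[of x] F01 by (cases "1 \<le> x") (auto simp: B_def field_simps)
    show "B x = 1" if "1 \<le> x" for x unfolding B_def F1[OF that] using F01 by (intro divide_self) linarith
    show "0 \<le> b x" for x using nn[of x] F01 by (simp add: b_def)
    show "b x = 0" if "x \<le> 0 \<or> 1 \<le> x" for x using z[OF that] by (simp add: b_def)
    show "B x = 0" if "x \<le> 0" for x using F0[OF that] by (simp add: B_def)
  qed (fact sb d)+
qed

section \<open>Smoothing kernels\<close>

text \<open>\<open>W\<close> is the smoothed Heaviside function, \<open>om\<close> the mollifier and
  \<open>om'\<close> its derivative. They are parameters linked by derivative assumptions, so that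
  rescaled kernels can be given by explicit formulas without \<open>deriv\<close>.\<close>

locale kernel =
  fixes W om om' :: "real \<Rightarrow> real" and r :: real
  assumes smooth_W: "smooth W" and W_deriv: "\<And>z. DERIV W z :> om z" and om_deriv: "\<And>z. DERIV om z :> om' z"
    and om_nonneg: "\<And>z. 0 \<le> om z" and r_pos: "0 < r" and W_left: "\<And>z. z \<le> - r \<Longrightarrow> W z = 0"
    and W_right: "\<And>z. r \<le> z \<Longrightarrow> W z = 1"
begin

lemma smooth_om: "smooth om" by (rule smooth_deriv[OF W_deriv smooth_W])

lemma smooth_om': "smooth om'" by (rule smooth_deriv[OF om_deriv smooth_om])

lemma W_mono: "x \<le> y \<Longrightarrow> W x \<le> W y" by (rule DERIV_nonneg_imp_nondecreasing) (use W_deriv om_nonneg in blast)+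

lemma W_nonneg: "0 \<le> W z" using W_mono[of "min z (-r)" z] W_left[of "min z (-r)"] by simp

lemma W_le_1: "W z \<le> 1" using W_mono[of z "max z r"] W_right[of "max z r"] by simp

lemma om_outside: "r \<le> \<bar>z\<bar> \<Longrightarrow> om z = 0"
proof -
  have inner: "om z = 0" if "r < \<bar>z\<bar>" for z
  proof -
    define U where "U = (if z < 0 then {..<-r} else {r<..})"
    have U: "open U" "z \<in> U" using that by (auto simp: U_def)
    have "DERIV (\<lambda>x. W z) z :> 0" by simp
    then have "DERIV W z :> 0"
      by (rule has_field_derivative_transform_within_open[OF _ U])
         (use that in \<open>auto simp: U_def W_left W_right split: if_splits\<close>)
    then show ?thesis using DERIV_unique W_deriv by blast
  qed
  assume *: "r \<le> \<bar>z\<bar>"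
  show "om z = 0"
  proof (cases "r < \<bar>z\<bar>")
    \<comment> \<open>On the boundary of the support a limit from outside is used: moving by
      \<open>sgn z * y\<close> with \<open>y > 0\<close> leaves the support.\<close>
    case False with * have "\<bar>z\<bar> = r" by simp
    have ev: "eventually (\<lambda>y. om (z + sgn z * y) = 0) (at_right 0)"
      by (rule eventually_mono[OF eventually_at_right_less])
         (use \<open>\<bar>z\<bar> = r\<close> r_pos in \<open>auto simp: sgn_if intro!: inner split: if_splits\<close>)
    have "((\<lambda>y. om (z + sgn z * y)) \<longlongrightarrow> om (z + sgn z * 0)) (at_right 0)"
      by (intro continuous_on_tendsto_compose[OF smooth_continuous[OF smooth_om, of UNIV]] tendsto_intros) auto
    moreover have "((\<lambda>y. om (z + sgn z * y)) \<longlongrightarrow> 0) (at_right 0)" by (rule tendsto_eventually[OF ev])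
    ultimately show ?thesis using tendsto_unique[of "at_right (0::real)"] by fastforce
  qed (rule inner)
qed

lemma om'_outside: "r < \<bar>z\<bar> \<Longrightarrow> om' z = 0"
proof -
  assume that: "r < \<bar>z\<bar>"
  define U where "U = (if z < 0 then {..<-r} else {r<..})"
  have U: "open U" "z \<in> U" using that by (auto simp: U_def)
  have "DERIV (\<lambda>x. 0) z :> 0" by simp
  then have "DERIV om z :> 0"
    by (rule has_field_derivative_transform_within_open[OF _ U])
       (use that in \<open>auto simp: U_def om_outside split: if_splits\<close>)
  then show ?thesis using DERIV_unique om_deriv by blast
qed

text \<open>One constant for both functions keeps the later estimates short. It exists because
  \<open>om\<close> and \<open>om'\<close> are continuous with compact support.\<close>

definition om_max where "om_max = (SOME M. 0 \<le> M \<and> (\<forall>z. \<bar>om z\<bar> \<le> M \<and> \<bar>om' z\<bar> \<le> M))"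

lemma om_max: "0 \<le> om_max" "\<bar>om z\<bar> \<le> om_max" "\<bar>om' z\<bar> \<le> om_max"
proof -
  have "bounded (om ` {-r..r})" "bounded (om' ` {-r..r})"
    by (auto intro!: compact_imp_bounded compact_continuous_image smooth_continuous smooth_om smooth_om')
  then obtain M1 M2 where M: "\<forall>z\<in>{-r..r}. \<bar>om z\<bar> \<le> M1" "\<forall>z\<in>{-r..r}. \<bar>om' z\<bar> \<le> M2" by (auto simp: bounded_iff)
  have 1: "\<bar>om z\<bar> \<le> max 0 (max M1 M2)" for z
  proof (cases "z \<in> {-r..r}")
    case True then show ?thesis using M by fastforce
  next
    case False then have "om z = 0" by (intro om_outside) auto
    then show ?thesis by simp
  qed
  have 2: "\<bar>om' z\<bar> \<le> max 0 (max M1 M2)" for z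
  proof (cases "z \<in> {-r..r}")
    case True then show ?thesis using M by fastforce
  next
    case False then have "om' z = 0" by (intro om'_outside) auto
    then show ?thesis by simp
  qed
  have "\<exists>M. 0 \<le> M \<and> (\<forall>z. \<bar>om z\<bar> \<le> M \<and> \<bar>om' z\<bar> \<le> M)" using 1 2 by (intro exI[of _ "max 0 (max M1 M2)"]) auto
  from someI_ex[OF this] show "0 \<le> om_max" "\<bar>om z\<bar> \<le> om_max" "\<bar>om' z\<bar> \<le> om_max" unfolding om_max_def by auto
qed

lemma om_lipschitz: "\<bar>om x - om y\<bar> \<le> om_max * \<bar>x - y\<bar>"
proof -
  have "norm (om x - om y) \<le> om_max * norm (x - y)"
    by (rule field_differentiable_bound[of UNIV om om']) (use om_deriv om_max in \<open>auto intro: DERIV_subset\<close>)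
  then show ?thesis by simp
qed

text \<open>Mean value estimate for \<open>W z - om y * z\<close>, whose derivative
  \<open>om z - om y\<close> is at most \<open>om_max * \<bar>x - y\<bar>\<close> between
  \<open>x\<close> and \<open>y\<close>. The bound is uniform, hence survives integration.\<close>

lemma W_taylor: "\<bar>W x - W y - om y * (x - y)\<bar> \<le> om_max * (x - y)\<^sup>2"
proof -
  have d: "((\<lambda>z. W z - om y * z) has_real_derivative om z - om y) (at z within closed_segment x y)" for z
    by (rule DERIV_subset[of _ _ _ UNIV]) (auto intro!: derivative_eq_intros W_deriv)
  have "norm ((W x - om y * x) - (W y - om y * y)) \<le> (om_max * \<bar>x - y\<bar>) * norm (x - y)"
  proof (rule field_differentiable_bound[of "closed_segment x y" "\<lambda>z. W z - om y * z" "\<lambda>z. om z - om y"])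
    fix z assume "z \<in> closed_segment x y"
    then have "\<bar>z - y\<bar> \<le> \<bar>x - y\<bar>" by (auto simp: closed_segment_eq_real_ivl split: if_splits)
    with om_lipschitz[of z y] om_max(1) show "norm (om z - om y) \<le> om_max * \<bar>x - y\<bar>"
      by (smt (verit) mult_left_mono real_norm_def)
  qed (use d in auto)
  then show ?thesis by (simp add: algebra_simps power2_eq_square abs_mult_self_eq)
qed

lemma borel_W [measurable]: "W \<in> borel_measurable borel"
  by (intro borel_measurable_continuous_onI smooth_continuous smooth_W)

lemma borel_om [measurable]: "om \<in> borel_measurable borel"
  by (intro borel_measurable_continuous_onI smooth_continuous smooth_om)

lemma borel_om' [measurable]: "om' \<in> borel_measurable borel"
  by (intro borel_measurable_continuous_onI smooth_continuous smooth_om')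

end

text \<open>For \<open>W\<close> with values in [0,1] this is the absolute difference of
  \<open>W\<close> and the Heaviside function. Its integral is the cost of smoothing per unit of
  jump.\<close>

definition kernel_tail :: "(real \<Rightarrow> real) \<Rightarrow> real \<Rightarrow> real" where "kernel_tail W z = (if 0 < z then 1 - W z else W z)"

lemma integrable_compact_bounded:
  fixes f :: "real \<Rightarrow> real"
  assumes [measurable]: "f \<in> borel_measurable lborel" and "\<And>x. x \<notin> {u..v} \<Longrightarrow> f x = 0" "\<And>x. \<bar>f x\<bar> \<le> M"
  shows "integrable lborel f"
proof (rule integrable_bound)
  show "integrable lborel (\<lambda>x. M * indicator {u..v} x)"
    by (intro integrable_mult_right) (auto simp: integrable_indicator_iff emeasure_lborel_Icc_eq)
  show "AE x in lborel. norm (f x) \<le> norm (M * indicator {u..v} x)"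
  proof (rule AE_I2)
    fix x show "norm (f x) \<le> norm (M * indicator {u..v} x)" using assms(2,3)[of x] by (cases "x \<in> {u..v}") auto
  qed
qed simp

text \<open>\<open>om\<close> is the box of height 1/2 on [-1,1], mollified at radius 1/4, whence
  the support radius 5/4. It rises by 1/2 and falls by 1/2, so \<integral>|om'| is at most 1; the
  sharp box has tail integral 1/2, which leaves room for the mollification.\<close>

lemma kernel_exists_1: "\<exists>W om om'. kernel W om om' (5/4) \<and> (LBINT z. \<bar>om' z\<bar>) \<le> 1 \<and> (LBINT z. kernel_tail W z) \<le> 1"
proof -
  obtain B b :: "real \<Rightarrow> real" where B: "smooth B" "smooth b" "\<And>x. DERIV B x :> b x" "\<And>x. 0 \<le> b x"
    "\<And>x. x \<le> 0 \<Longrightarrow> B x = 0" "\<And>x. 1 \<le> x \<Longrightarrow> B x = 1" "\<And>x. x \<le> 0 \<or> 1 \<le> x \<Longrightarrow> b x = 0" "\<And>x. 0 \<le> B x" "\<And>x. B x \<le> 1"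
    using smooth_step by blast
  \<comment> \<open>The affine change of variable moves the rise of \<open>B\<close> from [0,1] to
    [-1/4,1/4].\<close>
  define S s where "S = (\<lambda>z. B (2 * z + 1/2))" and "s = (\<lambda>z. 2 * b (2 * z + 1/2))"
  have sS: "smooth S" unfolding S_def by (rule smooth_affine[OF B(1)])
  have dS: "DERIV S z :> s z" for z unfolding S_def s_def
    by (rule DERIV_cong[OF DERIV_chain2[OF B(3)]]) (auto intro!: derivative_eq_intros)
  have sl: "S z = 0" "s z = 0" if "z \<le> -1/4" for z using that by (auto simp: S_def s_def B)
  have sr: "S z = 1" "s z = 0" if "z \<ge> 1/4" for z using that by (auto simp: S_def s_def B)
  have S01: "0 \<le> S z" "S z \<le> 1" "0 \<le> s z" for z by (auto simp: S_def s_def B)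
  obtain C where C: "\<And>z. DERIV C z :> S z" using continuous_antiderivative smooth_continuous[OF sS] by blast
  have Cl: "C z = C (-1/4)" if "z \<le> -1/4" for z by (rule deriv_zero_const) (use that C sl(1) in \<open>auto, metis\<close>)
  have Cr: "C z = C (1/4) + (z - 1/4)" if "z \<ge> 1/4" for z
  proof -
    have "C (1/4) - 1/4 = C z - z"
      by (rule deriv_zero_const[of "1/4" z "\<lambda>z. C z - z"]) (use that sr in \<open>auto intro!: derivative_eq_intros C\<close>)
    then show ?thesis by simp
  qed
  \<comment> \<open>The mean of \<open>S\<close> over [z - 1, z + 1]; its derivative is the
    mollified box \<open>om\<close>.\<close>
  define W where "W = (\<lambda>z. (C (z + 1) - C (z - 1)) / 2)"
  define om where "om = (\<lambda>z. (S (z + 1) - S (z - 1)) / 2)"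
  define om' where "om' = (\<lambda>z. (s (z + 1) - s (z - 1)) / 2)"
  have dsh: "DERIV (\<lambda>z. F (z + c)) z :> G (z + c)" if "\<And>z. DERIV F z :> G z" for F G :: "real \<Rightarrow> real" and c z
    by (rule DERIV_cong[OF DERIV_chain2[OF that]]) (auto intro!: derivative_eq_intros)
  have dshm: "DERIV (\<lambda>z. F (z - c)) z :> G (z - c)" if "\<And>z. DERIV F z :> G z" for F G :: "real \<Rightarrow> real" and c z
    using dsh[of F G "-c" z] that by simp
  have dW: "DERIV W z :> om z" for z unfolding W_def om_def by (intro DERIV_cdivide DERIV_diff dsh dshm C)
  have dom: "DERIV om z :> om' z" for z unfolding om'_def om_def by (intro DERIV_cdivide DERIV_diff dsh dshm dS)
  have sm_om: "smooth om"
  proof -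
    have "smooth (\<lambda>z. (1/2) * (S (1 * z + 1) - S (1 * z + (-1))))"
      by (intro smooth_mult smooth_const smooth_diff smooth_affine sS)
    then show ?thesis by (simp add: om_def)
  qed
  have omle: "om z \<le> 1/2" "0 \<le> om z" for z
  proof -
    show "om z \<le> 1/2" using S01[of "z+1"] S01[of "z-1"] by (simp add: om_def)
    have "S (z - 1) \<le> S (z + 1)" by (rule DERIV_nonneg_imp_nondecreasing) (use dS S01 in \<open>auto, blast\<close>)
    then show "0 \<le> om z" by (simp add: om_def)
  qed
  interpret K: kernel W om om' "5/4"
  proof
    show "smooth W" by (rule smooth_antideriv[OF dW sm_om])
    show "W z = 0" if "z \<le> - (5/4)" for z using Cl[of "z + 1"] Cl[of "z - 1"] that by (simp add: W_def)
    show "W z = 1" if "5/4 \<le> z" for z using Cr[of "z + 1"] Cr[of "z - 1"] that by (simp add: W_def)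
  qed (use dW dom omle in auto)
  have i1: "(LBINT z. \<bar>om' z\<bar>) \<le> 1"
  proof -
    have sc: "continuous_on UNIV s" using smooth_continuous[OF smooth_deriv[OF dS sS]] .
    \<comment> \<open>Since \<open>s\<close> is nonnegative, \<open>g\<close> dominates
      \<open>\<bar>om'\<bar>\<close>, and its antiderivative
      \<open>(S (z + 1) + S (z - 1)) / 2\<close> climbs from 0 to 1.\<close>
    define g where "g = (\<lambda>z. (s (z + 1) + s (z - 1)) / 2)"
    have gc: "continuous_on UNIV g" unfolding g_def by (intro continuous_intros continuous_on_compose2[OF sc]) auto
    have hb: "has_bochner_integral lborel (\<lambda>x. g x * indicator {-2..2} x)
       ((S (2 + 1) + S (2 - 1)) / 2 - (S (-2 + 1) + S (-2 - 1)) / 2)" unfolding g_def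
      by (rule has_bochner_integral_FTC_Icc_real)
         (use gc in \<open>auto simp: g_def continuous_on_eq_continuous_at intro!: DERIV_cdivide DERIV_add dsh dshm dS\<close>)
    have val: "(S (2 + 1) + S (2 - 1)) / 2 - (S (-2 + 1) + S (-2 - 1)) / 2 = (1::real)" by (simp add: sl sr)
    have le: "\<bar>om' z\<bar> \<le> g z * indicator {-2..2} z" for z
    proof (cases "z \<in> {-2..2}")
      case True then show ?thesis using S01(3)[of "z+1"] S01(3)[of "z-1"] by (simp add: om'_def g_def abs_if field_simps)
    next
      case False then have "om' z = 0" by (intro K.om'_outside) auto
      with False show ?thesis by simp
    qed
    have "(LBINT z. \<bar>om' z\<bar>) \<le> (LBINT x. g x * indicator {-2..2} x)"
      by (rule integral_mono) (use hb le in \<open>auto intro!: integrable_compact_bounded[of _ "-5/4" "5/4" K.om_max]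
            K.om_max simp: has_bochner_integral_iff K.om'_outside\<close>)
    with hb val show ?thesis by (simp add: has_bochner_integral_iff)
  qed
  have i2: "(LBINT z. kernel_tail W z) \<le> 1"
  proof -
    \<comment> \<open>The slope bound \<open>om \<le> 1/2\<close> puts the tail below two triangles
      of base 5/4 and height 5/8, each of area 25/64.\<close>
    have hb1: "has_bochner_integral lborel (\<lambda>x::real. (5/8 + x/2) * indicator {-5/4..0} x)
       ((5/8 * 0 + 0\<^sup>2/4) - (5/8 * (-5/4) + (-5/4)\<^sup>2/4))"
      by (rule has_bochner_integral_FTC_Icc_real) (auto intro!: derivative_eq_intros continuous_intros)
    have hb2: "has_bochner_integral lborel (\<lambda>x::real. (5/8 - x/2) * indicator {0..5/4} x)
       ((5/8 * (5/4) - (5/4)\<^sup>2/4) - (5/8 * 0 - 0\<^sup>2/4))"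
      by (rule has_bochner_integral_FTC_Icc_real) (auto intro!: derivative_eq_intros continuous_intros)
    have a: "W z \<le> 5/8 + z/2" if "-5/4 \<le> z" for z
    proof -
      have "5/8 + (-5/4)/2 - W (-5/4) \<le> 5/8 + z/2 - W z"
        by (rule DERIV_nonneg_imp_nondecreasing[OF that])
           (use omle in \<open>auto intro!: exI derivative_eq_intros dW simp: algebra_simps\<close>)
      then show ?thesis using K.W_left[of "-5/4"] by simp
    qed
    have b: "1 - W z \<le> 5/8 - z/2" if "z \<le> 5/4" for z
    proof -
      have "5/8 + z/2 - W z \<le> 5/8 + (5/4)/2 - W (5/4)"
        by (rule DERIV_nonneg_imp_nondecreasing[OF that])
           (use omle in \<open>auto intro!: exI derivative_eq_intros dW simp: algebra_simps\<close>)
      then show ?thesis using K.W_right[of "5/4"] by simp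
    qed
    have kb: "0 \<le> kernel_tail W z" "kernel_tail W z \<le> 1" for z
      using K.W_nonneg[of z] K.W_le_1[of z] by (auto simp: kernel_tail_def)
    have kz: "kernel_tail W z = 0" if "z \<notin> {-5/4..5/4}" for z
      using that by (auto simp: kernel_tail_def K.W_left K.W_right)
    have [measurable]: "kernel_tail W \<in> borel_measurable borel" unfolding kernel_tail_def by measurable
    have le: "kernel_tail W z \<le> (5/8 + z/2) * indicator {-5/4..0} z + (5/8 - z/2) * indicator {0..5/4} z" for z
      using a[of z] b[of z] kz[of z] by (auto simp: kernel_tail_def indicator_def)
    have "(LBINT z. kernel_tail W z) \<le>
      (LBINT z. (5/8 + z/2) * indicator {-5/4..0} z + (5/8 - z/2) * indicator {0..5/4} z)"
      by (rule integral_mono) (use hb1 hb2 le kb kz in \<open>auto intro!: integrable_compact_bounded[of _ "-5/4" "5/4" 1]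
            simp: has_bochner_integral_iff\<close>)
    also have "\<dots> \<le> 1" using hb1 hb2 by (simp add: has_bochner_integral_iff power2_eq_square)
    finally show ?thesis .
  qed
  from i1 i2 K.kernel_axioms show ?thesis by blast
qed

text \<open>Under the scaling z / e the integral of \<open>\<bar>om'\<bar>\<close> behaves like 1/e
  and the tail integral like e. Their product stays at most 1, and this product fixes the constant
  of the final estimate.\<close>

lemma kernel_exists:
  fixes e :: real
  assumes e: "0 < e"
  shows "\<exists>W om om' r. kernel W om om' r \<and> (LBINT z. \<bar>om' z\<bar>) \<le> 1 / e \<and> (LBINT z. kernel_tail W z) \<le> e"
proof -
  obtain W om om' where K: "kernel W om om' (5/4)" and i: "(LBINT z. \<bar>om' z\<bar>) \<le> 1" "(LBINT z. kernel_tail W z) \<le> 1"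
    using kernel_exists_1 by blast
  interpret K: kernel W om om' "5/4" by fact
  define W2 where "W2 = (\<lambda>z. W (z / e))"
  define om2 where "om2 = (\<lambda>z. om (z / e) / e)"
  define om2' where "om2' = (\<lambda>z. om' (z / e) / e\<^sup>2)"
  have "kernel W2 om2 om2' (5/4 * e)"
  proof
    show "smooth W2" using smooth_affine[OF K.smooth_W, of "1/e" 0] by (simp add: W2_def)
    show "DERIV W2 z :> om2 z" for z unfolding W2_def om2_def
      by (rule DERIV_cong[OF DERIV_chain2[OF K.W_deriv]]) (use e in \<open>auto intro!: derivative_eq_intros\<close>)
    have "DERIV (\<lambda>z. om (z / e)) z :> om' (z / e) / e" for z
      by (rule DERIV_cong[OF DERIV_chain2[OF K.om_deriv]]) (use e in \<open>auto intro!: derivative_eq_intros\<close>)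
    then show "DERIV om2 z :> om2' z" for z unfolding om2_def om2'_def
      by (rule DERIV_cong[OF DERIV_cdivide]) (simp add: power2_eq_square)
    show "0 \<le> om2 z" for z using K.om_nonneg e by (simp add: om2_def)
    show "W2 z = 0" if "z \<le> - (5/4 * e)" for z using that e by (simp add: W2_def K.W_left divide_simps)
    show "W2 z = 1" if "5/4 * e \<le> z" for z using that e by (simp add: W2_def K.W_right divide_simps)
  qed (use e in auto)
  moreover have "(LBINT z. \<bar>om2' z\<bar>) \<le> 1 / e"
  proof -
    have "(LBINT z. \<bar>om2' z\<bar>) = e * (LBINT z. \<bar>om2' (0 + e * z)\<bar>)"
      using lborel_integral_real_affine[of e "\<lambda>z. \<bar>om2' z\<bar>" 0] e by simp
    also have "(\<lambda>z. \<bar>om2' (0 + e * z)\<bar>) = (\<lambda>z. \<bar>om' z\<bar> / e\<^sup>2)" using e by (auto simp: om2'_def abs_divide)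
    also have "e * (LBINT z. \<bar>om' z\<bar> / e\<^sup>2) = (LBINT z. \<bar>om' z\<bar>) / e" using e by (simp add: power2_eq_square)
    finally show ?thesis using i(1) e by (simp add: divide_right_mono)
  qed
  moreover have "(LBINT z. kernel_tail W2 z) \<le> e"
  proof -
    have "(LBINT z. kernel_tail W2 z) = e * (LBINT z. kernel_tail W2 (0 + e * z))"
      using lborel_integral_real_affine[of e "\<lambda>z. kernel_tail W2 z" 0] e by simp
    also have "(\<lambda>z. kernel_tail W2 (0 + e * z)) = kernel_tail W"
      using e by (auto simp: kernel_tail_def W2_def zero_less_mult_iff)
    finally show ?thesis using i(2) e by (simp add: mult_left_le)
  qed
  ultimately show ?thesis by blast
qed

section \<open>The velocity function\<close>

locale flux =
  fixes f :: "real \<Rightarrow> real" and L :: real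
  assumes lip: "L-lipschitz_on UNIV f" and f0: "f 0 = 0" and diff0: "f differentiable (at 0)"
begin

lemma L_nonneg: "0 \<le> L" using lipschitz_on_nonneg[OF lip] .

lemma f_lip: "\<bar>f x - f y\<bar> \<le> L * \<bar>x - y\<bar>" using lipschitz_onD[OF lip, of x y] by (simp add: dist_real_def)

lemma f_bound: "\<bar>f x\<bar> \<le> L * \<bar>x\<bar>" using f_lip[of x 0] by (simp add: f0)

lemma f_cont: "continuous_on A f" using lipschitz_on_continuous_on[OF lip] continuous_on_subset by blast

lemma borel_f [measurable]: "f \<in> borel_measurable borel" by (intro borel_measurable_continuous_onI f_cont)

lemma vel_tendsto_0: "((\<lambda>h. f h / h) \<longlongrightarrow> deriv f 0) (at 0)"
proof -
  have "DERIV f (0) :> deriv f 0" using diff0 by (simp add: DERIV_deriv_iff_real_differentiable)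
  then show ?thesis by (simp add: DERIV_def f0)
qed

lemma vel_mult: "vel f v * v = f v" by (simp add: vel_def f0)

lemma vel_bound: "\<bar>vel f v\<bar> \<le> L"
proof (cases "v = 0")
  case True have "((\<lambda>h. \<bar>f h / h\<bar>) \<longlongrightarrow> \<bar>deriv f 0\<bar>) (at 0)" by (intro tendsto_intros vel_tendsto_0)
  then have "\<bar>deriv f 0\<bar> \<le> L"
    by (rule tendsto_upperbound) (use f_bound in \<open>auto simp: eventually_at_filter abs_divide divide_simps\<close>)
  with True show ?thesis by (simp add: vel_def)
next
  case False with f_bound[of v] show ?thesis by (simp add: vel_def abs_divide divide_simps)
qed

lemma vel_isCont: "isCont (vel f) v"
proof (cases "v = 0")
  case True have "(vel f \<longlongrightarrow> deriv f 0) (at 0)"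
    by (rule Lim_transform_eventually[OF vel_tendsto_0]) (auto simp: vel_def eventually_at_filter)
  with True show ?thesis by (simp add: isCont_def vel_def)
next
  case False have "isCont f v" using f_cont[of UNIV] by (simp add: continuous_on_eq_continuous_at)
  with False have "isCont (\<lambda>v. f v / v) v" by (intro continuous_intros) auto
  moreover have ev: "eventually (\<lambda>v. f v / v = vel f v) (nhds v)"
    by (rule eventually_mono[OF t1_space_nhds[OF False]]) (simp add: vel_def)
  ultimately show ?thesis using isCont_cong[OF ev] by simp
qed

lemma vel_cont: "continuous_on A (vel f)" using vel_isCont by (simp add: continuous_at_imp_continuous_on)

lemma Vel_min:
  assumes "vl \<le> vr"
  obtains z where "z \<in> {vl..vr}" "Vel f vl vr = vel f z" "\<And>k. k \<in> {vl..vr} \<Longrightarrow> vel f z \<le> vel f k"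
proof -
  obtain z where z: "z \<in> {vl..vr}" "\<forall>k\<in>{vl..vr}. vel f z \<le> vel f k"
    using continuous_attains_inf[OF compact_Icc _ vel_cont, of vl vr] assms by auto
  have "Inf (vel f ` {vl..vr}) = vel f z" by (rule cInf_eq_minimum) (use z in auto)
  with z assms that show ?thesis by (auto simp: Vel_def)
qed

lemma Vel_max:
  assumes "vr \<le> vl"
  obtains z where "z \<in> {vr..vl}" "Vel f vl vr = vel f z" "\<And>k. k \<in> {vr..vl} \<Longrightarrow> vel f k \<le> vel f z"
proof (cases "vl = vr")
  \<comment> \<open>For equal arguments \<open>Vel\<close> is defined as an infimum, here over a
    single point.\<close>
  case True then show ?thesis using that[of vl] by (simp add: Vel_def)
next
  case False
  obtain z where z: "z \<in> {vr..vl}" "\<forall>k\<in>{vr..vl}. vel f k \<le> vel f z"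
    using continuous_attains_sup[OF compact_Icc _ vel_cont, of vr vl] assms by auto
  have "Sup (vel f ` {vr..vl}) = vel f z" by (rule cSup_eq_maximum) (use z in auto)
  with z assms that False show ?thesis by (auto simp: Vel_def)
qed

lemma Vel_le: "vl \<le> k \<Longrightarrow> k \<le> vr \<Longrightarrow> Vel f vl vr \<le> vel f k"
  using Vel_min[of vl vr] by (metis atLeastAtMost_iff order_trans)

lemma Vel_ge: "vr \<le> k \<Longrightarrow> k \<le> vl \<Longrightarrow> vel f k \<le> Vel f vl vr"
  using Vel_max[of vr vl] by (metis atLeastAtMost_iff order_trans)

lemma Vel_bound: "\<bar>Vel f vl vr\<bar> \<le> L" by (metis Vel_max Vel_min vel_bound linear)

text \<open>In general \<open>f v / v\<close> is Lipschitz only away from vacuum, with a constant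
  that blows up like 1/d. This is why positive densities have to be bounded from below in the
  particle equations.\<close>

lemma vel_lip:
  assumes "0 < d" "d \<le> x" "d \<le> y"
  shows "\<bar>vel f x - vel f y\<bar> \<le> 2 * L / d * \<bar>x - y\<bar>"
proof -
  have eq: "vel f x - vel f y = (f x - f y) / x + f y / y * ((y - x) / x)"
    using assms by (simp add: vel_def field_simps)
  have "\<bar>(f x - f y) / x\<bar> \<le> L * \<bar>x - y\<bar> / d"
    using assms f_lip[of x y] L_nonneg unfolding abs_divide by (intro frac_le) auto
  moreover have "\<bar>f y / y * ((y - x) / x)\<bar> \<le> L * (\<bar>x - y\<bar> / d)" unfolding abs_mult
  proof (intro mult_mono)
    show "\<bar>f y / y\<bar> \<le> L" using vel_bound[of y] assms by (simp add: vel_def)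
    show "\<bar>(y - x) / x\<bar> \<le> \<bar>x - y\<bar> / d" using assms unfolding abs_divide by (intro frac_le) auto
  qed (use L_nonneg in auto)
  moreover have "2 * L / d * \<bar>x - y\<bar> = L * \<bar>x - y\<bar> / d + L * (\<bar>x - y\<bar> / d)" by simp
  ultimately show ?thesis unfolding eq by linarith
qed

text \<open>Raising \<open>vr\<close> enlarges the interval of a minimum or shrinks the interval of
  a maximum; when \<open>vl\<close> is crossed, \<open>vel f vl\<close> separates the two
  values.\<close>

lemma Vel_antimono_right:
  assumes "vr \<le> vr'"
  shows "Vel f vl vr' \<le> Vel f vl vr"
proof -
  consider "vl \<le> vr" | "vr < vl" "vl \<le> vr'" | "vr' < vl" by linarith
  then show ?thesis
  proof cases
    case 1
    obtain z where "z \<in> {vl..vr}" "Vel f vl vr = vel f z" by (rule Vel_min[OF 1])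
    then show ?thesis using assms Vel_le[of vl z vr'] by simp
  next
    case 2 then show ?thesis using Vel_le[of vl vl vr'] Vel_ge[of vr vl vl] by simp
  next
    case 3
    then obtain z where "z \<in> {vr'..vl}" "Vel f vl vr' = vel f z" using Vel_max[of vr' vl] by auto
    then show ?thesis using assms Vel_ge[of vr z vl] by simp
  qed
qed

text \<open>Moving the endpoint from \<open>vr\<close> to \<open>vr'\<close> exchanges only
  candidates in \<open>{vr..vr'}\<close>, on which \<open>vel f\<close> oscillates by at most
  \<open>c\<close>. The bound does not involve \<open>vl\<close>, so the cell on the other side may
  be vacuum.\<close>

lemma Vel_lip_right_aux:
  assumes d: "0 < d" "d \<le> vr" "vr \<le> vr'"
  shows "Vel f vl vr \<le> Vel f vl vr' + 2 * L / d * (vr' - vr)"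
proof -
  define c where "c = 2 * L / d * (vr' - vr)"
  have K: "vel f x \<le> vel f y + c" if "vr \<le> x" "x \<le> vr'" "vr \<le> y" "y \<le> vr'" for x y
  proof -
    have "2 * L / d * \<bar>x - y\<bar> \<le> c" unfolding c_def using that L_nonneg d by (intro mult_left_mono) auto
    moreover have "\<bar>vel f x - vel f y\<bar> \<le> 2 * L / d * \<bar>x - y\<bar>" using that d by (intro vel_lip) auto
    ultimately show ?thesis by linarith
  qed
  have nn: "0 \<le> c" unfolding c_def using L_nonneg d by simp
  have "Vel f vl vr \<le> Vel f vl vr' + c"
  proof -
    consider "vl \<le> vr" | "vr < vl" "vl \<le> vr'" | "vr' < vl" by linarith
    then show ?thesis
    proof cases
      case 1 then have "vl \<le> vr'" using d by linarith
      from Vel_min[OF this] obtain z where z: "vl \<le> z" "z \<le> vr'" "Vel f vl vr' = vel f z"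
        by (metis atLeastAtMost_iff)
      show ?thesis
      proof (cases "z \<le> vr")
        case True then show ?thesis using Vel_le[OF z(1) True] z(3) nn by linarith
      next
        case False then show ?thesis using Vel_le[OF 1 order_refl] K[of vr z] z d by linarith
      qed
    next
      case 2
      obtain z where z: "vl \<le> z" "z \<le> vr'" "Vel f vl vr' = vel f z"
        using Vel_min[OF 2(2)] by (metis atLeastAtMost_iff)
      obtain w where w: "vr \<le> w" "w \<le> vl" "Vel f vl vr = vel f w"
        using Vel_max[OF less_imp_le[OF 2(1)]] by (metis atLeastAtMost_iff)
      show ?thesis using K[of w z] z w 2 by linarith
    next
      case 3 then have "vr \<le> vl" using d by linarith
      from Vel_max[OF this] obtain w where w: "vr \<le> w" "w \<le> vl" "Vel f vl vr = vel f w" by (metis atLeastAtMost_iff)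
      show ?thesis
      proof (cases "vr' \<le> w")
        case True then show ?thesis using Vel_ge[OF True w(2)] w(3) nn by linarith
      next
        case False then show ?thesis using Vel_ge[OF order_refl less_imp_le[OF 3]] K[of w vr'] w d by linarith
      qed
    qed
  qed
  then show ?thesis by (simp add: c_def)
qed

lemma Vel_lip_right:
  assumes d: "0 < d" "d \<le> vr" "d \<le> vr'"
  shows "\<bar>Vel f vl vr - Vel f vl vr'\<bar> \<le> 2 * L / d * \<bar>vr - vr'\<bar>"
proof (cases "vr \<le> vr'")
  case True then have "\<bar>vr - vr'\<bar> = vr' - vr" by simp
  then show ?thesis
    using Vel_lip_right_aux[OF d(1,2) True, of vl] Vel_antimono_right[OF True, of vl] by (simp only: abs_if split: if_split) linarith
next
  case False then have le: "vr' \<le> vr" by simp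
  then have "\<bar>vr - vr'\<bar> = vr - vr'" by simp
  then show ?thesis
    using Vel_lip_right_aux[OF d(1,3) le, of vl] Vel_antimono_right[OF le, of vl] by (simp only: abs_if split: if_split) linarith
qed

lemma flux_uminus: "flux (\<lambda>x. - f x) L"
  by standard (use lip f0 diff0 in \<open>auto simp: lipschitz_on_def dist_real_def\<close>)

text \<open>Reflection of space: changing the sign of the flux exchanges the two sides of a particle
  and turns minima into maxima. Estimates in the right argument thereby yield those in the left
  one.\<close>

lemma Vel_uminus: "Vel (\<lambda>x. - f x) vr vl = - Vel f vl vr"
proof -
  interpret m: flux "\<lambda>x. - f x" L by (rule flux_uminus)
  have "deriv (\<lambda>x. - f x) 0 = - deriv f 0"
    by (rule DERIV_imp_deriv, rule DERIV_minus) (use diff0 in \<open>simp add: DERIV_deriv_iff_real_differentiable\<close>)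
  then have v: "vel (\<lambda>x. - f x) z = - vel f z" for z by (simp add: vel_def)
  show ?thesis
  proof (cases "vl \<le> vr")
    case True
    obtain z where z: "z \<in> {vl..vr}" "Vel f vl vr = vel f z" "\<And>k. k \<in> {vl..vr} \<Longrightarrow> vel f z \<le> vel f k"
      by (rule Vel_min[OF True]) blast
    obtain w where w: "w \<in> {vl..vr}" "Vel (\<lambda>x. - f x) vr vl = vel (\<lambda>x. - f x) w"
      "\<And>k. k \<in> {vl..vr} \<Longrightarrow> vel (\<lambda>x. - f x) k \<le> vel (\<lambda>x. - f x) w" by (rule m.Vel_max[OF True]) blast
    show ?thesis using z(3)[OF w(1)] w(3)[OF z(1)] z(2) w(2) by (simp add: v)
  next
    case False then have le: "vr \<le> vl" by simp
    obtain z where z: "z \<in> {vr..vl}" "Vel f vl vr = vel f z" "\<And>k. k \<in> {vr..vl} \<Longrightarrow> vel f k \<le> vel f z"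
      by (rule Vel_max[OF le]) blast
    obtain w where w: "w \<in> {vr..vl}" "Vel (\<lambda>x. - f x) vr vl = vel (\<lambda>x. - f x) w"
      "\<And>k. k \<in> {vr..vl} \<Longrightarrow> vel (\<lambda>x. - f x) w \<le> vel (\<lambda>x. - f x) k" by (rule m.Vel_min[OF le]) blast
    show ?thesis using z(3)[OF w(1)] w(3)[OF z(1)] z(2) w(2) by (simp add: v)
  qed
qed

lemma Vel_lip_left:
  assumes d: "0 < d" "d \<le> vl" "d \<le> vl'"
  shows "\<bar>Vel f vl vr - Vel f vl' vr\<bar> \<le> 2 * L / d * \<bar>vl - vl'\<bar>"
proof -
  interpret m: flux "\<lambda>x. - f x" L by (rule flux_uminus)
  show ?thesis using m.Vel_lip_right[OF d, of vr] by (simp add: Vel_uminus abs_minus_commute)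
qed

text \<open>On the same side of \<open>k\<close> the difference is f a - f b up to sign. On opposite
  sides the Lipschitz bound is applied to f a - f k and f b - f k, and the distances to
  \<open>k\<close> add up to the distance of \<open>a\<close> and \<open>b\<close>.\<close>

lemma Kruzkov_flux_lip: "\<bar>sgn (a - k) * (f a - f k) - sgn (b - k) * (f b - f k)\<bar> \<le> L * \<bar>a - b\<bar>"
proof -
  have mono: "L * \<bar>x\<bar> + L * \<bar>y\<bar> \<le> L * \<bar>z\<bar>" if "\<bar>x\<bar> + \<bar>y\<bar> \<le> \<bar>z\<bar>" for x y z :: real
    using mult_left_mono[OF that L_nonneg] by (simp add: algebra_simps)
  have "(sgn (a - k) = sgn (b - k) \<and> a \<noteq> k) \<or> (a = k \<or> b = k) \<or> (sgn (a - k) = - sgn (b - k) \<and> a \<noteq> k \<and> b \<noteq> k)"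
    by (cases a k rule: linorder_cases; cases b k rule: linorder_cases) (auto simp: sgn_if)
  then consider "sgn (a - k) = sgn (b - k)" "a \<noteq> k" | "a = k \<or> b = k" | "sgn (a - k) = - sgn (b - k)" "a \<noteq> k" "b \<noteq> k"
    by blast
  then show ?thesis
  proof cases
    case 1 then have "sgn (a - k) * (f a - f k) - sgn (b - k) * (f b - f k) = sgn (a - k) * (f a - f b)"
      by (simp add: algebra_simps)
    moreover have "\<bar>sgn (a - k) * (f a - f b)\<bar> = \<bar>f a - f b\<bar>" using 1(2) by (simp add: abs_mult abs_sgn_eq)
    ultimately show ?thesis using f_lip[of a b] by simp
  next
    case 2 then show ?thesis using f_lip[of a b] by (auto simp: abs_mult abs_sgn_eq abs_minus_commute)
  next
    case 3 then have "\<bar>a - k\<bar> + \<bar>b - k\<bar> \<le> \<bar>a - b\<bar>"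
      by (cases a k rule: linorder_cases; cases b k rule: linorder_cases) auto
    from mono[OF this] f_lip[of a k] f_lip[of b k]
    have "\<bar>f a - f k\<bar> + \<bar>f b - f k\<bar> \<le> L * \<bar>a - b\<bar>" by simp
    moreover have "\<bar>sgn (a - k) * (f a - f k) - sgn (b - k) * (f b - f k)\<bar> \<le> \<bar>f a - f k\<bar> + \<bar>f b - f k\<bar>"
      using 3(2,3) by (intro order_trans[OF abs_triangle_ineq4]) (simp add: abs_mult abs_sgn_eq)
    ultimately show ?thesis by linarith
  qed
qed

definition kruzkov :: "real \<Rightarrow> real \<Rightarrow> real" where "kruzkov a k = sgn (a - k) * (f a - f k)"

lemma kruzkov_lip: "\<bar>kruzkov a k - kruzkov b k\<bar> \<le> L * \<bar>a - b\<bar>" unfolding kruzkov_def by (rule Kruzkov_flux_lip)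

text \<open>Allows a cell density and the value of \<open>w\<close> to exchange the roles of state
  and Kruzkov constant.\<close>

lemma kruzkov_sym: "kruzkov a k = kruzkov k a" by (auto simp: kruzkov_def sgn_if algebra_simps)

lemma kruzkov_lip2: "\<bar>kruzkov a k - kruzkov a l\<bar> \<le> L * \<bar>k - l\<bar>"
  using kruzkov_lip[of k a l] by (simp add: kruzkov_sym)

lemma kruzkov_bound: "\<bar>kruzkov a k\<bar> \<le> L * \<bar>a - k\<bar>" using kruzkov_lip[of a k k] by (simp add: kruzkov_def)

lemma borel_kruzkov [measurable]: "(\<lambda>k. kruzkov a k) \<in> borel_measurable borel" unfolding kruzkov_def by measurable

lemma borel_kruzkov' [measurable]: "(\<lambda>a. kruzkov a k) \<in> borel_measurable borel" unfolding kruzkov_def by measurable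

end

section \<open>Particle configurations at a fixed time\<close>

text \<open>Particles are renumbered 1,...,n. Cell \<open>i\<close> lies between the particles
  \<open>i\<close> and \<open>Suc i\<close>; the cells 0 and \<open>n\<close> are the unbounded
  ones, and there is no particle 0.\<close>

definition config :: "nat \<Rightarrow> (nat \<Rightarrow> real) \<Rightarrow> (nat \<Rightarrow> real) \<Rightarrow> bool" where
  "config n \<xi> \<nu> \<longleftrightarrow> 1 \<le> n \<and> (\<forall>i\<in>{1..<n}. \<xi> i < \<xi> (Suc i)) \<and> \<nu> 0 = 0 \<and> \<nu> n = 0 \<and> (\<forall>i\<le>n. 0 \<le> \<nu> i)"

lemma sum_by_parts:
  fixes s g :: "nat \<Rightarrow> real"
  shows "(\<Sum>i\<le>n. s i * (g (Suc i) - g i)) = s n * g (Suc n) - s 0 * g 0 + (\<Sum>i<n. g (Suc i) * (s i - s (Suc i)))"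
  by (induction n) (auto simp: algebra_simps)

definition particle_vel :: "(real \<Rightarrow> real) \<Rightarrow> (nat \<Rightarrow> real) \<Rightarrow> nat \<Rightarrow> real" where
  "particle_vel f \<nu> i = Vel f (\<nu> (i - 1)) (\<nu> i)"

definition cell_field :: "(real \<Rightarrow> real) \<Rightarrow> (nat \<Rightarrow> real) \<Rightarrow> (nat \<Rightarrow> real) \<Rightarrow> nat \<Rightarrow> real \<Rightarrow> real" where
  "cell_field f \<xi> \<nu> i x =
     (\<xi> (Suc i) - x) / (\<xi> (Suc i) - \<xi> i) * particle_vel f \<nu> i
     + (x - \<xi> i) / (\<xi> (Suc i) - \<xi> i) * particle_vel f \<nu> (Suc i)"

text \<open>The function |A v - f(v)| at one time, up to values at the particles. The unbounded
  cells contribute 0, because there v = 0 and f(0) = 0.\<close>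

definition flux_error :: "(real \<Rightarrow> real) \<Rightarrow> nat \<Rightarrow> (nat \<Rightarrow> real) \<Rightarrow> (nat \<Rightarrow> real) \<Rightarrow> real \<Rightarrow> real" where
  "flux_error f n \<xi> \<nu> x =
     (\<Sum>i\<in>{1..<n}. \<bar>cell_field f \<xi> \<nu> i x * \<nu> i - f (\<nu> i)\<bar> * indicator {\<xi> i..\<xi> (Suc i)} x)"

text \<open>The time derivative of a density that keeps the mass
  \<open>\<nu> i * (\<xi> (Suc i) - \<xi> i)\<close> constant.\<close>

definition density_rate :: "(real \<Rightarrow> real) \<Rightarrow> nat \<Rightarrow> (nat \<Rightarrow> real) \<Rightarrow> (nat \<Rightarrow> real) \<Rightarrow> nat \<Rightarrow> real" where
  "density_rate f n \<xi> \<nu> i =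
     (if i \<in> {1..<n} then - \<nu> i * (particle_vel f \<nu> (Suc i) - particle_vel f \<nu> i) / (\<xi> (Suc i) - \<xi> i) else 0)"

lemma cell_field_continuous: "continuous_on A (cell_field f \<xi> \<nu> i)"
  unfolding cell_field_def divide_inverse by (intro continuous_intros)

context kernel
begin

text \<open>The values 0 and 1 are the limits of \<open>W\<close> for particles at minus and plus
  infinity, the far ends of the outer cells.\<close>

definition Wt :: "nat \<Rightarrow> (nat \<Rightarrow> real) \<Rightarrow> real \<Rightarrow> nat \<Rightarrow> real" where
  "Wt n \<xi> y i = (if i = 0 then 0 else if i \<le> n then W (\<xi> i - y) else 1)"

definition omt :: "nat \<Rightarrow> (nat \<Rightarrow> real) \<Rightarrow> real \<Rightarrow> nat \<Rightarrow> real" where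
  "omt n \<xi> y i = (if i = 0 then 0 else if i \<le> n then om (\<xi> i - y) else 0)"

text \<open>A smoothed indicator function of cell \<open>i\<close> in the variable \<open>y\<close>;
  together these weights form a partition of unity.\<close>

definition cell_weight :: "nat \<Rightarrow> (nat \<Rightarrow> real) \<Rightarrow> nat \<Rightarrow> real \<Rightarrow> real" where
  "cell_weight n \<xi> i y = Wt n \<xi> y (Suc i) - Wt n \<xi> y i"

lemma cell_weight_sum: "(\<Sum>i\<le>n. cell_weight n \<xi> i y) = 1"
proof -
  have "(\<Sum>i\<le>m. cell_weight n \<xi> i y) = Wt n \<xi> y (Suc m) - Wt n \<xi> y 0" for m
    by (induction m) (auto simp: cell_weight_def)
  then show ?thesis by (simp add: Wt_def)
qed

lemma cell_weight_nonneg: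
  assumes "config n \<xi> \<nu>" "i \<le> n"
  shows "0 \<le> cell_weight n \<xi> i y"
proof -
  have "\<xi> i \<le> \<xi> (Suc i)" if "i \<noteq> 0" "Suc i \<le> n" using assms that unfolding config_def by (intro less_imp_le) auto
  then show ?thesis using assms W_nonneg W_le_1 W_mono[of "\<xi> i - y" "\<xi> (Suc i) - y"]
    by (auto simp: cell_weight_def Wt_def)
qed

lemma borel_Wt [measurable]: "(\<lambda>y. Wt n \<xi> y i) \<in> borel_measurable borel" unfolding Wt_def by measurable

lemma borel_omt [measurable]: "(\<lambda>y. omt n \<xi> y i) \<in> borel_measurable borel" unfolding omt_def by measurable

lemma borel_cell_weight [measurable]: "cell_weight n \<xi> i \<in> borel_measurable borel"
  unfolding cell_weight_def by measurable

end

locale kernel_flux = kernel W om om' r + flux f L for W om om' r f L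
begin

text \<open>Integration by parts over one cell. The boundary terms give the transport by the two
  particles and the flux \<open>f (\<nu> i)\<close>. The field is affine, so the remaining term is
  its slope times the cell weight, which is the change of density.\<close>

lemma cell_identity:
  assumes c: "config n \<xi> \<nu>" and i: "i \<in> {1..<n}"
  shows "has_bochner_integral lborel
     (\<lambda>x. (om' (x - y) * (cell_field f \<xi> \<nu> i x * \<nu> i - f (\<nu> i))) * indicator {\<xi> i..\<xi> (Suc i)} x)
     ((omt n \<xi> y (Suc i) * particle_vel f \<nu> (Suc i) - omt n \<xi> y i * particle_vel f \<nu> i) * \<nu> i
       + density_rate f n \<xi> \<nu> i * cell_weight n \<xi> i y - f (\<nu> i) * (omt n \<xi> y (Suc i) - omt n \<xi> y i))"
proof -
  define g where "g = \<xi> (Suc i) - \<xi> i"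
  define V where "V = particle_vel f \<nu>"
  have g: "g > 0" using c i by (auto simp: g_def config_def)
  define s where "s = (V (Suc i) - V i) / g"
  \<comment> \<open>Antiderivative of the integrand; two terms suffice because the second derivative
    of the field vanishes.\<close>
  define H where "H = (\<lambda>x. om (x - y) * (cell_field f \<xi> \<nu> i x * \<nu> i - f (\<nu> i)) - W (x - y) * (s * \<nu> i))"
  have cd: "DERIV (cell_field f \<xi> \<nu> i) x :> s" for x
    unfolding cell_field_def V_def[symmetric] g_def[symmetric] s_def
    using g by (auto intro!: derivative_eq_intros simp: field_simps)
  have d1: "DERIV (\<lambda>x. om (x - y)) x :> om' (x - y)" and d2: "DERIV (\<lambda>x. W (x - y)) x :> om (x - y)" for x
    by (auto intro!: DERIV_cong[OF DERIV_chain2[OF om_deriv]] DERIV_cong[OF DERIV_chain2[OF W_deriv]]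
        derivative_eq_intros)
  have "has_bochner_integral lborel
     (\<lambda>x. (om' (x - y) * (cell_field f \<xi> \<nu> i x * \<nu> i - f (\<nu> i))) * indicator {\<xi> i..\<xi> (Suc i)} x)
     (H (\<xi> (Suc i)) - H (\<xi> i))"
  proof (rule has_bochner_integral_FTC_Icc_real)
    show "\<xi> i \<le> \<xi> (Suc i)" using g by (simp add: g_def)
    show "DERIV H x :> om' (x - y) * (cell_field f \<xi> \<nu> i x * \<nu> i - f (\<nu> i))" for x unfolding H_def
      by (rule DERIV_cong[OF DERIV_diff[OF DERIV_mult[OF d1 DERIV_diff[OF DERIV_cmult_right[OF cd] DERIV_const]]
            DERIV_cmult_right[OF d2]]]) (simp add: algebra_simps)
    have "continuous_on UNIV (\<lambda>x. om' (x - y) * (cell_field f \<xi> \<nu> i x * \<nu> i - f (\<nu> i)))"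
      by (intro continuous_intros cell_field_continuous
          continuous_on_compose2[OF smooth_continuous[OF smooth_om', of UNIV]]) auto
    then show "isCont (\<lambda>x. om' (x - y) * (cell_field f \<xi> \<nu> i x * \<nu> i - f (\<nu> i))) x" for x
      by (simp add: continuous_on_eq_continuous_at)
  qed
  moreover have "H (\<xi> (Suc i)) - H (\<xi> i) =
    ((omt n \<xi> y (Suc i) * V (Suc i) - omt n \<xi> y i * V i) * \<nu> i
       + density_rate f n \<xi> \<nu> i * cell_weight n \<xi> i y - f (\<nu> i) * (omt n \<xi> y (Suc i) - omt n \<xi> y i))"
  proof -
    have c1: "cell_field f \<xi> \<nu> i (\<xi> i) = V i" "cell_field f \<xi> \<nu> i (\<xi> (Suc i)) = V (Suc i)"
      using g by (auto simp: cell_field_def V_def g_def)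
    have dr: "density_rate f n \<xi> \<nu> i = - (s * \<nu> i)" using i by (simp add: density_rate_def s_def V_def g_def)
    have "Wt n \<xi> y i = W (\<xi> i - y)" "Wt n \<xi> y (Suc i) = W (\<xi> (Suc i) - y)"
         "omt n \<xi> y i = om (\<xi> i - y)" "omt n \<xi> y (Suc i) = om (\<xi> (Suc i) - y)"
      using i by (auto simp: Wt_def omt_def)
    then show ?thesis unfolding H_def c1 dr cell_weight_def by (simp add: algebra_simps)
  qed
  ultimately show ?thesis by (simp add: V_def)
qed

text \<open>Here the choice of \<open>Vel\<close> is used. The sign terms differ only for
  \<open>k\<close> between \<open>a\<close> and \<open>b\<close>, and there the minimum or maximum
  gives \<open>k * (vel f k - Vel f a b)\<close> the sign opposite to that of the
  difference.\<close>

lemma entropy_jump: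
  assumes "0 \<le> a" "0 \<le> b"
  shows "(f k - k * Vel f a b) * (sgn (a - k) - sgn (b - k)) \<le> 0"
proof -
  have eq: "f k - k * Vel f a b = k * (vel f k - Vel f a b)" using vel_mult[of k] by (simp add: algebra_simps)
  have "sgn (a - k) = sgn (b - k) \<or> (a \<le> k \<and> k \<le> b \<and> a < b) \<or> (b \<le> k \<and> k \<le> a \<and> b < a)" by (simp add: sgn_if)
  then consider "a \<le> k" "k \<le> b" "a < b" | "b \<le> k" "k \<le> a" "b < a" | "sgn (a - k) = sgn (b - k)" by blast
  then show ?thesis
  proof cases
    case 1 then have "0 \<le> f k - k * Vel f a b" unfolding eq using Vel_le[of a k b] assms by simp
    then show ?thesis using 1 by (intro mult_nonneg_nonpos) (auto simp: sgn_if)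
  next
    case 2 then have "f k - k * Vel f a b \<le> 0" unfolding eq using Vel_ge[of b k a] assms
      by (intro mult_nonneg_nonpos) auto
    then show ?thesis using 2 by (intro mult_nonpos_nonneg) (auto simp: sgn_if)
  qed simp
qed

text \<open>Each cell splits into three parts: the flux error \<open>R\<close> times a sign, the
  Kruzkov flux, and terms \<open>f k - k * V\<close> at its two particles. Summed by parts, the last
  ones leave at every particle a nonnegative weight times the nonpositive expression of
  \<open>entropy_jump\<close>.\<close>

lemma entropy_production:
  assumes c: "config n \<xi> \<nu>"
  shows "(\<Sum>i\<le>n. density_rate f n \<xi> \<nu> i * (cell_weight n \<xi> i y * sgn (\<nu> i - k))
      + (omt n \<xi> y (Suc i) * particle_vel f \<nu> (Suc i) - omt n \<xi> y i * particle_vel f \<nu> i) * \<bar>\<nu> i - k\<bar>)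
    \<le> (\<Sum>i\<le>n. kruzkov (\<nu> i) k * (omt n \<xi> y (Suc i) - omt n \<xi> y i)) + (LBINT x. \<bar>om' (x - y)\<bar> * flux_error f n \<xi> \<nu> x)"
proof -
  define V where "V = particle_vel f \<nu>"
  define ot where "ot = omt n \<xi> y"
  define s where "s = (\<lambda>i. sgn (\<nu> i - k))"
  define R where "R = (\<lambda>i. (ot (Suc i) * V (Suc i) - ot i * V i) * \<nu> i
       + density_rate f n \<xi> \<nu> i * cell_weight n \<xi> i y - f (\<nu> i) * (ot (Suc i) - ot i))"
  define B where "B = (\<lambda>i x. \<bar>om' (x - y)\<bar> * (\<bar>cell_field f \<xi> \<nu> i x * \<nu> i - f (\<nu> i)\<bar> * indicator {\<xi> i..\<xi> (Suc i)} x))"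
  have n: "1 \<le> n" "\<nu> 0 = 0" "\<nu> n = 0" "\<And>i. i \<le> n \<Longrightarrow> 0 \<le> \<nu> i" using c by (auto simp: config_def)
  have term_eq: "density_rate f n \<xi> \<nu> i * (cell_weight n \<xi> i y * s i) + (ot (Suc i) * V (Suc i) - ot i * V i) * \<bar>\<nu> i - k\<bar>
      = s i * R i + kruzkov (\<nu> i) k * (ot (Suc i) - ot i)
        + s i * (ot (Suc i) * (f k - k * V (Suc i)) - ot i * (f k - k * V i))" for i
  proof -
    have e1: "\<bar>\<nu> i - k\<bar> = s i * (\<nu> i - k)" by (simp add: s_def abs_sgn mult.commute)
    have e2: "kruzkov (\<nu> i) k = s i * (f (\<nu> i) - f k)" by (simp add: s_def kruzkov_def)
    \<comment> \<open>With the modulus written as sign times argument, the splitting is a polynomial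
      identity, valid for an arbitrary number in place of the sign.\<close>
    have "d * (w * t) + (p * v - q * u) * (t * (x - k))
      = t * ((p * v - q * u) * x + d * w - F * (p - q)) + t * (F - G) * (p - q)
        + t * (p * (G - k * v) - q * (G - k * u))" for d w t p v q u x F G :: real by algebra
    then show ?thesis unfolding e1 e2 R_def by blast
  qed
  have Rb: "has_bochner_integral lborel
     (\<lambda>x. (om' (x - y) * (cell_field f \<xi> \<nu> i x * \<nu> i - f (\<nu> i))) * indicator {\<xi> i..\<xi> (Suc i)} x) (R i)"
    if "i \<in> {1..<n}" for i using cell_identity[OF c that, of y] by (simp add: R_def V_def ot_def)
  have Beq: "B i x = norm ((om' (x - y) * (cell_field f \<xi> \<nu> i x * \<nu> i - f (\<nu> i))) * indicator {\<xi> i..\<xi> (Suc i)} x)" for i x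
    by (simp add: B_def abs_mult)
  have Bint: "integrable lborel (B i)" if "i \<in> {1..<n}" for i
    unfolding Beq[abs_def] by (rule integrable_norm) (use Rb[OF that] in \<open>simp add: has_bochner_integral_iff\<close>)
  have RB: "s i * R i \<le> (LBINT x. B i x)" if "i \<in> {1..<n}" for i
  proof -
    have "s i * R i \<le> \<bar>R i\<bar>" by (auto simp: s_def sgn_if)
    also have "\<dots> \<le> (LBINT x. B i x)"
      unfolding Beq has_bochner_integral_integral_eq[OF Rb[OF that], symmetric] real_norm_def[symmetric]
      by (rule integral_norm_bound)
    finally show ?thesis .
  qed
  \<comment> \<open>In the outer cells the density, its flux and the density rate are 0, so
    \<open>R\<close> vanishes.\<close>
  have "(\<Sum>i\<le>n. s i * R i) = (\<Sum>i\<in>{1..<n}. s i * R i)"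
  proof (rule sum.mono_neutral_right)
    show "\<forall>i\<in>{..n} - {1..<n}. s i * R i = 0"
    proof
      fix i assume "i \<in> {..n} - {1..<n}"
      then have "i = 0 \<or> i = n" by auto
      then have "R i = 0" using n by (auto simp: R_def density_rate_def f0)
      then show "s i * R i = 0" by simp
    qed
  qed auto
  also have "\<dots> \<le> (\<Sum>i\<in>{1..<n}. LBINT x. B i x)" by (intro sum_mono RB) auto
  also have "\<dots> = (LBINT x. (\<Sum>i\<in>{1..<n}. B i x))"
    by (rule integral_sum[symmetric]) (use Bint in auto)
  also have "\<dots> = (LBINT x. \<bar>om' (x - y)\<bar> * flux_error f n \<xi> \<nu> x)"
    by (simp only: B_def flux_error_def sum_distrib_left)
  finally have 1: "(\<Sum>i\<le>n. s i * R i) \<le> (LBINT x. \<bar>om' (x - y)\<bar> * flux_error f n \<xi> \<nu> x)" .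
  \<comment> \<open>The conventions \<open>omt = 0\<close> at the indices 0 and \<open>Suc n\<close>
    remove the boundary terms of the summation by parts.\<close>
  define g where "g = (\<lambda>i. ot i * (f k - k * V i))"
  have "(\<Sum>i\<le>n. s i * (g (Suc i) - g i)) = (\<Sum>i<n. g (Suc i) * (s i - s (Suc i)))"
    unfolding sum_by_parts by (simp add: g_def ot_def omt_def)
  also have "\<dots> \<le> 0"
  proof (rule sum_nonpos)
    fix i assume i: "i \<in> {..<n}"
    have "(f k - k * V (Suc i)) * (s i - s (Suc i)) \<le> 0"
      unfolding s_def V_def particle_vel_def using entropy_jump[of "\<nu> i" "\<nu> (Suc i)" k] n(4)[of i] n(4)[of "Suc i"] i by simp
    moreover have "0 \<le> ot (Suc i)" using om_nonneg by (simp add: ot_def omt_def)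
    ultimately show "g (Suc i) * (s i - s (Suc i)) \<le> 0"
      unfolding g_def mult.assoc by (rule mult_nonneg_nonpos[rotated])
  qed
  finally have 2: "(\<Sum>i\<le>n. s i * (g (Suc i) - g i)) \<le> 0" .
  have "(\<Sum>i\<le>n. density_rate f n \<xi> \<nu> i * (cell_weight n \<xi> i y * s i) + (ot (Suc i) * V (Suc i) - ot i * V i) * \<bar>\<nu> i - k\<bar>)
     = (\<Sum>i\<le>n. s i * R i) + (\<Sum>i\<le>n. kruzkov (\<nu> i) k * (ot (Suc i) - ot i)) + (\<Sum>i\<le>n. s i * (g (Suc i) - g i))"
    unfolding term_eq sum.distrib g_def by simp
  with 1 2 show ?thesis unfolding V_def ot_def s_def by linarith
qed

end

section \<open>The smoothed distance of a configuration to a function\<close>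

definition loc_integrable :: "(real \<Rightarrow> real) \<Rightarrow> bool" where
  "loc_integrable c \<longleftrightarrow> c \<in> borel_measurable borel \<and> (\<forall>u v. integrable lborel (\<lambda>y. indicator {u..v} y * c y))"

lemma loc_integrable_mult:
  assumes c: "loc_integrable c" and [measurable]: "g \<in> borel_measurable borel"
    and supp: "\<And>y. y \<notin> {u..v} \<Longrightarrow> g y = 0" and bd: "\<And>y. \<bar>g y\<bar> \<le> M"
  shows "integrable lborel (\<lambda>y. g y * c y)"
proof (rule integrable_bound)
  show "integrable lborel (\<lambda>y. M * (indicator {u..v} y * c y))" using c by (auto simp: loc_integrable_def)
  show "AE y in lborel. norm (g y * c y) \<le> norm (M * (indicator {u..v} y * c y))"
  proof (rule AE_I2)
    fix y
    have "0 \<le> M" using bd[of y] by linarith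
    then show "norm (g y * c y) \<le> norm (M * (indicator {u..v} y * c y))"
      using supp[of y] bd[of y] by (cases "y \<in> {u..v}") (auto simp: abs_mult intro!: mult_right_mono)
  qed
  show "(\<lambda>y. g y * c y) \<in> borel_measurable lborel" using c by (auto simp: loc_integrable_def)
qed

lemma loc_integrable_abs_diff:
  assumes w: "integrable lborel w"
  shows "loc_integrable (\<lambda>y. \<bar>d - w y\<bar>)"
proof -
  have [measurable]: "w \<in> borel_measurable borel" using w by auto
  have "integrable lborel (\<lambda>y. indicator {u..v} y * \<bar>d - w y\<bar>)" for u v
  proof (rule integrable_bound)
    show "integrable lborel (\<lambda>y. indicator {u..v} y * \<bar>d\<bar> + \<bar>w y\<bar>)"
      using w by (intro integrable_add integrable_mult_left integrable_abs)
        (auto simp: integrable_indicator_iff emeasure_lborel_Icc_eq)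
    show "AE y in lborel. norm (indicator {u..v} y * \<bar>d - w y\<bar>) \<le> norm (indicator {u..v} y * \<bar>d\<bar> + \<bar>w y\<bar>)"
      by (rule AE_I2) (auto simp: indicator_def)
  qed measurable
  then show ?thesis by (simp add: loc_integrable_def)
qed

lemma loc_integrable_const: "loc_integrable (\<lambda>y. d)" using loc_integrable_abs_diff[of "\<lambda>y. 0" "\<bar>d\<bar>"]
    loc_integrable_abs_diff[of "\<lambda>y. 0" 1]
  unfolding loc_integrable_def by (auto intro!: integrable_mult_left simp: integrable_indicator_iff emeasure_lborel_Icc_eq)

lemma loc_integrable_sgn:
  assumes w: "integrable lborel w"
  shows "loc_integrable (\<lambda>y. sgn (d - w y))"
proof -
  have [measurable]: "w \<in> borel_measurable borel" using w by auto
  have "integrable lborel (\<lambda>y. indicator {u..v} y * sgn (d - w y))" for u v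
    by (rule integrable_compact_bounded[of _ u v 1]) (auto simp: indicator_def sgn_if)
  then show ?thesis by (simp add: loc_integrable_def)
qed

lemma DERIV_quadratic_remainder:
  fixes F :: "real \<Rightarrow> real"
  assumes "\<And>h. \<bar>h\<bar> \<le> 1 \<Longrightarrow> \<bar>F (z + h) - F z - D * h\<bar> \<le> K * h\<^sup>2"
  shows "DERIV F z :> D"
proof -
  have "((\<lambda>h. (F (z + h) - F z) / h - D) \<longlongrightarrow> 0) (at 0)"
  proof (rule Lim_null_comparison)
    show "eventually (\<lambda>h. norm ((F (z + h) - F z) / h - D) \<le> K * \<bar>h\<bar>) (at 0)"
    proof -
      have "eventually (\<lambda>h::real. h \<noteq> 0 \<and> dist h 0 < 1) (at 0)" by (auto simp: eventually_at intro!: exI[of _ 1])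
      then show ?thesis
      proof (rule eventually_mono)
        fix h :: real assume h: "h \<noteq> 0 \<and> dist h 0 < 1"
        have "(F (z + h) - F z) / h - D = (F (z + h) - F z - D * h) / h" using h by (simp add: field_simps)
        then have "norm ((F (z + h) - F z) / h - D) = \<bar>F (z + h) - F z - D * h\<bar> / \<bar>h\<bar>" by (simp add: abs_divide)
        also have "\<dots> \<le> K * h\<^sup>2 / \<bar>h\<bar>" using h assms[of h] by (intro divide_right_mono) (auto simp: dist_real_def)
        also have "\<dots> = K * \<bar>h\<bar>"
        proof -
          have "h\<^sup>2 = \<bar>h\<bar> * \<bar>h\<bar>" by (simp add: power2_eq_square)
          then show ?thesis using h by (simp del: abs_mult_self_eq)
        qed
        finally show "norm ((F (z + h) - F z) / h - D) \<le> K * \<bar>h\<bar>" .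
      qed
    qed
    show "((\<lambda>h. K * \<bar>h\<bar>) \<longlongrightarrow> 0) (at 0)" by (rule tendsto_eq_intros refl tendsto_rabs_zero tendsto_ident_at)+ simp
  qed
  from LIM_zero_cancel[OF this] show ?thesis by (simp add: DERIV_def)
qed

lemma config_ends:
  assumes "config n \<xi> \<nu>" "i \<le> n" "i \<notin> {1..<n}" shows "\<nu> i = 0"
proof -
  have "i = 0 \<or> i = n" using assms by auto
  then show ?thesis using assms by (auto simp: config_def)
qed

lemma config_less:
  assumes "config n \<xi> \<nu>" "1 \<le> i" "i < j" "j \<le> n"
  shows "\<xi> i < \<xi> j" using assms(3,4)
proof (induction j)
  case (Suc j) have "\<xi> j < \<xi> (Suc j)" if "1 \<le> j" using assms(1) Suc.prems that by (auto simp: config_def)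
  with Suc assms(2) show ?case by (cases "i = j") force+
qed simp

section \<open>Dependence of the weights on the particle positions\<close>

context kernel
begin

lemma W_diff_supp: "y \<notin> {min a b - r..max a b + r} \<Longrightarrow> W (a - y) - W (b - y) = 0"
  using W_left[of "a - y"] W_left[of "b - y"] W_right[of "a - y"] W_right[of "b - y"]
  by (auto simp: min_def max_def split: if_splits)

lemma W_diff_bound: "\<bar>W a - W b\<bar> \<le> 1" using W_nonneg[of a] W_nonneg[of b] W_le_1[of a] W_le_1[of b] by linarith

lemma W_diff_integrable:
  assumes "loc_integrable c"
  shows "integrable lborel (\<lambda>y. (W (a - y) - W (b - y)) * c y)"
  by (rule loc_integrable_mult[OF assms _ W_diff_supp W_diff_bound]) measurable

lemma om_integrable:
  assumes "loc_integrable c"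
  shows "integrable lborel (\<lambda>y. om (a - y) * c y)"
  by (rule loc_integrable_mult[OF assms, of _ "a - r" "a + r" om_max])
     (measurable, auto intro!: om_outside om_max)

text \<open>The integral of \<open>W (z - y) * c y\<close> alone may diverge as \<open>y\<close>
  tends to minus infinity. Subtracting a fixed translate makes the weight compactly supported and
  leaves differences in \<open>z\<close> unchanged.\<close>

definition W_moment :: "(real \<Rightarrow> real) \<Rightarrow> real \<Rightarrow> real" where "W_moment c z = (LBINT y. (W (z - y) - W (- y)) * c y)"

lemma W_moment_diff:
  assumes "loc_integrable c"
  shows "W_moment c a - W_moment c b = (LBINT y. (W (a - y) - W (b - y)) * c y)"
proof -
  have "W_moment c a - W_moment c b = (LBINT y. (W (a - y) - W (- y)) * c y - (W (b - y) - W (- y)) * c y)"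
    unfolding W_moment_def using W_diff_integrable[OF assms, of a 0] W_diff_integrable[OF assms, of b 0]
    by (subst integral_diff) auto
  then show ?thesis by (simp add: algebra_simps)
qed

text \<open>Differentiation under the integral sign by \<open>W_taylor\<close>: for
  \<open>\<bar>h\<bar> \<le> 1\<close> the remainder is quadratic in \<open>h\<close> and supported
  in one bounded interval, on which \<open>c\<close> is integrable.\<close>

lemma W_moment_deriv:
  assumes c: "loc_integrable c"
  shows "DERIV (W_moment c) z :> (LBINT y. om (z - y) * c y)"
proof (rule DERIV_quadratic_remainder)
  fix h :: real assume h: "\<bar>h\<bar> \<le> 1"
  have cb [measurable]: "c \<in> borel_measurable borel" using c by (simp add: loc_integrable_def)
  define R where "R = (\<lambda>y. (W (z + h - y) - W (z - y)) * c y - h * (om (z - y) * c y))"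
  define G where "G = (\<lambda>y. indicator {z - r - 1..z + r + 1} y * c y)"
  have iR: "integrable lborel R" unfolding R_def
    by (intro integrable_diff integrable_mult_right W_diff_integrable om_integrable c)
  have iG: "integrable lborel G" using c by (simp add: G_def loc_integrable_def)
  have "W_moment c (z + h) - W_moment c z - (LBINT y. om (z - y) * c y) * h = (LBINT y. R y)"
    unfolding W_moment_diff[OF c] R_def
    by (subst integral_diff)
       (auto intro!: integrable_mult_right W_diff_integrable om_integrable c)
  also have "\<bar>\<dots>\<bar> \<le> (LBINT y. \<bar>R y\<bar>)" using integral_norm_bound[of lborel R] by simp
  also have "\<dots> \<le> (LBINT y. om_max * h\<^sup>2 * \<bar>G y\<bar>)"
  proof (rule integral_mono)
    fix y
    show "\<bar>R y\<bar> \<le> om_max * h\<^sup>2 * \<bar>G y\<bar>"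
    proof (cases "y \<in> {z - r - 1..z + r + 1}")
      case True have "\<bar>R y\<bar> = \<bar>W (z + h - y) - W (z - y) - om (z - y) * ((z + h - y) - (z - y))\<bar> * \<bar>c y\<bar>"
        unfolding R_def abs_mult[symmetric] by (simp add: algebra_simps)
      also have "\<dots> \<le> om_max * ((z + h - y) - (z - y))\<^sup>2 * \<bar>c y\<bar>" by (intro mult_right_mono W_taylor) auto
      finally show ?thesis using True by (simp add: G_def)
    next
      case False then have "W (z + h - y) - W (z - y) = 0"
        using h by (intro W_diff_supp) (auto simp: min_def max_def)
      moreover have "om (z - y) = 0" using False by (intro om_outside) auto
      ultimately show ?thesis using om_max by (simp add: R_def)
    qed
  qed (use iR iG in \<open>auto intro!: integrable_abs integrable_mult_right\<close>)
  also have "\<dots> = (om_max * (LBINT y. \<bar>G y\<bar>)) * h\<^sup>2" by simp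
  finally show "\<bar>W_moment c (z + h) - W_moment c z - (LBINT y. om (z - y) * c y) * h\<bar>
      \<le> (om_max * (LBINT y. \<bar>G y\<bar>)) * h\<^sup>2" .
qed

text \<open>Monotonicity of \<open>W\<close> rules out cancellation, so the L^1 distance of two
  translates inherits the continuity of the moment in \<open>a\<close> and \<open>b\<close>.\<close>

lemma W_L1_dist: "(LBINT y. \<bar>W (a - y) - W (b - y)\<bar>) = \<bar>W_moment (\<lambda>y. 1) a - W_moment (\<lambda>y. 1) b\<bar>"
proof -
  have eq: "(LBINT y. \<bar>W (a - y) - W (b - y)\<bar>) = \<bar>W_moment (\<lambda>y. 1) a - W_moment (\<lambda>y. 1) b\<bar>" if "b \<le> a" for a b
  proof -
    have p: "\<bar>W (a - y) - W (b - y)\<bar> = W (a - y) - W (b - y)" for y using W_mono[of "b - y" "a - y"] that by simp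
    have "0 \<le> (LBINT y. \<bar>W (a - y) - W (b - y)\<bar>)" by simp
    then show ?thesis unfolding p W_moment_diff[OF loc_integrable_const] by simp
  qed
  show ?thesis
  proof (cases "b \<le> a")
    case False then show ?thesis using eq[of a b] by (simp add: abs_minus_commute)
  qed (rule eq)
qed

definition smoothed_dist :: "nat \<Rightarrow> (nat \<Rightarrow> real) \<Rightarrow> (nat \<Rightarrow> real) \<Rightarrow> (real \<Rightarrow> real) \<Rightarrow> real" where
  "smoothed_dist n \<xi> \<nu> w = (\<Sum>i\<le>n. (LBINT y. cell_weight n \<xi> i y * \<bar>\<nu> i - w y\<bar>))"

lemma cell_weight_le_1:
  assumes "config n \<xi> \<nu>" "i \<le> n"
  shows "cell_weight n \<xi> i y \<le> 1"
proof -
  have "cell_weight n \<xi> i y \<le> (\<Sum>j\<le>n. cell_weight n \<xi> j y)"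
    using assms by (intro member_le_sum) (auto intro: cell_weight_nonneg)
  then show ?thesis by (simp add: cell_weight_sum)
qed

lemma cell_weight_supp:
  assumes "config n \<xi> \<nu>" "i \<in> {1..<n}" "y \<notin> {\<xi> i - r..\<xi> (Suc i) + r}"
  shows "cell_weight n \<xi> i y = 0"
proof -
  have "\<xi> i < \<xi> (Suc i)" using assms by (auto simp: config_def)
  then show ?thesis using assms W_diff_supp[of y "\<xi> (Suc i)" "\<xi> i"]
    by (auto simp: cell_weight_def Wt_def min_def max_def)
qed

lemma cell_weight_abs:
  assumes "config n \<xi> \<nu>" "i \<le> n"
  shows "\<bar>cell_weight n \<xi> i y\<bar> \<le> 1"
  using cell_weight_nonneg[OF assms, of y] cell_weight_le_1[OF assms, of y] by simp

lemma cell_weight_mult_integrable: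
  assumes "config n \<xi> \<nu>" "i \<in> {1..<n}" "loc_integrable c"
  shows "integrable lborel (\<lambda>y. cell_weight n \<xi> i y * c y)"
  using assms(2) by (intro loc_integrable_mult[OF assms(3) _ cell_weight_supp[OF assms(1,2)] cell_weight_abs[OF assms(1)]])
    auto

text \<open>The weight of an outer cell does not decay on one side; integrability of
  \<open>w\<close> is enough there because \<open>d\<close> is 0.\<close>

lemma cell_integrable:
  assumes c: "config n \<xi> \<nu>" and w: "integrable lborel w" and i: "i \<le> n" and d: "i \<notin> {1..<n} \<Longrightarrow> d = 0"
  shows "integrable lborel (\<lambda>y. cell_weight n \<xi> i y * \<bar>d - w y\<bar>)"
proof (cases "i \<in> {1..<n}")
  case True then show ?thesis by (intro cell_weight_mult_integrable[OF c] loc_integrable_abs_diff w)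
next
  case False have [measurable]: "w \<in> borel_measurable borel" using w by auto
  show ?thesis
  proof (rule integrable_bound[OF w])
    show "AE y in lborel. norm (cell_weight n \<xi> i y * \<bar>d - w y\<bar>) \<le> norm (w y)"
      using d[OF False] cell_weight_abs[OF c i] by (auto simp: abs_mult intro!: mult_left_le_one_le)
  qed measurable
qed

lemma smoothed_dist_integral:
  assumes c: "config n \<xi> \<nu>" and w: "integrable lborel w"
  shows "smoothed_dist n \<xi> \<nu> w = (LBINT y. (\<Sum>i\<le>n. cell_weight n \<xi> i y * \<bar>\<nu> i - w y\<bar>))"
    and "integrable lborel (\<lambda>y. \<Sum>i\<le>n. cell_weight n \<xi> i y * \<bar>\<nu> i - w y\<bar>)"
proof -
  have int: "integrable lborel (\<lambda>y. cell_weight n \<xi> i y * \<bar>\<nu> i - w y\<bar>)" if "i \<in> {..n}" for i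
    using that by (intro cell_integrable[OF c w]) (auto intro: config_ends[OF c])
  show "smoothed_dist n \<xi> \<nu> w = (LBINT y. (\<Sum>i\<le>n. cell_weight n \<xi> i y * \<bar>\<nu> i - w y\<bar>))"
    unfolding smoothed_dist_def by (rule integral_sum[symmetric, OF int])
  show "integrable lborel (\<lambda>y. \<Sum>i\<le>n. cell_weight n \<xi> i y * \<bar>\<nu> i - w y\<bar>)"
    by (rule integrable_sum[OF int])
qed

text \<open>The weights are nonnegative with sum 1 at every \<open>y\<close>, which gives the
  Lipschitz constant 1 in L^1.\<close>

lemma smoothed_dist_lipschitz:
  assumes c: "config n \<xi> \<nu>" and w: "integrable lborel w" and w': "integrable lborel w'"
  shows "\<bar>smoothed_dist n \<xi> \<nu> w - smoothed_dist n \<xi> \<nu> w'\<bar> \<le> (LBINT y. \<bar>w y - w' y\<bar>)"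
proof -
  let ?g = "\<lambda>w y. \<Sum>i\<le>n. cell_weight n \<xi> i y * \<bar>\<nu> i - w y\<bar>"
  note I = smoothed_dist_integral[OF c w] smoothed_dist_integral[OF c w']
  have eq: "smoothed_dist n \<xi> \<nu> w - smoothed_dist n \<xi> \<nu> w' = (LBINT y. ?g w y - ?g w' y)"
    unfolding I(1) I(3) by (rule integral_diff[symmetric, OF I(2) I(4)])
  have "\<bar>smoothed_dist n \<xi> \<nu> w - smoothed_dist n \<xi> \<nu> w'\<bar> \<le> (LBINT y. \<bar>?g w y - ?g w' y\<bar>)"
    unfolding eq using integral_norm_bound[of lborel "\<lambda>y. ?g w y - ?g w' y"] by simp
  also have "\<dots> \<le> (LBINT y. \<bar>w y - w' y\<bar>)"
  proof (rule integral_mono)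
    fix y
    have "\<bar>?g w y - ?g w' y\<bar> = \<bar>\<Sum>i\<le>n. cell_weight n \<xi> i y * (\<bar>\<nu> i - w y\<bar> - \<bar>\<nu> i - w' y\<bar>)\<bar>"
      by (simp only: sum_subtractf right_diff_distrib)
    also have "\<dots> \<le> (\<Sum>i\<le>n. \<bar>cell_weight n \<xi> i y * (\<bar>\<nu> i - w y\<bar> - \<bar>\<nu> i - w' y\<bar>)\<bar>)" by (rule sum_abs)
    also have "\<dots> \<le> (\<Sum>i\<le>n. cell_weight n \<xi> i y * \<bar>w y - w' y\<bar>)"
      by (intro sum_mono) (auto simp: abs_mult cell_weight_nonneg[OF c] intro!: mult_left_mono)
    also have "\<dots> = \<bar>w y - w' y\<bar>" by (simp add: sum_distrib_right[symmetric] cell_weight_sum)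
    finally show "\<bar>?g w y - ?g w' y\<bar> \<le> \<bar>w y - w' y\<bar>" .
  qed (use I(2,4) w w' in auto)
  finally show ?thesis .
qed

end

context kernel_flux
begin

text \<open>The Kruzkov fluxes tested with the derivatives of the weights. The term appears with
  opposite signs when the particles move and when \<open>w\<close> evolves, which makes the two
  effects cancel.\<close>

definition flux_pairing :: "nat \<Rightarrow> (nat \<Rightarrow> real) \<Rightarrow> (nat \<Rightarrow> real) \<Rightarrow> (real \<Rightarrow> real) \<Rightarrow> real" where
  "flux_pairing n \<xi> \<nu> w = (\<Sum>i\<le>n. (LBINT y. kruzkov (\<nu> i) (w y) * (omt n \<xi> y (Suc i) - omt n \<xi> y i)))"

lemma omt_supp_ex:
  obtains u v where "\<And>y i. y \<notin> {u..v} \<Longrightarrow> omt n \<xi> y i = 0"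
proof -
  define u where "u = Min (\<xi> ` {0..n}) - r"
  define v where "v = Max (\<xi> ` {0..n}) + r"
  have "omt n \<xi> y i = 0" if y: "y \<notin> {u..v}" for y i
  proof (cases "1 \<le> i \<and> i \<le> n")
    case True then have "u + r \<le> \<xi> i" "\<xi> i \<le> v - r" by (auto simp: u_def v_def)
    with y have "r \<le> \<bar>\<xi> i - y\<bar>" by auto
    then show ?thesis using True by (simp add: omt_def om_outside)
  qed (auto simp: omt_def)
  then show ?thesis using that by blast
qed

lemma omt_bound: "\<bar>omt n \<xi> y i\<bar> \<le> om_max" using om_max by (auto simp: omt_def)

lemma omt_mult_integrable:
  assumes "loc_integrable c" shows "integrable lborel (\<lambda>y. omt n \<xi> y i * c y)"
proof -
  obtain u v where "\<And>y i. y \<notin> {u..v} \<Longrightarrow> omt n \<xi> y i = 0" using omt_supp_ex by blast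
  then show ?thesis by (intro loc_integrable_mult[OF assms _ _ omt_bound]) auto
qed

lemma loc_integrable_kruzkov:
  assumes w: "integrable lborel w"
  shows "loc_integrable (\<lambda>y. kruzkov d (w y))"
proof -
  have [measurable]: "w \<in> borel_measurable borel" using w by auto
  have "integrable lborel (\<lambda>y. indicator {u..v} y * kruzkov d (w y))" for u v
  proof (rule integrable_bound)
    show "integrable lborel (\<lambda>y. L * (indicator {u..v} y * \<bar>d - w y\<bar>))"
      using loc_integrable_abs_diff[OF w, of d] by (auto simp: loc_integrable_def)
    show "AE y in lborel. norm (indicator {u..v} y * kruzkov d (w y)) \<le> norm (L * (indicator {u..v} y * \<bar>d - w y\<bar>))"
      using kruzkov_bound L_nonneg by (intro AE_I2) (auto simp: indicator_def abs_mult)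
  qed measurable
  then show ?thesis by (simp add: loc_integrable_def)
qed

lemma flux_pairing_integrable:
  assumes w: "integrable lborel w"
  shows "integrable lborel (\<lambda>y. kruzkov d (w y) * (omt n \<xi> y (Suc i) - omt n \<xi> y i))"
proof -
  have "integrable lborel (\<lambda>y. omt n \<xi> y (Suc i) * kruzkov d (w y) - omt n \<xi> y i * kruzkov d (w y))"
    by (intro integrable_diff omt_mult_integrable loc_integrable_kruzkov w)
  then show ?thesis by (simp add: algebra_simps)
qed

lemma flux_pairing_lipschitz:
  assumes w: "integrable lborel w" and w': "integrable lborel w'"
  shows "\<bar>flux_pairing n \<xi> \<nu> w - flux_pairing n \<xi> \<nu> w'\<bar> \<le> real (Suc n) * (2 * om_max * L) * (LBINT y. \<bar>w y - w' y\<bar>)"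
proof -
  let ?o = "\<lambda>i y. omt n \<xi> y (Suc i) - omt n \<xi> y i"
  have one: "\<bar>(LBINT y. kruzkov (\<nu> i) (w y) * ?o i y) - (LBINT y. kruzkov (\<nu> i) (w' y) * ?o i y)\<bar>
     \<le> 2 * om_max * L * (LBINT y. \<bar>w y - w' y\<bar>)" for i
  proof -
    have eq: "(LBINT y. kruzkov (\<nu> i) (w y) * ?o i y) - (LBINT y. kruzkov (\<nu> i) (w' y) * ?o i y)
        = (LBINT y. kruzkov (\<nu> i) (w y) * ?o i y - kruzkov (\<nu> i) (w' y) * ?o i y)"
      by (rule integral_diff[symmetric]) (intro flux_pairing_integrable w w')+
    have "\<bar>(LBINT y. kruzkov (\<nu> i) (w y) * ?o i y) - (LBINT y. kruzkov (\<nu> i) (w' y) * ?o i y)\<bar>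
       \<le> (LBINT y. \<bar>kruzkov (\<nu> i) (w y) * ?o i y - kruzkov (\<nu> i) (w' y) * ?o i y\<bar>)"
      unfolding eq using integral_norm_bound[of lborel "\<lambda>y. kruzkov (\<nu> i) (w y) * ?o i y - kruzkov (\<nu> i) (w' y) * ?o i y"] by simp
    also have "\<dots> \<le> (LBINT y. 2 * om_max * L * \<bar>w y - w' y\<bar>)"
    proof (rule integral_mono)
      fix y
      have "\<bar>kruzkov (\<nu> i) (w y) * ?o i y - kruzkov (\<nu> i) (w' y) * ?o i y\<bar>
          = \<bar>kruzkov (\<nu> i) (w y) - kruzkov (\<nu> i) (w' y)\<bar> * \<bar>?o i y\<bar>"
        by (simp only: abs_mult[symmetric] left_diff_distrib)
      also have "\<dots> \<le> (L * \<bar>w y - w' y\<bar>) * (2 * om_max)"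
      proof (rule mult_mono)
        show "\<bar>?o i y\<bar> \<le> 2 * om_max" using omt_bound[of n \<xi> y i] omt_bound[of n \<xi> y "Suc i"] by linarith
      qed (use kruzkov_lip2 L_nonneg in auto)
      finally show "\<bar>kruzkov (\<nu> i) (w y) * ?o i y - kruzkov (\<nu> i) (w' y) * ?o i y\<bar> \<le> 2 * om_max * L * \<bar>w y - w' y\<bar>"
        by (simp add: mult_ac)
    qed (use w w' in \<open>auto intro!: flux_pairing_integrable\<close>)
    finally show ?thesis by simp
  qed
  have "\<bar>flux_pairing n \<xi> \<nu> w - flux_pairing n \<xi> \<nu> w'\<bar>
     \<le> (\<Sum>i\<le>n. \<bar>(LBINT y. kruzkov (\<nu> i) (w y) * ?o i y) - (LBINT y. kruzkov (\<nu> i) (w' y) * ?o i y)\<bar>)"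
    unfolding flux_pairing_def sum_subtractf[symmetric] by (rule sum_abs)
  also have "\<dots> \<le> (\<Sum>i\<le>n. 2 * om_max * L * (LBINT y. \<bar>w y - w' y\<bar>))" by (intro sum_mono one)
  finally show ?thesis by simp
qed

end

lemma DERIV_left_quotient:
  assumes "DERIV g t :> D"
  shows "((\<lambda>s. (g t - g s) / (t - s)) \<longlongrightarrow> D) (at_left t)"
proof -
  have "((\<lambda>s. (g s - g t) / (s - t)) \<longlongrightarrow> D) (at t)" using assms by (simp add: has_field_derivative_iff)
  then have "((\<lambda>s. (g s - g t) / (s - t)) \<longlongrightarrow> D) (at_left t)" by (rule filterlim_mono) (auto simp: at_le)
  moreover have "(\<lambda>s. (g s - g t) / (s - t)) = (\<lambda>s. (g t - g s) / (t - s))"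
    by (rule ext) (metis minus_diff_eq minus_divide_divide)
  ultimately show ?thesis by simp
qed

text \<open>Fubini and translation invariance; with \<open>g = \<bar>om'\<bar>\<close> this produces
  the factor in front of the flux error.\<close>

lemma convolution_integral:
  fixes g e :: "real \<Rightarrow> real"
  assumes g: "integrable lborel g" and e: "integrable lborel e"
  shows "integrable lborel (\<lambda>y. LBINT x. g (x - y) * e x)"
    and "(LBINT y. LBINT x. g (x - y) * e x) = (LBINT z. g z) * (LBINT x. e x)"
proof -
  have [measurable]: "g \<in> borel_measurable borel" "e \<in> borel_measurable borel" using g e by auto
  have trans: "integrable lborel (\<lambda>y. g (x - y))" "(LBINT y. g (x - y)) = (LBINT z. g z)" for x
    using lborel_integrable_real_affine[of g "-1" x] g lborel_integral_real_affine[of "-1" g x] by auto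
  have trans_abs: "(LBINT y. \<bar>g (x - y)\<bar>) = (LBINT z. \<bar>g z\<bar>)" for x
    using lborel_integral_real_affine[of "-1" "\<lambda>z. \<bar>g z\<bar>" x] by auto
  have P: "integrable (lborel \<Otimes>\<^sub>M lborel) (\<lambda>(x, y). g (x - y) * e x)"
  proof (rule lborel_pair.Fubini_integrable)
    show "(\<lambda>(x, y). g (x - y) * e x) \<in> borel_measurable (lborel \<Otimes>\<^sub>M lborel)" by measurable
    have "(\<lambda>x. LBINT y. norm (g (x - y) * e x)) = (\<lambda>x. (LBINT z. \<bar>g z\<bar>) * \<bar>e x\<bar>)" by (simp add: abs_mult trans_abs)
    then show "integrable lborel (\<lambda>x. LBINT y. norm (case (x, y) of (x, y) \<Rightarrow> g (x - y) * e x))" using e by simp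
    show "AE x in lborel. integrable lborel (\<lambda>y. case (x, y) of (x, y) \<Rightarrow> g (x - y) * e x)"
      by (rule AE_I2) (auto intro!: integrable_mult_left trans)
  qed
  then show "integrable lborel (\<lambda>y. LBINT x. g (x - y) * e x)" by (rule lborel_pair.integrable_snd)
  have "(LBINT y. LBINT x. g (x - y) * e x) = (LBINT x. LBINT y. g (x - y) * e x)"
    by (rule lborel_pair.Fubini_integral[OF P])
  also have "\<dots> = (LBINT x. (LBINT z. g z) * e x)" by (simp add: trans)
  finally show "(LBINT y. LBINT x. g (x - y) * e x) = (LBINT z. g z) * (LBINT x. e x)" by simp
qed

lemma cell_error_integrable: "integrable lborel (\<lambda>x. \<bar>cell_field f \<xi> \<nu> i x * d - e\<bar> * indicator {u..v} x)"
proof -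
  have "set_integrable lborel {u..v} (\<lambda>x. \<bar>cell_field f \<xi> \<nu> i x * d - e\<bar>)"
    by (rule borel_integrable_atLeastAtMost') (intro continuous_intros cell_field_continuous)
  then show ?thesis by (simp add: set_integrable_def mult.commute)
qed

lemma flux_error_integrable: "integrable lborel (flux_error f n \<xi> \<nu>)"
  unfolding flux_error_def by (intro integrable_sum cell_error_integrable)

lemma (in kernel) om'_integrable: "integrable lborel om'"
  by (rule integrable_compact_bounded[of _ "-r" r om_max]) (auto intro!: om'_outside om_max)

section \<open>Backward difference quotients of the smoothed distance\<close>

context kernel
begin

text \<open>All dependence on the positions is moved into the differentiable function
  \<open>W_moment\<close>. The constant \<open>C\<close> does not depend on \<xi>; it collects the
  half-line part of an outer weight, for which \<open>c\<close> has to be integrable.\<close>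

lemma cell_weight_moment:
  assumes c: "loc_integrable c" and n: "1 \<le> n" and i: "i \<le> n" and ends: "i \<notin> {1..<n} \<Longrightarrow> integrable lborel c"
  obtains C where "\<And>\<xi>. (LBINT y. cell_weight n \<xi> i y * c y)
     = C + (if i < n then W_moment c (\<xi> (Suc i)) else 0) - (if 0 < i then W_moment c (\<xi> i) else 0)"
proof -
  have cm [measurable]: "c \<in> borel_measurable borel" using c by (simp add: loc_integrable_def)
  have Wc: "integrable lborel (\<lambda>y. W (- y) * c y)" "integrable lborel (\<lambda>y. (1 - W (- y)) * c y)" if ci: "integrable lborel c"
  proof -
    show "integrable lborel (\<lambda>y. W (- y) * c y)"
      by (rule integrable_bound[OF ci])
         (use W_nonneg W_le_1 in \<open>auto simp: abs_mult intro!: mult_left_le_one_le\<close>)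
    show "integrable lborel (\<lambda>y. (1 - W (- y)) * c y)"
      by (rule integrable_bound[OF ci])
         (use W_nonneg W_le_1 in \<open>auto simp: abs_mult intro!: mult_left_le_one_le\<close>)
  qed
  consider "i = 0" | "i = n" "0 < i" | "0 < i" "i < n" using i by linarith
  then show ?thesis
  proof cases
    case 1 with ends have ci: "integrable lborel c" by auto
    have "(LBINT y. cell_weight n \<xi> i y * c y) = (LBINT y. W (- y) * c y) + W_moment c (\<xi> (Suc 0))" for \<xi>
    proof -
      have "(LBINT y. cell_weight n \<xi> i y * c y) = (LBINT y. W (- y) * c y + (W (\<xi> (Suc 0) - y) - W (- y)) * c y)"
        using 1 n by (intro integral_cong) (auto simp: cell_weight_def Wt_def algebra_simps)
      then show ?thesis unfolding W_moment_def using Wc(1)[OF ci] W_diff_integrable[OF c, of "\<xi> (Suc 0)" 0] by simp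
    qed
    then show ?thesis using 1 n by (intro that[of "LBINT y. W (- y) * c y"]) auto
  next
    case 2 with ends have ci: "integrable lborel c" by auto
    have "(LBINT y. cell_weight n \<xi> i y * c y) = (LBINT y. (1 - W (- y)) * c y) - W_moment c (\<xi> i)" for \<xi>
    proof -
      have "(LBINT y. cell_weight n \<xi> i y * c y) = (LBINT y. (1 - W (- y)) * c y - (W (\<xi> i - y) - W (- y)) * c y)"
        using 2 n by (intro integral_cong) (auto simp: cell_weight_def Wt_def algebra_simps)
      then show ?thesis unfolding W_moment_def using Wc(2)[OF ci] W_diff_integrable[OF c, of "\<xi> i" 0] by simp
    qed
    then show ?thesis using 2 n by (intro that[of "LBINT y. (1 - W (- y)) * c y"]) auto
  next
    case 3 have "(LBINT y. cell_weight n \<xi> i y * c y) = W_moment c (\<xi> (Suc i)) - W_moment c (\<xi> i)" for \<xi>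
      unfolding W_moment_diff[OF c] using 3
      by (intro integral_cong) (auto simp: cell_weight_def Wt_def)
    then show ?thesis using 3 by (intro that[of 0]) auto
  qed
qed

lemma cell_weight_L1_dist:
  assumes "1 \<le> n" "i \<le> n"
  shows "integrable lborel (\<lambda>y. \<bar>cell_weight n \<xi> i y - cell_weight n \<xi>' i y\<bar>)" (is ?A)
   and "(LBINT y. \<bar>cell_weight n \<xi> i y - cell_weight n \<xi>' i y\<bar>)
     \<le> (if i < n then \<bar>W_moment (\<lambda>y. 1) (\<xi> (Suc i)) - W_moment (\<lambda>y. 1) (\<xi>' (Suc i))\<bar> else 0)
      + (if 0 < i then \<bar>W_moment (\<lambda>y. 1) (\<xi> i) - W_moment (\<lambda>y. 1) (\<xi>' i)\<bar> else 0)" (is ?B)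
proof -
  let ?p = "\<lambda>y. if i < n then W (\<xi> (Suc i) - y) - W (\<xi>' (Suc i) - y) else 0"
  let ?q = "\<lambda>y. if 0 < i then W (\<xi> i - y) - W (\<xi>' i - y) else 0"
  have eq: "cell_weight n \<xi> i y - cell_weight n \<xi>' i y = ?p y - ?q y" for y
    using assms by (auto simp: cell_weight_def Wt_def)
  have ip: "integrable lborel ?p" and iq: "integrable lborel ?q"
    using W_diff_integrable[OF loc_integrable_const[of 1]] by (cases "i < n"; cases "0 < i"; simp)+
  show ?A unfolding eq using ip iq by (intro integrable_abs integrable_diff)
  have "(LBINT y. \<bar>?p y - ?q y\<bar>) \<le> (LBINT y. \<bar>?p y\<bar> + \<bar>?q y\<bar>)"
    using ip iq by (intro integral_mono integrable_abs integrable_diff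
        integrable_add abs_triangle_ineq4)
  also have "\<dots> = (LBINT y. \<bar>?p y\<bar>) + (LBINT y. \<bar>?q y\<bar>)"
    using ip iq by (intro integral_add integrable_abs)
  also have "(LBINT y. \<bar>?p y\<bar>) = (if i < n then \<bar>W_moment (\<lambda>y. 1) (\<xi> (Suc i)) - W_moment (\<lambda>y. 1) (\<xi>' (Suc i))\<bar> else 0)"
    by (simp add: W_L1_dist)
  also have "(LBINT y. \<bar>?q y\<bar>) = (if 0 < i then \<bar>W_moment (\<lambda>y. 1) (\<xi> i) - W_moment (\<lambda>y. 1) (\<xi>' i)\<bar> else 0)"
    by (simp add: W_L1_dist)
  finally show ?B unfolding eq .
qed

lemma abs_diff_subgradient: "\<bar>a - w\<bar> - \<bar>b - w\<bar> \<le> (a - b) * sgn (a - w)" for a b w :: real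
  by (auto simp: sgn_if abs_if)

text \<open>Convexity of the modulus: the subgradient at \<open>\<nu> i\<close> bounds the effect of
  the density change from above. What remains is the change of the weight at fixed density and a
  product of two increments, which is of higher order.\<close>

lemma cell_term_change:
  assumes c: "config n \<xi> \<nu>" and c': "config n \<xi>' \<nu>'" and w: "integrable lborel w" and i: "i \<le> n"
  shows "(LBINT y. cell_weight n \<xi> i y * \<bar>\<nu> i - w y\<bar>) - (LBINT y. cell_weight n \<xi>' i y * \<bar>\<nu>' i - w y\<bar>)
    \<le> (\<nu> i - \<nu>' i) * (LBINT y. cell_weight n \<xi> i y * sgn (\<nu> i - w y))
     + ((LBINT y. cell_weight n \<xi> i y * \<bar>\<nu> i - w y\<bar>) - (LBINT y. cell_weight n \<xi>' i y * \<bar>\<nu> i - w y\<bar>))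
     + \<bar>\<nu> i - \<nu>' i\<bar> * (LBINT y. \<bar>cell_weight n \<xi> i y - cell_weight n \<xi>' i y\<bar>)"
proof (cases "i \<in> {1..<n}")
  case False then have "\<nu> i = 0" "\<nu>' i = 0" using config_ends[OF c i] config_ends[OF c' i] by auto
  then show ?thesis by simp
next
  case True have n: "1 \<le> n" using c by (simp add: config_def)
  note L1 = cell_weight_L1_dist(1)[OF n i, of \<xi> \<xi>']
  note I1 = cell_weight_mult_integrable[OF c True loc_integrable_sgn[OF w, of "\<nu> i"]]
  note I2 = cell_weight_mult_integrable[OF c' True loc_integrable_abs_diff[OF w, of "\<nu> i"]]
  note I3 = cell_weight_mult_integrable[OF c' True loc_integrable_abs_diff[OF w, of "\<nu>' i"]]
  have "(LBINT y. cell_weight n \<xi>' i y * \<bar>\<nu> i - w y\<bar>) - (LBINT y. cell_weight n \<xi>' i y * \<bar>\<nu>' i - w y\<bar>)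
     = (LBINT y. cell_weight n \<xi>' i y * \<bar>\<nu> i - w y\<bar> - cell_weight n \<xi>' i y * \<bar>\<nu>' i - w y\<bar>)"
    by (rule integral_diff[symmetric, OF I2 I3])
  also have "\<dots> \<le> (LBINT y. (\<nu> i - \<nu>' i) * (cell_weight n \<xi> i y * sgn (\<nu> i - w y))
      + \<bar>\<nu> i - \<nu>' i\<bar> * \<bar>cell_weight n \<xi> i y - cell_weight n \<xi>' i y\<bar>)"
  proof (rule integral_mono)
    fix y
    define p where "p = cell_weight n \<xi> i y"
    define q where "q = cell_weight n \<xi>' i y"
    define s where "s = sgn (\<nu> i - w y)"
    have q0: "0 \<le> q" unfolding q_def by (rule cell_weight_nonneg[OF c' i])
    have "q * \<bar>\<nu> i - w y\<bar> - q * \<bar>\<nu>' i - w y\<bar> \<le> q * ((\<nu> i - \<nu>' i) * s)"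
      unfolding right_diff_distrib[symmetric] s_def by (rule mult_left_mono[OF abs_diff_subgradient q0])
    also have "\<dots> = (\<nu> i - \<nu>' i) * (p * s) + (q - p) * ((\<nu> i - \<nu>' i) * s)" by (simp add: algebra_simps)
    also have "(q - p) * ((\<nu> i - \<nu>' i) * s) \<le> \<bar>\<nu> i - \<nu>' i\<bar> * \<bar>p - q\<bar>"
    proof -
      have "(q - p) * ((\<nu> i - \<nu>' i) * s) \<le> \<bar>(q - p) * ((\<nu> i - \<nu>' i) * s)\<bar>" by simp
      also have "\<dots> = \<bar>\<nu> i - \<nu>' i\<bar> * \<bar>p - q\<bar> * \<bar>s\<bar>" by (simp add: abs_mult abs_minus_commute)
      also have "\<dots> \<le> \<bar>\<nu> i - \<nu>' i\<bar> * \<bar>p - q\<bar>" by (rule mult_left_le) (auto simp: s_def sgn_if)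
      finally show ?thesis .
    qed
    finally show "cell_weight n \<xi>' i y * \<bar>\<nu> i - w y\<bar> - cell_weight n \<xi>' i y * \<bar>\<nu>' i - w y\<bar>
      \<le> (\<nu> i - \<nu>' i) * (cell_weight n \<xi> i y * sgn (\<nu> i - w y))
      + \<bar>\<nu> i - \<nu>' i\<bar> * \<bar>cell_weight n \<xi> i y - cell_weight n \<xi>' i y\<bar>" by (simp add: p_def q_def s_def)
  qed (intro integrable_diff integrable_add integrable_mult_right I1 I2 I3 L1)+
  also have "\<dots> = (\<nu> i - \<nu>' i) * (LBINT y. cell_weight n \<xi> i y * sgn (\<nu> i - w y))
     + \<bar>\<nu> i - \<nu>' i\<bar> * (LBINT y. \<bar>cell_weight n \<xi> i y - cell_weight n \<xi>' i y\<bar>)"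
    using I1 L1 by (subst integral_add) auto
  finally show ?thesis by linarith
qed

end

context kernel_flux
begin

text \<open>The pointwise inequality is used with the Kruzkov constant \<open>w y\<close>, different
  for each \<open>y\<close>, and then integrated over \<open>y\<close>.\<close>

lemma entropy_production_integrated:
  assumes c: "config n \<xi> \<nu>" and w: "integrable lborel w"
  shows "(\<Sum>i\<le>n. density_rate f n \<xi> \<nu> i * (LBINT y. cell_weight n \<xi> i y * sgn (\<nu> i - w y))
       + (LBINT y. (omt n \<xi> y (Suc i) * particle_vel f \<nu> (Suc i) - omt n \<xi> y i * particle_vel f \<nu> i) * \<bar>\<nu> i - w y\<bar>))
     \<le> flux_pairing n \<xi> \<nu> w + (LBINT z. \<bar>om' z\<bar>) * (LBINT x. flux_error f n \<xi> \<nu> x)"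
proof -
  let ?a = "\<lambda>i y. density_rate f n \<xi> \<nu> i * (cell_weight n \<xi> i y * sgn (\<nu> i - w y))"
  let ?b = "\<lambda>i y. (omt n \<xi> y (Suc i) * particle_vel f \<nu> (Suc i) - omt n \<xi> y i * particle_vel f \<nu> i) * \<bar>\<nu> i - w y\<bar>"
  let ?k = "\<lambda>i y. kruzkov (\<nu> i) (w y) * (omt n \<xi> y (Suc i) - omt n \<xi> y i)"
  let ?e = "\<lambda>y. LBINT x. \<bar>om' (x - y)\<bar> * flux_error f n \<xi> \<nu> x"
  have ia: "integrable lborel (?a i)" if "i \<le> n" for i
  proof (cases "i \<in> {1..<n}")
    case True then show ?thesis
      by (intro integrable_mult_right cell_weight_mult_integrable[OF c] loc_integrable_sgn w)
  next
    case False then have "?a i = (\<lambda>y. 0)" by (auto simp: density_rate_def)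
    then show ?thesis by simp
  qed
  have ib: "integrable lborel (?b i)" for i
  proof -
    have "integrable lborel (\<lambda>y. particle_vel f \<nu> (Suc i) * (omt n \<xi> y (Suc i) * \<bar>\<nu> i - w y\<bar>)
        - particle_vel f \<nu> i * (omt n \<xi> y i * \<bar>\<nu> i - w y\<bar>))"
      by (intro integrable_diff integrable_mult_right omt_mult_integrable loc_integrable_abs_diff w)
    then show ?thesis by (simp add: algebra_simps)
  qed
  have ik: "integrable lborel (?k i)" for i by (rule flux_pairing_integrable[OF w])
  have ie: "integrable lborel ?e"
    by (rule convolution_integral(1)[of "\<lambda>z. \<bar>om' z\<bar>"]) (auto intro: om'_integrable flux_error_integrable)
  have "(\<Sum>i\<le>n. density_rate f n \<xi> \<nu> i * (LBINT y. cell_weight n \<xi> i y * sgn (\<nu> i - w y)) + (LBINT y. ?b i y))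
      = (\<Sum>i\<le>n. (LBINT y. ?a i y + ?b i y))" using ia ib by (intro sum.cong) auto
  also have "\<dots> = (LBINT y. (\<Sum>i\<le>n. ?a i y + ?b i y))"
    using ia ib by (intro integral_sum[symmetric]) auto
  also have "\<dots> \<le> (LBINT y. (\<Sum>i\<le>n. ?k i y) + ?e y)"
  proof (rule integral_mono)
    show "integrable lborel (\<lambda>y. \<Sum>i\<le>n. ?a i y + ?b i y)"
      using ia ib by (intro integrable_sum integrable_add) auto
    show "integrable lborel (\<lambda>y. (\<Sum>i\<le>n. ?k i y) + ?e y)"
      using ik ie by (intro integrable_sum integrable_add) auto
    show "(\<Sum>i\<le>n. ?a i y + ?b i y) \<le> (\<Sum>i\<le>n. ?k i y) + ?e y" for y by (rule entropy_production[OF c])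
  qed
  also have "\<dots> = (LBINT y. (\<Sum>i\<le>n. ?k i y)) + (LBINT y. ?e y)"
    using ik ie by (intro integral_add integrable_sum) auto
  also have "(LBINT y. (\<Sum>i\<le>n. ?k i y)) = flux_pairing n \<xi> \<nu> w"
    unfolding flux_pairing_def using ik by (intro integral_sum) auto
  also have "(LBINT y. ?e y) = (LBINT z. \<bar>om' z\<bar>) * (LBINT x. flux_error f n \<xi> \<nu> x)"
    by (rule convolution_integral(2)[of "\<lambda>z. \<bar>om' z\<bar>"]) (auto intro: om'_integrable flux_error_integrable)
  finally show ?thesis .
qed

text \<open>Here \<open>w\<close> is held fixed and only the particles move. The upper bound
  \<open>U\<close> from \<open>cell_term_change\<close>, divided by \<open>t - s\<close>, has a
  limit that \<open>entropy_production_integrated\<close> estimates. The product term drops out,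
  since \<open>R\<close> tends to 0 while the density quotients converge.\<close>

lemma smoothed_dist_left_rate:
  fixes \<xi> \<nu> :: "nat \<Rightarrow> real \<Rightarrow> real"
  assumes c: "config n (\<lambda>i. \<xi> i t) (\<lambda>i. \<nu> i t)"
    and ev: "eventually (\<lambda>s. config n (\<lambda>i. \<xi> i s) (\<lambda>i. \<nu> i s)) (at_left t)"
    and dx: "\<And>i. i \<in> {1..n} \<Longrightarrow> DERIV (\<xi> i) t :> particle_vel f (\<lambda>i. \<nu> i t) i" and dd: "\<And>i. i \<in> {1..<n} \<Longrightarrow>
      DERIV (\<nu> i) t :> density_rate f n (\<lambda>i. \<xi> i t) (\<lambda>i. \<nu> i t) i" and w: "integrable lborel w" and e: "0 < e"
  shows "eventually (\<lambda>s. smoothed_dist n (\<lambda>i. \<xi> i t) (\<lambda>i. \<nu> i t) w - smoothed_dist n (\<lambda>i. \<xi> i s) (\<lambda>i. \<nu> i s) w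
     \<le> (t - s) * (flux_pairing n (\<lambda>i. \<xi> i t) (\<lambda>i. \<nu> i t) w
        + (LBINT z. \<bar>om' z\<bar>) * (LBINT x. flux_error f n (\<lambda>i. \<xi> i t) (\<lambda>i. \<nu> i t) x) + e)) (at_left t)"
proof -
  define \<xi>t \<nu>t where "\<xi>t = (\<lambda>i. \<xi> i t)" and "\<nu>t = (\<lambda>i. \<nu> i t)"
  define V where "V = particle_vel f \<nu>t"
  define D where "D = density_rate f n \<xi>t \<nu>t"
  define J where "J = (\<lambda>i s. LBINT y. cell_weight n (\<lambda>i. \<xi> i s) i y * \<bar>\<nu> i t - w y\<bar>)"
  define S where "S = (\<lambda>i. LBINT y. cell_weight n \<xi>t i y * sgn (\<nu> i t - w y))"
  define R where "R = (\<lambda>i s. LBINT y. \<bar>cell_weight n \<xi>t i y - cell_weight n (\<lambda>i. \<xi> i s) i y\<bar>)"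
  define J' where "J' = (\<lambda>i. LBINT y. (omt n \<xi>t y (Suc i) * V (Suc i) - omt n \<xi>t y i * V i) * \<bar>\<nu> i t - w y\<bar>)"
  define U where "U = (\<lambda>s. \<Sum>i\<le>n. (\<nu> i t - \<nu> i s) * S i + (J i t - J i s) + \<bar>\<nu> i t - \<nu> i s\<bar> * R i s)"
  define rate where "rate = (\<Sum>i\<le>n. D i * S i + J' i)"
  have n: "1 \<le> n" using c by (simp add: config_def)
  have dJ: "DERIV (J i) t :> J' i" if i: "i \<le> n" for i
  proof -
    define c where "c = (\<lambda>y. \<bar>\<nu> i t - w y\<bar>)"
    have lc: "loc_integrable c" unfolding c_def by (rule loc_integrable_abs_diff[OF w])
    have ends: "integrable lborel c" if "i \<notin> {1..<n}" using config_ends[OF assms(1) i that] w by (simp add: c_def)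
    obtain C where C: "\<And>\<xi>. (LBINT y. cell_weight n \<xi> i y * c y)
       = C + (if i < n then W_moment c (\<xi> (Suc i)) else 0) - (if 0 < i then W_moment c (\<xi> i) else 0)"
      using cell_weight_moment[OF lc n i ends] by blast
    have Jeq: "J i = (\<lambda>s. C + (if i < n then W_moment c (\<xi> (Suc i) s) else 0) - (if 0 < i then W_moment c (\<xi> i s) else 0))"
      unfolding J_def using C by (auto simp: c_def)
    have d: "DERIV (\<lambda>s. W_moment c (\<xi> j s)) t :> (LBINT y. om (\<xi> j t - y) * c y) * V j" if "j \<in> {1..n}" for j
      using DERIV_chain2[OF W_moment_deriv[OF lc] dx[OF that]] by (simp add: V_def \<nu>t_def)
    have J'eq: "J' i = (if i < n then (LBINT y. om (\<xi> (Suc i) t - y) * c y) * V (Suc i) else 0)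
         - (if 0 < i then (LBINT y. om (\<xi> i t - y) * c y) * V i else 0)"
    proof -
      have o: "(LBINT y. omt n \<xi>t y j * c y) = (if 1 \<le> j \<and> j \<le> n then (LBINT y. om (\<xi> j t - y) * c y) else 0)" for j
        by (auto simp: omt_def \<xi>t_def)
      have "J' i = (LBINT y. V (Suc i) * (omt n \<xi>t y (Suc i) * c y) - V i * (omt n \<xi>t y i * c y))"
        unfolding J'_def c_def by (simp add: algebra_simps)
      also have "\<dots> = V (Suc i) * (LBINT y. omt n \<xi>t y (Suc i) * c y) - V i * (LBINT y. omt n \<xi>t y i * c y)"
        by (subst integral_diff) (auto intro!: integrable_mult_right omt_mult_integrable lc)
      finally show ?thesis unfolding o using i by auto
    qed
    have d1: "((\<lambda>s. if i < n then W_moment c (\<xi> (Suc i) s) else 0) has_real_derivative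
        (if i < n then (LBINT y. om (\<xi> (Suc i) t - y) * c y) * V (Suc i) else 0)) (at t)"
      using d[of "Suc i"] by auto
    have d2: "((\<lambda>s. if 0 < i then W_moment c (\<xi> i s) else 0) has_real_derivative
        (if 0 < i then (LBINT y. om (\<xi> i t - y) * c y) * V i else 0)) (at t)" using d[of i] i by auto
    show ?thesis unfolding Jeq J'eq by (rule DERIV_cong[OF DERIV_diff[OF DERIV_add[OF DERIV_const d1] d2]]) simp
  qed
  have R0: "(R i \<longlongrightarrow> 0) (at_left t)" if i: "i \<le> n" for i
  proof -
    let ?M = "W_moment (\<lambda>y. 1)"
    let ?b = "\<lambda>s. (if i < n then \<bar>?M (\<xi> (Suc i) t) - ?M (\<xi> (Suc i) s)\<bar> else 0) + (if 0 < i then \<bar>?M (\<xi> i t) - ?M (\<xi> i s)\<bar> else 0)"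
    have Mc: "((\<lambda>s. \<bar>?M (\<xi> j t) - ?M (\<xi> j s)\<bar>) \<longlongrightarrow> 0) (at_left t)" if "j \<in> {1..n}" for j
    proof -
      have "isCont (\<lambda>s. ?M (\<xi> j s)) t"
        by (rule DERIV_isCont[OF DERIV_chain2[OF W_moment_deriv[OF loc_integrable_const] dx[OF that]]])
      then have "((\<lambda>s. ?M (\<xi> j s)) \<longlongrightarrow> ?M (\<xi> j t)) (at_left t)" by (simp add: isCont_def filterlim_at_split)
      then have "((\<lambda>s. \<bar>?M (\<xi> j t) - ?M (\<xi> j s)\<bar>) \<longlongrightarrow> \<bar>?M (\<xi> j t) - ?M (\<xi> j t)\<bar>) (at_left t)"
        by (intro tendsto_intros)
      then show ?thesis by simp
    qed
    have "((\<lambda>s. if i < n then \<bar>?M (\<xi> (Suc i) t) - ?M (\<xi> (Suc i) s)\<bar> else 0) \<longlongrightarrow> 0) (at_left t)"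
      using Mc[of "Suc i"] by (cases "i < n") auto
    moreover have "((\<lambda>s. if 0 < i then \<bar>?M (\<xi> i t) - ?M (\<xi> i s)\<bar> else 0) \<longlongrightarrow> 0) (at_left t)"
      using Mc[of i] i by (cases "0 < i") auto
    ultimately have "(?b \<longlongrightarrow> 0 + 0) (at_left t)" by (rule tendsto_add)
    then have b0: "(?b \<longlongrightarrow> 0) (at_left t)" by simp
    show ?thesis
    proof (rule tendsto_sandwich[OF _ _ tendsto_const b0])
      show "eventually (\<lambda>s. 0 \<le> R i s) (at_left t)" by (auto simp: R_def)
      show "eventually (\<lambda>s. R i s \<le> ?b s) (at_left t)"
        using cell_weight_L1_dist(2)[OF n i, of \<xi>t] by (auto simp: R_def \<xi>t_def intro!: always_eventually)
    qed
  qed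
  have dq: "((\<lambda>s. (\<nu> i t - \<nu> i s) / (t - s)) \<longlongrightarrow> D i) (at_left t)" if i: "i \<le> n" for i
  proof (cases "i \<in> {1..<n}")
    case True from DERIV_left_quotient[OF dd[OF this]] show ?thesis by (simp add: D_def \<xi>t_def \<nu>t_def)
  next
    case False have "D i = 0" using False by (auto simp: D_def density_rate_def)
    moreover have "eventually (\<lambda>s. (\<nu> i t - \<nu> i s) / (t - s) = 0) (at_left t)"
    proof (rule eventually_mono[OF ev])
      fix s assume "config n (\<lambda>i. \<xi> i s) (\<lambda>i. \<nu> i s)"
      from config_ends[OF this i False] config_ends[OF c i False]
      show "(\<nu> i t - \<nu> i s) / (t - s) = 0" by simp
    qed
    ultimately show ?thesis by (simp add: tendsto_eventually)
  qed
  have lim: "((\<lambda>s. U s / (t - s)) \<longlongrightarrow> rate) (at_left t)"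
  proof -
    have "((\<lambda>s. \<Sum>i\<le>n. ((\<nu> i t - \<nu> i s) / (t - s)) * S i + (J i t - J i s) / (t - s)
        + \<bar>(\<nu> i t - \<nu> i s) / (t - s)\<bar> * R i s) \<longlongrightarrow> (\<Sum>i\<le>n. D i * S i + J' i + \<bar>D i\<bar> * 0)) (at_left t)"
      by (intro tendsto_sum tendsto_add tendsto_mult tendsto_rabs dq R0 DERIV_left_quotient dJ tendsto_const) auto
    then have *: "((\<lambda>s. \<Sum>i\<le>n. ((\<nu> i t - \<nu> i s) / (t - s)) * S i + (J i t - J i s) / (t - s)
        + \<bar>(\<nu> i t - \<nu> i s) / (t - s)\<bar> * R i s) \<longlongrightarrow> rate) (at_left t)" by (simp add: rate_def)
    have "eventually (\<lambda>s. s < t) (at_left t)" by (simp add: eventually_at_filter)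
    then have "eventually (\<lambda>s. (\<Sum>i\<le>n. ((\<nu> i t - \<nu> i s) / (t - s)) * S i + (J i t - J i s) / (t - s)
        + \<bar>(\<nu> i t - \<nu> i s) / (t - s)\<bar> * R i s) = U s / (t - s)) (at_left t)"
    proof (rule eventually_mono)
      fix s assume "s < t"
      then show "(\<Sum>i\<le>n. ((\<nu> i t - \<nu> i s) / (t - s)) * S i + (J i t - J i s) / (t - s)
        + \<bar>(\<nu> i t - \<nu> i s) / (t - s)\<bar> * R i s) = U s / (t - s)" unfolding U_def sum_divide_distrib
        by (intro sum.cong refl) (simp add: add_divide_distrib abs_divide)
    qed
    from Lim_transform_eventually[OF * this] show ?thesis .
  qed
  have rate_le: "rate \<le> flux_pairing n \<xi>t \<nu>t w + (LBINT z. \<bar>om' z\<bar>) * (LBINT x. flux_error f n \<xi>t \<nu>t x)"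
    using entropy_production_integrated[OF c[folded \<xi>t_def \<nu>t_def] w]
    unfolding rate_def D_def S_def J'_def V_def by (simp add: \<nu>t_def)
  have "eventually (\<lambda>s. U s / (t - s) < rate + e) (at_left t)" using e by (intro order_tendstoD(2)[OF lim]) auto
  moreover have "eventually (\<lambda>s. s < t) (at_left t)" by (simp add: eventually_at_filter)
  ultimately show ?thesis using ev
  proof eventually_elim
    case (elim s) have "smoothed_dist n \<xi>t \<nu>t w - smoothed_dist n (\<lambda>i. \<xi> i s) (\<lambda>i. \<nu> i s) w \<le> U s"
      unfolding smoothed_dist_def U_def sum_subtractf[symmetric]
    proof (rule sum_mono)
      fix i assume "i \<in> {..n}"
      then show "(LBINT y. cell_weight n \<xi>t i y * \<bar>\<nu>t i - w y\<bar>)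
          - (LBINT y. cell_weight n (\<lambda>i. \<xi> i s) i y * \<bar>\<nu> i s - w y\<bar>)
         \<le> (\<nu> i t - \<nu> i s) * S i + (J i t - J i s) + \<bar>\<nu> i t - \<nu> i s\<bar> * R i s"
        using cell_term_change[OF c elim(3) w, of i] unfolding S_def J_def R_def \<nu>t_def \<xi>t_def by simp
    qed
    also have "\<dots> \<le> (t - s) * (rate + e)" using elim by (simp add: divide_simps mult.commute)
    also have "\<dots> \<le> (t - s) * (flux_pairing n \<xi>t \<nu>t w + (LBINT z. \<bar>om' z\<bar>) * (LBINT x. flux_error f n \<xi>t \<nu>t x) + e)"
      using rate_le elim by (intro mult_left_mono) auto
    finally show ?case unfolding \<xi>t_def \<nu>t_def .
  qed
qed

end

section \<open>Entropy solutions tested with tensor products\<close>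

lemma Ck_plane_tensor: "Ck_real k \<alpha> \<Longrightarrow> Ck_real k \<mu> \<Longrightarrow> Ck_plane k (\<lambda>z. \<alpha> (fst z) * \<mu> (snd z))"
proof (induction k arbitrary: \<alpha> \<mu>)
  case 0 then show ?case
    by (auto intro!: continuous_intros continuous_on_compose2[of UNIV \<alpha>] continuous_on_compose2[of UNIV \<mu>])
next
  case (Suc k)
  then obtain \<alpha>' \<mu>' where d: "\<And>x. DERIV \<alpha> x :> \<alpha>' x" "Ck_real k \<alpha>'" "\<And>x. DERIV \<mu> x :> \<mu>' x" "Ck_real k \<mu>'" by auto
  have "((\<lambda>z. \<alpha> (fst z) * \<mu> (snd z)) has_derivative
      (\<lambda>h. (\<alpha>' (fst z) * \<mu> (snd z)) * fst h + (\<alpha> (fst z) * \<mu>' (snd z)) * snd h)) (at z)" for z :: "real \<times> real"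
  proof -
    have a: "((\<lambda>z. \<alpha> (fst z)) has_derivative (\<lambda>h. fst h * \<alpha>' (fst z))) (at z)"
      by (rule DERIV_compose_FDERIV[OF d(1)]) (auto intro!: derivative_eq_intros)
    have b: "((\<lambda>z. \<mu> (snd z)) has_derivative (\<lambda>h. snd h * \<mu>' (snd z))) (at z)"
      by (rule DERIV_compose_FDERIV[OF d(3)]) (auto intro!: derivative_eq_intros)
    show ?thesis by (rule has_derivative_eq_rhs[OF has_derivative_mult[OF a b]]) (simp add: algebra_simps)
  qed
  moreover have "Ck_plane k (\<lambda>z. \<alpha>' (fst z) * \<mu> (snd z))" "Ck_plane k (\<lambda>z. \<alpha> (fst z) * \<mu>' (snd z))"
    using Suc.IH d Ck_real_Suc_D Suc.prems by blast+
  ultimately show ?case unfolding Ck_plane.simps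
    by (intro exI[of _ "\<lambda>z. \<alpha>' (fst z) * \<mu> (snd z)"] exI[of _ "\<lambda>z. \<alpha> (fst z) * \<mu>' (snd z)"] conjI allI)
qed

lemma test_function_tensor:
  assumes "smooth \<psi>" "smooth \<mu>" "\<And>y. y \<notin> {-R..R} \<Longrightarrow> \<psi> y = 0" "\<And>s. s \<notin> {-R'..T'} \<Longrightarrow> \<mu> s = 0" "T' < T"
  shows "test_function T (\<lambda>z. \<psi> (fst z) * \<mu> (snd z))"
proof -
  let ?K = "{-R..R} \<times> {-R'..T'}"
  have sub: "{z. \<psi> (fst z) * \<mu> (snd z) \<noteq> 0} \<subseteq> ?K" using assms(3,4) by force
  have cK: "compact ?K" by (intro compact_Times compact_Icc)
  have cl: "closure {z. \<psi> (fst z) * \<mu> (snd z) \<noteq> 0} \<subseteq> ?K"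
    using sub compact_imp_closed[OF cK] by (rule closure_minimal)
  moreover have "compact (closure {z. \<psi> (fst z) * \<mu> (snd z) \<noteq> 0})"
    using compact_Int_closed[OF cK closed_closure, of "{z. \<psi> (fst z) * \<mu> (snd z) \<noteq> 0}"]
    by (simp only: inf.absorb2[OF cl])
  ultimately show ?thesis using assms(1,2,5) Ck_plane_tensor unfolding test_function_def smooth_def by fastforce
qed

lemma bounded_of_compact_support:
  fixes g :: "real \<Rightarrow> real"
  assumes "continuous_on UNIV g" "\<And>y. y \<notin> {a..b} \<Longrightarrow> g y = 0"
  obtains M where "0 \<le> M" "\<And>y. \<bar>g y\<bar> \<le> M"
proof -
  have "bounded (g ` {a..b})"
    using assms(1) continuous_on_subset by (intro compact_imp_bounded compact_continuous_image) auto
  then obtain M where M: "\<forall>y\<in>{a..b}. \<bar>g y\<bar> \<le> M" by (auto simp: bounded_iff)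
  have "\<bar>g y\<bar> \<le> max 0 M" for y using M assms(2)[of y] by (cases "y \<in> {a..b}") (auto simp: max_def)
  with that[of "max 0 M"] show ?thesis by simp
qed

lemma deriv_zero_outside:
  fixes \<psi> :: "real \<Rightarrow> real"
  assumes "\<And>y. DERIV \<psi> y :> \<psi>' y" "\<And>y. y \<notin> {a..b} \<Longrightarrow> \<psi> y = 0" "y \<notin> {a..b}"
  shows "\<psi>' y = 0"
proof -
  have "DERIV (\<lambda>x. 0) y :> 0" by simp
  then have "DERIV \<psi> y :> 0"
    by (rule has_field_derivative_transform_within_open[of _ _ _ "- {a..b}"]) (use assms in auto)
  then show ?thesis using DERIV_unique assms(1) by blast
qed

text \<open>The only kink of the modulus is at \<open>k\<close>, a null set. On either side of it
  the pair consists of an affine function and of \<open>f\<close>, up to sign and an additive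
  constant.\<close>

lemma (in flux) kruzkov_entropy_pair: "entropy_pair f (\<lambda>s. \<bar>s - k\<bar>) (\<lambda>s. kruzkov s k)"
proof -
  have "convex_on UNIV (\<lambda>s. \<bar>s - k\<bar>)" using convex_on_dist[of UNIV k] by (simp add: dist_real_def abs_minus_commute)
  moreover have "L-lipschitz_on {a..b} (\<lambda>s. kruzkov s k)" for a b
    using kruzkov_lip L_nonneg by (auto simp: lipschitz_on_def dist_real_def)
  moreover have "AE s in lborel. \<forall>d e. DERIV (\<lambda>s. \<bar>s - k\<bar>) s :> d \<and> DERIV f s :> e
        \<longrightarrow> DERIV (\<lambda>s. kruzkov s k) s :> d * e" using AE_lborel_singleton[of k]
  proof eventually_elim
    case (elim s)
    define U where "U = (if k < s then {k<..} else {..<k})"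
    have U: "open U" "s \<in> U" using elim by (auto simp: U_def)
    have dabs: "DERIV (\<lambda>s. \<bar>s - k\<bar>) s :> sgn (s - k)"
    proof (rule has_field_derivative_transform_within_open[OF _ U])
      show "DERIV (\<lambda>x. sgn (s - k) * (x - k)) s :> sgn (s - k)" by (auto intro!: derivative_eq_intros)
      show "sgn (s - k) * (x - k) = \<bar>x - k\<bar>" if "x \<in> U" for x
        using that elim by (auto simp: U_def sgn_if split: if_splits)
    qed
    have dk: "DERIV (\<lambda>s. kruzkov s k) s :> sgn (s - k) * e" if "DERIV f s :> e" for e
    proof (rule has_field_derivative_transform_within_open[OF _ U])
      show "DERIV (\<lambda>x. sgn (s - k) * (f x - f k)) s :> sgn (s - k) * e" by (auto intro!: derivative_eq_intros that)
      show "sgn (s - k) * (f x - f k) = kruzkov x k" if "x \<in> U" for x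
        using that elim by (auto simp: U_def kruzkov_def sgn_if split: if_splits)
    qed
    show ?case using DERIV_unique[OF dabs] dk by blast
  qed
  ultimately show ?thesis unfolding entropy_pair_def by blast
qed

text \<open>The test function is the difference of two smooth steps that start at \<open>s1\<close>
  and \<open>s2\<close>. Their derivatives are approximate unit masses to the right of these points,
  so only right limits of \<open>H\<close> enter. The auxiliary \<open>F\<close> lets the weak
  inequality be stated for an integrand known almost everywhere.\<close>

lemma weak_inequality_localization:
  fixes H g :: "real \<Rightarrow> real"
  assumes s: "s1 < s2" "s2 < T" and H: "(H \<longlongrightarrow> H s1) (at_right s1)" "(H \<longlongrightarrow> H s2) (at_right s2)"
    and g: "\<And>s. \<bar>g s\<bar> \<le> G" "integrable lborel (\<lambda>s. indicator {s1<..<s2} s * g s)"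
    and ineq: "\<And>\<mu> \<mu>' R' T'. \<lbrakk>smooth \<mu>; \<And>s. DERIV \<mu> s :> \<mu>' s; \<And>s. 0 \<le> \<mu> s; T' < T;
        \<And>s. s \<notin> {-R'..T'} \<Longrightarrow> \<mu> s = 0\<rbrakk> \<Longrightarrow> \<exists>F. integrable lborel F \<and> 0 \<le> (LBINT s. F s)
        \<and> (AE s in lborel. F s = indicator {..<T} s * (\<mu>' s * H s + \<mu> s * g s))"
  shows "H s2 - H s1 \<le> (LBINT s. indicator {s1<..<s2} s * g s)" (is "_ \<le> ?I")
proof (rule field_le_epsilon)
  fix e :: real assume e: "0 < e"
  \<comment> \<open>Four contributions share \<open>e\<close>: two from the values of
    \<open>H\<close> near \<open>s1\<close> and \<open>s2\<close>, two from \<open>g\<close> on the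
    transition intervals.\<close>
  define \<eta> where "\<eta> = e / 4"
  have \<eta>: "0 < \<eta>" using e by (simp add: \<eta>_def)
  have G: "0 \<le> G" using g(1)[of 0] by linarith
  obtain B b :: "real \<Rightarrow> real" where B: "smooth B" "smooth b" "\<And>x. DERIV B x :> b x" "\<And>x. 0 \<le> b x"
    "\<And>x. x \<le> 0 \<Longrightarrow> B x = 0" "\<And>x. 1 \<le> x \<Longrightarrow> B x = 1" "\<And>x. x \<le> 0 \<or> 1 \<le> x \<Longrightarrow> b x = 0" "\<And>x. 0 \<le> B x" "\<And>x. B x \<le> 1"
    using smooth_step by blast
  define \<rho> where "\<rho> = (\<lambda>a d s. b ((s - a) / d) / d)"
  have \<rho>d: "DERIV (\<lambda>s. B ((s - a) / d)) s :> \<rho> a d s" if "0 < d" for a d s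
    unfolding \<rho>_def by (rule DERIV_cong[OF DERIV_chain2[OF B(3)]]) (use that in \<open>auto intro!: derivative_eq_intros\<close>)
  have \<rho>0: "\<rho> a d s = 0" if "0 < d" "s \<notin> {a..a + d}" for a d s
    using that B(7)[of "(s - a) / d"] by (auto simp: \<rho>_def divide_simps)
  have \<rho>nn: "0 \<le> \<rho> a d s" if "0 < d" for a d s using that B(4) by (simp add: \<rho>_def)
  have \<rho>i: "has_bochner_integral lborel (\<rho> a d) 1" if d: "0 < d" for a d
  proof -
    have "has_bochner_integral lborel (\<lambda>s. \<rho> a d s * indicator {a..a + d} s) (B ((a + d - a) / d) - B ((a - a) / d))"
    proof (rule has_bochner_integral_FTC_Icc_real)
      have "continuous_on UNIV (\<rho> a d)" unfolding \<rho>_def divide_inverse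
        by (intro continuous_intros continuous_on_compose2[OF smooth_continuous[OF B(2), of UNIV]]) auto
      then show "isCont (\<rho> a d) x" for x by (simp add: continuous_on_eq_continuous_at)
    qed (use d \<rho>d in auto)
    moreover have "(\<lambda>s. \<rho> a d s * indicator {a..a + d} s) = \<rho> a d"
    proof
      show "\<rho> a d s * indicator {a..a + d} s = \<rho> a d s" for s
        using \<rho>0[OF d, of s a] by (cases "s \<in> {a..a + d}") auto
    qed
    ultimately show ?thesis using d by (simp add: B(5,6))
  qed
  have sm: "smooth (\<lambda>s. B ((s - a) / d))" if "0 < d" for a d
    using smooth_affine[OF B(1), of "1 / d" "- (a / d)"] by (simp add: diff_divide_distrib)
  have near: "\<exists>d>0. d \<le> c \<and> (\<forall>s'\<in>{s..s + d}. \<bar>H s' - H s\<bar> \<le> \<eta>)" if lim: "(H \<longlongrightarrow> H s) (at_right s)" and c: "0 < c" for s c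
  proof -
    obtain q where q: "s < q" "\<And>y. s < y \<Longrightarrow> y < q \<Longrightarrow> dist (H y) (H s) < \<eta>"
      using tendstoD[OF lim \<eta>] unfolding eventually_at_right_field by blast
    have "\<bar>H s' - H s\<bar> \<le> \<eta>" if "s' \<in> {s..s + min c ((q - s) / 2)}" for s'
    proof -
      have "min c ((q - s) / 2) \<le> (q - s) / 2" by (rule min.cobounded2)
      then have "s' < q" using that q(1) by (simp add: field_simps)
      then show ?thesis using q(2)[of s'] that \<eta> by (cases "s' = s") (auto simp: dist_real_def)
    qed
    then show ?thesis using c q(1) by (intro exI[of _ "min c ((q - s) / 2)"]) auto
  qed
  \<comment> \<open>Widths of the transitions: the first bound makes \<open>G\<close> times the
    width at most \<eta>; the second lets the first step end before the other one starts, or keeps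
    the support below \<open>T\<close>.\<close>
  have "0 < min (\<eta> / (G + 1)) (s2 - s1)" "0 < min (\<eta> / (G + 1)) ((T - s2) / 2)" using \<eta> G s by auto
  from near[OF H(1) this(1)] near[OF H(2) this(2)]
  obtain d1 d2 where d1: "0 < d1" "d1 \<le> \<eta> / (G + 1)" "d1 \<le> s2 - s1" "\<And>s'. s' \<in> {s1..s1 + d1} \<Longrightarrow> \<bar>H s' - H s1\<bar> \<le> \<eta>"
    and d2: "0 < d2" "d2 \<le> \<eta> / (G + 1)" "d2 \<le> (T - s2) / 2" "\<And>s'. s' \<in> {s2..s2 + d2} \<Longrightarrow> \<bar>H s' - H s2\<bar> \<le> \<eta>" by auto
  have d2T: "s2 + d2 < T" using d2(3) s by (simp add: field_simps)
  define \<mu> where "\<mu> = (\<lambda>s. B ((s - s1) / d1) - B ((s - s2) / d2))"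
  define \<mu>' where "\<mu>' = (\<lambda>s. \<rho> s1 d1 s - \<rho> s2 d2 s)"
  have 1: "B ((s - s1) / d1) = (if s \<le> s1 then 0 else if s1 + d1 \<le> s then 1 else B ((s - s1) / d1))" for s
    using d1(1) by (auto simp: B(5,6) divide_simps)
  have 2: "B ((s - s2) / d2) = (if s \<le> s2 then 0 else if s2 + d2 \<le> s then 1 else B ((s - s2) / d2))" for s
    using d2(1) by (auto simp: B(5,6) divide_simps)
  have \<mu>nn: "0 \<le> \<mu> s" for s using 1[of s] 2[of s] B(8,9) s d1(3) by (auto simp: \<mu>_def split: if_splits)
  have \<mu>le: "\<mu> s \<le> 1" for s using B(8)[of "(s - s2) / d2"] B(9)[of "(s - s1) / d1"] unfolding \<mu>_def by linarith
  have \<mu>0: "\<mu> s = 0" if "s \<notin> {s1..s2 + d2}" for s using 1[of s] 2[of s] that s d1 d2 by (auto simp: \<mu>_def)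
  have \<mu>1: "\<mu> s = 1" if "s1 + d1 \<le> s" "s \<le> s2" for s using 1[of s] 2[of s] that s d1 d2 by (auto simp: \<mu>_def)
  have "\<exists>F. integrable lborel F \<and> 0 \<le> (LBINT s. F s)
      \<and> (AE s in lborel. F s = indicator {..<T} s * (\<mu>' s * H s + \<mu> s * g s))"
  proof (rule ineq[of \<mu> \<mu>' "s2 + d2" "- s1"])
    show "smooth \<mu>" unfolding \<mu>_def by (intro smooth_diff sm d1 d2)
    show "DERIV \<mu> s :> \<mu>' s" for s unfolding \<mu>_def \<mu>'_def by (intro DERIV_diff \<rho>d d1 d2)
    show "\<mu> s' = 0" if "s' \<notin> {- (- s1)..s2 + d2}" for s' using that by (intro \<mu>0) auto
  qed (use d2T \<mu>nn in auto)
  then obtain F where F: "integrable lborel F" "0 \<le> (LBINT s. F s)"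
    "AE s in lborel. F s = indicator {..<T} s * (\<mu>' s * H s + \<mu> s * g s)" by blast
  \<comment> \<open>A majorant with known integral: \<open>H\<close> is replaced by its values at
    \<open>s1\<close> and \<open>s2\<close> up to \<eta>, and \<mu> by the indicator of the interval
    up to the transition zones.\<close>
  let ?r = "\<lambda>s. \<rho> s1 d1 s * (H s1 + \<eta>) - \<rho> s2 d2 s * (H s2 - \<eta>) + indicator {s1<..<s2} s * g s
    + G * (indicator {s1..s1 + d1} s + indicator {s2..s2 + d2} s)"
  have r: "has_bochner_integral lborel ?r
      (1 * (H s1 + \<eta>) - 1 * (H s2 - \<eta>) + ?I + G * (max 0 (s1 + d1 - s1) + max 0 (s2 + d2 - s2)))"
    by (intro has_bochner_integral_add has_bochner_integral_diff has_bochner_integral_mult_left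
        has_bochner_integral_mult_right \<rho>i d1 d2)
       (auto simp: has_bochner_integral_iff g(2) integrable_indicator_iff emeasure_lborel_Icc_eq)
  have le: "indicator {..<T} s * (\<mu>' s * H s + \<mu> s * g s) \<le> ?r s" for s
  proof (cases "s < T")
    case False then have "s \<notin> {s1..s1 + d1}" "s \<notin> {s2..s2 + d2}" using s d1 d2T by auto
    then show ?thesis using False s \<rho>0[OF d1(1), of s s1] \<rho>0[OF d2(1), of s s2] by auto
  next
    case True have a1: "\<rho> s1 d1 s * H s \<le> \<rho> s1 d1 s * (H s1 + \<eta>)"
    proof (cases "s \<in> {s1..s1 + d1}")
      case True with d1(4)[OF True] show ?thesis by (intro mult_left_mono \<rho>nn d1) auto
    qed (simp add: \<rho>0[OF d1(1)])
    have a2: "\<rho> s2 d2 s * (H s2 - \<eta>) \<le> \<rho> s2 d2 s * H s"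
    proof (cases "s \<in> {s2..s2 + d2}")
      case True with d2(4)[OF True] show ?thesis by (intro mult_left_mono \<rho>nn d2) auto
    qed (simp add: \<rho>0[OF d2(1)])
    have cg: "\<bar>\<mu> s * g s\<bar> \<le> G" "\<bar>(1 - \<mu> s) * g s\<bar> \<le> G"
      using \<mu>nn[of s] \<mu>le[of s] g(1)[of s] G unfolding abs_mult by (intro order_trans[OF mult_left_le_one_le]; simp)+
    have a3: "\<mu> s * g s \<le> indicator {s1<..<s2} s * g s + G * (indicator {s1..s1 + d1} s + indicator {s2..s2 + d2} s)"
    proof -
      consider "s \<notin> {s1..s2 + d2}" | "s1 + d1 < s" "s < s2" | "s1 \<le> s" "s \<le> s1 + d1" "s < s2" | "s2 \<le> s" "s \<le> s2 + d2"
        by fastforce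
      then show ?thesis
      proof cases
        case 1 then show ?thesis using \<mu>0[OF 1] G d1 d2(1) s by (auto simp: indicator_def)
      next
        case 2 then show ?thesis using \<mu>1[of s] G d1(1) by (auto simp: indicator_def)
      next
        case 3 then show ?thesis using cg G by (cases "s = s1") (auto simp: indicator_def algebra_simps)
      next
        case 4 then show ?thesis using cg(1) G by (auto simp: indicator_def)
      qed
    qed
    show ?thesis using True a1 a2 a3 by (simp add: \<mu>'_def algebra_simps)
  qed
  have "(LBINT s. F s) \<le> (LBINT s. ?r s)"
    by (rule integral_mono_AE[OF F(1)]) (use r F(3) le in \<open>auto simp: has_bochner_integral_iff elim!: eventually_mono\<close>)
  with F(2) r have "H s2 - H s1 \<le> ?I + 2 * \<eta> + G * (d1 + d2)" using d1(1) d2(1) by (simp add: has_bochner_integral_iff)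
  moreover have "G * d \<le> \<eta>" if "d \<le> \<eta> / (G + 1)" "0 < d" for d
  proof -
    have "G * d \<le> (G + 1) * d" using that by simp
    also have "\<dots> \<le> \<eta>" using that G by (simp add: field_simps)
    finally show ?thesis .
  qed
  note this[OF d1(2,1)] this[OF d2(2,1)]
  ultimately show "H s2 - H s1 \<le> ?I + e" by (simp add: \<eta>_def distrib_left)
qed

text \<open>Extending \<open>h\<close> by \<open>h0\<close> to negative times turns the initial condition into an instance of the
  preceding lemma.\<close>

lemma time_localization:
  fixes h g :: "real \<Rightarrow> real" and T h0 :: real
  assumes T: "0 < T" and hc: "continuous_on {0..T} h" and gc: "continuous_on {0..T} g"
    and ineq: "\<And>\<mu> \<mu>' R' T'. \<lbrakk>smooth \<mu>; \<And>s. DERIV \<mu> s :> \<mu>' s; \<And>s. 0 \<le> \<mu> s; T' < T;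
        \<And>s. s \<notin> {-R'..T'} \<Longrightarrow> \<mu> s = 0\<rbrakk> \<Longrightarrow> 0 \<le> (LBINT s. indicator {0<..<T} s * (\<mu>' s * h s + \<mu> s * g s)) + \<mu> 0 * h0"
  shows "\<And>s1 s2. 0 \<le> s1 \<Longrightarrow> s1 \<le> s2 \<Longrightarrow> s2 \<le> T \<Longrightarrow> h s2 - h s1 \<le> integral {s1..s2} g" and "h 0 \<le> h0"
proof -
  define H where "H = (\<lambda>s. if s < 0 then h0 else h s)"
  define k where "k = (\<lambda>s. if 0 < s \<and> s < T then g s else 0)"
  have "bounded (g ` {0..T})" by (intro compact_imp_bounded compact_continuous_image gc compact_Icc)
  then obtain G where G: "\<forall>s\<in>{0..T}. \<bar>g s\<bar> \<le> G" by (auto simp: bounded_iff)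
  have kG: "\<bar>k s\<bar> \<le> max 0 G" for s using G[rule_format, of s] by (auto simp: k_def)
  have gi: "set_integrable lborel A g" if "A \<subseteq> {0..T}" "A \<in> sets borel" for A
    by (rule set_integrable_subset[OF borel_integrable_atLeastAtMost'[OF gc]]) (use that in auto)
  have weak: "\<exists>F. integrable lborel F \<and> 0 \<le> (LBINT s. F s)
        \<and> (AE s in lborel. F s = indicator {..<T} s * (\<mu>' s * H s + \<mu> s * k s))"
    if \<mu>: "smooth \<mu>" "\<And>s. DERIV \<mu> s :> \<mu>' s" "\<And>s. 0 \<le> \<mu> s" "T' < T" "\<And>s. s \<notin> {-R'..T'} \<Longrightarrow> \<mu> s = 0" for \<mu> \<mu>' R' T'
  proof -
    \<comment> \<open>A point to the left of the support, so the integral of \<open>\<mu>'\<close>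
      over \<open>{a..0}\<close> is \<open>\<mu> 0\<close>; this turns the initial term into a bulk
      term for negative times.\<close>
    define a where "a = - \<bar>R'\<bar> - 1"
    have c: "continuous_on UNIV \<mu>" "continuous_on UNIV \<mu>'" using smooth_continuous smooth_deriv \<mu>(1,2) by blast+
    have z: "\<mu>' s = 0" if "s \<notin> {-R'..T'}" for s using deriv_zero_outside[OF \<mu>(2,5) that] by blast
    let ?L = "\<lambda>s. \<mu>' s * indicator {a..0} s" and ?M = "\<lambda>s. indicator {0<..<T} s * (\<mu>' s * h s + \<mu> s * g s)"
    have L: "has_bochner_integral lborel ?L (\<mu> 0 - \<mu> a)"
      by (rule has_bochner_integral_FTC_Icc_real)
         (use \<mu>(2) c(2) in \<open>auto simp: a_def continuous_on_eq_continuous_at\<close>)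
    have "set_integrable lborel {0..T} (\<lambda>s. \<mu>' s * h s + \<mu> s * g s)"
      using c continuous_on_subset by (intro borel_integrable_atLeastAtMost' continuous_intros hc gc) auto
    then have "set_integrable lborel {0<..<T} (\<lambda>s. \<mu>' s * h s + \<mu> s * g s)" by (rule set_integrable_subset) auto
    then have M: "integrable lborel ?M" by (simp add: set_integrable_def)
    have "\<mu> a = 0" by (rule \<mu>(5)) (auto simp: a_def)
    moreover have "0 \<le> (LBINT s. ?M s) + \<mu> 0 * h0" by (rule ineq[where R'=R' and T'=T']) (use \<mu> in auto)
    ultimately have "0 \<le> (LBINT s. ?L s * h0 + ?M s)" using L M by (simp add: has_bochner_integral_iff)
    moreover have "integrable lborel (\<lambda>s. ?L s * h0 + ?M s)" using L M by (simp add: has_bochner_integral_iff)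
    moreover have "AE s in lborel. ?L s * h0 + ?M s = indicator {..<T} s * (\<mu>' s * H s + \<mu> s * k s)"
      using AE_lborel_singleton[of 0]
    proof (rule eventually_mono)
      fix s :: real assume "s \<noteq> 0"
      then consider "s < a" | "a \<le> s" "s < 0" | "0 < s" "s < T" | "T \<le> s" "0 < s" using T by linarith
      then show "?L s * h0 + ?M s = indicator {..<T} s * (\<mu>' s * H s + \<mu> s * k s)"
      proof cases
        case 1 then have "s \<notin> {-R'..T'}" by (auto simp: a_def)
        then show ?thesis using z \<mu>(5) 1 by (auto simp: a_def indicator_def)
      qed (use T in \<open>auto simp: H_def k_def indicator_def\<close>)
    qed
    ultimately show ?thesis by blast
  qed
  have right: "(H \<longlongrightarrow> H s) (at_right s)" if "0 \<le> s" "s < T" for s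
  proof -
    have "(h \<longlongrightarrow> h s) (at_right s)"
      by (rule continuous_on_Icc_at_rightD[OF continuous_on_subset[OF hc]]) (use that in auto)
    then have "(H \<longlongrightarrow> h s) (at_right s)"
      by (rule Lim_transform_eventually) (use that in \<open>auto simp: H_def eventually_at_filter\<close>)
    then show ?thesis using that by (simp add: H_def)
  qed
  have main: "h s2 - h s1 \<le> integral {s1..s2} g" if s: "0 \<le> s1" "s1 < s2" "s2 < T" for s1 s2
  proof -
    have e: "indicator {s1<..<s2} x * k x = indicator {s1<..<s2} x *\<^sub>R g x" for x :: real
      using s by (auto simp: k_def indicator_def)
    have i: "set_integrable lborel {s1<..<s2} g" using s by (intro gi) auto
    have "H s2 - H s1 \<le> (LBINT s. indicator {s1<..<s2} s * k s)"
      by (rule weak_inequality_localization[OF s(2,3) right right kG _ weak])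
         (use s i in \<open>auto simp: e set_integrable_def\<close>)
    also have "\<dots> = integral {s1..s2} g" unfolding e using set_borel_integral_eq_integral(2)[OF i]
      by (simp add: set_lebesgue_integral_def integral_open_interval_real)
    finally show ?thesis using s by (simp add: H_def)
  qed
  show "h s2 - h s1 \<le> integral {s1..s2} g" if s: "0 \<le> s1" "s1 \<le> s2" "s2 \<le> T" for s1 s2
  proof -
    consider "s1 = s2" | "s1 < s2" "s2 < T" | "s1 < s2" "s2 = T" using s by linarith
    then show ?thesis
    proof cases
      \<comment> \<open>The localisation requires room to the right of \<open>s2\<close>; the
        endpoint \<open>T\<close> is reached by continuity from the left.\<close>
      case 3 have "continuous_on {s1..T} (\<lambda>t. h t - h s1 - integral {s1..t} g)"
        by (intro continuous_intros indefinite_integral_continuous_1 integrable_continuous_real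
            continuous_on_subset[OF hc] continuous_on_subset[OF gc]) (use s in auto)
      then have "((\<lambda>t. h t - h s1 - integral {s1..t} g) \<longlongrightarrow> h T - h s1 - integral {s1..T} g) (at_left T)"
        using continuous_on_Icc_at_leftD[of s1 T "\<lambda>t. h t - h s1 - integral {s1..t} g"] 3 by blast
      then have "h T - h s1 - integral {s1..T} g \<le> 0"
      proof (rule tendsto_upperbound)
        have "eventually (\<lambda>t. s1 < t \<and> t < T) (at_left T)"
          using eventually_at_left_real[of s1 T] 3 by (auto elim: eventually_mono)
        then show "eventually (\<lambda>t. h t - h s1 - integral {s1..t} g \<le> 0) (at_left T)"
          by (rule eventually_mono) (use main s in force)
      qed auto
      with 3 show ?thesis by simp
    qed (use main s in auto)
  qed
  \<comment> \<open>Between -1 and 0 the rate \<open>k\<close> vanishes, so \<open>H\<close> cannot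
    jump upwards at 0.\<close>
  have "H 0 - H (- 1) \<le> (LBINT s. indicator {-1<..<0} s * k s)"
  proof (rule weak_inequality_localization[OF _ T _ right kG _ weak])
    have "eventually (\<lambda>s. s \<in> {-1<..<0}) (at_right (- 1::real))" by (rule eventually_at_right_real) simp
    then show "(H \<longlongrightarrow> H (- 1)) (at_right (- 1))"
      by (intro tendsto_eventually) (auto simp: H_def elim!: eventually_mono)
    have "(\<lambda>s. indicator {-1<..<0} s * k s) = (\<lambda>s. 0)" by (auto simp: k_def indicator_def)
    then show "integrable lborel (\<lambda>s. indicator {-1<..<0} s * k s)" by simp
  qed (use T in auto)
  moreover have "(\<lambda>s. indicator {-1<..<0} s * k s) = (\<lambda>s. 0)" by (auto simp: k_def indicator_def)
  ultimately show "h 0 \<le> h0" by (simp add: H_def)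
qed

lemma integral_diff_bound:
  fixes f g h :: "real \<Rightarrow> real"
  assumes i: "integrable lborel f" "integrable lborel g" "integrable lborel h" and le: "\<And>y. \<bar>f y - g y\<bar> \<le> h y"
  shows "\<bar>(LBINT y. f y) - (LBINT y. g y)\<bar> \<le> (LBINT y. h y)"
proof -
  have "\<bar>(LBINT y. f y) - (LBINT y. g y)\<bar> = \<bar>LBINT y. (f y - g y)\<bar>" using i by simp
  also have "\<dots> \<le> (LBINT y. \<bar>f y - g y\<bar>)" using i by (intro integral_abs_bound)
  also have "\<dots> \<le> (LBINT y. h y)" using i le by (intro integral_mono) auto
  finally show ?thesis .
qed

lemma abs_diff_lipschitz: "\<bar>\<bar>a - k\<bar> - \<bar>b - k\<bar>\<bar> \<le> 1 * \<bar>a - b\<bar>" for a b k :: real by simp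

section \<open>Kruzkov inequalities for spatial weights\<close>

locale entropy_data = flux f L for f :: "real \<Rightarrow> real" and L :: real +
  fixes u0 :: "real \<Rightarrow> real" and T :: real and u w :: "real \<Rightarrow> real \<Rightarrow> real"
  assumes T_pos: "0 < T" and u0_int: "integrable lborel u0"
    and sol: "entropy_solution f u0 T u" and rep: "L1_continuous_representative T u w"
begin

lemma w_int: "s \<in> {0..T} \<Longrightarrow> integrable lborel (\<lambda>y. w y s)" using rep by (auto simp: L1_continuous_representative_def)

lemma L1_continuous_functional:
  assumes "\<And>s s'. s \<in> {0..T} \<Longrightarrow> s' \<in> {0..T} \<Longrightarrow> \<bar>h s - h s'\<bar> \<le> C * (LBINT y. \<bar>w y s - w y s'\<bar>)"
  shows "continuous_on {0..T} h" unfolding continuous_on_def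
proof
  fix s assume s: "s \<in> {0..T}"
  have "((\<lambda>t. LBINT y. \<bar>w y t - w y s\<bar>) \<longlongrightarrow> 0) (at s within {0..T})"
    using rep s by (auto simp: L1_continuous_representative_def)
  then have "((\<lambda>t. C * (LBINT y. \<bar>w y t - w y s\<bar>)) \<longlongrightarrow> C * 0) (at s within {0..T})" by (intro tendsto_intros)
  then have "((\<lambda>t. C * (LBINT y. \<bar>w y t - w y s\<bar>)) \<longlongrightarrow> 0) (at s within {0..T})" by simp
  moreover have "eventually (\<lambda>t. norm (h t - h s) \<le> C * (LBINT y. \<bar>w y t - w y s\<bar>)) (at s within {0..T})"
    using assms s by (auto simp: eventually_at_filter)
  ultimately have "((\<lambda>t. h t - h s) \<longlongrightarrow> 0) (at s within {0..T})" by (rule Lim_null_comparison[rotated])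
  then show "(h \<longlongrightarrow> h s) (at s within {0..T})" by (rule LIM_zero_cancel)
qed

lemma w_bound: obtains K where "\<And>s. s \<in> {0..T} \<Longrightarrow> (LBINT y. \<bar>w y s\<bar>) \<le> K"
proof -
  have "continuous_on {0..T} (\<lambda>s. LBINT y. \<bar>w y s\<bar>)"
  proof (rule L1_continuous_functional[where C=1])
    fix s s' assume s: "s \<in> {0..T}" "s' \<in> {0..T}"
    note I = w_int[OF s(1)] w_int[OF s(2)]
    show "\<bar>(LBINT y. \<bar>w y s\<bar>) - (LBINT y. \<bar>w y s'\<bar>)\<bar> \<le> 1 * (LBINT y. \<bar>w y s - w y s'\<bar>)"
      unfolding mult_1 by (rule integral_diff_bound) (use I in auto)
  qed
  then have "bounded ((\<lambda>s. LBINT y. \<bar>w y s\<bar>) ` {0..T})" by (intro compact_imp_bounded compact_continuous_image) auto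
  then obtain K where "\<forall>s\<in>{0..T}. \<bar>LBINT y. \<bar>w y s\<bar>\<bar> \<le> K" by (auto simp: bounded_iff)
  with that show ?thesis by fastforce
qed

lemma weighted_continuous:
  assumes int: "\<And>s. s \<in> {0..T} \<Longrightarrow> integrable lborel (\<lambda>y. \<psi> y * q (w y s))" and bd: "\<And>y. \<bar>\<psi> y\<bar> \<le> M"
    and lip: "\<And>a b. \<bar>q a - q b\<bar> \<le> C * \<bar>a - b\<bar>"
  shows "continuous_on {0..T} (\<lambda>s. LBINT y. \<psi> y * q (w y s))"
proof (rule L1_continuous_functional[where C="M * C"])
  fix s s' assume s: "s \<in> {0..T}" "s' \<in> {0..T}"
  have "\<bar>(LBINT y. \<psi> y * q (w y s)) - (LBINT y. \<psi> y * q (w y s'))\<bar> \<le> (LBINT y. M * C * \<bar>w y s - w y s'\<bar>)"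
  proof (rule integral_diff_bound[OF int[OF s(1)] int[OF s(2)]])
    fix y
    have "\<bar>\<psi> y\<bar> * \<bar>q (w y s) - q (w y s')\<bar> \<le> M * (C * \<bar>w y s - w y s'\<bar>)"
      by (rule mult_mono) (use bd[of y] lip in auto)
    then show "\<bar>\<psi> y * q (w y s) - \<psi> y * q (w y s')\<bar> \<le> M * C * \<bar>w y s - w y s'\<bar>"
      unfolding right_diff_distrib[symmetric] abs_mult by (simp only: mult.assoc)
  qed (use w_int s in auto)
  then show "\<bar>(LBINT y. \<psi> y * q (w y s)) - (LBINT y. \<psi> y * q (w y s'))\<bar> \<le> M * C * (LBINT y. \<bar>w y s - w y s'\<bar>)"
    by simp
qed

lemmas weighted_dist_continuous = weighted_continuous[where q="\<lambda>a. \<bar>a - k\<bar>" and C=1 for k, OF _ _ abs_diff_lipschitz]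
  and weighted_flux_continuous = weighted_continuous[where q="\<lambda>a. kruzkov a k" and C=L for k, OF _ _ kruzkov_lip]

lemma weighted_flux_integrable:
  assumes s: "s \<in> {0..T}" and m: "\<psi> \<in> borel_measurable borel"
    and supp: "\<And>y. y \<notin> {a..b} \<Longrightarrow> \<psi> y = 0" and bd: "\<And>y. \<bar>\<psi> y\<bar> \<le> M"
  shows "integrable lborel (\<lambda>y. \<psi> y * kruzkov (w y s) k)"
proof -
  note [measurable] = m
  have [measurable]: "(\<lambda>y. w y s) \<in> borel_measurable borel" using w_int[OF s] by auto
  show ?thesis
  proof (rule integrable_bound)
    show "integrable lborel (\<lambda>y. L * (\<psi> y * \<bar>k - w y s\<bar>))"
      using assms by (intro integrable_mult_right loc_integrable_mult[OF loc_integrable_abs_diff[OF w_int[OF s]]]) auto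
    show "AE y in lborel. norm (\<psi> y * kruzkov (w y s) k) \<le> norm (L * (\<psi> y * \<bar>k - w y s\<bar>))"
    proof (rule AE_I2)
      fix y
      have "\<bar>\<psi> y\<bar> * \<bar>kruzkov (w y s) k\<bar> \<le> \<bar>\<psi> y\<bar> * (L * \<bar>k - w y s\<bar>)"
        by (intro mult_left_mono) (use kruzkov_bound[of "w y s" k] in \<open>auto simp: abs_minus_commute\<close>)
      then show "norm (\<psi> y * kruzkov (w y s) k) \<le> norm (L * (\<psi> y * \<bar>k - w y s\<bar>))"
        using L_nonneg by (simp add: abs_mult mult_ac)
    qed
  qed measurable
qed

text \<open>Joint measurability is known for \<open>u\<close> on the strip, while \<open>w\<close>
  is given as integrable on each time slice. Hence the exceptional null set of the plane is passed
  to slices by Fubini, and \<open>u\<close> is replaced by \<open>w\<close> slice by slice.\<close>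

lemma u_eq_w_sections: "AE t in lborel. AE x in lborel. t \<in> {0<..<T} \<longrightarrow> w x t = u x t"
proof -
  have "AE z in lborel. snd z \<in> {0<..<T} \<longrightarrow> w (fst z) (snd z) = u (fst z) (snd z)"
    using rep by (simp add: L1_continuous_representative_def)
  then obtain N where N: "N \<in> null_sets lborel"
    "{z. \<not> (snd z \<in> {0<..<T} \<longrightarrow> w (fst z) (snd z) = u (fst z) (snd z))} \<subseteq> N" by (auto simp: eventually_ae_filter)
  have Ns: "N \<in> sets (lborel \<Otimes>\<^sub>M lborel)" using null_setsD2[OF N(1)] unfolding lborel_prod .
  have "AE z in (lborel \<Otimes>\<^sub>M lborel). z \<notin> N" using AE_not_in[OF N(1)] unfolding lborel_prod .
  from lborel_pair.AE_pair[OF this] have "AE x in lborel. AE t in lborel. (x, t) \<notin> N" .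
  moreover have "{z \<in> space (lborel \<Otimes>\<^sub>M lborel). (fst z, snd z) \<notin> N} \<in> sets (lborel \<Otimes>\<^sub>M lborel)"
    using sets.compl_sets[OF Ns] by (auto simp: set_diff_eq)
  ultimately have "AE t in lborel. AE x in lborel. (x, t) \<notin> N"
    using lborel_pair.AE_commute[of "\<lambda>x t. (x, t) \<notin> N"] by simp
  moreover have "t \<in> {0<..<T} \<longrightarrow> w x t = u x t" if "(x, t) \<notin> N" for x t
    using subsetD[OF N(2), of "(x, t)"] that by auto
  ultimately show ?thesis by (auto elim!: eventually_mono)
qed

lemma tensor_inequality:
  assumes \<psi>: "smooth \<psi>" "\<And>y. DERIV \<psi> y :> \<psi>' y" "\<And>y. 0 \<le> \<psi> y" "\<And>y. y \<notin> {-R..R} \<Longrightarrow> \<psi> y = 0"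
    and \<mu>: "smooth \<mu>" "\<And>s. DERIV \<mu> s :> \<mu>' s" "\<And>s. 0 \<le> \<mu> s" "T' < T" "\<And>s. s \<notin> {-R'..T'} \<Longrightarrow> \<mu> s = 0"
  shows "0 \<le> (LBINT s. indicator {0<..<T} s * (\<mu>' s * (LBINT y. \<psi> y * \<bar>w y s - k\<bar>)
       + \<mu> s * (LBINT y. \<psi>' y * kruzkov (w y s) k))) + \<mu> 0 * (LBINT y. \<psi> y * \<bar>u0 y - k\<bar>)"
proof -
  let ?h = "\<lambda>s. LBINT y. \<psi> y * \<bar>w y s - k\<bar>" and ?q = "\<lambda>s. LBINT y. \<psi>' y * kruzkov (w y s) k"
  have c: "continuous_on UNIV \<psi>" "continuous_on UNIV \<psi>'" "continuous_on UNIV \<mu>" "continuous_on UNIV \<mu>'"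
    using smooth_continuous smooth_deriv \<psi>(1,2) \<mu>(1,2) by blast+
  have z: "\<psi>' y = 0" if "y \<notin> {-R..R}" for y using deriv_zero_outside[OF \<psi>(2,4) that] by blast
  have z': "\<mu>' y = 0" if "y \<notin> {-R'..T'}" for y using deriv_zero_outside[OF \<mu>(2,5) that] by blast
  obtain A1 where A1: "0 \<le> A1" "\<And>y. \<bar>\<psi> y\<bar> \<le> A1" using bounded_of_compact_support[OF c(1) \<psi>(4)] by blast
  obtain A2 where A2: "0 \<le> A2" "\<And>y. \<bar>\<psi>' y\<bar> \<le> A2" using bounded_of_compact_support[OF c(2) z] by blast
  obtain A3 where A3: "0 \<le> A3" "\<And>y. \<bar>\<mu> y\<bar> \<le> A3" using bounded_of_compact_support[OF c(3) \<mu>(5)] by blast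
  obtain A4 where A4: "0 \<le> A4" "\<And>y. \<bar>\<mu>' y\<bar> \<le> A4" using bounded_of_compact_support[OF c(4) z'] by blast
  have [measurable]: "\<psi> \<in> borel_measurable borel" "\<psi>' \<in> borel_measurable borel"
    "\<mu> \<in> borel_measurable borel" "\<mu>' \<in> borel_measurable borel"
    using c by (auto intro: borel_measurable_continuous_onI)
  define S where "S = (UNIV :: real set) \<times> {0<..<T}"
  have S[measurable]: "S \<in> sets borel" unfolding S_def by (intro borel_open open_Times) auto
  \<comment> \<open>The Borel function to which Fubini is applied; \<open>w\<close> enters only
    after the inner integral has been isolated.\<close>
  define v where "v = (\<lambda>z. indicator S z * u (fst z) (snd z))"
  have v[measurable]: "v \<in> borel_measurable borel"
    using sol by (simp add: entropy_solution_def set_borel_measurable_def v_def S_def)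
  obtain M0 where M0: "AE z in lborel. snd z \<in> {0<..<T} \<longrightarrow> \<bar>u (fst z) (snd z)\<bar> \<le> M0"
    using sol by (auto simp: entropy_solution_def)
  define M where "M = max 0 M0"
  have M: "AE z in lborel. \<bar>v z\<bar> \<le> M" using M0 by eventually_elim (auto simp: v_def S_def M_def indicator_def)
  define \<phi> where "\<phi> = (\<lambda>z. \<psi> (fst z) * \<mu> (snd z))"
  define G where "G = (\<lambda>z. indicator S z * (\<bar>v z - k\<bar> * (\<psi> (fst z) * \<mu>' (snd z))
      + kruzkov (v z) k * (\<psi>' (fst z) * \<mu> (snd z))))"
  have dt: "dt \<phi> z = \<psi> (fst z) * \<mu>' (snd z)" for z
    unfolding dt_def \<phi>_def by (rule DERIV_imp_deriv) (auto intro!: derivative_eq_intros \<mu>(2))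
  have dx: "dx \<phi> z = \<psi>' (fst z) * \<mu> (snd z)" for z
    unfolding dx_def \<phi>_def by (rule DERIV_imp_deriv) (auto intro!: derivative_eq_intros \<psi>(2))
  have tf: "test_function T \<phi>" unfolding \<phi>_def by (rule test_function_tensor[OF \<psi>(1) \<mu>(1) \<psi>(4) \<mu>(5) \<mu>(4)])
  have "0 \<le> balance (\<lambda>s. \<bar>s - k\<bar>) (\<lambda>s. kruzkov s k) u0 T u \<phi>" using sol kruzkov_entropy_pair[of k] tf \<psi>(3) \<mu>(3)
    unfolding entropy_solution_def by (auto simp: \<phi>_def)
  also have "balance (\<lambda>s. \<bar>s - k\<bar>) (\<lambda>s. kruzkov s k) u0 T u \<phi> = (LBINT z. G z) + \<mu> 0 * (LBINT y. \<psi> y * \<bar>u0 y - k\<bar>)"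
  proof -
    have "(LBINT z:UNIV \<times> {0<..<T}. \<bar>u (fst z) (snd z) - k\<bar> * dt \<phi> z + kruzkov (u (fst z) (snd z)) k * dx \<phi> z)
      = (LBINT z. G z)" unfolding set_lebesgue_integral_def dt dx G_def v_def S_def
      by (intro integral_cong) (auto simp: indicator_def)
    moreover have "(LBINT x. \<bar>u0 x - k\<bar> * \<phi> (x, 0)) = \<mu> 0 * (LBINT y. \<psi> y * \<bar>u0 y - k\<bar>)"
      unfolding \<phi>_def by (subst integral_mult_right_zero[symmetric]) (simp add: mult_ac)
    ultimately show ?thesis unfolding balance_def by simp
  qed
  also have "(LBINT z. G z) = (LBINT s. indicator {0<..<T} s * (\<mu>' s * ?h s + \<mu> s * ?q s))"
  proof -
    have [measurable]: "G \<in> borel_measurable borel"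
    proof -
      have [measurable]: "(fst :: real \<times> real \<Rightarrow> real) \<in> borel_measurable borel" "(snd :: real \<times> real \<Rightarrow> real) \<in> borel_measurable borel"
        by (auto intro!: borel_measurable_continuous_onI continuous_intros)
      show ?thesis unfolding G_def kruzkov_def by measurable
    qed
    define C where "C = (M + \<bar>k\<bar>) * (A1 * A4) + (L * (M + \<bar>k\<bar>)) * (A2 * A3)"
    let ?K = "{-R..R} \<times> {-R'..T'}"
    have iG: "integrable lborel G"
    proof (rule integrable_bound)
      have "emeasure lborel ?K < \<infinity>" by (intro emeasure_bounded_finite bounded_Times) auto
      moreover have "?K \<in> sets borel" by (intro borel_closed closed_Times) auto
      ultimately show "integrable lborel (\<lambda>z. C * indicator ?K z)"
        by (intro integrable_mult_right) (simp add: integrable_indicator_iff)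
      show "AE z in lborel. norm (G z) \<le> norm (C * indicator ?K z)" using M
      proof eventually_elim
        case (elim z) have vk: "\<bar>v z - k\<bar> \<le> M + \<bar>k\<bar>" using elim by simp
        have Cnn: "0 \<le> C" unfolding C_def using A1 A2 A3 A4 L_nonneg by (auto simp: M_def)
        have "\<bar>G z\<bar> \<le> \<bar>\<bar>v z - k\<bar> * (\<psi> (fst z) * \<mu>' (snd z)) + kruzkov (v z) k * (\<psi>' (fst z) * \<mu> (snd z))\<bar>"
          by (auto simp: G_def indicator_def)
        also have "\<dots> \<le> \<bar>v z - k\<bar> * (\<bar>\<psi> (fst z)\<bar> * \<bar>\<mu>' (snd z)\<bar>) + \<bar>kruzkov (v z) k\<bar> * (\<bar>\<psi>' (fst z)\<bar> * \<bar>\<mu> (snd z)\<bar>)"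
          by (rule order_trans[OF abs_triangle_ineq]) (simp add: abs_mult)
        also have "\<dots> \<le> C * indicator ?K z"
        proof (cases "z \<in> ?K")
          case True have k2: "\<bar>kruzkov (v z) k\<bar> \<le> L * (M + \<bar>k\<bar>)"
            using kruzkov_bound[of "v z" k] mult_left_mono[OF vk L_nonneg] by linarith
          have "\<bar>v z - k\<bar> * (\<bar>\<psi> (fst z)\<bar> * \<bar>\<mu>' (snd z)\<bar>) + \<bar>kruzkov (v z) k\<bar> * (\<bar>\<psi>' (fst z)\<bar> * \<bar>\<mu> (snd z)\<bar>) \<le> C"
            unfolding C_def using A1 A2 A3 A4 vk k2 L_nonneg by (intro add_mono mult_mono mult_nonneg_nonneg) auto
          with True show ?thesis by simp
        next
          case False then consider "fst z \<notin> {-R..R}" | "snd z \<notin> {-R'..T'}" by (cases z) auto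
          then show ?thesis using \<psi>(4) z \<mu>(5) z' False by cases auto
        qed
        finally show ?case using Cnn by simp
      qed
    qed measurable
    have iP: "integrable (lborel \<Otimes>\<^sub>M lborel) (\<lambda>(x, t). G (x, t))" using iG by (simp add: lborel_prod)
    have "(LBINT z. G z) = (LBINT t. LBINT x. G (x, t))"
      using lborel_pair.integral_snd[OF iP] by (simp add: lborel_prod)
    also have "\<dots> = (LBINT s. indicator {0<..<T} s * (\<mu>' s * ?h s + \<mu> s * ?q s))"
    proof (rule integral_cong_AE)
      show "(\<lambda>t. LBINT x. G (x, t)) \<in> borel_measurable lborel" using lborel_pair.integrable_snd[OF iP] by auto
      have I1: "integrable lborel (\<lambda>y. \<psi> y * \<bar>w y s - k\<bar>)" if "s \<in> {0..T}" for s
        using loc_integrable_mult[OF loc_integrable_abs_diff[OF w_int[OF that], of k] _ \<psi>(4) A1(2)]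
        by (simp add: abs_minus_commute)
      have I2: "integrable lborel (\<lambda>y. \<psi>' y * kruzkov (w y s) k)" if "s \<in> {0..T}" for s
        by (rule weighted_flux_integrable[OF that _ z A2(2)]) measurable
      have "continuous_on {0..T} (\<lambda>s. \<mu>' s * ?h s + \<mu> s * ?q s)"
        by (intro continuous_intros weighted_dist_continuous[OF I1 A1(2)] weighted_flux_continuous[OF I2 A2(2)]
            continuous_on_subset[OF c(3)] continuous_on_subset[OF c(4)]) auto
      then have "continuous_on {0<..<T} (\<lambda>s. \<mu>' s * ?h s + \<mu> s * ?q s)" by (rule continuous_on_subset) auto
      from borel_measurable_continuous_on_indicator[OF _ this]
      show "(\<lambda>s. indicator {0<..<T} s * (\<mu>' s * ?h s + \<mu> s * ?q s)) \<in> borel_measurable lborel" by simp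
      show "AE t in lborel. (LBINT x. G (x, t)) = indicator {0<..<T} t * (\<mu>' t * ?h t + \<mu> t * ?q t)"
        using u_eq_w_sections
      proof eventually_elim
        case (elim t) show ?case
        proof (cases "t \<in> {0<..<T}")
          case False then show ?thesis by (simp add: G_def S_def)
        next
          case True then have t: "t \<in> {0..T}" by auto
          have [measurable]: "(\<lambda>y. w y t) \<in> borel_measurable borel" using w_int[OF t] by auto
          have "(LBINT x. G (x, t)) = (LBINT x. \<mu>' t * (\<psi> x * \<bar>w x t - k\<bar>) + \<mu> t * (\<psi>' x * kruzkov (w x t) k))"
          proof (rule integral_cong_AE)
            show "(\<lambda>x. G (x, t)) \<in> borel_measurable lborel" by measurable
            show "AE x in lborel. G (x, t) = \<mu>' t * (\<psi> x * \<bar>w x t - k\<bar>) + \<mu> t * (\<psi>' x * kruzkov (w x t) k)"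
              using elim by eventually_elim (use True in \<open>auto simp: G_def v_def S_def\<close>)
          qed measurable
          also have "\<dots> = \<mu>' t * ?h t + \<mu> t * ?q t" using I1[OF t] I2[OF t] by simp
          finally show ?thesis using True by simp
        qed
      qed
    qed
    finally show ?thesis .
  qed
  finally show ?thesis .
qed

lemma compact_test_inequality:
  assumes \<psi>: "smooth \<psi>" "\<And>y. DERIV \<psi> y :> \<psi>' y" "\<And>y. 0 \<le> \<psi> y" "\<And>y. y \<notin> {-R..R} \<Longrightarrow> \<psi> y = 0"
  shows "\<And>s1 s2. 0 \<le> s1 \<Longrightarrow> s1 \<le> s2 \<Longrightarrow> s2 \<le> T \<Longrightarrow>
       (LBINT y. \<psi> y * \<bar>w y s2 - k\<bar>) - (LBINT y. \<psi> y * \<bar>w y s1 - k\<bar>)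
       \<le> integral {s1..s2} (\<lambda>s. LBINT y. \<psi>' y * kruzkov (w y s) k)"
    and "(LBINT y. \<psi> y * \<bar>w y 0 - k\<bar>) \<le> (LBINT y. \<psi> y * \<bar>u0 y - k\<bar>)"
    and "continuous_on {0..T} (\<lambda>s. LBINT y. \<psi>' y * kruzkov (w y s) k)"
proof -
  have c: "continuous_on UNIV \<psi>" "continuous_on UNIV \<psi>'" using smooth_continuous smooth_deriv \<psi>(1,2) by blast+
  have z: "\<psi>' y = 0" if "y \<notin> {-R..R}" for y using deriv_zero_outside[OF \<psi>(2,4) that] by blast
  obtain A1 where A1: "0 \<le> A1" "\<And>y. \<bar>\<psi> y\<bar> \<le> A1" using bounded_of_compact_support[OF c(1) \<psi>(4)] by blast
  obtain A2 where A2: "0 \<le> A2" "\<And>y. \<bar>\<psi>' y\<bar> \<le> A2" using bounded_of_compact_support[OF c(2) z] by blast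
  have [measurable]: "\<psi> \<in> borel_measurable borel" "\<psi>' \<in> borel_measurable borel"
    using c by (auto intro: borel_measurable_continuous_onI)
  have I1: "integrable lborel (\<lambda>y. \<psi> y * \<bar>w y s - k\<bar>)" if "s \<in> {0..T}" for s
    using loc_integrable_mult[OF loc_integrable_abs_diff[OF w_int[OF that], of k] _ \<psi>(4) A1(2)]
    by (simp add: abs_minus_commute)
  have I2: "integrable lborel (\<lambda>y. \<psi>' y * kruzkov (w y s) k)" if "s \<in> {0..T}" for s
    by (rule weighted_flux_integrable[OF that _ z A2(2)]) measurable
  have C1: "continuous_on {0..T} (\<lambda>s. LBINT y. \<psi> y * \<bar>w y s - k\<bar>)" by (rule weighted_dist_continuous[OF I1 A1(2)])
  have C2: "continuous_on {0..T} (\<lambda>s. LBINT y. \<psi>' y * kruzkov (w y s) k)"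
    by (rule weighted_flux_continuous[OF I2 A2(2)])
  have TI: "0 \<le> (LBINT s. indicator {0<..<T} s * (\<mu>' s * (LBINT y. \<psi> y * \<bar>w y s - k\<bar>)
       + \<mu> s * (LBINT y. \<psi>' y * kruzkov (w y s) k))) + \<mu> 0 * (LBINT y. \<psi> y * \<bar>u0 y - k\<bar>)"
    if "smooth \<mu>" "\<And>s. DERIV \<mu> s :> \<mu>' s" "\<And>s. 0 \<le> \<mu> s" "T' < T" "\<And>s. s \<notin> {-R'..T'} \<Longrightarrow> \<mu> s = 0" for \<mu> \<mu>' R' T'
    by (rule tensor_inequality[OF \<psi> that])
  show "(LBINT y. \<psi> y * \<bar>w y s2 - k\<bar>) - (LBINT y. \<psi> y * \<bar>w y s1 - k\<bar>)
       \<le> integral {s1..s2} (\<lambda>s. LBINT y. \<psi>' y * kruzkov (w y s) k)" if "0 \<le> s1" "s1 \<le> s2" "s2 \<le> T" for s1 s2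
    by (rule time_localization(1)[OF T_pos C1 C2 _ that]) (rule TI; assumption)
  show "(LBINT y. \<psi> y * \<bar>w y 0 - k\<bar>) \<le> (LBINT y. \<psi> y * \<bar>u0 y - k\<bar>)"
    by (rule time_localization(2)[OF T_pos C1 C2]) (rule TI; assumption)
  show "continuous_on {0..T} (\<lambda>s. LBINT y. \<psi>' y * kruzkov (w y s) k)" by (rule C2)
qed

text \<open>The weight may tend to 1 at infinity, so the Kruzkov constant is 0 and integrability of
  \<open>w\<close> takes over. Cut-offs at distance \<open>m j\<close> have slope of order 1 over
  \<open>m j\<close>; the flux they create is at most that slope times \<open>L\<close> times the
  L^1 norm of \<open>w\<close>, which is bounded in time.\<close>

lemma tail_test_inequality:
  assumes \<psi>: "smooth \<psi>" "\<And>y. DERIV \<psi> y :> \<psi>' y" "\<And>y. 0 \<le> \<psi> y" "\<And>y. \<psi> y \<le> 1" "\<And>y. y \<notin> {-R..R} \<Longrightarrow> \<psi>' y = 0"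
  shows "\<And>s1 s2. 0 \<le> s1 \<Longrightarrow> s1 \<le> s2 \<Longrightarrow> s2 \<le> T \<Longrightarrow>
       (LBINT y. \<psi> y * \<bar>w y s2 - 0\<bar>) - (LBINT y. \<psi> y * \<bar>w y s1 - 0\<bar>)
       \<le> integral {s1..s2} (\<lambda>s. LBINT y. \<psi>' y * kruzkov (w y s) 0)"
    and "(LBINT y. \<psi> y * \<bar>w y 0 - 0\<bar>) \<le> (LBINT y. \<psi> y * \<bar>u0 y - 0\<bar>)"
    and "continuous_on {0..T} (\<lambda>s. LBINT y. \<psi>' y * kruzkov (w y s) 0)"
proof -
  let ?h = "\<lambda>s. LBINT y. \<psi> y * \<bar>w y s - 0\<bar>" and ?g = "\<lambda>s. LBINT y. \<psi>' y * kruzkov (w y s) 0"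
  obtain B b :: "real \<Rightarrow> real" where B: "smooth B" "smooth b" "\<And>x. DERIV B x :> b x" "\<And>x. 0 \<le> b x"
    "\<And>x. x \<le> 0 \<Longrightarrow> B x = 0" "\<And>x. 1 \<le> x \<Longrightarrow> B x = 1" "\<And>x. x \<le> 0 \<or> 1 \<le> x \<Longrightarrow> b x = 0" "\<And>x. 0 \<le> B x" "\<And>x. B x \<le> 1"
    using smooth_step by blast
  obtain Mb where Mb: "0 \<le> Mb" "\<And>y. \<bar>b y\<bar> \<le> Mb"
    using bounded_of_compact_support[of b 0 1] smooth_continuous[OF B(2)] B(7) by (metis atLeastAtMost_iff linear)
  define m where "m = (\<lambda>j::nat. real (Suc j))"
  have m: "0 < m j" for j by (simp add: m_def)
  \<comment> \<open>Equal to 1 for \<open>\<bar>y\<bar> \<le> m j\<close> and to 0 for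
    \<open>\<bar>y\<bar> \<ge> 2 * m j\<close>.\<close>
  define \<mu> where "\<mu> = (\<lambda>j y. B (y / m j + 2) * B (2 - y / m j))"
  define \<mu>' where "\<mu>' = (\<lambda>j y. (b (y / m j + 2) * B (2 - y / m j) - B (y / m j + 2) * b (2 - y / m j)) / m j)"
  have d\<mu>: "DERIV (\<mu> j) y :> \<mu>' j y" for j y
  proof -
    have 1: "DERIV (\<lambda>y. B (y / m j + 2)) y :> b (y / m j + 2) * (1 / m j)"
      by (rule DERIV_chain2[OF B(3)]) (use m[of j] in \<open>auto intro!: derivative_eq_intros\<close>)
    have 2: "DERIV (\<lambda>y. B (2 - y / m j)) y :> b (2 - y / m j) * (- 1 / m j)"
      by (rule DERIV_chain2[OF B(3)]) (use m[of j] in \<open>auto intro!: derivative_eq_intros\<close>)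
    show ?thesis unfolding \<mu>_def \<mu>'_def
      by (rule DERIV_cong[OF DERIV_mult[OF 1 2]]) (use m[of j] in \<open>simp add: field_simps\<close>)
  qed
  have s\<mu>: "smooth (\<mu> j)" for j
  proof -
    have "smooth (\<lambda>y. B ((1 / m j) * y + 2) * B ((- 1 / m j) * y + 2))" by (intro smooth_mult smooth_affine B(1))
    then show ?thesis by (simp add: \<mu>_def algebra_simps)
  qed
  have \<mu>01: "0 \<le> \<mu> j y" "\<mu> j y \<le> 1" for j y unfolding \<mu>_def using B(8,9) by (auto intro: mult_le_one)
  have \<mu>1: "\<mu> j y = 1" if "\<bar>y\<bar> \<le> m j" for j y
  proof -
    have "y / m j \<ge> -1" "y / m j \<le> 1" using that m[of j] by (auto simp: divide_simps)
    then show ?thesis by (simp add: \<mu>_def B(6))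
  qed
  have \<mu>0: "\<mu> j y = 0" if "y \<notin> {- (2 * m j)..2 * m j}" for j y
  proof -
    have "y / m j \<le> -2 \<or> y / m j \<ge> 2" using that m[of j] by (auto simp: divide_simps)
    then show ?thesis by (auto simp: \<mu>_def B(5))
  qed
  have \<mu>'b: "\<bar>\<mu>' j y\<bar> \<le> 2 * Mb / m j" for j y
  proof -
    have "\<bar>b (y / m j + 2) * B (2 - y / m j)\<bar> \<le> Mb * 1" "\<bar>B (y / m j + 2) * b (2 - y / m j)\<bar> \<le> 1 * Mb"
      unfolding abs_mult using B(8,9) Mb by (intro mult_mono; simp)+
    then have "\<bar>b (y / m j + 2) * B (2 - y / m j) - B (y / m j + 2) * b (2 - y / m j)\<bar> \<le> 2 * Mb" by linarith
    then show ?thesis unfolding \<mu>'_def abs_divide using m[of j] by (simp add: divide_right_mono)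
  qed
  define \<psi>m where "\<psi>m = (\<lambda>j y. \<psi> y * \<mu> j y)"
  define \<psi>m' where "\<psi>m' = (\<lambda>j y. \<psi>' y * \<mu> j y + \<mu>' j y * \<psi> y)"
  let ?hm = "\<lambda>j s. LBINT y. \<psi>m j y * \<bar>w y s - 0\<bar>" and ?gm = "\<lambda>j s. LBINT y. \<psi>m' j y * kruzkov (w y s) 0"
  have c: "continuous_on UNIV \<psi>" "continuous_on UNIV \<psi>'" "continuous_on UNIV (\<mu> j)" "continuous_on UNIV (\<mu>' j)" for j
    using smooth_continuous smooth_deriv \<psi>(1,2) s\<mu> d\<mu> by blast+
  have [measurable]: "\<psi> \<in> borel_measurable borel" "\<psi>' \<in> borel_measurable borel"
    "\<mu> j \<in> borel_measurable borel" "\<mu>' j \<in> borel_measurable borel" for j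
    using c by (auto intro: borel_measurable_continuous_onI)
  obtain A2 where A2: "0 \<le> A2" "\<And>y. \<bar>\<psi>' y\<bar> \<le> A2" using bounded_of_compact_support[OF c(2) \<psi>(5)] by blast
  have test: "smooth (\<psi>m j)" "\<And>y. DERIV (\<psi>m j) y :> \<psi>m' j y" "\<And>y. 0 \<le> \<psi>m j y"
      "\<And>y. y \<notin> {-(2 * m j)..2 * m j} \<Longrightarrow> \<psi>m j y = 0" for j
  proof -
    show "smooth (\<psi>m j)" unfolding \<psi>m_def by (intro smooth_mult \<psi>(1) s\<mu>)
    show "DERIV (\<psi>m j) y :> \<psi>m' j y" for y unfolding \<psi>m_def \<psi>m'_def by (intro DERIV_mult \<psi>(2) d\<mu>)
    show "0 \<le> \<psi>m j y" for y unfolding \<psi>m_def using \<psi>(3) \<mu>01 by simp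
    show "\<psi>m j y = 0" if "y \<notin> {-(2 * m j)..2 * m j}" for y using \<mu>0[OF that] by (simp add: \<psi>m_def)
  qed
  have CT1: "?hm j s2 - ?hm j s1 \<le> integral {s1..s2} (?gm j)" if "0 \<le> s1" "s1 \<le> s2" "s2 \<le> T" for j s1 s2
    by (rule compact_test_inequality(1)[where \<psi>'="\<psi>m' j" and R="2 * m j"]; (rule test that | assumption)+)
  have CT2: "?hm j 0 \<le> (LBINT y. \<psi>m j y * \<bar>u0 y - 0\<bar>)" for j
    by (rule compact_test_inequality(2)[where \<psi>'="\<psi>m' j" and R="2 * m j"]; (rule test | assumption)+)
  have CT3: "continuous_on {0..T} (?gm j)" for j
    by (rule compact_test_inequality(3)[where \<psi>="\<psi>m j" and R="2 * m j"]; (rule test | assumption)+)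
  obtain K where K: "\<And>s. s \<in> {0..T} \<Longrightarrow> (LBINT y. \<bar>w y s\<bar>) \<le> K" using w_bound by blast
  have I: "integrable lborel (\<lambda>y. \<psi>' y * kruzkov (w y s) 0)" if "s \<in> {0..T}" for s
    by (rule weighted_flux_integrable[OF that _ \<psi>(5) A2(2)]) measurable
  show gc: "continuous_on {0..T} ?g" by (rule weighted_flux_continuous[OF I A2(2)])
  have hlim: "(\<lambda>j. LBINT y. \<psi>m j y * \<bar>v y - 0\<bar>) \<longlonglongrightarrow> (LBINT y. \<psi> y * \<bar>v y - 0\<bar>)" if v: "integrable lborel v" for v
  proof (rule integral_dominated_convergence[where w="\<lambda>y. \<bar>v y\<bar>"])
    have [measurable]: "v \<in> borel_measurable borel" using v by auto
    show "(\<lambda>y. \<psi> y * \<bar>v y - 0\<bar>) \<in> borel_measurable lborel" by measurable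
    show "(\<lambda>y. \<psi>m j y * \<bar>v y - 0\<bar>) \<in> borel_measurable lborel" for j unfolding \<psi>m_def by measurable
    show "integrable lborel (\<lambda>y. \<bar>v y\<bar>)" using v by simp
    show "AE y in lborel. (\<lambda>j. \<psi>m j y * \<bar>v y - 0\<bar>) \<longlonglongrightarrow> \<psi> y * \<bar>v y - 0\<bar>"
    proof (rule AE_I2, rule tendsto_eventually)
      fix y
      obtain J where J: "\<bar>y\<bar> \<le> real J" using real_arch_simple by blast
      have "\<psi>m j y * \<bar>v y - 0\<bar> = \<psi> y * \<bar>v y - 0\<bar>" if "J \<le> j" for j
      proof -
        have "\<bar>y\<bar> \<le> m j" using J that unfolding m_def by linarith
        then show ?thesis by (simp add: \<psi>m_def \<mu>1)
      qed
      then show "eventually (\<lambda>j. \<psi>m j y * \<bar>v y - 0\<bar> = \<psi> y * \<bar>v y - 0\<bar>) sequentially"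
        using eventually_sequentially by blast
    qed
    show "AE y in lborel. norm (\<psi>m j y * \<bar>v y - 0\<bar>) \<le> \<bar>v y\<bar>" for j
    proof (rule AE_I2)
      fix y
      have "\<bar>\<psi>m j y\<bar> \<le> 1" unfolding \<psi>m_def using \<psi>(3,4) \<mu>01 by (auto simp: abs_mult intro: mult_le_one)
      then show "norm (\<psi>m j y * \<bar>v y - 0\<bar>) \<le> \<bar>v y\<bar>" by (auto simp: abs_mult intro!: mult_left_le_one_le)
    qed
  qed
  show "?h 0 \<le> (LBINT y. \<psi> y * \<bar>u0 y - 0\<bar>)"
    by (rule LIMSEQ_le[OF hlim[OF w_int] hlim[OF u0_int]]) (use T_pos CT2 in auto)
  show "?h s2 - ?h s1 \<le> integral {s1..s2} ?g" if s: "0 \<le> s1" "s1 \<le> s2" "s2 \<le> T" for s1 s2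
  proof -
    define C where "C = 2 * Mb * L * K"
    have gm: "?gm j s \<le> ?g s + C / m j" if j: "R \<le> m j" and s: "s \<in> {0..T}" for j s
    proof -
      have [measurable]: "(\<lambda>y. w y s) \<in> borel_measurable borel" using w_int[OF s] by auto
      \<comment> \<open>The cut-off is 1 on the support of \<open>\<psi>'\<close>, so only the term
        with \<open>\<mu>'\<close> disturbs the flux.\<close>
      have p: "\<psi>' y * \<mu> j y = \<psi>' y" for y
      proof (cases "y \<in> {-R..R}")
        case True then show ?thesis using j by (subst \<mu>1) auto
      qed (simp add: \<psi>(5))
      have le: "\<bar>\<mu>' j y * \<psi> y * kruzkov (w y s) 0\<bar> \<le> 2 * Mb / m j * L * \<bar>w y s\<bar>" for y
      proof -
        have "\<bar>\<mu>' j y\<bar> * \<bar>\<psi> y\<bar> \<le> 2 * Mb / m j * 1" using \<mu>'b[of j y] \<psi>(3,4)[of y] by (intro mult_mono) auto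
        moreover have "\<bar>kruzkov (w y s) 0\<bar> \<le> L * \<bar>w y s\<bar>" using kruzkov_bound[of "w y s" 0] by simp
        ultimately have "(\<bar>\<mu>' j y\<bar> * \<bar>\<psi> y\<bar>) * \<bar>kruzkov (w y s) 0\<bar> \<le> (2 * Mb / m j * 1) * (L * \<bar>w y s\<bar>)"
          using Mb(1) m[of j] by (rule_tac mult_mono) auto
        then show ?thesis by (simp add: abs_mult mult_ac)
      qed
      have i2: "integrable lborel (\<lambda>y. \<mu>' j y * \<psi> y * kruzkov (w y s) 0)"
      proof (rule integrable_bound)
        show "integrable lborel (\<lambda>y. 2 * Mb / m j * L * \<bar>w y s\<bar>)" using w_int[OF s] by simp
        show "AE y in lborel. norm (\<mu>' j y * \<psi> y * kruzkov (w y s) 0) \<le> norm (2 * Mb / m j * L * \<bar>w y s\<bar>)"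
        proof (rule AE_I2)
          fix y show "norm (\<mu>' j y * \<psi> y * kruzkov (w y s) 0) \<le> norm (2 * Mb / m j * L * \<bar>w y s\<bar>)"
            by (simp only: real_norm_def) (rule order_trans[OF le abs_ge_self])
        qed
      qed measurable
      have "?gm j s = (LBINT y. \<psi>' y * kruzkov (w y s) 0 + \<mu>' j y * \<psi> y * kruzkov (w y s) 0)"
        unfolding \<psi>m'_def p by (simp add: algebra_simps)
      also have "\<dots> = ?g s + (LBINT y. \<mu>' j y * \<psi> y * kruzkov (w y s) 0)"
        by (rule integral_add[OF I[OF s] i2])
      also have "(LBINT y. \<mu>' j y * \<psi> y * kruzkov (w y s) 0) \<le> (LBINT y. 2 * Mb / m j * L * \<bar>w y s\<bar>)"
        by (rule integral_mono[OF i2 _ abs_le_D1[OF le]]) (use w_int[OF s] in simp)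
      also have "\<dots> = 2 * Mb / m j * L * (LBINT y. \<bar>w y s\<bar>)" by simp
      also have "\<dots> \<le> 2 * Mb / m j * L * K" using K[OF s] Mb(1) m[of j] L_nonneg by (intro mult_left_mono) auto
      also have "\<dots> = C / m j" by (simp add: C_def)
      finally show ?thesis by simp
    qed
    have ev: "eventually (\<lambda>j. ?hm j s2 - ?hm j s1
        \<le> integral {s1..s2} ?g + C * (s2 - s1) * inverse (m j)) sequentially"
    proof -
      obtain J where J: "R \<le> real J" using real_arch_simple by blast
      have "?hm j s2 - ?hm j s1 \<le> integral {s1..s2} ?g + C * (s2 - s1) * inverse (m j)" if "J \<le> j" for j
      proof -
        have jR: "R \<le> m j" using J that unfolding m_def by linarith
        have sub: "{s1..s2} \<subseteq> {0..T}" using s by auto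
        have "?hm j s2 - ?hm j s1 \<le> integral {s1..s2} (?gm j)" by (rule CT1[OF s])
        also have "\<dots> \<le> integral {s1..s2} (\<lambda>s. ?g s + C / m j)"
        proof (rule integral_le)
          show "(?gm j) integrable_on {s1..s2}"
            by (rule integrable_continuous_real[OF continuous_on_subset[OF CT3 sub]])
          show "(\<lambda>s. ?g s + C / m j) integrable_on {s1..s2}"
            by (intro integrable_continuous_real continuous_intros continuous_on_subset[OF gc sub])
          show "?gm j s \<le> ?g s + C / m j" if "s \<in> {s1..s2}" for s using gm[OF jR] that sub by blast
        qed
        also have "\<dots> = integral {s1..s2} ?g + C * (s2 - s1) * inverse (m j)"
        proof -
          have "integral {s1..s2} (\<lambda>s. ?g s + C / m j) = integral {s1..s2} ?g + integral {s1..s2} (\<lambda>s. C / m j)"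
            by (intro Henstock_Kurzweil_Integration.integral_add integrable_continuous_real
                continuous_on_subset[OF gc sub] continuous_on_const)
          then show ?thesis using s by (simp add: divide_inverse)
        qed
        finally show ?thesis .
      qed
      then show ?thesis using eventually_sequentially by blast
    qed
    have l1: "(\<lambda>j. ?hm j s2 - ?hm j s1) \<longlonglongrightarrow> ?h s2 - ?h s1" using s by (intro tendsto_diff hlim w_int) auto
    have "(\<lambda>j. integral {s1..s2} ?g + C * (s2 - s1) * inverse (m j)) \<longlonglongrightarrow> integral {s1..s2} ?g + C * (s2 - s1) * 0"
      unfolding m_def by (intro tendsto_intros LIMSEQ_inverse_real_of_nat)
    then have l2: "(\<lambda>j. integral {s1..s2} ?g + C * (s2 - s1) * inverse (m j)) \<longlonglongrightarrow> integral {s1..s2} ?g" by simp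
    show ?thesis by (rule tendsto_le[OF _ l2 l1 ev]) simp
  qed
qed

end

section \<open>Entropy inequality against frozen particles\<close>

locale comparison = kernel_flux W om om' r f L + entropy_data f L u0 T u w for W om om' r f L u0 T u w
begin

lemma smooth_Wt: "smooth (\<lambda>y. Wt n \<xi> y i)"
  unfolding Wt_def by (cases "i = 0"; cases "i \<le> n") (simp_all add: smooth_const smooth_reflect smooth_W)

lemma smooth_cell_weight: "smooth (cell_weight n \<xi> i)" unfolding cell_weight_def by (intro smooth_diff smooth_Wt)

lemma Wt_deriv: "DERIV (\<lambda>y. Wt n \<xi> y i) y :> - omt n \<xi> y i"
proof -
  have "DERIV (\<lambda>y. W (c - y)) y :> - om (c - y)" for c
    by (rule DERIV_cong[OF DERIV_chain2[OF W_deriv]]) (auto intro!: derivative_eq_intros)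
  then show ?thesis by (simp add: Wt_def omt_def)
qed

lemma cell_weight_deriv: "DERIV (cell_weight n \<xi> i) y :> - (omt n \<xi> y (Suc i) - omt n \<xi> y i)"
  unfolding cell_weight_def by (rule DERIV_cong[OF DERIV_diff[OF Wt_deriv Wt_deriv]]) simp

lemma frozen_cell_inequality:
  assumes c: "config n \<xi> \<nu>" and i: "i \<le> n"
  defines "g \<equiv> (\<lambda>s. LBINT y. kruzkov (\<nu> i) (w y s) * (omt n \<xi> y (Suc i) - omt n \<xi> y i))"
  shows "\<And>s1 s2. 0 \<le> s1 \<Longrightarrow> s1 \<le> s2 \<Longrightarrow> s2 \<le> T \<Longrightarrow>
       (LBINT y. cell_weight n \<xi> i y * \<bar>\<nu> i - w y s2\<bar>) - (LBINT y. cell_weight n \<xi> i y * \<bar>\<nu> i - w y s1\<bar>)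
       \<le> integral {s1..s2} (\<lambda>s. - g s)"
    and "(LBINT y. cell_weight n \<xi> i y * \<bar>\<nu> i - w y 0\<bar>) \<le> (LBINT y. cell_weight n \<xi> i y * \<bar>\<nu> i - u0 y\<bar>)"
    and "continuous_on {0..T} g"
proof -
  let ?c = "\<lambda>v. LBINT y. cell_weight n \<xi> i y * \<bar>\<nu> i - v y\<bar>"
  let ?p = "\<lambda>y. - (omt n \<xi> y (Suc i) - omt n \<xi> y i)"
  have eq: "(LBINT y. ?p y * kruzkov (w y s) (\<nu> i)) = - g s" for s
  proof -
    have "(LBINT y. ?p y * kruzkov (w y s) (\<nu> i))
      = (LBINT y. - (kruzkov (\<nu> i) (w y s) * (omt n \<xi> y (Suc i) - omt n \<xi> y i)))"
      by (intro integral_cong) (auto simp: kruzkov_sym[of _ "\<nu> i"] algebra_simps)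
    then show ?thesis by (simp add: g_def)
  qed
  have nn: "0 \<le> cell_weight n \<xi> i y" for y by (rule cell_weight_nonneg[OF c i])
  have "((\<forall>s1 s2. 0 \<le> s1 \<longrightarrow> s1 \<le> s2 \<longrightarrow> s2 \<le> T \<longrightarrow>
       (LBINT y. cell_weight n \<xi> i y * \<bar>w y s2 - \<nu> i\<bar>) - (LBINT y. cell_weight n \<xi> i y * \<bar>w y s1 - \<nu> i\<bar>)
       \<le> integral {s1..s2} (\<lambda>s. LBINT y. ?p y * kruzkov (w y s) (\<nu> i)))
     \<and> (LBINT y. cell_weight n \<xi> i y * \<bar>w y 0 - \<nu> i\<bar>) \<le> (LBINT y. cell_weight n \<xi> i y * \<bar>u0 y - \<nu> i\<bar>))
     \<and> continuous_on {0..T} (\<lambda>s. LBINT y. ?p y * kruzkov (w y s) (\<nu> i))"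
  proof (cases "i \<in> {1..<n}")
    case True
    define R where "R = max \<bar>\<xi> i - r\<bar> \<bar>\<xi> (Suc i) + r\<bar>"
    have z: "cell_weight n \<xi> i y = 0" if "y \<notin> {-R..R}" for y
      by (rule cell_weight_supp[OF c True]) (use that in \<open>auto simp: R_def\<close>)
    show ?thesis
      by (intro conjI allI impI; rule compact_test_inequality[where \<psi>'="?p" and R=R];
          (rule smooth_cell_weight cell_weight_deriv nn z | assumption)+)
  next
    case False then have d0: "\<nu> i = 0" by (rule config_ends[OF c i])
    obtain u' v' where uv: "\<And>y i. y \<notin> {u'..v'} \<Longrightarrow> omt n \<xi> y i = 0" using omt_supp_ex by blast
    define R where "R = max \<bar>u'\<bar> \<bar>v'\<bar>"
    have z: "?p y = 0" if "y \<notin> {-R..R}" for y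
    proof -
      have "y \<notin> {u'..v'}" using that unfolding R_def by (auto simp: max_def split: if_splits)
      then show ?thesis using uv by simp
    qed
    show ?thesis unfolding d0
      by (intro conjI allI impI; rule tail_test_inequality[where \<psi>'="?p" and R=R];
          (rule smooth_cell_weight cell_weight_deriv nn cell_weight_le_1[OF c i] z | assumption)+)
  qed
  note Y = this[unfolded eq]
  show "?c (\<lambda>y. w y s2) - ?c (\<lambda>y. w y s1) \<le> integral {s1..s2} (\<lambda>s. - g s)" if "0 \<le> s1" "s1 \<le> s2" "s2 \<le> T" for s1 s2
    using Y that by (simp only: abs_minus_commute[of "\<nu> i"])
  show "?c (\<lambda>y. w y 0) \<le> ?c u0" using Y by (simp only: abs_minus_commute[of "\<nu> i"])
  have "continuous_on {0..T} (\<lambda>s. - (- g s))" by (rule continuous_on_minus[OF conjunct2[OF Y]])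
  then show "continuous_on {0..T} g" by simp
qed

lemma frozen_config_inequality:
  assumes c: "config n \<xi> \<nu>"
  shows "\<And>s1 s2. 0 \<le> s1 \<Longrightarrow> s1 \<le> s2 \<Longrightarrow> s2 \<le> T \<Longrightarrow>
       smoothed_dist n \<xi> \<nu> (\<lambda>y. w y s2) - smoothed_dist n \<xi> \<nu> (\<lambda>y. w y s1)
       \<le> integral {s1..s2} (\<lambda>s. - flux_pairing n \<xi> \<nu> (\<lambda>y. w y s))"
    and "smoothed_dist n \<xi> \<nu> (\<lambda>y. w y 0) \<le> smoothed_dist n \<xi> \<nu> u0"
    and "continuous_on {0..T} (\<lambda>s. flux_pairing n \<xi> \<nu> (\<lambda>y. w y s))"
proof -
  let ?g = "\<lambda>i s. LBINT y. kruzkov (\<nu> i) (w y s) * (omt n \<xi> y (Suc i) - omt n \<xi> y i)"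
  note F = frozen_cell_inequality[OF c]
  show "smoothed_dist n \<xi> \<nu> (\<lambda>y. w y s2) - smoothed_dist n \<xi> \<nu> (\<lambda>y. w y s1)
       \<le> integral {s1..s2} (\<lambda>s. - flux_pairing n \<xi> \<nu> (\<lambda>y. w y s))" if s: "0 \<le> s1" "s1 \<le> s2" "s2 \<le> T" for s1 s2
  proof -
    have int: "(\<lambda>s. - ?g i s) integrable_on {s1..s2}" if "i \<le> n" for i
      by (intro integrable_continuous_real continuous_on_minus continuous_on_subset[OF F(3)[OF that]]) (use s in auto)
    have "smoothed_dist n \<xi> \<nu> (\<lambda>y. w y s2) - smoothed_dist n \<xi> \<nu> (\<lambda>y. w y s1)
      \<le> (\<Sum>i\<le>n. integral {s1..s2} (\<lambda>s. - ?g i s))"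
      unfolding smoothed_dist_def sum_subtractf[symmetric] by (intro sum_mono F(1) s) auto
    also have "\<dots> = integral {s1..s2} (\<lambda>s. \<Sum>i\<le>n. - ?g i s)"
      by (rule Henstock_Kurzweil_Integration.integral_sum[symmetric]) (use int in auto)
    also have "(\<lambda>s. \<Sum>i\<le>n. - ?g i s) = (\<lambda>s. - flux_pairing n \<xi> \<nu> (\<lambda>y. w y s))"
      by (simp only: flux_pairing_def sum_negf)
    finally show ?thesis .
  qed
  show "smoothed_dist n \<xi> \<nu> (\<lambda>y. w y 0) \<le> smoothed_dist n \<xi> \<nu> u0"
    unfolding smoothed_dist_def by (intro sum_mono F(2)) auto
  show "continuous_on {0..T} (\<lambda>s. flux_pairing n \<xi> \<nu> (\<lambda>y. w y s))"
    unfolding flux_pairing_def by (intro continuous_on_sum F(3)) auto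
qed

end

section \<open>The flow between two collisions\<close>

lemma convergent_bounded:
  fixes x :: "nat \<Rightarrow> real"
  assumes "x \<longlonglongrightarrow> l" obtains K where "\<And>j. \<bar>x j\<bar> \<le> K" "\<bar>l\<bar> \<le> K"
proof -
  have "Bseq x" using assms convergent_imp_Bseq convergentI by blast
  then obtain K where K: "\<And>j. \<bar>x j\<bar> \<le> K" by (auto simp: Bseq_def)
  have "(\<lambda>j. \<bar>x j\<bar>) \<longlonglongrightarrow> \<bar>l\<bar>" by (rule tendsto_rabs[OF assms])
  then have "\<bar>l\<bar> \<le> K" by (rule LIMSEQ_le_const2) (use K in auto)
  with K that show ?thesis by blast
qed

lemma indicator_abs_integrable:
  fixes w :: "real \<Rightarrow> real"
  assumes "integrable lborel w"
  shows "integrable lborel (\<lambda>y. indicator {u..v} y * D + \<bar>w y\<bar>)"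
  using assms by (intro integrable_add integrable_mult_left integrable_abs)
    (auto simp: integrable_indicator_iff emeasure_lborel_Icc_eq)

context kernel
begin

text \<open>Dominated convergence without any ordering of the positions, so that cells may collapse
  in the limit. In the outer cells the densities are 0 throughout and \<open>w\<close> itself is the
  dominating function.\<close>

lemma cell_term_tendsto:
  assumes w: "integrable lborel w" and n: "1 \<le> n" and i: "i \<le> n" and x: "\<And>k. k \<in> {1..n} \<Longrightarrow> (\<lambda>j. xs j k) \<longlonglongrightarrow> \<xi> k"
    and d: "ds \<longlonglongrightarrow> d" and ends: "i \<notin> {1..<n} \<Longrightarrow> (\<forall>j. ds j = 0) \<and> d = 0"
  shows "(\<lambda>j. LBINT y. cell_weight n (xs j) i y * \<bar>ds j - w y\<bar>) \<longlonglongrightarrow> (LBINT y. cell_weight n \<xi> i y * \<bar>d - w y\<bar>)"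
proof -
  have [measurable]: "w \<in> borel_measurable borel" using w by auto
  have Wt_lim: "(\<lambda>j. Wt n (xs j) y k) \<longlonglongrightarrow> Wt n \<xi> y k" for y k
  proof (cases "k \<in> {1..n}")
    case True have "(\<lambda>j. W (xs j k - y)) \<longlonglongrightarrow> W (\<xi> k - y)"
      by (intro continuous_on_tendsto_compose[OF smooth_continuous[OF smooth_W, of UNIV]] tendsto_intros x True) auto
    with True show ?thesis by (auto simp: Wt_def)
  qed (auto simp: Wt_def)
  have pw: "(\<lambda>j. cell_weight n (xs j) i y * \<bar>ds j - w y\<bar>) \<longlonglongrightarrow> cell_weight n \<xi> i y * \<bar>d - w y\<bar>" for y
    unfolding cell_weight_def by (intro tendsto_intros Wt_lim d)
  have cb: "\<bar>cell_weight n \<zeta> i y\<bar> \<le> 1" for \<zeta> y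
    using W_nonneg W_le_1 W_diff_bound by (auto simp: cell_weight_def Wt_def)
  show ?thesis
  proof (cases "i \<in> {1..<n}")
    case False then have z: "ds j = 0" "d = 0" for j using ends by auto
    show ?thesis
    proof (rule integral_dominated_convergence[where w="\<lambda>y. \<bar>w y\<bar>"])
      show "AE y in lborel. norm (cell_weight n (xs j) i y * \<bar>ds j - w y\<bar>) \<le> \<bar>w y\<bar>" for j
        using cb by (auto simp: z abs_mult intro!: mult_left_le_one_le)
    qed (use w pw in auto)
  next
    case True
    obtain D where D: "\<And>j. \<bar>ds j\<bar> \<le> D" using convergent_bounded[OF d] by blast
    obtain K1 where K1: "\<And>j. \<bar>xs j i\<bar> \<le> K1" using convergent_bounded[OF x[of i]] True by auto
    obtain K2 where K2: "\<And>j. \<bar>xs j (Suc i)\<bar> \<le> K2" using convergent_bounded[OF x[of "Suc i"]] True by auto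
    define K where "K = max K1 K2 + r"
    show ?thesis
    proof (rule integral_dominated_convergence[where w="\<lambda>y. indicator {-K..K} y * D + \<bar>w y\<bar>"])
      show "integrable lborel (\<lambda>y. indicator {-K..K} y * D + \<bar>w y\<bar>)" by (rule indicator_abs_integrable[OF w])
      show "AE y in lborel. norm (cell_weight n (xs j) i y * \<bar>ds j - w y\<bar>) \<le> indicator {-K..K} y * D + \<bar>w y\<bar>" for j
      proof (rule AE_I2)
        fix y
        show "norm (cell_weight n (xs j) i y * \<bar>ds j - w y\<bar>) \<le> indicator {-K..K} y * D + \<bar>w y\<bar>"
        proof (cases "y \<in> {-K..K}")
          case yK: True
          have "\<bar>cell_weight n (xs j) i y\<bar> * \<bar>\<bar>ds j - w y\<bar>\<bar> \<le> 1 * (D + \<bar>w y\<bar>)"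
            by (rule mult_mono) (use cb D[of j] in auto)
          with yK show ?thesis by (simp add: abs_mult)
        next
          case yK: False
          have "y \<notin> {min (xs j (Suc i)) (xs j i) - r..max (xs j (Suc i)) (xs j i) + r}"
            using yK K1[of j] K2[of j] unfolding K_def by (auto simp: min_def max_def split: if_splits)
          then have "cell_weight n (xs j) i y = 0"
            using W_diff_supp[of y "xs j (Suc i)" "xs j i"] True by (auto simp: cell_weight_def Wt_def)
          then show ?thesis by (simp add: indicator_simps(2)[OF yK])
        qed
      qed
    qed (use pw in auto)
  qed
qed

end

lemma (in kernel_flux) flux_pairing_tendsto:
  assumes w: "integrable lborel w" and x: "\<And>k. k \<in> {1..n} \<Longrightarrow> (\<lambda>j. xs j k) \<longlonglongrightarrow> \<xi> k"
    and d: "\<And>i. i \<le> n \<Longrightarrow> (\<lambda>j. ds j i) \<longlonglongrightarrow> \<nu> i"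
  shows "(\<lambda>j. flux_pairing n (xs j) (ds j) w) \<longlonglongrightarrow> flux_pairing n \<xi> \<nu> w" unfolding flux_pairing_def
proof (rule tendsto_sum)
  fix i assume i: "i \<in> {..n}"
  have [measurable]: "w \<in> borel_measurable borel" using w by auto
  have om_lim: "(\<lambda>j. omt n (xs j) y k) \<longlonglongrightarrow> omt n \<xi> y k" for y k
  proof (cases "k \<in> {1..n}")
    case True have "(\<lambda>j. om (xs j k - y)) \<longlonglongrightarrow> om (\<xi> k - y)"
      by (intro continuous_on_tendsto_compose[OF smooth_continuous[OF smooth_om, of UNIV]] tendsto_intros x True) auto
    with True show ?thesis by (auto simp: omt_def)
  qed (auto simp: omt_def)
  have kr_lim: "(\<lambda>j. kruzkov (ds j i) z) \<longlonglongrightarrow> kruzkov (\<nu> i) z" for z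
  proof -
    have di: "(\<lambda>j. ds j i) \<longlonglongrightarrow> \<nu> i" using d i by auto
    have "(\<lambda>j. kruzkov (ds j i) z - kruzkov (\<nu> i) z) \<longlonglongrightarrow> 0"
    proof (rule Lim_null_comparison)
      show "eventually (\<lambda>j. norm (kruzkov (ds j i) z - kruzkov (\<nu> i) z) \<le> L * \<bar>ds j i - \<nu> i\<bar>) sequentially"
        using kruzkov_lip by (auto intro!: always_eventually)
      have "(\<lambda>j. L * \<bar>ds j i - \<nu> i\<bar>) \<longlonglongrightarrow> L * \<bar>\<nu> i - \<nu> i\<bar>" by (intro tendsto_intros di)
      then show "(\<lambda>j. L * \<bar>ds j i - \<nu> i\<bar>) \<longlonglongrightarrow> 0" by simp
    qed
    then show ?thesis by (rule LIM_zero_cancel)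
  qed
  obtain D where D: "\<And>j. \<bar>ds j i\<bar> \<le> D" using convergent_bounded[OF d[of i]] i by auto
  have "\<exists>K. \<forall>k\<in>{1..n}. \<forall>j. \<bar>xs j k\<bar> \<le> K"
  proof -
    have "\<forall>k\<in>{1..n}. \<exists>K. \<forall>j. \<bar>xs j k\<bar> \<le> K" using convergent_bounded[OF x] by metis
    then obtain KK where KK: "\<And>k j. k \<in> {1..n} \<Longrightarrow> \<bar>xs j k\<bar> \<le> KK k" by metis
    have "\<bar>xs j k\<bar> \<le> Max (KK ` {1..n})" if "k \<in> {1..n}" for k j
      using KK[OF that, of j] that by (meson Max_ge finite_atLeastAtMost finite_imageI imageI order_trans)
    then show ?thesis by blast
  qed
  then obtain K0 where K0: "\<And>k j. k \<in> {1..n} \<Longrightarrow> \<bar>xs j k\<bar> \<le> K0" by blast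
  define K where "K = K0 + r"
  have supp: "omt n (xs j) y k = 0" if "y \<notin> {-K..K}" for j y k
  proof (cases "k \<in> {1..n}")
    case True have "r \<le> \<bar>xs j k - y\<bar>" using K0[OF True, of j] that unfolding K_def by auto
    then show ?thesis using True by (simp add: omt_def om_outside)
  qed (auto simp: omt_def)
  show "(\<lambda>j. LBINT y. kruzkov (ds j i) (w y) * (omt n (xs j) y (Suc i) - omt n (xs j) y i))
     \<longlonglongrightarrow> (LBINT y. kruzkov (\<nu> i) (w y) * (omt n \<xi> y (Suc i) - omt n \<xi> y i))"
  proof (rule integral_dominated_convergence[where w="\<lambda>y. (L * (2 * om_max)) * (indicator {-K..K} y * D + \<bar>w y\<bar>)"])
    show "integrable lborel (\<lambda>y. (L * (2 * om_max)) * (indicator {-K..K} y * D + \<bar>w y\<bar>))"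
      by (intro integrable_mult_right indicator_abs_integrable[OF w])
    show "AE y in lborel. norm (kruzkov (ds j i) (w y) * (omt n (xs j) y (Suc i) - omt n (xs j) y i))
        \<le> (L * (2 * om_max)) * (indicator {-K..K} y * D + \<bar>w y\<bar>)" for j
    proof (rule AE_I2)
      fix y
      show "norm (kruzkov (ds j i) (w y) * (omt n (xs j) y (Suc i) - omt n (xs j) y i))
        \<le> (L * (2 * om_max)) * (indicator {-K..K} y * D + \<bar>w y\<bar>)"
      proof (cases "y \<in> {-K..K}")
        case True have "\<bar>kruzkov (ds j i) (w y)\<bar> \<le> L * (D + \<bar>w y\<bar>)"
        proof -
          have "\<bar>ds j i - w y\<bar> \<le> D + \<bar>w y\<bar>" using D[of j] by linarith
          from mult_left_mono[OF this L_nonneg] kruzkov_bound[of "ds j i" "w y"] show ?thesis by linarith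
        qed
        moreover have "\<bar>omt n (xs j) y (Suc i) - omt n (xs j) y i\<bar> \<le> 2 * om_max"
          using omt_bound[of n "xs j" y i] omt_bound[of n "xs j" y "Suc i"] by linarith
        ultimately have "\<bar>kruzkov (ds j i) (w y)\<bar> * \<bar>omt n (xs j) y (Suc i) - omt n (xs j) y i\<bar>
            \<le> (L * (D + \<bar>w y\<bar>)) * (2 * om_max)" using L_nonneg D[of j] by (rule_tac mult_mono) auto
        with True show ?thesis by (simp add: abs_mult mult_ac)
      next
        case False then show ?thesis using L_nonneg om_max(1) by (simp add: supp)
      qed
    qed
    show "AE y in lborel. (\<lambda>j. kruzkov (ds j i) (w y) * (omt n (xs j) y (Suc i) - omt n (xs j) y i))
       \<longlonglongrightarrow> kruzkov (\<nu> i) (w y) * (omt n \<xi> y (Suc i) - omt n \<xi> y i)" by (intro AE_I2 tendsto_intros kr_lim om_lim)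
  qed measurable
qed

section \<open>Bounds and continuity of the flux error\<close>

context flux
begin

lemma particle_vel_bound: "\<bar>particle_vel f \<nu> i\<bar> \<le> L" unfolding particle_vel_def by (rule Vel_bound)

lemma cell_field_bound:
  assumes "\<xi> i < \<xi> (Suc i)" "x \<in> {\<xi> i..\<xi> (Suc i)}"
  shows "\<bar>cell_field f \<xi> \<nu> i x\<bar> \<le> L"
proof -
  define g where "g = \<xi> (Suc i) - \<xi> i"
  define p where "p = (\<xi> (Suc i) - x) / g"
  define q where "q = (x - \<xi> i) / g"
  have g: "0 < g" using assms by (simp add: g_def)
  have pq: "0 \<le> p" "0 \<le> q" "p + q = 1" using assms g by (auto simp: p_def q_def g_def add_divide_distrib[symmetric])
  have "cell_field f \<xi> \<nu> i x = p * particle_vel f \<nu> i + q * particle_vel f \<nu> (Suc i)"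
    by (simp add: cell_field_def p_def q_def g_def)
  also have "\<bar>\<dots>\<bar> \<le> p * L + q * L"
    by (rule order_trans[OF abs_triangle_ineq])
       (intro add_mono; simp add: abs_mult pq mult_left_mono particle_vel_bound)
  also have "\<dots> = L" using pq by (simp add: distrib_right[symmetric])
  finally show ?thesis .
qed

lemma cell_error_bound:
  assumes "\<xi> i < \<xi> (Suc i)" "0 \<le> \<nu> i"
  shows "\<bar>cell_field f \<xi> \<nu> i x * \<nu> i - f (\<nu> i)\<bar> * indicator {\<xi> i..\<xi> (Suc i)} x
     \<le> 2 * L * \<nu> i * indicator {\<xi> i..\<xi> (Suc i)} x"
proof (cases "x \<in> {\<xi> i..\<xi> (Suc i)}")
  case True have "\<bar>cell_field f \<xi> \<nu> i x * \<nu> i\<bar> \<le> L * \<nu> i"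
    unfolding abs_mult using cell_field_bound[OF assms(1) True] assms(2) by (simp add: mult_right_mono)
  moreover have "\<bar>f (\<nu> i)\<bar> \<le> L * \<nu> i" using f_bound[of "\<nu> i"] assms(2) by simp
  ultimately have "\<bar>cell_field f \<xi> \<nu> i x * \<nu> i - f (\<nu> i)\<bar> \<le> 2 * L * \<nu> i" by linarith
  with True show ?thesis by simp
qed simp

text \<open>The field is a convex combination of velocities bounded by \<open>L\<close>, and
  \<open>\<bar>f v\<bar> \<le> L * \<bar>v\<bar>\<close>. The error is thus controlled by the total
  mass, which is constant during a stage.\<close>

lemma flux_error_integral_bound:
  assumes c: "config n \<xi> \<nu>"
  shows "(LBINT x. flux_error f n \<xi> \<nu> x) \<le> 2 * L * (\<Sum>i\<in>{1..<n}. \<nu> i * (\<xi> (Suc i) - \<xi> i))"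
proof -
  have "(LBINT x. flux_error f n \<xi> \<nu> x)
     = (\<Sum>i\<in>{1..<n}. (LBINT x. \<bar>cell_field f \<xi> \<nu> i x * \<nu> i - f (\<nu> i)\<bar> * indicator {\<xi> i..\<xi> (Suc i)} x))"
    unfolding flux_error_def by (intro integral_sum cell_error_integrable)
  also have "\<dots> \<le> (\<Sum>i\<in>{1..<n}. 2 * L * (\<nu> i * (\<xi> (Suc i) - \<xi> i)))"
  proof (rule sum_mono)
    fix i assume i: "i \<in> {1..<n}"
    have lt: "\<xi> i < \<xi> (Suc i)" "0 \<le> \<nu> i" using c i by (auto simp: config_def)
    have "(LBINT x. \<bar>cell_field f \<xi> \<nu> i x * \<nu> i - f (\<nu> i)\<bar> * indicator {\<xi> i..\<xi> (Suc i)} x)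
      \<le> (LBINT x. 2 * L * \<nu> i * indicator {\<xi> i..\<xi> (Suc i)} x)"
      by (intro integral_mono cell_error_integrable cell_error_bound[where \<nu>=\<nu>, OF lt])
         (simp add: integrable_indicator_iff emeasure_lborel_Icc_eq)
    also have "\<dots> = 2 * L * (\<nu> i * (\<xi> (Suc i) - \<xi> i))" using lt by simp
    finally show "(LBINT x. \<bar>cell_field f \<xi> \<nu> i x * \<nu> i - f (\<nu> i)\<bar> * indicator {\<xi> i..\<xi> (Suc i)} x)
      \<le> 2 * L * (\<nu> i * (\<xi> (Suc i) - \<xi> i))" .
  qed
  finally show ?thesis by (simp only: sum_distrib_left)
qed

lemma flux_error_nonneg: "0 \<le> flux_error f n \<xi> \<nu> x" unfolding flux_error_def by (intro sum_nonneg) auto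

lemma flux_error_integral_tendsto:
  assumes c: "config n \<xi> \<nu>" and cj: "\<And>j. config n (xs j) (ds j)" and x: "\<And>k. k \<in> {1..n} \<Longrightarrow> (\<lambda>j. xs j k) \<longlonglongrightarrow> \<xi> k"
    and d: "\<And>i. i \<le> n \<Longrightarrow> (\<lambda>j. ds j i) \<longlonglongrightarrow> \<nu> i"
    and v: "\<And>i. i \<in> {1..n} \<Longrightarrow> (\<lambda>j. particle_vel f (ds j) i) \<longlonglongrightarrow> particle_vel f \<nu> i"
  shows "(\<lambda>j. LBINT x. flux_error f n (xs j) (ds j) x) \<longlonglongrightarrow> (LBINT x. flux_error f n \<xi> \<nu> x)"
proof -
  let ?c = "\<lambda>\<xi> \<nu> i x. \<bar>cell_field f \<xi> \<nu> i x * \<nu> i - f (\<nu> i)\<bar> * indicator {\<xi> i..\<xi> (Suc i)} x"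
  have eq: "(LBINT x. flux_error f n \<xi> \<nu> x) = (\<Sum>i\<in>{1..<n}. (LBINT x. ?c \<xi> \<nu> i x))" for \<xi> \<nu>
    unfolding flux_error_def by (intro integral_sum cell_error_integrable)
  show ?thesis unfolding eq
  proof (rule tendsto_sum)
    fix i assume i: "i \<in> {1..<n}"
    have lt: "\<xi> i < \<xi> (Suc i)" "0 \<le> \<nu> i" using c i by (auto simp: config_def)
    have ltj: "xs j i < xs j (Suc i)" "0 \<le> ds j i" for j using cj[of j] i by (auto simp: config_def)
    have xi: "(\<lambda>j. xs j i) \<longlonglongrightarrow> \<xi> i" "(\<lambda>j. xs j (Suc i)) \<longlonglongrightarrow> \<xi> (Suc i)" using x i by auto
    have di: "(\<lambda>j. ds j i) \<longlonglongrightarrow> \<nu> i" using d i by auto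
    have vi: "(\<lambda>j. particle_vel f (ds j) i) \<longlonglongrightarrow> particle_vel f \<nu> i"
      "(\<lambda>j. particle_vel f (ds j) (Suc i)) \<longlonglongrightarrow> particle_vel f \<nu> (Suc i)" using v i by auto
    obtain D where D: "\<And>j. \<bar>ds j i\<bar> \<le> D" using convergent_bounded[OF di] by blast
    obtain K1 where K1: "\<And>j. \<bar>xs j i\<bar> \<le> K1" using convergent_bounded[OF xi(1)] by blast
    obtain K2 where K2: "\<And>j. \<bar>xs j (Suc i)\<bar> \<le> K2" using convergent_bounded[OF xi(2)] by blast
    show "(\<lambda>j. LBINT x. ?c (xs j) (ds j) i x) \<longlonglongrightarrow> (LBINT x. ?c \<xi> \<nu> i x)"
    proof (rule integral_dominated_convergence[where w="\<lambda>x. 2 * L * D * indicator {-K1..K2} x"])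
      show "integrable lborel (\<lambda>x. 2 * L * D * indicator {-K1..K2} x)"
        by (intro integrable_mult_right) (simp add: integrable_indicator_iff emeasure_lborel_Icc_eq)
      show "(\<lambda>x. ?c \<xi> \<nu> i x) \<in> borel_measurable lborel" using cell_error_integrable[of f \<xi> \<nu> i] by auto
      show "(\<lambda>x. ?c (xs j) (ds j) i x) \<in> borel_measurable lborel" for j
        using cell_error_integrable[of f "xs j" "ds j" i] by auto
      show "AE x in lborel. norm (?c (xs j) (ds j) i x) \<le> 2 * L * D * indicator {-K1..K2} x" for j
      proof (rule AE_I2)
        fix x
        have "norm (?c (xs j) (ds j) i x) \<le> 2 * L * ds j i * indicator {xs j i..xs j (Suc i)} x"
          using cell_error_bound[where \<xi>="xs j" and \<nu>="ds j" and i=i and x=x, OF ltj] by simp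
        also have "\<dots> \<le> 2 * L * D * indicator {-K1..K2} x"
        proof (cases "x \<in> {xs j i..xs j (Suc i)}")
          case True then have "x \<in> {-K1..K2}" using K1[of j] K2[of j] by auto
          moreover have "2 * L * ds j i \<le> 2 * L * D" using D[of j] L_nonneg by (intro mult_left_mono) auto
          ultimately show ?thesis using True by simp
        next
          case False have "0 \<le> D" using D[of 0] by linarith
          with False show ?thesis using L_nonneg by simp
        qed
        finally show "norm (?c (xs j) (ds j) i x) \<le> 2 * L * D * indicator {-K1..K2} x" .
      qed
      show "AE x in lborel. (\<lambda>j. ?c (xs j) (ds j) i x) \<longlonglongrightarrow> ?c \<xi> \<nu> i x"
        using AE_lborel_singleton[of "\<xi> i"] AE_lborel_singleton[of "\<xi> (Suc i)"]
      proof eventually_elim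
        case (elim x) have cf: "(\<lambda>j. cell_field f (xs j) (ds j) i x) \<longlonglongrightarrow> cell_field f \<xi> \<nu> i x"
          unfolding cell_field_def using lt by (intro tendsto_intros xi vi) auto
        have fc: "(\<lambda>j. f (ds j i)) \<longlonglongrightarrow> f (\<nu> i)" by (intro continuous_on_tendsto_compose[OF f_cont[of UNIV] di]) auto
        \<comment> \<open>Away from the endpoints of the limit cell, membership in the moving cell
          is eventually constant; the two endpoints form a null set.\<close>
        have ind: "(\<lambda>j. indicator {xs j i..xs j (Suc i)} x :: real) \<longlonglongrightarrow> indicator {\<xi> i..\<xi> (Suc i)} x"
        proof (rule tendsto_eventually)
          have "eventually (\<lambda>j. (xs j i < x) = (\<xi> i < x)) sequentially"
          proof (cases "\<xi> i < x")
            case True from order_tendstoD(2)[OF xi(1) True] show ?thesis using True by simp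
          next
            case False then have "x < \<xi> i" using elim by simp
            from order_tendstoD(1)[OF xi(1) this] show ?thesis by (rule eventually_mono) (use False in auto)
          qed
          moreover have "eventually (\<lambda>j. xs j i \<noteq> x) sequentially"
            using tendsto_imp_eventually_ne[OF xi(1)] elim by auto
          moreover have "eventually (\<lambda>j. (x < xs j (Suc i)) = (x < \<xi> (Suc i))) sequentially"
          proof (cases "x < \<xi> (Suc i)")
            case True from order_tendstoD(1)[OF xi(2) True] show ?thesis using True by simp
          next
            case False then have "\<xi> (Suc i) < x" using elim by simp
            from order_tendstoD(2)[OF xi(2) this] show ?thesis by (rule eventually_mono) (use False in auto)
          qed
          moreover have "eventually (\<lambda>j. xs j (Suc i) \<noteq> x) sequentially"
            using tendsto_imp_eventually_ne[OF xi(2)] elim by auto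
          ultimately show "eventually (\<lambda>j. indicator {xs j i..xs j (Suc i)} x = (indicator {\<xi> i..\<xi> (Suc i)} x :: real)) sequentially"
            by eventually_elim (use elim in \<open>auto simp: indicator_def\<close>)
        qed
        show ?case by (intro tendsto_intros cf di fc ind)
      qed
    qed
  qed
qed

end

section \<open>One stage of the flow and the variation of its densities\<close>

definition total_jump :: "nat \<Rightarrow> (nat \<Rightarrow> real) \<Rightarrow> real" where "total_jump n \<nu> = (\<Sum>i<n. \<bar>\<nu> (Suc i) - \<nu> i\<bar>)"

lemma total_jump_nonneg: "0 \<le> total_jump n \<nu>" unfolding total_jump_def by (intro sum_nonneg) auto

text \<open>Cell 0 is vacuum, so a density is a sum of jumps. This is the source of all upper bounds
  on densities.\<close>

lemma le_total_jump:
  assumes "\<nu> 0 = 0" "i \<le> n"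
  shows "\<nu> i \<le> total_jump n \<nu>"
proof -
  have "\<nu> i = (\<Sum>l<i. \<nu> (Suc l) - \<nu> l)" using assms by (simp add: sum_lessThan_telescope)
  also have "\<dots> \<le> (\<Sum>l<i. \<bar>\<nu> (Suc l) - \<nu> l\<bar>)" by (intro sum_mono) auto
  also have "\<dots> \<le> total_jump n \<nu>" unfolding total_jump_def using assms by (intro sum_mono2) auto
  finally show ?thesis .
qed

lemma sum_by_parts_shift:
  fixes s g :: "nat \<Rightarrow> real"
  shows "(\<Sum>i<n. s (Suc i) * (g (Suc i) - g i)) = s n * g n - s 0 * g 0 - (\<Sum>i<n. g i * (s (Suc i) - s i))"
  by (induction n) (auto simp: algebra_simps)

text \<open>A stage in consecutive numbering. Densities and gaps are controlled on
  \<open>{a..<b}\<close> only, because at \<open>b\<close> a gap may close, while positions are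
  continuous up to \<open>b\<close>.\<close>

locale stage_flow = flux f L for f :: "real \<Rightarrow> real" and L :: real +
  fixes n :: nat and \<xi> \<nu> :: "nat \<Rightarrow> real \<Rightarrow> real" and a b :: real
  assumes ab: "a < b" and conf: "\<And>t. t \<in> {a..<b} \<Longrightarrow> config n (\<lambda>i. \<xi> i t) (\<lambda>i. \<nu> i t)"
    and cont: "\<And>i. i \<in> {1..n} \<Longrightarrow> continuous_on {a..b} (\<xi> i)" and der: "\<And>i t. i \<in> {1..n} \<Longrightarrow> t \<in> {a<..<b} \<Longrightarrow>
        DERIV (\<xi> i) t :> particle_vel f (\<lambda>i. \<nu> i t) i"
    and vcont: "\<And>i. i \<in> {1..n} \<Longrightarrow> continuous_on {a<..<b} (\<lambda>t. particle_vel f (\<lambda>i. \<nu> i t) i)"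
    and dens: "\<And>i t. i \<in> {1..<n} \<Longrightarrow> t \<in> {a<..<b} \<Longrightarrow>
        \<nu> i t = (\<xi> (Suc i) a - \<xi> i a) / (\<xi> (Suc i) t - \<xi> i t) * \<nu> i a"
begin

lemma n_pos: "1 \<le> n" using conf[of a] ab by (simp add: config_def)

lemma gap_pos: "i \<in> {1..<n} \<Longrightarrow> t \<in> {a..<b} \<Longrightarrow> \<xi> i t < \<xi> (Suc i) t" using conf[of t] by (auto simp: config_def)

lemma dens_ends: "i \<le> n \<Longrightarrow> i \<notin> {1..<n} \<Longrightarrow> t \<in> {a..<b} \<Longrightarrow> \<nu> i t = 0" using config_ends[OF conf] by simp

lemma dens': "i \<in> {1..<n} \<Longrightarrow> t \<in> {a..<b} \<Longrightarrow>
    \<nu> i t = (\<xi> (Suc i) a - \<xi> i a) / (\<xi> (Suc i) t - \<xi> i t) * \<nu> i a"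
  using dens[of i t] gap_pos[of i a] ab by (cases "t = a") auto

lemma mass: "i \<in> {1..<n} \<Longrightarrow> t \<in> {a..<b} \<Longrightarrow> \<nu> i t * (\<xi> (Suc i) t - \<xi> i t) = \<nu> i a * (\<xi> (Suc i) a - \<xi> i a)"
  using dens'[of i t] gap_pos[of i t] by simp

lemma cont_dens: "i \<le> n \<Longrightarrow> continuous_on {a..<b} (\<nu> i)"
proof (cases "i \<in> {1..<n}")
  case True have "continuous_on {a..<b} (\<lambda>t. (\<xi> (Suc i) a - \<xi> i a) / (\<xi> (Suc i) t - \<xi> i t) * \<nu> i a)"
  proof (intro continuous_intros continuous_on_subset[OF cont])
    show "\<forall>t\<in>{a..<b}. \<xi> (Suc i) t - \<xi> i t \<noteq> 0" using gap_pos[OF True] by fastforce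
  qed (use True in auto)
  then show ?thesis by (rule continuous_on_eq) (rule dens'[OF True, symmetric])
next
  case False
  assume "i \<le> n"
  then show ?thesis by (intro continuous_on_eq[OF continuous_on_const[of _ 0]]) (simp add: dens_ends[OF _ False])
qed

lemma dens_deriv:
  assumes i: "i \<in> {1..<n}" and t: "t \<in> {a<..<b}"
  shows "DERIV (\<nu> i) t :> density_rate f n (\<lambda>i. \<xi> i t) (\<lambda>i. \<nu> i t) i"
proof -
  define m where "m = (\<xi> (Suc i) a - \<xi> i a) * \<nu> i a"
  have g: "0 < \<xi> (Suc i) t - \<xi> i t" using gap_pos[OF i, of t] t by simp
  have "DERIV (\<lambda>t. m / (\<xi> (Suc i) t - \<xi> i t)) t :> density_rate f n (\<lambda>i. \<xi> i t) (\<lambda>i. \<nu> i t) i"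
  proof -
    have d: "((\<lambda>t. \<xi> (Suc i) t - \<xi> i t) has_real_derivative
        particle_vel f (\<lambda>i. \<nu> i t) (Suc i) - particle_vel f (\<lambda>i. \<nu> i t) i) (at t)"
      using i t by (intro DERIV_diff der) auto
    have "((\<lambda>t. m / (\<xi> (Suc i) t - \<xi> i t)) has_real_derivative
      (0 * (\<xi> (Suc i) t - \<xi> i t) - m * (particle_vel f (\<lambda>i. \<nu> i t) (Suc i) - particle_vel f (\<lambda>i. \<nu> i t) i))
       / ((\<xi> (Suc i) t - \<xi> i t) * (\<xi> (Suc i) t - \<xi> i t))) (at t)"
      by (rule DERIV_divide[OF DERIV_const d]) (use g in simp)
    moreover have "density_rate f n (\<lambda>i. \<xi> i t) (\<lambda>i. \<nu> i t) i
      = (0 * (\<xi> (Suc i) t - \<xi> i t) - m * (particle_vel f (\<lambda>i. \<nu> i t) (Suc i) - particle_vel f (\<lambda>i. \<nu> i t) i))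
       / ((\<xi> (Suc i) t - \<xi> i t) * (\<xi> (Suc i) t - \<xi> i t))"
    proof -
      have "\<nu> i t = m / (\<xi> (Suc i) t - \<xi> i t)" using dens[OF i t] by (simp add: m_def)
      then show ?thesis using i by (simp add: density_rate_def)
    qed
    ultimately show ?thesis by simp
  qed
  then show ?thesis
    by (rule has_field_derivative_transform_within_open[of _ _ _ "{a<..<b}"])
       (use t dens[OF i] in \<open>auto simp: m_def\<close>)
qed

lemma eventually_stage: "t \<in> {a<..<b} \<Longrightarrow> eventually (\<lambda>s. s \<in> {a<..<t}) (at_left t)"
  using eventually_at_left_real[of a t] by simp

text \<open>A maximum principle: at a weak local maximum of the densities, \<open>Vel\<close> is at
  most \<open>vel f (\<nu> i)\<close> on the left of the cell and at least that on the right, so the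
  cell does not shrink and its density does not grow. At a local minimum the opposite holds, and on
  monotone stretches the sign terms cancel.\<close>

lemma total_jump_decreasing:
  assumes st: "a \<le> s" "s \<le> t" "t < b"
  shows "total_jump n (\<lambda>i. \<nu> i t) \<le> total_jump n (\<lambda>i. \<nu> i s)"
proof (rule left_dini_nonincreasing[where g="\<lambda>t. total_jump n (\<lambda>i. \<nu> i t)", OF st(2)])
  show "continuous_on {s..t} (\<lambda>t. total_jump n (\<lambda>i. \<nu> i t))"
    unfolding total_jump_def by (intro continuous_intros continuous_on_subset[OF cont_dens]) (use st in auto)
  fix \<tau> e :: real assume \<tau>: "s < \<tau>" "\<tau> \<le> t" and e: "0 < e"
  have \<tau>ab: "\<tau> \<in> {a<..<b}" using \<tau> st by auto
  define V where "V = particle_vel f (\<lambda>i. \<nu> i \<tau>)"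
  define d where "d = density_rate f n (\<lambda>i. \<xi> i \<tau>) (\<lambda>i. \<nu> i \<tau>)"
  \<comment> \<open>A subgradient of the modulus at the jump between the cells \<open>i - 1\<close>
    and \<open>i\<close>.\<close>
  define \<sigma> where "\<sigma> = (\<lambda>i. sgn (\<nu> i \<tau> - \<nu> (i - 1) \<tau>))"
  have c: "config n (\<lambda>i. \<xi> i \<tau>) (\<lambda>i. \<nu> i \<tau>)" using conf[of \<tau>] \<tau>ab by simp
  have dq: "((\<lambda>s. (\<nu> i \<tau> - \<nu> i s) / (\<tau> - s)) \<longlongrightarrow> d i) (at_left \<tau>)" if i: "i \<le> n" for i
  proof (cases "i \<in> {1..<n}")
    case True from DERIV_left_quotient[OF dens_deriv[OF True \<tau>ab]] show ?thesis by (simp add: d_def)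
  next
    case False have "d i = 0" using False by (auto simp: d_def density_rate_def)
    moreover have "eventually (\<lambda>s. (\<nu> i \<tau> - \<nu> i s) / (\<tau> - s) = 0) (at_left \<tau>)"
      by (rule eventually_mono[OF eventually_stage[OF \<tau>ab]]) (use dens_ends[OF i False] \<tau>ab in auto)
    ultimately show ?thesis by (simp add: tendsto_eventually)
  qed
  define U where "U = (\<lambda>s. \<Sum>i<n. \<sigma> (Suc i) * ((\<nu> (Suc i) \<tau> - \<nu> i \<tau>) - (\<nu> (Suc i) s - \<nu> i s)))"
  have le: "total_jump n (\<lambda>i. \<nu> i \<tau>) - total_jump n (\<lambda>i. \<nu> i s) \<le> U s" for s
  proof -
    have "\<bar>x\<bar> - \<bar>y\<bar> \<le> sgn x * (x - y)" for x y :: real by (auto simp: sgn_if)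
    then show ?thesis unfolding total_jump_def U_def sum_subtractf[symmetric] \<sigma>_def by (intro sum_mono) auto
  qed
  have "((\<lambda>s. \<Sum>i<n. \<sigma> (Suc i) * ((\<nu> (Suc i) \<tau> - \<nu> (Suc i) s) / (\<tau> - s) - (\<nu> i \<tau> - \<nu> i s) / (\<tau> - s)))
     \<longlongrightarrow> (\<Sum>i<n. \<sigma> (Suc i) * (d (Suc i) - d i))) (at_left \<tau>)"
    by (intro tendsto_sum tendsto_mult tendsto_diff dq tendsto_const) auto
  moreover have "(\<lambda>s. \<Sum>i<n. \<sigma> (Suc i) * ((\<nu> (Suc i) \<tau> - \<nu> (Suc i) s) / (\<tau> - s) - (\<nu> i \<tau> - \<nu> i s) / (\<tau> - s)))
     = (\<lambda>s. U s / (\<tau> - s))" unfolding U_def sum_divide_distrib diff_divide_distrib[symmetric]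
    by (intro ext sum.cong refl) (simp add: algebra_simps)
  ultimately have lim: "((\<lambda>s. U s / (\<tau> - s)) \<longlongrightarrow> (\<Sum>i<n. \<sigma> (Suc i) * (d (Suc i) - d i))) (at_left \<tau>)" by simp
  have d0: "d 0 = 0" "d n = 0" by (auto simp: d_def density_rate_def)
  have "(\<Sum>i<n. \<sigma> (Suc i) * (d (Suc i) - d i)) = - (\<Sum>i<n. d i * (\<sigma> (Suc i) - \<sigma> i))"
    unfolding sum_by_parts_shift by (simp add: d0)
  also have "\<dots> \<le> 0"
  proof -
    have "0 \<le> (\<Sum>i<n. d i * (\<sigma> (Suc i) - \<sigma> i))"
    proof (rule sum_nonneg)
      fix i assume "i \<in> {..<n}"
      show "0 \<le> d i * (\<sigma> (Suc i) - \<sigma> i)"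
      proof (cases "i \<in> {1..<n}")
        case True
        let ?l = "\<nu> (i - 1) \<tau>" and ?m = "\<nu> i \<tau>" and ?r = "\<nu> (Suc i) \<tau>"
        have V: "V i = Vel f ?l ?m" "V (Suc i) = Vel f ?m ?r" by (auto simp: V_def particle_vel_def)
        have g: "0 < \<xi> (Suc i) \<tau> - \<xi> i \<tau>" "0 \<le> ?m" using c True by (auto simp: config_def)
        have deq: "d i = (- ?m / (\<xi> (Suc i) \<tau> - \<xi> i \<tau>)) * (V (Suc i) - V i)"
          using True by (simp add: d_def density_rate_def V_def)
        have neg: "- ?m / (\<xi> (Suc i) \<tau> - \<xi> i \<tau>) \<le> 0" using g by (simp add: divide_nonpos_pos)
        \<comment> \<open>Equal signs belong to a monotone stretch, a decrease of the sign to a weak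
          local maximum, an increase to a weak local minimum.\<close>
        have "(\<sigma> (Suc i) - \<sigma> i = 0) \<or> (\<sigma> (Suc i) - \<sigma> i \<le> 0 \<and> ?l \<le> ?m \<and> ?r \<le> ?m)
            \<or> (0 \<le> \<sigma> (Suc i) - \<sigma> i \<and> ?m \<le> ?l \<and> ?m \<le> ?r)" by (auto simp: \<sigma>_def sgn_if)
        then consider "\<sigma> (Suc i) - \<sigma> i = 0" | "\<sigma> (Suc i) - \<sigma> i \<le> 0" "?l \<le> ?m" "?r \<le> ?m"
            | "0 \<le> \<sigma> (Suc i) - \<sigma> i" "?m \<le> ?l" "?m \<le> ?r" by blast
        then show ?thesis
        proof cases
          case 1 then show ?thesis by simp
        next
          case 2
          have "V i \<le> V (Suc i)" unfolding V using Vel_le[OF 2(2) order_refl] Vel_ge[OF 2(3) order_refl] by linarith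
          then have "d i \<le> 0" unfolding deq by (intro mult_nonpos_nonneg neg) simp
          then show ?thesis using 2(1) by (rule mult_nonpos_nonpos)
        next
          case 3
          have "V (Suc i) \<le> V i" unfolding V using Vel_ge[OF order_refl 3(2)] Vel_le[OF order_refl 3(3)] by linarith
          then have "0 \<le> d i" unfolding deq by (intro mult_nonpos_nonpos neg) simp
          then show ?thesis using 3(1) by (rule mult_nonneg_nonneg)
        qed
      next
        case False then have "d i = 0" by (auto simp: d_def density_rate_def)
        then show ?thesis by simp
      qed
    qed
    then show ?thesis by simp
  qed
  finally have "(\<Sum>i<n. \<sigma> (Suc i) * (d (Suc i) - d i)) < e" using e by simp
  from order_tendstoD(2)[OF lim this] eventually_stage[OF \<tau>ab]
  show "eventually (\<lambda>s. total_jump n (\<lambda>i. \<nu> i \<tau>) - total_jump n (\<lambda>i. \<nu> i s) \<le> e * (\<tau> - s)) (at_left \<tau>)"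
  proof eventually_elim
    case (elim s) have "U s \<le> e * (\<tau> - s)" using elim by (simp add: divide_simps)
    with le[of s] show ?case by linarith
  qed
qed

definition stage_error :: "real \<Rightarrow> real" where "stage_error t = (LBINT x. flux_error f n (\<lambda>i. \<xi> i t) (\<lambda>i. \<nu> i t) x)"

lemma stage_error_nonneg: "0 \<le> stage_error t"
  unfolding stage_error_def by (intro integral_nonneg flux_error_nonneg)

lemma stage_error_bound:
  assumes "t \<in> {a..<b}"
  shows "stage_error t \<le> 2 * L * (\<Sum>i\<in>{1..<n}. \<nu> i a * (\<xi> (Suc i) a - \<xi> i a))"
proof -
  have "stage_error t \<le> 2 * L * (\<Sum>i\<in>{1..<n}. \<nu> i t * (\<xi> (Suc i) t - \<xi> i t))"
    unfolding stage_error_def by (rule flux_error_integral_bound[OF conf[OF assms]])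
  also have "(\<Sum>i\<in>{1..<n}. \<nu> i t * (\<xi> (Suc i) t - \<xi> i t)) = (\<Sum>i\<in>{1..<n}. \<nu> i a * (\<xi> (Suc i) a - \<xi> i a))"
    by (intro sum.cong refl mass assms) auto
  finally show ?thesis .
qed

lemma stage_seq:
  assumes "x \<longlonglongrightarrow> t" "\<And>j. x j \<in> {a..<b}" "t \<in> {a..<b}"
  shows "k \<in> {1..n} \<Longrightarrow> (\<lambda>j. \<xi> k (x j)) \<longlonglongrightarrow> \<xi> k t" and "i \<le> n \<Longrightarrow> (\<lambda>j. \<nu> i (x j)) \<longlonglongrightarrow> \<nu> i t"
proof -
  show "(\<lambda>j. \<xi> k (x j)) \<longlonglongrightarrow> \<xi> k t" if "k \<in> {1..n}"
    by (rule continuous_on_tendsto_compose[OF cont[OF that] assms(1)])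
       (use assms in \<open>auto intro!: always_eventually less_imp_le\<close>)
  show "(\<lambda>j. \<nu> i (x j)) \<longlonglongrightarrow> \<nu> i t" if "i \<le> n"
    by (rule continuous_on_tendsto_compose[OF cont_dens[OF that] assms(1)])
       (use assms in \<open>auto intro!: always_eventually\<close>)
qed

lemma stage_error_continuous: "continuous_on {a<..<b} stage_error" unfolding continuous_on_sequentially
proof (intro ballI allI impI, elim conjE)
  fix t x assume t: "t \<in> {a<..<b}" and x: "\<forall>j. x j \<in> {a<..<b}" "x \<longlonglongrightarrow> t"
  have x': "x j \<in> {a..<b}" for j using x(1)[rule_format, of j] by auto
  have t': "t \<in> {a..<b}" using t by auto
  show "(stage_error \<circ> x) \<longlonglongrightarrow> stage_error t" unfolding stage_error_def o_def
  proof (rule flux_error_integral_tendsto)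
    show "(\<lambda>j. particle_vel f (\<lambda>i. \<nu> i (x j)) i) \<longlonglongrightarrow> particle_vel f (\<lambda>i. \<nu> i t) i" if "i \<in> {1..n}" for i
      by (rule continuous_on_tendsto_compose[OF vcont[OF that] x(2) t]) (use x in simp)
  qed (use conf t' x' stage_seq[OF x(2) x' t'] in auto)
qed

lemma stage_error_integrable: "set_integrable lborel {a<..<b} stage_error" unfolding set_integrable_def
proof (rule integrable_bound)
  define M where "M = 2 * L * (\<Sum>i\<in>{1..<n}. \<nu> i a * (\<xi> (Suc i) a - \<xi> i a))"
  show "integrable lborel (\<lambda>t. M * indicator {a..b} t)"
    by (intro integrable_mult_right) (simp add: integrable_indicator_iff emeasure_lborel_Icc_eq)
  show "(\<lambda>t. indicator {a<..<b} t *\<^sub>R stage_error t) \<in> borel_measurable lborel"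
    using borel_measurable_continuous_on_indicator[OF _ stage_error_continuous] by simp
  show "AE t in lborel. norm (indicator {a<..<b} t *\<^sub>R stage_error t) \<le> norm (M * indicator {a..b} t)"
  proof (rule AE_I2)
    fix t
    show "norm (indicator {a<..<b} t *\<^sub>R stage_error t) \<le> norm (M * indicator {a..b} t)"
    proof (cases "t \<in> {a<..<b}")
      case True then have "stage_error t \<le> M" unfolding M_def by (intro stage_error_bound) auto
      with True stage_error_nonneg[of t] show ?thesis by simp
    qed simp
  qed
qed

end

section \<open>Growth of the smoothed distance\<close>

lemma (in entropy_data) L1_dist_continuous:
  assumes t: "t \<in> {0..T}"
  shows "continuous_on {0..T} (\<lambda>s. LBINT y. \<bar>w y s - w y t\<bar>)"
proof (rule L1_continuous_functional[where C=1])
  fix s s' assume s: "s \<in> {0..T}" "s' \<in> {0..T}"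
  note I = w_int[OF s(1)] w_int[OF s(2)] w_int[OF t]
  have eq: "(LBINT y. \<bar>w y s - w y t\<bar>) - (LBINT y. \<bar>w y s' - w y t\<bar>)
      = (LBINT y. \<bar>w y s - w y t\<bar> - \<bar>w y s' - w y t\<bar>)" using I by simp
  have "\<bar>LBINT y. \<bar>w y s - w y t\<bar> - \<bar>w y s' - w y t\<bar>\<bar> \<le> (LBINT y. \<bar>\<bar>w y s - w y t\<bar> - \<bar>w y s' - w y t\<bar>\<bar>)"
    using integral_norm_bound[of lborel "\<lambda>y. \<bar>w y s - w y t\<bar> - \<bar>w y s' - w y t\<bar>"] by simp
  also have "\<dots> \<le> (LBINT y. \<bar>w y s - w y s'\<bar>)" using I by (intro integral_mono) auto
  finally show "\<bar>(LBINT y. \<bar>w y s - w y t\<bar>) - (LBINT y. \<bar>w y s' - w y t\<bar>)\<bar> \<le> 1 * (LBINT y. \<bar>w y s - w y s'\<bar>)"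
    unfolding eq by simp
qed

locale stage_comparison = comparison W om om' r f L u0 T u w + stage_flow f L n \<xi> \<nu> a b
  for W om om' r f L u0 T u w n \<xi> \<nu> a b +
  assumes a_nonneg: "0 \<le> a" and b_le_T: "b \<le> T"
begin

abbreviation sd :: "real \<Rightarrow> (real \<Rightarrow> real) \<Rightarrow> real" where "sd t v \<equiv> smoothed_dist n (\<lambda>i. \<xi> i t) (\<lambda>i. \<nu> i t) v"

abbreviation fp :: "real \<Rightarrow> (real \<Rightarrow> real) \<Rightarrow> real" where "fp t v \<equiv> flux_pairing n (\<lambda>i. \<xi> i t) (\<lambda>i. \<nu> i t) v"

definition Phi :: "real \<Rightarrow> real" where "Phi t = sd t (\<lambda>y. w y t)"

definition om'_norm :: real where "om'_norm = (LBINT z. \<bar>om' z\<bar>)"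

lemma om'_norm_nonneg: "0 \<le> om'_norm" unfolding om'_norm_def by simp

lemma time_sub: "t \<in> {a..<b} \<Longrightarrow> t \<in> {0..T}" using a_nonneg b_le_T by auto

lemma sd_tendsto:
  assumes v: "integrable lborel v" and x: "x \<longlonglongrightarrow> t" "\<And>j. x j \<in> {a..<b}" "t \<in> {a..<b}"
  shows "(\<lambda>j. sd (x j) v) \<longlonglongrightarrow> sd t v" unfolding smoothed_dist_def
proof (rule tendsto_sum)
  fix i assume i: "i \<in> {..n}"
  show "(\<lambda>j. LBINT y. cell_weight n (\<lambda>i. \<xi> i (x j)) i y * \<bar>\<nu> i (x j) - v y\<bar>)
     \<longlonglongrightarrow> (LBINT y. cell_weight n (\<lambda>i. \<xi> i t) i y * \<bar>\<nu> i t - v y\<bar>)"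
    by (rule cell_term_tendsto[OF v n_pos _ stage_seq(1)[OF x] stage_seq(2)[OF x]]) (use i dens_ends x in auto)
qed

lemma fp_tendsto:
  assumes v: "integrable lborel v" and x: "x \<longlonglongrightarrow> t" "\<And>j. x j \<in> {a..<b}" "t \<in> {a..<b}"
  shows "(\<lambda>j. fp (x j) v) \<longlonglongrightarrow> fp t v" by (rule flux_pairing_tendsto[OF v stage_seq(1)[OF x] stage_seq(2)[OF x]])

text \<open>Two continuities are combined: that of \<open>w\<close> into L^1, uniformly in the
  configuration by \<open>smoothed_dist_lipschitz\<close>, and that of the configuration for fixed
  \<open>w\<close>.\<close>

lemma Phi_continuous: "continuous_on {a..<b} Phi" unfolding continuous_on_sequentially
proof (intro ballI allI impI, elim conjE)
  fix t x assume t: "t \<in> {a..<b}" and x: "\<forall>j. x j \<in> {a..<b}" "x \<longlonglongrightarrow> t"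
  have x': "x j \<in> {a..<b}" for j using x(1) by blast
  note tT = time_sub[OF t]
  have "(\<lambda>j. LBINT y. \<bar>w y (x j) - w y t\<bar>) \<longlonglongrightarrow> (LBINT y. \<bar>w y t - w y t\<bar>)"
    by (rule continuous_on_tendsto_compose[OF L1_dist_continuous[OF tT] x(2) tT]) (use time_sub x' in auto)
  then have l1: "(\<lambda>j. LBINT y. \<bar>w y (x j) - w y t\<bar>) \<longlonglongrightarrow> 0" by simp
  have "(\<lambda>j. sd (x j) (\<lambda>y. w y (x j)) - sd (x j) (\<lambda>y. w y t)) \<longlonglongrightarrow> 0"
  proof (rule Lim_null_comparison[OF _ l1])
    show "eventually (\<lambda>j. norm (sd (x j) (\<lambda>y. w y (x j)) - sd (x j) (\<lambda>y. w y t))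
        \<le> (LBINT y. \<bar>w y (x j) - w y t\<bar>)) sequentially"
      using smoothed_dist_lipschitz[OF conf[OF x'] w_int[OF time_sub[OF x']] w_int[OF tT]]
      by (intro always_eventually) simp
  qed
  from tendsto_add[OF this sd_tendsto[OF w_int[OF tT] x(2) x' t]]
  show "(Phi \<circ> x) \<longlonglongrightarrow> Phi t" by (simp add: Phi_def o_def)
qed

text \<open>The intermediate state has the particles at time \<open>s\<close> and \<open>w\<close>
  at time \<open>t\<close>. Moving the particles yields \<open>fp t\<close> at \<open>w\<close> of
  time \<open>t\<close>; the evolution of \<open>w\<close> with particles frozen at \<open>s\<close>
  yields the integral of minus \<open>fp s\<close>. By continuity of \<open>fp\<close> in both
  arguments these cancel up to an arbitrarily small rate.\<close>

lemma Phi_left_rate: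
  assumes t: "t \<in> {a<..<b}" and e: "0 < e"
  shows "eventually (\<lambda>s. Phi t - Phi s \<le> (t - s) * (om'_norm * stage_error t + e)) (at_left t)"
proof -
  have t': "t \<in> {a..<b}" using t by auto
  note tT = time_sub[OF t']
  \<comment> \<open>One third for the moving particles, two thirds for exchanging both arguments of
    the flux pairing.\<close>
  define d where "d = e / 3"
  have d: "0 < d" using e by (simp add: d_def)
  define C where "C = real (Suc n) * (2 * om_max * L)"
  have A: "eventually (\<lambda>s. sd t (\<lambda>y. w y t) - sd s (\<lambda>y. w y t)
     \<le> (t - s) * (fp t (\<lambda>y. w y t) + om'_norm * stage_error t + d)) (at_left t)"
    unfolding om'_norm_def stage_error_def
  proof (rule smoothed_dist_left_rate)
    show "eventually (\<lambda>s. config n (\<lambda>i. \<xi> i s) (\<lambda>i. \<nu> i s)) (at_left t)"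
      by (rule eventually_mono[OF eventually_stage[OF t]]) (use t in \<open>auto intro!: conf\<close>)
  qed (use t t' d conf der dens_deriv w_int[OF tT] in auto)
  have fpl: "((\<lambda>s. fp s (\<lambda>y. w y t)) \<longlongrightarrow> fp t (\<lambda>y. w y t)) (at t within {a..<b})"
    unfolding tendsto_at_iff_sequentially using fp_tendsto[OF w_int[OF tT] _ _ t'] by (auto simp: o_def)
  have at_left_sub: "at_left t = at t within {a..<t}" using t by (intro at_within_nhd[of _ "{a<..}"]) auto
  have le: "at_left t \<le> at t within {a..<b}" unfolding at_left_sub by (rule at_le) (use t in auto)
  have B1: "eventually (\<lambda>s. dist (fp s (\<lambda>y. w y t)) (fp t (\<lambda>y. w y t)) < d) (at_left t)"
    using tendstoD[OF tendsto_mono[OF le fpl] d] .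
  have "((\<lambda>s. C * (LBINT y. \<bar>w y s - w y t\<bar>)) \<longlongrightarrow> C * (LBINT y. \<bar>w y t - w y t\<bar>)) (at t within {0..T})"
    by (rule tendsto_mult[OF tendsto_const L1_dist_continuous[OF tT, unfolded continuous_on_def, rule_format, OF tT]])
  then have "((\<lambda>s. C * (LBINT y. \<bar>w y s - w y t\<bar>)) \<longlongrightarrow> 0) (at t within {0..T})" by simp
  from tendstoD[OF this d] obtain \<eta> where \<eta>: "0 < \<eta>"
    "\<And>s. s \<in> {0..T} \<Longrightarrow> s \<noteq> t \<Longrightarrow> dist s t < \<eta> \<Longrightarrow> \<bar>C * (LBINT y. \<bar>w y s - w y t\<bar>)\<bar> < d"
    unfolding eventually_at by (auto simp: dist_real_def)
  have B2: "eventually (\<lambda>s. t - \<eta> < s) (at_left t)"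
    using eventually_at_left_real[of "t - \<eta>" t] \<eta>(1) by (auto elim: eventually_mono)
  show ?thesis using A B1 B2 eventually_stage[OF t]
  proof eventually_elim
    case (elim s) have s: "s \<in> {a..<b}" "s < t" using elim(4) t by auto
    note cs = conf[OF s(1)]
    have fpb: "- fp s (\<lambda>y. w y \<sigma>) \<le> - fp t (\<lambda>y. w y t) + 2 * d" if \<sigma>: "\<sigma> \<in> {s..t}" for \<sigma>
    proof -
      have \<sigma>T: "\<sigma> \<in> {0..T}" using \<sigma> time_sub[OF s(1)] tT by auto
      have "\<bar>fp s (\<lambda>y. w y \<sigma>) - fp s (\<lambda>y. w y t)\<bar> \<le> C * (LBINT y. \<bar>w y \<sigma> - w y t\<bar>)"
        unfolding C_def by (rule flux_pairing_lipschitz[OF w_int[OF \<sigma>T] w_int[OF tT]])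
      moreover have "C * (LBINT y. \<bar>w y \<sigma> - w y t\<bar>) \<le> d"
      proof (cases "\<sigma> = t")
        case True then show ?thesis using d by simp
      next
        case False then show ?thesis using \<eta>(2)[OF \<sigma>T False] \<sigma> elim(3) by (auto simp: dist_real_def)
      qed
      ultimately show ?thesis using elim(2) by (auto simp: dist_real_def)
    qed
    have "sd s (\<lambda>y. w y t) - sd s (\<lambda>y. w y s) \<le> integral {s..t} (\<lambda>\<sigma>. - fp s (\<lambda>y. w y \<sigma>))"
      by (rule frozen_config_inequality(1)[OF cs]) (use time_sub[OF s(1)] tT s in auto)
    also have "\<dots> \<le> integral {s..t} (\<lambda>\<sigma>. - fp t (\<lambda>y. w y t) + 2 * d)"
    proof (rule integral_le)
      show "(\<lambda>\<sigma>. - fp s (\<lambda>y. w y \<sigma>)) integrable_on {s..t}" by (intro integrable_continuous_real continuous_on_minus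
            continuous_on_subset[OF frozen_config_inequality(3)[OF cs]]) (use time_sub[OF s(1)] tT in auto)
      show "(\<lambda>\<sigma>. - fp t (\<lambda>y. w y t) + 2 * d) integrable_on {s..t}" by (rule integrable_const_ivl)
    qed (use fpb in blast)
    also have "\<dots> = (t - s) * (- fp t (\<lambda>y. w y t) + 2 * d)" using s by simp
    finally have "Phi t - Phi s \<le> (t - s) * (fp t (\<lambda>y. w y t) + om'_norm * stage_error t + d)
        + (t - s) * (- fp t (\<lambda>y. w y t) + 2 * d)" unfolding Phi_def using elim(1) by linarith
    also have "\<dots> = (t - s) * (om'_norm * stage_error t + e)"
    proof -
      have "e = 3 * d" by (simp add: d_def)
      then show ?thesis by (simp only:) (simp add: algebra_simps)
    qed
    finally show ?case .
  qed
qed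

text \<open>The error is continuous inside the stage, so its integral has it as derivative.
  Subtracting this integral leaves a function with nonpositive backward rates, to which
  \<open>left_dini_nonincreasing\<close> applies.\<close>

lemma Phi_growth:
  assumes st: "a < s" "s \<le> t" "t < b"
  shows "Phi t \<le> Phi s + om'_norm * integral {s..t} stage_error"
proof -
  let ?I = "\<lambda>x. integral {s..x} stage_error"
  have Ec: "continuous_on {s..t} stage_error"
    by (rule continuous_on_subset[OF stage_error_continuous]) (use st in auto)
  have "Phi t - om'_norm * ?I t \<le> Phi s - om'_norm * ?I s"
  proof (rule left_dini_nonincreasing[OF st(2)])
    show "continuous_on {s..t} (\<lambda>x. Phi x - om'_norm * ?I x)"
      by (intro continuous_intros indefinite_integral_continuous_1 integrable_continuous_real[OF Ec]
          continuous_on_subset[OF Phi_continuous]) (use st in auto)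
    fix x e :: real assume x: "s < x" "x \<le> t" and e: "0 < e"
    have xab: "x \<in> {a<..<b}" using x st by auto
    have dI: "(?I has_real_derivative stage_error x) (at x within {s..t})"
      using integral_has_real_derivative[OF Ec, of x] x by auto
    \<comment> \<open>Chosen so that the deviation of the quotient of the integral contributes at
      most \<open>e / 2\<close>; the 1 keeps the divisor positive.\<close>
    define d where "d = e / (2 * (om'_norm + 1))"
    have d: "0 < d" using e om'_norm_nonneg by (simp add: d_def)
    have "((\<lambda>y. (?I y - ?I x) / (y - x)) \<longlongrightarrow> stage_error x) (at x within {s..t})"
      using dI by (simp add: has_field_derivative_iff)
    moreover have "at_left x \<le> at x within {s..t}"
    proof -
      have "at_left x = at x within {s..<x}" using x by (intro at_within_nhd[of _ "{s<..}"]) auto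
      then show ?thesis using x by (auto intro!: at_le)
    qed
    ultimately have "((\<lambda>y. (?I y - ?I x) / (y - x)) \<longlongrightarrow> stage_error x) (at_left x)" using tendsto_mono by blast
    from order_tendstoD(1)[OF this, of "stage_error x - d"] d
    have 1: "eventually (\<lambda>y. stage_error x - d < (?I y - ?I x) / (y - x)) (at_left x)" by simp
    have e2: "0 < e / 2" using e by simp
    show "eventually (\<lambda>y. (Phi x - om'_norm * ?I x) - (Phi y - om'_norm * ?I y) \<le> e * (x - y)) (at_left x)"
      using 1 Phi_left_rate[OF xab e2] eventually_stage[OF xab]
    proof eventually_elim
      case (elim y) have yx: "y < x" using elim(3) by simp
      have "(x - y) * (stage_error x - d) \<le> ?I x - ?I y"
      proof -
        have "(?I y - ?I x) / (y - x) = (?I x - ?I y) / (x - y)" by (metis minus_diff_eq minus_divide_divide)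
        with elim(1) yx show ?thesis by (simp add: pos_less_divide_eq mult.commute)
      qed
      from mult_left_mono[OF this om'_norm_nonneg]
      have "om'_norm * ((x - y) * (stage_error x - d)) \<le> om'_norm * ?I x - om'_norm * ?I y"
        by (simp add: right_diff_distrib)
      moreover have "(x - y) * (om'_norm * stage_error x + e / 2) = om'_norm * ((x - y) * (stage_error x - d))
          + (x - y) * (om'_norm * d + e / 2)" by (simp add: algebra_simps)
      moreover have "(x - y) * (om'_norm * d + e / 2) \<le> (x - y) * e"
      proof (rule mult_left_mono)
        have "om'_norm * d \<le> (om'_norm + 1) * d" using d by simp
        also have "\<dots> = e / 2" using om'_norm_nonneg by (simp add: d_def field_simps)
        finally show "om'_norm * d + e / 2 \<le> e" by simp
      qed (use yx in simp)
      ultimately show ?case using elim(2) by (simp add: mult.commute)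
    qed
  qed
  then show ?thesis by simp
qed

text \<open>Continuity of the error is known in the open stage only, so the growth estimate starts
  at \<open>s > a\<close>, and then \<open>s\<close> is sent to \<open>a\<close>.\<close>

lemma stage_estimate:
  assumes t: "t \<in> {a<..<b}"
  shows "Phi t \<le> Phi a + om'_norm * (LBINT s:{a<..<b}. stage_error s)"
proof -
  let ?E = "LBINT s:{a<..<b}. stage_error s"
  have le: "integral {s..t} stage_error \<le> ?E" if s: "a < s" "s \<le> t" for s
  proof -
    have si: "set_integrable lborel {s..t} stage_error"
      by (rule set_integrable_subset[OF stage_error_integrable]) (use s t in auto)
    have "integral {s..t} stage_error = (LBINT s:{s..t}. stage_error s)"
      using set_borel_integral_eq_integral(2)[OF si] by simp
    also have "\<dots> \<le> ?E" unfolding set_lebesgue_integral_def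
    proof (rule integral_mono)
      show "indicator {s..t} x *\<^sub>R stage_error x \<le> indicator {a<..<b} x *\<^sub>R stage_error x" for x
        using s t stage_error_nonneg[of x] by (auto simp: indicator_def)
    qed (use si stage_error_integrable in \<open>auto simp: set_integrable_def\<close>)
    finally show ?thesis .
  qed
  have P: "Phi t - om'_norm * ?E \<le> Phi s" if s: "a < s" "s \<le> t" for s
    using Phi_growth[of s t] mult_left_mono[OF le[OF s] om'_norm_nonneg] s t by auto
  have "(Phi \<longlongrightarrow> Phi a) (at a within {a..<b})" using Phi_continuous ab by (auto simp: continuous_on_def)
  moreover have "at_right a \<le> at a within {a..<b}"
  proof -
    have "at_right a = at a within {a<..<b}" using ab by (intro at_within_nhd[of _ "{..<b}"]) auto
    then show ?thesis by (auto intro!: at_le)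
  qed
  ultimately have lim: "(Phi \<longlongrightarrow> Phi a) (at_right a)" using tendsto_mono by blast
  have "Phi t - om'_norm * ?E \<le> Phi a"
  proof (rule tendsto_lowerbound[OF lim])
    have "eventually (\<lambda>s. s \<in> {a<..<t}) (at_right a)" using eventually_at_right_real[of a t] t by simp
    then show "eventually (\<lambda>s. Phi t - om'_norm * ?E \<le> Phi s) (at_right a)"
      by (rule eventually_mono) (use P in auto)
  qed simp
  then show ?thesis by simp
qed

end

section \<open>Removing the smoothing\<close>

text \<open>The step function with values \<nu>, written as a superposition of Heaviside functions,
  so that smoothing can be estimated jump by jump.\<close>

definition jump_profile :: "nat \<Rightarrow> (nat \<Rightarrow> real) \<Rightarrow> (nat \<Rightarrow> real) \<Rightarrow> real \<Rightarrow> real" where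
  "jump_profile n \<xi> \<nu> y = (\<Sum>l<n. (\<nu> (Suc l) - \<nu> l) * of_bool (\<xi> (Suc l) < y))"

lemma jump_profile_integrable:
  assumes "\<nu> 0 = \<nu> n"
  shows "integrable lborel (jump_profile n \<xi> \<nu>)"
proof -
  define u where "u = Min (\<xi> ` {0..n})"
  define v where "v = Max (\<xi> ` {0..n})"
  have uv: "u \<le> \<xi> i" "\<xi> i \<le> v" if "i \<le> n" for i using that by (auto simp: u_def v_def)
  show ?thesis
  proof (rule integrable_compact_bounded[of _ u v "total_jump n \<nu>"])
    show "jump_profile n \<xi> \<nu> \<in> borel_measurable lborel" unfolding jump_profile_def by measurable
    show "jump_profile n \<xi> \<nu> y = 0" if y: "y \<notin> {u..v}" for y
    proof (cases "y < u")
      case True have "\<not> \<xi> (Suc l) < y" if "l < n" for l using uv(1)[of "Suc l"] True that by auto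
      then show ?thesis by (simp add: jump_profile_def)
    next
      case False have "\<xi> (Suc l) < y" if "l < n" for l using uv(2)[of "Suc l"] False y that by auto
      then have "jump_profile n \<xi> \<nu> y = (\<Sum>l<n. \<nu> (Suc l) - \<nu> l)" by (simp add: jump_profile_def)
      then show ?thesis using assms by (simp add: sum_lessThan_telescope)
    qed
    show "\<bar>jump_profile n \<xi> \<nu> y\<bar> \<le> total_jump n \<nu>" for y unfolding jump_profile_def total_jump_def
      by (rule order_trans[OF sum_abs]) (intro sum_mono, auto simp: abs_mult)
  qed
qed

context kernel
begin

lemma kernel_tail_integral:
  shows "integrable lborel (\<lambda>y. kernel_tail W (c - y))"
    and "(LBINT y. kernel_tail W (c - y)) = (LBINT z. kernel_tail W z)"
proof -
  have [measurable]: "kernel_tail W \<in> borel_measurable borel" unfolding kernel_tail_def by measurable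
  have k0: "integrable lborel (kernel_tail W)"
  proof (rule integrable_compact_bounded[of _ "-r" r 1])
    show "kernel_tail W x = 0" if "x \<notin> {-r..r}" for x
      using that r_pos by (auto simp: kernel_tail_def W_left W_right)
    show "\<bar>kernel_tail W x\<bar> \<le> 1" for x using W_nonneg[of x] W_le_1[of x] by (auto simp: kernel_tail_def)
  qed measurable
  show "integrable lborel (\<lambda>y. kernel_tail W (c - y))"
    "(LBINT y. kernel_tail W (c - y)) = (LBINT z. kernel_tail W z)"
    using lborel_integrable_real_affine[OF k0, of "-1" c] lborel_integral_real_affine[of "-1" "kernel_tail W" c] by auto
qed

lemma cell_weight_partial_sum: "(\<Sum>i\<le>l. cell_weight n \<xi> i y) = Wt n \<xi> y (Suc l)"
  by (induction l) (auto simp: cell_weight_def Wt_def)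

text \<open>Both \<open>\<nu> i\<close> and the profile at \<open>y\<close> are sums of jumps, and
  jump \<open>l\<close> enters only one of them exactly if cell \<open>i\<close> and
  \<open>y\<close> lie on different sides of particle \<open>Suc l\<close>. The weights of the cells
  on the wrong side add up to \<open>W\<close> or \<open>1 - W\<close> there, that is, to
  \<open>kernel_tail\<close>.\<close>

lemma smoothing_defect:
  assumes c: "config n \<xi> \<nu>" and y: "\<And>i. i \<in> {1..n} \<Longrightarrow> y \<noteq> \<xi> i"
  shows "(\<Sum>i\<le>n. cell_weight n \<xi> i y * \<bar>\<nu> i - jump_profile n \<xi> \<nu> y\<bar>)
    \<le> (\<Sum>l<n. \<bar>\<nu> (Suc l) - \<nu> l\<bar> * kernel_tail W (\<xi> (Suc l) - y))"
proof -
  let ?c = "\<lambda>l. \<nu> (Suc l) - \<nu> l"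
  let ?q = "\<lambda>i l. \<bar>of_bool (l < i) - of_bool (\<xi> (Suc l) < y) :: real\<bar>"
  have d: "\<nu> i = (\<Sum>l<n. ?c l * of_bool (l < i))" if "i \<le> n" for i
  proof -
    have "(\<Sum>l<n. ?c l * of_bool (l < i)) = (\<Sum>l\<in>{..<i}. ?c l)" using that by (intro sum.mono_neutral_cong_right) auto
    then show ?thesis using c by (simp add: sum_lessThan_telescope config_def)
  qed
  have "(\<Sum>i\<le>n. cell_weight n \<xi> i y * \<bar>\<nu> i - jump_profile n \<xi> \<nu> y\<bar>)
     \<le> (\<Sum>i\<le>n. cell_weight n \<xi> i y * (\<Sum>l<n. \<bar>?c l\<bar> * ?q i l))"
  proof (intro sum_mono mult_left_mono)
    fix i assume i: "i \<in> {..n}"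
    have "\<nu> i - jump_profile n \<xi> \<nu> y = (\<Sum>l<n. ?c l * (of_bool (l < i) - of_bool (\<xi> (Suc l) < y)))"
      unfolding jump_profile_def using i by (subst d) (auto simp: sum_subtractf right_diff_distrib)
    then show "\<bar>\<nu> i - jump_profile n \<xi> \<nu> y\<bar> \<le> (\<Sum>l<n. \<bar>?c l\<bar> * ?q i l)"
      by (simp only:) (rule order_trans[OF sum_abs], simp add: abs_mult)
    show "0 \<le> cell_weight n \<xi> i y" using cell_weight_nonneg[OF c] i by auto
  qed
  also have "\<dots> = (\<Sum>l<n. \<bar>?c l\<bar> * (\<Sum>i\<le>n. cell_weight n \<xi> i y * ?q i l))"
    unfolding sum_distrib_left by (subst sum.swap) (simp add: mult_ac)
  also have "\<dots> = (\<Sum>l<n. \<bar>?c l\<bar> * kernel_tail W (\<xi> (Suc l) - y))"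
  proof (rule sum.cong[OF refl])
    fix l assume l: "l \<in> {..<n}"
    have W: "Wt n \<xi> y (Suc l) = W (\<xi> (Suc l) - y)" using l by (simp add: Wt_def)
    have "(\<Sum>i\<le>n. cell_weight n \<xi> i y * ?q i l) = kernel_tail W (\<xi> (Suc l) - y)"
    proof (cases "\<xi> (Suc l) < y")
      case True have "(\<Sum>i\<le>n. cell_weight n \<xi> i y * ?q i l) = (\<Sum>i\<le>l. cell_weight n \<xi> i y)"
        using l True by (intro sum.mono_neutral_cong_right) auto
      then show ?thesis using True unfolding cell_weight_partial_sum W by (simp add: kernel_tail_def)
    next
      case False have "y \<noteq> \<xi> (Suc l)" using y l by simp
      with False have lt: "0 < \<xi> (Suc l) - y" by simp
      have "(\<Sum>i\<le>n. cell_weight n \<xi> i y * ?q i l) = (\<Sum>i\<le>n. cell_weight n \<xi> i y - (if i \<le> l then cell_weight n \<xi> i y else 0))"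
        using False by (intro sum.cong) auto
      also have "\<dots> = 1 - (\<Sum>i\<le>l. cell_weight n \<xi> i y)"
      proof -
        have "(\<Sum>i\<le>n. if i \<le> l then cell_weight n \<xi> i y else 0) = (\<Sum>i\<le>l. cell_weight n \<xi> i y)"
          using l by (intro sum.mono_neutral_cong_right) auto
        then show ?thesis by (simp add: sum_subtractf cell_weight_sum)
      qed
      finally show ?thesis using lt unfolding cell_weight_partial_sum W by (simp add: kernel_tail_def)
    qed
    then show "\<bar>?c l\<bar> * (\<Sum>i\<le>n. cell_weight n \<xi> i y * ?q i l) = \<bar>?c l\<bar> * kernel_tail W (\<xi> (Suc l) - y)" by simp
  qed
  finally show ?thesis .
qed

text \<open>The defect at \<open>y\<close> is at most a sum of translates of
  \<open>kernel_tail\<close>, one per jump, each with integral \<alpha>. Particle positions are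
  excluded as a null set.\<close>

lemma smoothed_dist_vs_L1:
  assumes c: "config n \<xi> \<nu>" and v: "integrable lborel v"
  defines "\<alpha> \<equiv> (LBINT z. kernel_tail W z)"
  shows "\<bar>smoothed_dist n \<xi> \<nu> v - (LBINT y. \<bar>jump_profile n \<xi> \<nu> y - v y\<bar>)\<bar> \<le> \<alpha> * total_jump n \<nu>"
proof -
  let ?V = "jump_profile n \<xi> \<nu>"
  let ?R = "\<lambda>y. \<Sum>l<n. \<bar>\<nu> (Suc l) - \<nu> l\<bar> * kernel_tail W (\<xi> (Suc l) - y)"
  let ?S = "\<lambda>y. \<Sum>i\<le>n. cell_weight n \<xi> i y * \<bar>\<nu> i - v y\<bar>"
  have Vi: "integrable lborel ?V" using c by (intro jump_profile_integrable) (auto simp: config_def)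
  note SI = smoothed_dist_integral[OF c v]
  have Ri: "integrable lborel ?R"
    by (intro integrable_sum integrable_mult_right kernel_tail_integral)
  have Rint: "(LBINT y. ?R y) = \<alpha> * total_jump n \<nu>"
    by (subst integral_sum) (auto intro!: integrable_mult_right kernel_tail_integral(1)
         simp: kernel_tail_integral(2) \<alpha>_def total_jump_def sum_distrib_left mult.commute)
  have ne: "AE y in lborel. \<forall>i\<in>{1..n}. y \<noteq> \<xi> i" by (rule AE_finite_allI) (auto intro: AE_lborel_singleton)
  have pw: "\<bar>?S y - \<bar>?V y - v y\<bar>\<bar> \<le> ?R y" if "\<forall>i\<in>{1..n}. y \<noteq> \<xi> i" for y
  proof -
    have "?S y - \<bar>?V y - v y\<bar> = (\<Sum>i\<le>n. cell_weight n \<xi> i y * (\<bar>\<nu> i - v y\<bar> - \<bar>?V y - v y\<bar>))"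
      unfolding right_diff_distrib sum_subtractf sum_distrib_right[symmetric] cell_weight_sum by simp
    then have "\<bar>?S y - \<bar>?V y - v y\<bar>\<bar> \<le> (\<Sum>i\<le>n. \<bar>cell_weight n \<xi> i y * (\<bar>\<nu> i - v y\<bar> - \<bar>?V y - v y\<bar>)\<bar>)"
      by (simp only:) (rule sum_abs)
    also have "\<dots> \<le> (\<Sum>i\<le>n. cell_weight n \<xi> i y * \<bar>\<nu> i - ?V y\<bar>)"
      by (intro sum_mono) (auto simp: abs_mult cell_weight_nonneg[OF c] intro!: mult_left_mono)
    also have "\<dots> \<le> ?R y" by (rule smoothing_defect[OF c]) (use that in auto)
    finally show ?thesis .
  qed
  have eq: "smoothed_dist n \<xi> \<nu> v - (LBINT y. \<bar>?V y - v y\<bar>) = (LBINT y. ?S y - \<bar>?V y - v y\<bar>)"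
    unfolding SI(1) using SI(2) Vi v by (intro integral_diff[symmetric]) auto
  have "\<bar>LBINT y. ?S y - \<bar>?V y - v y\<bar>\<bar> \<le> (LBINT y. \<bar>?S y - \<bar>?V y - v y\<bar>\<bar>)"
    using integral_norm_bound[of lborel "\<lambda>y. ?S y - \<bar>?V y - v y\<bar>"] by simp
  also have "\<dots> \<le> (LBINT y. ?R y)"
    by (rule integral_mono_AE) (use SI(2) Vi v Ri ne pw in \<open>auto elim!: eventually_mono\<close>)
  finally show ?thesis unfolding eq Rint .
qed

end

section \<open>Enumeration of the remaining particles\<close>

text \<open>Particle \<open>N\<close> is never deleted, since a collision removes all but the
  rightmost of the particles that meet.\<close>

definition valid_index :: "nat \<Rightarrow> nat set \<Rightarrow> bool" where "valid_index N S \<longleftrightarrow> S \<subseteq> {1..N} \<and> N \<in> S"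

lemma valid_index_finite: "valid_index N S \<Longrightarrow> finite S" unfolding valid_index_def using finite_subset by blast

lemma valid_index_card: "valid_index N S \<Longrightarrow> 1 \<le> card S"
  using valid_index_finite[of N S] by (auto simp: valid_index_def Suc_le_eq card_gt_0_iff)

lemma enum_0 [simp]: "enum N S 0 = 0" by (simp add: enum_def)

lemma enum_Suc_card [simp]: "enum N S (Suc (card S)) = Suc N" by (simp add: enum_def)

lemma enum_in:
  assumes "valid_index N S" "1 \<le> i" "i \<le> card S"
  shows "enum N S i \<in> S"
proof -
  have "i - 1 < length (sorted_list_of_set S)" using assms by simp
  from nth_mem[OF this] show ?thesis using assms valid_index_finite[OF assms(1)] by (simp add: enum_def)
qed

lemma enum_less:
  assumes v: "valid_index N S" and ij: "i < j" "j \<le> Suc (card S)"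
  shows "enum N S i < enum N S j"
proof -
  have S: "\<And>k. k \<in> S \<Longrightarrow> 1 \<le> k \<and> k \<le> N" using v by (auto simp: valid_index_def)
  consider "i = 0" "j = Suc (card S)" | "i = 0" "1 \<le> j" "j \<le> card S" | "1 \<le> i" "j = Suc (card S)"
    | "1 \<le> i" "j \<le> card S" using ij by linarith
  then show ?thesis
  proof cases
    case 2 then show ?thesis using S[OF enum_in[OF v 2(2,3)]] by simp
  next
    case 3 then show ?thesis using S[OF enum_in[OF v 3(1)]] ij by simp
  next
    case 4 have "sorted_list_of_set S ! (i - 1) < sorted_list_of_set S ! (j - 1)"
      by (rule sorted_wrt_nth_less[OF strict_sorted_list_of_set]) (use ij 4 in auto)
    then show ?thesis using 4 ij by (simp add: enum_def)
  qed simp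
qed

lemma enum_surj:
  assumes v: "valid_index N S" and k: "k \<in> S"
  obtains i where "1 \<le> i" "i \<le> card S" "enum N S i = k"
proof -
  have "k \<in> set (sorted_list_of_set S)" using k valid_index_finite[OF v] by simp
  then obtain j where j: "j < card S" "sorted_list_of_set S ! j = k" by (auto simp: in_set_conv_nth)
  then show ?thesis by (intro that[of "Suc j"]) (auto simp: enum_def)
qed

lemma enum_card:
  assumes v: "valid_index N S"
  shows "enum N S (card S) = N"
proof -
  obtain i where i: "1 \<le> i" "i \<le> card S" "enum N S i = N"
    using enum_surj[OF v, of N] v by (auto simp: valid_index_def)
  have "enum N S (card S) \<le> N"
    using enum_in[OF v valid_index_card[OF v] order_refl] v by (auto simp: valid_index_def)
  moreover have "enum N S i \<le> enum N S (card S)" using enum_less[OF v, of i "card S"] i by (cases "i = card S") auto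
  ultimately show ?thesis using i by simp
qed

lemma enum_successor:
  assumes v: "valid_index N S" and k: "k \<in> S" "enum N S i < k" and i: "i \<le> card S"
  shows "enum N S (Suc i) \<le> k"
proof -
  obtain j where j: "1 \<le> j" "j \<le> card S" "enum N S j = k" using enum_surj[OF v k(1)] by blast
  have "i < j"
  proof (rule ccontr)
    assume "\<not> i < j"
    then have "enum N S j \<le> enum N S i" using enum_less[OF v, of j i] i by (cases "i = j") auto
    with j k show False by simp
  qed
  then show ?thesis using enum_less[OF v, of "Suc i" j] j by (cases "Suc i = j") auto
qed

text \<open>The composition of two increasing enumerations is again increasing; hence the survivors
  of a stage can be described in the numbering of that stage.\<close>

lemma enum_image:
  assumes v: "valid_index N S" and vK: "valid_index (card S) K"
  shows "card (enum N S ` K) = card K" "i \<le> Suc (card K) \<Longrightarrow> enum N (enum N S ` K) i = enum N S (enum (card S) K i)"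
    "valid_index N (enum N S ` K)"
proof -
  have K: "\<And>k. k \<in> K \<Longrightarrow> 1 \<le> k \<and> k \<le> card S" using vK by (auto simp: valid_index_def)
  have mono: "enum N S k < enum N S l" if "k \<in> K" "l \<in> K" "k < l" for k l
    using enum_less[OF v that(3)] K[OF that(2)] by simp
  have inj: "inj_on (enum N S) K" by (rule inj_onI) (metis mono less_irrefl linorder_neqE_nat)
  show c: "card (enum N S ` K) = card K" by (rule card_image[OF inj])
  show "valid_index N (enum N S ` K)"
  proof -
    have "card S \<in> K" using vK by (simp add: valid_index_def)
    then have "N \<in> enum N S ` K" using enum_card[OF v] by (metis imageI)
    moreover have "enum N S ` K \<subseteq> {1..N}" using enum_in[OF v] K v by (fastforce simp: valid_index_def)
    ultimately show ?thesis by (simp add: valid_index_def)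
  qed
  have fK: "finite K" by (rule valid_index_finite[OF vK])
  have sl: "sorted_list_of_set (enum N S ` K) = map (enum N S) (sorted_list_of_set K)"
  proof (rule sorted_list_of_set.idem_if_sorted_distinct[of "map (enum N S) (sorted_list_of_set K)", simplified fK set_map set_sorted_list_of_set])
    show "sorted (map (enum N S) (sorted_list_of_set K))" unfolding sorted_map
      by (rule sorted_wrt_mono_rel[OF _ strict_sorted_list_of_set]) (use mono fK in \<open>auto intro: less_imp_le\<close>)
    show "distinct (map (enum N S) (sorted_list_of_set K))" using inj fK by (simp add: distinct_map)
  qed
  show "enum N (enum N S ` K) i = enum N S (enum (card S) K i)" if i: "i \<le> Suc (card K)"
  proof -
    consider "i = 0" | "1 \<le> i" "i \<le> card K" | "i = Suc (card K)" using i by linarith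
    then show ?thesis
    proof cases
      case 2 then have "enum N (enum N S ` K) i = enum N S (sorted_list_of_set K ! (i - 1))"
        using c sl by (simp add: enum_def)
      also have "sorted_list_of_set K ! (i - 1) = enum (card S) K i" using 2 by (simp add: enum_def)
      finally show ?thesis .
    next
      case 3 then have "enum (card S) K i = Suc (card S)" by simp
      moreover have "enum N (enum N S ` K) i = Suc N" unfolding 3 c[symmetric] by simp
      ultimately show ?thesis by simp
    qed simp
  qed
qed

text \<open>Triangle inequality between consecutive chosen indices; at a collision it says that
  deleting cells creates no variation.\<close>

lemma total_jump_subsequence:
  assumes \<kappa>: "\<And>i j. i < j \<Longrightarrow> j \<le> n' \<Longrightarrow> \<kappa> i < (\<kappa> j :: nat)" and n: "\<kappa> n' \<le> n"
  shows "total_jump n' (\<lambda>i. \<nu> (\<kappa> i)) \<le> total_jump n \<nu>"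
proof -
  have step: "\<bar>\<nu> l - \<nu> k\<bar> \<le> (\<Sum>i=k..<l. \<bar>\<nu> (Suc i) - \<nu> i\<bar>)" if "k \<le> l" for k l
  proof -
    have "\<nu> l - \<nu> k = (\<Sum>i=k..<l. \<nu> (Suc i) - \<nu> i)" using that by (simp add: sum_Suc_diff')
    then show ?thesis by (simp only:) (rule sum_abs)
  qed
  have "total_jump m (\<lambda>i. \<nu> (\<kappa> i)) \<le> (\<Sum>l<\<kappa> m. \<bar>\<nu> (Suc l) - \<nu> l\<bar>)" if "m \<le> n'" for m using that
  proof (induction m)
    case 0 then show ?case by (simp add: total_jump_def sum_nonneg)
  next
    case (Suc m) have lt: "\<kappa> m < \<kappa> (Suc m)" using \<kappa> Suc.prems by simp
    have "total_jump (Suc m) (\<lambda>i. \<nu> (\<kappa> i)) = total_jump m (\<lambda>i. \<nu> (\<kappa> i)) + \<bar>\<nu> (\<kappa> (Suc m)) - \<nu> (\<kappa> m)\<bar>"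
      by (simp add: total_jump_def)
    also have "\<dots> \<le> (\<Sum>l<\<kappa> m. \<bar>\<nu> (Suc l) - \<nu> l\<bar>) + (\<Sum>i=\<kappa> m..<\<kappa> (Suc m). \<bar>\<nu> (Suc i) - \<nu> i\<bar>)"
      using Suc lt by (intro add_mono step) auto
    also have "\<dots> = (\<Sum>l<\<kappa> (Suc m). \<bar>\<nu> (Suc l) - \<nu> l\<bar>)"
      unfolding lessThan_atLeast0 using lt by (intro sum.atLeastLessThan_concat) auto
    finally show ?case .
  qed
  from this[of n'] have "total_jump n' (\<lambda>i. \<nu> (\<kappa> i)) \<le> (\<Sum>l<\<kappa> n'. \<bar>\<nu> (Suc l) - \<nu> l\<bar>)" by simp
  also have "\<dots> \<le> total_jump n \<nu>" unfolding total_jump_def using n by (intro sum_mono2) auto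
  finally show ?thesis .
qed

section \<open>Passing through a collision\<close>

definition survivors :: "nat \<Rightarrow> (nat \<Rightarrow> real) \<Rightarrow> nat set" where "survivors n x = {i \<in> {1..n}. i = n \<or> x i \<noteq> x (Suc i)}"

lemma survivors_valid: "1 \<le> n \<Longrightarrow> valid_index n (survivors n x)" by (auto simp: survivors_def valid_index_def)

text \<open>A deleted particle sits at the position of its successor, so the coincidence propagates
  down from the next survivor. Hence a surviving cell keeps its right end although the particle
  there may be deleted.\<close>

lemma survivors_right_end:
  assumes n: "1 \<le> n" and i: "i < card (survivors n x)"
  defines "\<kappa> \<equiv> enum n (survivors n x)"
  shows "x (Suc (\<kappa> i)) = x (\<kappa> (Suc i))"
proof -
  note v = survivors_valid[OF n, of x]
  have lt: "\<kappa> i < \<kappa> (Suc i)" unfolding \<kappa>_def using enum_less[OF v, of i "Suc i"] i by simp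
  have le: "\<kappa> (Suc i) \<le> n" using enum_in[OF v, of "Suc i"] i by (auto simp: \<kappa>_def survivors_def)
  have "x k = x (\<kappa> (Suc i))" if "Suc (\<kappa> i) \<le> k" "k \<le> \<kappa> (Suc i)" for k using that(2,1)
  proof (induction k rule: inc_induct)
    case (step k) have "k \<notin> survivors n x" using enum_successor[OF v, of k i] step i unfolding \<kappa>_def by fastforce
    then have "x k = x (Suc k)" using step le by (auto simp: survivors_def)
    with step show ?case by simp
  qed simp
  from this[of "Suc (\<kappa> i)"] lt show ?thesis by simp
qed

lemma survivors_increasing:
  assumes n: "1 \<le> n" and mono: "\<And>i j. 1 \<le> i \<Longrightarrow> i \<le> j \<Longrightarrow> j \<le> n \<Longrightarrow> x i \<le> (x j :: real)"
    and i: "i \<in> {1..<card (survivors n x)}"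
  defines "\<kappa> \<equiv> enum n (survivors n x)"
  shows "x (\<kappa> i) < x (\<kappa> (Suc i))"
proof -
  note v = survivors_valid[OF n, of x]
  have K: "\<kappa> i \<in> survivors n x" unfolding \<kappa>_def using enum_in[OF v, of i] i by simp
  have lt: "\<kappa> i < \<kappa> (Suc i)" unfolding \<kappa>_def using enum_less[OF v, of i "Suc i"] i by simp
  have le: "\<kappa> (Suc i) \<le> n" using enum_in[OF v, of "Suc i"] i by (auto simp: \<kappa>_def survivors_def)
  have "x (\<kappa> i) \<noteq> x (Suc (\<kappa> i))" using K lt le by (auto simp: survivors_def)
  moreover have "x (\<kappa> i) \<le> x (Suc (\<kappa> i))" using K lt le by (intro mono) (auto simp: survivors_def)
  moreover have "x (Suc (\<kappa> i)) = x (\<kappa> (Suc i))" unfolding \<kappa>_def using i by (intro survivors_right_end n) auto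
  ultimately show ?thesis by simp
qed

context stage_flow
begin

text \<open>A sequence tending to \<open>b\<close> from inside the stage. It starts with the
  fraction 1/2, so it never equals \<open>a\<close>.\<close>

definition approach :: "nat \<Rightarrow> real" where "approach j = b - (b - a) * inverse (real (Suc (Suc j)))"

lemma approach_in: "approach j \<in> {a<..<b}"
proof -
  have "0 < inverse (real (Suc (Suc j)))" "inverse (real (Suc (Suc j))) < 1" by (auto simp: inverse_eq_divide)
  then have "0 < (b - a) * inverse (real (Suc (Suc j)))" "(b - a) * inverse (real (Suc (Suc j))) < (b - a) * 1"
    using ab by (auto intro!: mult_strict_left_mono)
  then show ?thesis by (simp add: approach_def)
qed

lemma approach_tendsto: "approach \<longlonglongrightarrow> b"
proof -
  have "(\<lambda>j. b - (b - a) * inverse (real (Suc (Suc j)))) \<longlonglongrightarrow> b - (b - a) * 0"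
    by (intro tendsto_intros LIMSEQ_Suc[OF LIMSEQ_inverse_real_of_nat])
  then show ?thesis by (simp add: approach_def[abs_def])
qed

lemma approach_at_left: "filterlim approach (at_left b) sequentially"
proof -
  have "approach j < b" for j using approach_in[of j] by simp
  then show ?thesis unfolding filterlim_at using approach_tendsto by (auto intro!: always_eventually less_imp_neq)
qed

lemma position_tendsto: "k \<in> {1..n} \<Longrightarrow> (\<lambda>j. \<xi> k (approach j)) \<longlonglongrightarrow> \<xi> k b"
  by (rule continuous_on_tendsto_compose[OF cont approach_tendsto])
     (use ab approach_in in \<open>auto intro!: always_eventually less_imp_le\<close>)

lemma position_mono:
  assumes "1 \<le> i" "i \<le> j" "j \<le> n"
  shows "\<xi> i b \<le> \<xi> j b"
proof (cases "i = j")
  case False show ?thesis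
  proof (rule LIMSEQ_le[OF position_tendsto position_tendsto])
    have "\<xi> i (approach m) \<le> \<xi> j (approach m)" for m
      using config_less[OF conf, of "approach m" i j] approach_in[of m] assms False by simp
    then show "\<exists>N. \<forall>m\<ge>N. \<xi> i (approach m) \<le> \<xi> j (approach m)" by blast
  qed (use assms in auto)
qed simp

definition kept :: "nat set" where "kept = survivors n (\<lambda>i. \<xi> i b)"

definition kept_enum :: "nat \<Rightarrow> nat" where "kept_enum = enum n kept"

lemma kept_valid: "valid_index n kept" unfolding kept_def by (rule survivors_valid[OF n_pos])

lemma kept_enum_less: "i < j \<Longrightarrow> j \<le> Suc (card kept) \<Longrightarrow> kept_enum i < kept_enum j"
  unfolding kept_enum_def by (rule enum_less[OF kept_valid])

lemma kept_enum_le: "i \<le> card kept \<Longrightarrow> kept_enum i \<le> n"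
  using enum_in[OF kept_valid, of i] kept_valid by (cases "i = 0") (auto simp: kept_enum_def valid_index_def)

context
  assumes dens_lim: "\<And>i. i \<in> kept \<Longrightarrow> ((\<nu> i) \<longlongrightarrow> \<nu> i b) (at_left b)" and ends_b: "\<nu> 0 b = 0" "\<nu> n b = 0"
begin

lemma kept_dens_tendsto:
  assumes "i \<le> card kept"
  shows "(\<lambda>j. \<nu> (kept_enum i) (approach j)) \<longlonglongrightarrow> \<nu> (kept_enum i) b"
proof (cases "i = 0")
  case True have "\<nu> 0 (approach j) = 0" for j using dens_ends[of 0 "approach j"] approach_in[of j] by simp
  with True show ?thesis by (simp add: kept_enum_def ends_b)
next
  case False with assms have "kept_enum i \<in> kept" unfolding kept_enum_def by (intro enum_in[OF kept_valid]) auto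
  from filterlim_compose[OF dens_lim[OF this] approach_at_left] show ?thesis .
qed

lemma kept_config: "config (card kept) (\<lambda>i. \<xi> (kept_enum i) b) (\<lambda>i. \<nu> (kept_enum i) b)" unfolding config_def
proof (intro conjI ballI allI impI)
  show "1 \<le> card kept" by (rule valid_index_card[OF kept_valid])
  show "\<xi> (kept_enum i) b < \<xi> (kept_enum (Suc i)) b" if "i \<in> {1..<card kept}" for i
    using survivors_increasing[OF n_pos, of "\<lambda>i. \<xi> i b" i] position_mono that by (simp add: kept_enum_def kept_def)
  show "\<nu> (kept_enum 0) b = 0" by (simp add: kept_enum_def ends_b)
  show "\<nu> (kept_enum (card kept)) b = 0" by (simp add: kept_enum_def enum_card[OF kept_valid] ends_b)
  fix i assume i: "i \<le> card kept"
  show "0 \<le> \<nu> (kept_enum i) b"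
  proof (rule LIMSEQ_le_const[OF kept_dens_tendsto[OF i]])
    have "0 \<le> \<nu> (kept_enum i) (approach j)" for j
      using conf[of "approach j"] approach_in[of j] kept_enum_le[OF i] by (auto simp: config_def)
    then show "\<exists>N. \<forall>j\<ge>N. 0 \<le> \<nu> (kept_enum i) (approach j)" by blast
  qed
qed

text \<open>No growth inside the stage, none by selecting the survivors, then the limit at
  \<open>b\<close>. Selecting before the limit means that only the densities of survivors have to
  converge.\<close>

lemma kept_total_jump: "total_jump (card kept) (\<lambda>i. \<nu> (kept_enum i) b) \<le> total_jump n (\<lambda>i. \<nu> i a)"
proof (rule LIMSEQ_le_const2)
  show "(\<lambda>j. total_jump (card kept) (\<lambda>i. \<nu> (kept_enum i) (approach j))) \<longlonglongrightarrow>
      total_jump (card kept) (\<lambda>i. \<nu> (kept_enum i) b)"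
    unfolding total_jump_def by (intro tendsto_intros kept_dens_tendsto) auto
  have "total_jump (card kept) (\<lambda>i. \<nu> (kept_enum i) (approach j)) \<le> total_jump n (\<lambda>i. \<nu> i a)" for j
  proof -
    have "total_jump (card kept) (\<lambda>i. \<nu> (kept_enum i) (approach j)) \<le> total_jump n (\<lambda>i. \<nu> i (approach j))"
      by (rule total_jump_subsequence) (auto intro: kept_enum_less kept_enum_le)
    also have "\<dots> \<le> total_jump n (\<lambda>i. \<nu> i a)" by (rule total_jump_decreasing) (use approach_in[of j] in auto)
    finally show ?thesis .
  qed
  then show "\<exists>N. \<forall>j\<ge>N. total_jump (card kept) (\<lambda>i. \<nu> (kept_enum i) (approach j)) \<le> total_jump n (\<lambda>i. \<nu> i a)"
    by blast
qed

end

end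

lemma (in stage_comparison) collision_estimate:
  assumes dens_lim: "\<And>i. i \<in> kept \<Longrightarrow> ((\<nu> i) \<longlongrightarrow> \<nu> i b) (at_left b)" and ends_b: "\<nu> 0 b = 0" "\<nu> n b = 0"
  shows "smoothed_dist (card kept) (\<lambda>i. \<xi> (kept_enum i) b) (\<lambda>i. \<nu> (kept_enum i) b) (\<lambda>y. w y b)
     \<le> smoothed_dist n (\<lambda>i. \<xi> i a) (\<lambda>i. \<nu> i a) (\<lambda>y. w y a) + om'_norm * (LBINT s:{a<..<b}. stage_error s)"
proof -
  let ?E = "LBINT s:{a<..<b}. stage_error s"
  have bT: "b \<in> {0..T}" using ab a_nonneg b_le_T by auto
  have aT: "approach j \<in> {0..T}" for j using approach_in[of j] a_nonneg b_le_T by auto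
  have ap: "approach j \<in> {a..<b}" for j using approach_in[of j] by auto
  define t where "t = (\<lambda>i j. LBINT y. cell_weight n (\<lambda>i. \<xi> i (approach j)) i y * \<bar>\<nu> i (approach j) - w y b\<bar>)"
  have weight_eq: "cell_weight (card kept) (\<lambda>i. \<xi> (kept_enum i) b) i = cell_weight n (\<lambda>i. \<xi> i b) (kept_enum i)"
    if i: "i \<le> card kept" for i
  proof
    fix y
    have 1: "Wt (card kept) (\<lambda>i. \<xi> (kept_enum i) b) y i = Wt n (\<lambda>i. \<xi> i b) y (kept_enum i)"
    proof (cases "i = 0")
      case True then show ?thesis by (simp add: Wt_def kept_enum_def)
    next
      case False then have "kept_enum i \<noteq> 0" using kept_enum_less[of 0 i] i by auto
      with False i kept_enum_le[OF i] show ?thesis by (simp add: Wt_def)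
    qed
    \<comment> \<open>In the old numbering the right end of the cell may be a deleted particle, but
      it sits at the position of the next survivor.\<close>
    have 2: "Wt (card kept) (\<lambda>i. \<xi> (kept_enum i) b) y (Suc i) = Wt n (\<lambda>i. \<xi> i b) y (Suc (kept_enum i))"
    proof (cases "i = card kept")
      case True then have "kept_enum i = n" by (simp add: kept_enum_def enum_card[OF kept_valid])
      with True show ?thesis by (simp add: Wt_def)
    next
      case False with i have "i < card kept" by simp
      then have "\<xi> (Suc (kept_enum i)) b = \<xi> (kept_enum (Suc i)) b"
        using survivors_right_end[OF n_pos, of i "\<lambda>i. \<xi> i b"] by (simp add: kept_def kept_enum_def)
      moreover have "kept_enum i < n"
        using kept_enum_less[of i "Suc i"] kept_enum_le[of "Suc i"] \<open>i < card kept\<close> by simp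
      ultimately show ?thesis using \<open>i < card kept\<close> by (simp add: Wt_def)
    qed
    show "cell_weight (card kept) (\<lambda>i. \<xi> (kept_enum i) b) i y = cell_weight n (\<lambda>i. \<xi> i b) (kept_enum i) y"
      unfolding cell_weight_def 1 2 ..
  qed
  have lim: "(\<lambda>j. \<Sum>i\<le>card kept. t (kept_enum i) j) \<longlonglongrightarrow>
     smoothed_dist (card kept) (\<lambda>i. \<xi> (kept_enum i) b) (\<lambda>i. \<nu> (kept_enum i) b) (\<lambda>y. w y b)"
    unfolding smoothed_dist_def
  proof (rule tendsto_sum)
    fix i assume "i \<in> {..card kept}"
    then have i: "i \<le> card kept" by simp
    have ends: "(\<forall>j. \<nu> (kept_enum i) (approach j) = 0) \<and> \<nu> (kept_enum i) b = 0" if "kept_enum i \<notin> {1..<n}"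
    proof -
      have "kept_enum i = 0 \<or> kept_enum i = n" using that kept_enum_le[OF i] by auto
      then show ?thesis using dens_ends[OF kept_enum_le[OF i] that ap] ends_b by auto
    qed
    show "(\<lambda>j. t (kept_enum i) j) \<longlonglongrightarrow> (LBINT y. cell_weight (card kept) (\<lambda>i. \<xi> (kept_enum i) b) i y * \<bar>\<nu> (kept_enum i) b - w y b\<bar>)"
      unfolding t_def weight_eq[OF i]
      by (rule cell_term_tendsto[OF w_int[OF bT] n_pos kept_enum_le[OF i] position_tendsto
            kept_dens_tendsto[OF dens_lim ends_b i] ends]) auto
  qed
  have upper: "(\<Sum>i\<le>card kept. t (kept_enum i) j) \<le> Phi a + om'_norm * ?E + (LBINT y. \<bar>w y (approach j) - w y b\<bar>)" for j
  proof -
    have inj: "inj_on kept_enum {..card kept}"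
    proof (rule inj_onI)
      fix x y assume "x \<in> {..card kept}" "y \<in> {..card kept}" "kept_enum x = kept_enum y"
      then show "x = y" using kept_enum_less[of x y] kept_enum_less[of y x] by (cases x y rule: linorder_cases) auto
    qed
    have tnn: "0 \<le> t i j" if "i \<le> n" for i
      unfolding t_def using cell_weight_nonneg[OF conf[OF ap] that] by (intro integral_nonneg) simp
    have "(\<Sum>i\<le>card kept. t (kept_enum i) j) = (\<Sum>i\<in>kept_enum ` {..card kept}. t i j)"
      by (simp add: sum.reindex[OF inj])
    also have "\<dots> \<le> (\<Sum>i\<le>n. t i j)" using kept_enum_le tnn by (intro sum_mono2) auto
    also have "\<dots> = sd (approach j) (\<lambda>y. w y b)" by (simp add: t_def smoothed_dist_def)
    also have "\<dots> \<le> Phi (approach j) + (LBINT y. \<bar>w y (approach j) - w y b\<bar>)"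
      using smoothed_dist_lipschitz[OF conf[OF ap[of j]] w_int[OF aT[of j]] w_int[OF bT]] unfolding Phi_def by linarith
    also have "Phi (approach j) \<le> Phi a + om'_norm * ?E" by (rule stage_estimate[OF approach_in])
    finally show ?thesis by simp
  qed
  have "(\<lambda>j. LBINT y. \<bar>w y (approach j) - w y b\<bar>) \<longlonglongrightarrow> (LBINT y. \<bar>w y b - w y b\<bar>)"
    by (rule continuous_on_tendsto_compose[OF L1_dist_continuous[OF bT] approach_tendsto bT]) (use aT in auto)
  then have "(\<lambda>j. Phi a + om'_norm * ?E + (LBINT y. \<bar>w y (approach j) - w y b\<bar>)) \<longlonglongrightarrow> Phi a + om'_norm * ?E + 0"
    by (intro tendsto_intros) simp
  from LIMSEQ_le[OF lim this] upper show ?thesis by (auto simp: Phi_def)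
qed

section \<open>Ordinary differential equations with Lipschitz right-hand side\<close>

definition lipschitz_field :: "nat \<Rightarrow> real \<Rightarrow> ((nat \<Rightarrow> real) \<Rightarrow> nat \<Rightarrow> real) \<Rightarrow> bool" where
  "lipschitz_field n K G \<longleftrightarrow> 0 \<le> K \<and>
     (\<forall>i\<in>{1..n}. \<forall>x x'. \<bar>G x i - G x' i\<bar> \<le> K * (\<Sum>l\<in>{1..n}. \<bar>x l - x' l\<bar>))"

lemma lipschitz_fieldD: "lipschitz_field n K G \<Longrightarrow> i \<in> {1..n} \<Longrightarrow> \<bar>G x i - G x' i\<bar> \<le> K * (\<Sum>l\<in>{1..n}. \<bar>x l - x' l\<bar>)"
  by (auto simp: lipschitz_field_def)

lemma lipschitz_field_continuous:
  assumes G: "lipschitz_field n K G" and i: "i \<in> {1..n}" and Z: "\<And>l. l \<in> {1..n} \<Longrightarrow> continuous_on S (Z l)"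
  shows "continuous_on S (\<lambda>s. G (\<lambda>l. Z l s) i)" unfolding continuous_on_def
proof
  fix s assume s: "s \<in> S"
  have "((\<lambda>t. K * (\<Sum>l\<in>{1..n}. \<bar>Z l t - Z l s\<bar>)) \<longlongrightarrow> K * (\<Sum>l\<in>{1..n}. \<bar>Z l s - Z l s\<bar>)) (at s within S)"
    using Z s by (intro tendsto_intros) (auto simp: continuous_on_def)
  then have lim: "((\<lambda>t. K * (\<Sum>l\<in>{1..n}. \<bar>Z l t - Z l s\<bar>)) \<longlongrightarrow> 0) (at s within S)" by simp
  have "((\<lambda>t. G (\<lambda>l. Z l t) i - G (\<lambda>l. Z l s) i) \<longlongrightarrow> 0) (at s within S)"
    by (rule Lim_null_comparison[OF _ lim]) (use lipschitz_fieldD[OF G i] in \<open>auto intro!: always_eventually\<close>)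
  then show "((\<lambda>t. G (\<lambda>l. Z l t) i) \<longlongrightarrow> G (\<lambda>l. Z l s) i) (at s within S)" by (rule LIM_zero_cancel)
qed

fun picard_iterate :: "((nat \<Rightarrow> real) \<Rightarrow> nat \<Rightarrow> real) \<Rightarrow> (nat \<Rightarrow> real) \<Rightarrow> real \<Rightarrow> nat \<Rightarrow> nat \<Rightarrow> real \<Rightarrow> real" where
  "picard_iterate G x a 0 = (\<lambda>i t. x i)"
| "picard_iterate G x a (Suc k) = (\<lambda>i t. x i + integral {a..t} (\<lambda>s. G (\<lambda>l. picard_iterate G x a k l s) i))"

lemma picard_iterate_continuous:
  assumes G: "lipschitz_field n K G" and i: "i \<in> {1..n}"
  shows "continuous_on {a..b} (picard_iterate G x a k i)" using i
proof (induction k arbitrary: i)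
  case (Suc k) have "continuous_on {a..b} (\<lambda>s. G (\<lambda>l. picard_iterate G x a k l s) i)"
    by (rule lipschitz_field_continuous[OF G Suc.prems Suc.IH])
  then show ?case by (auto intro!: continuous_intros indefinite_integral_continuous_1 integrable_continuous_real)
qed simp

text \<open>The weight \<open>exp (c (t - a))\<close> makes the Picard map a contraction on the whole interval.\<close>

lemma picard_iterate_contracts:
  assumes G: "lipschitz_field n K G"
  obtains C where "\<And>k i t. i \<in> {1..n} \<Longrightarrow> t \<in> {a..b} \<Longrightarrow>
      \<bar>picard_iterate G x a (Suc k) i t - picard_iterate G x a k i t\<bar> \<le> C * (1/2) ^ k"
proof -
  let ?Y = "picard_iterate G x a"
  define D where "D = (\<lambda>k t. \<Sum>l\<in>{1..n}. \<bar>?Y (Suc k) l t - ?Y k l t\<bar>)"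
  have K: "0 \<le> K" using G by (simp add: lipschitz_field_def)
  \<comment> \<open>Makes \<open>real n * K / c \<le> 1/2\<close>, the contraction factor; the 1
    keeps \<open>c\<close> positive.\<close>
  define c where "c = 2 * real n * K + 1"
  have c: "0 < c" unfolding c_def using K by (simp add: add_nonneg_pos)
  have Yc: "continuous_on {a..b} (?Y k i)" if "i \<in> {1..n}" for k i by (rule picard_iterate_continuous[OF G that])
  have Dc: "continuous_on {a..b} (D k)" for k unfolding D_def by (intro continuous_intros Yc)
  have "bounded (D 0 ` {a..b})" by (intro compact_imp_bounded compact_continuous_image Dc compact_Icc)
  then obtain C0 where C0: "\<forall>t\<in>{a..b}. \<bar>D 0 t\<bar> \<le> C0" by (auto simp: bounded_iff)
  define C where "C = max 0 C0"
  have Cnn: "0 \<le> C" by (simp add: C_def)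
  have bound: "D k t \<le> C * (1/2) ^ k * exp (c * (t - a))" if "t \<in> {a..b}" for k t using that
  proof (induction k arbitrary: t)
    case 0 have "D 0 t \<le> C" using C0 0 by (force simp: C_def)
    also have "\<dots> \<le> C * exp (c * (t - a))" using 0 c Cnn by (simp add: mult_le_cancel_left1)
    finally show ?case by simp
  next
    case (Suc k)
    define B where "B = C * (1/2) ^ k"
    have B: "0 \<le> B" using Cnn by (simp add: B_def)
    have sub: "{a..t} \<subseteq> {a..b}" using Suc.prems by auto
    have one: "\<bar>?Y (Suc (Suc k)) i t - ?Y (Suc k) i t\<bar> \<le> K * B * (exp (c * (t - a)) / c)" if i: "i \<in> {1..n}" for i
    proof -
      have gc: "continuous_on {a..t} (\<lambda>s. G (\<lambda>l. ?Y k l s) i)" for k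
        by (rule lipschitz_field_continuous[OF G i continuous_on_subset[OF Yc sub]])
      have Ys: "?Y (Suc j) i t = x i + integral {a..t} (\<lambda>s. G (\<lambda>l. ?Y j l s) i)" for j by simp
      have "?Y (Suc (Suc k)) i t - ?Y (Suc k) i t
          = integral {a..t} (\<lambda>s. G (\<lambda>l. ?Y (Suc k) l s) i - G (\<lambda>l. ?Y k l s) i)"
        unfolding Ys[of "Suc k"] Ys[of k] add_diff_cancel_left
        by (rule Henstock_Kurzweil_Integration.integral_diff[symmetric]) (intro integrable_continuous_real gc)+
      also have "norm \<dots> \<le> integral {a..t} (\<lambda>s. K * B * exp (c * (s - a)))"
      proof (rule integral_norm_bound_integral)
        show "(\<lambda>s. G (\<lambda>l. ?Y (Suc k) l s) i - G (\<lambda>l. ?Y k l s) i) integrable_on {a..t}"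
          by (intro integrable_continuous_real continuous_on_diff gc)
        show "(\<lambda>s. K * B * exp (c * (s - a))) integrable_on {a..t}"
          by (intro integrable_continuous_real continuous_intros)
        fix s assume s: "s \<in> {a..t}"
        have "norm (G (\<lambda>l. ?Y (Suc k) l s) i - G (\<lambda>l. ?Y k l s) i) \<le> K * D k s"
          unfolding D_def real_norm_def by (rule lipschitz_fieldD[OF G i])
        also have "\<dots> \<le> K * (B * exp (c * (s - a)))"
          unfolding B_def using Suc.IH[of s] s sub K by (intro mult_left_mono) auto
        finally show "norm (G (\<lambda>l. ?Y (Suc k) l s) i - G (\<lambda>l. ?Y k l s) i) \<le> K * B * exp (c * (s - a))"
          by (simp only: mult.assoc)
      qed
      also have "integral {a..t} (\<lambda>s. K * B * exp (c * (s - a))) = K * B * (exp (c * (t - a)) / c) - K * B * (exp (c * (a - a)) / c)"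
      proof (rule integral_unique, rule fundamental_theorem_of_calculus)
        show "a \<le> t" using Suc.prems by simp
        show "((\<lambda>s. K * B * (exp (c * (s - a)) / c)) has_vector_derivative K * B * exp (c * (s - a))) (at s within {a..t})" for s
          unfolding has_real_derivative_iff_has_vector_derivative[symmetric]
          using c by (auto intro!: derivative_eq_intros)
      qed
      also have "\<dots> \<le> K * B * (exp (c * (t - a)) / c)" using K B c by simp
      finally show ?thesis by simp
    qed
    have "D (Suc k) t \<le> (\<Sum>l\<in>{1..n}. K * B * (exp (c * (t - a)) / c))" unfolding D_def by (rule sum_mono[OF one])
    also have "\<dots> = (real n * K / c) * (B * exp (c * (t - a)))" by simp
    also have "\<dots> \<le> (1/2) * (B * exp (c * (t - a)))"
    proof (rule mult_right_mono)
      show "real n * K / c \<le> 1/2" using c by (simp add: c_def divide_simps)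
      show "0 \<le> B * exp (c * (t - a))" using B by simp
    qed
    finally show ?case by (simp add: B_def)
  qed
  have "\<bar>?Y (Suc k) i t - ?Y k i t\<bar> \<le> (C * exp (c * (b - a))) * (1/2) ^ k" if "i \<in> {1..n}" "t \<in> {a..b}" for k i t
  proof -
    have "\<bar>?Y (Suc k) i t - ?Y k i t\<bar> \<le> D k t" unfolding D_def using that(1) by (intro member_le_sum) auto
    also have "\<dots> \<le> C * (1/2) ^ k * exp (c * (t - a))" by (rule bound[OF that(2)])
    also have "\<dots> \<le> C * (1/2) ^ k * exp (c * (b - a))" using that(2) c Cnn by (intro mult_left_mono) auto
    finally show ?thesis by (simp only: mult_ac)
  qed
  with that show ?thesis by blast
qed

text \<open>The geometric bound makes the telescoping series of iterates converge uniformly. The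
  Lipschitz condition carries this over to the right-hand sides, so the integral equation passes to
  the limit.\<close>

lemma ode_exists:
  assumes G: "lipschitz_field n K G"
  obtains X where "\<And>i. i \<in> {1..n} \<Longrightarrow> continuous_on {a..b} (X i)" "\<And>i. i \<in> {1..n} \<Longrightarrow> a \<le> b \<Longrightarrow> X i a = x i"
    "\<And>i t. i \<in> {1..n} \<Longrightarrow> t \<in> {a<..<b} \<Longrightarrow> DERIV (X i) t :> G (\<lambda>l. X l t) i"
proof -
  let ?Y = "picard_iterate G x a"
  obtain C where C: "\<And>k i t. i \<in> {1..n} \<Longrightarrow> t \<in> {a..b} \<Longrightarrow> \<bar>?Y (Suc k) i t - ?Y k i t\<bar> \<le> C * (1/2) ^ k"
    using picard_iterate_contracts[OF G] by blast
  define X where "X = (\<lambda>i t. x i + (\<Sum>k. ?Y (Suc k) i t - ?Y k i t))"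
  have tel: "?Y m i t = x i + (\<Sum>k<m. ?Y (Suc k) i t - ?Y k i t)" for m i t
  proof -
    have "(\<Sum>k<m. ?Y (Suc k) i t - ?Y k i t) = ?Y m i t - ?Y 0 i t" by (rule sum_lessThan_telescope)
    then show ?thesis by (simp del: picard_iterate.simps(2))
  qed
  have ul: "uniform_limit {a..b} (\<lambda>m. ?Y m i) (X i) sequentially" if i: "i \<in> {1..n}" for i
  proof -
    have "uniform_limit {a..b} (\<lambda>m t. \<Sum>k<m. ?Y (Suc k) i t - ?Y k i t) (\<lambda>t. \<Sum>k. ?Y (Suc k) i t - ?Y k i t) sequentially"
    proof (rule Weierstrass_m_test)
      show "norm (?Y (Suc k) i t - ?Y k i t) \<le> C * (1/2) ^ k" if "t \<in> {a..b}" for k t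
        using C[OF i that] by (simp only: real_norm_def)
      show "summable (\<lambda>k. C * (1/2) ^ k :: real)" by (intro summable_mult summable_geometric) simp
    qed
    then have "uniform_limit {a..b} (\<lambda>m t. x i + (\<Sum>k<m. ?Y (Suc k) i t - ?Y k i t)) (\<lambda>t. x i + (\<Sum>k. ?Y (Suc k) i t - ?Y k i t)) sequentially"
      by (intro uniform_limit_add uniform_limit_const)
    then show ?thesis unfolding X_def tel[symmetric] .
  qed
  have Yc: "continuous_on {a..b} (?Y k i)" if "i \<in> {1..n}" for k i by (rule picard_iterate_continuous[OF G that])
  have Xc: "continuous_on {a..b} (X i)" if "i \<in> {1..n}" for i
    by (rule uniform_limit_theorem[OF _ ul[OF that]]) (use Yc[OF that] in \<open>auto intro!: always_eventually\<close>)
  have Xeq: "X i t = x i + integral {a..t} (\<lambda>s. G (\<lambda>l. X l s) i)" if i: "i \<in> {1..n}" and t: "t \<in> {a..b}" for i t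
  proof -
    have sub: "{a..t} \<subseteq> {a..b}" using t by auto
    have K: "0 \<le> K" using G by (simp add: lipschitz_field_def)
    have "uniform_limit {a..t} (\<lambda>m s. G (\<lambda>l. ?Y m l s) i) (\<lambda>s. G (\<lambda>l. X l s) i) sequentially"
      unfolding uniform_limit_iff
    proof (intro allI impI)
      fix e :: real assume e: "0 < e"
      define d where "d = e / (K * real n + 1)"
      have Kn: "0 < K * real n + 1" using K by (simp add: add_nonneg_pos)
      have d: "0 < d" using e Kn by (simp add: d_def)
      have "eventually (\<lambda>m. \<forall>l\<in>{1..n}. \<forall>s\<in>{a..b}. dist (?Y m l s) (X l s) < d) sequentially"
        by (intro eventually_ball_finite) (use uniform_limitD[OF ul d] in auto)
      then show "eventually (\<lambda>m. \<forall>s\<in>{a..t}. dist (G (\<lambda>l. ?Y m l s) i) (G (\<lambda>l. X l s) i) < e) sequentially"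
      proof (rule eventually_mono, intro ballI)
        fix m s assume m: "\<forall>l\<in>{1..n}. \<forall>s\<in>{a..b}. dist (?Y m l s) (X l s) < d" and s: "s \<in> {a..t}"
        have sb: "s \<in> {a..b}" using s sub by blast
        have "dist (G (\<lambda>l. ?Y m l s) i) (G (\<lambda>l. X l s) i) \<le> K * (\<Sum>l\<in>{1..n}. \<bar>?Y m l s - X l s\<bar>)"
          unfolding dist_real_def by (rule lipschitz_fieldD[OF G i])
        also have "\<dots> \<le> K * (\<Sum>l\<in>{1..n}. d)"
          using m sb K by (intro mult_left_mono sum_mono) (auto simp: dist_real_def intro: less_imp_le)
        also have "\<dots> = K * real n * d" by simp
        also have "\<dots> < (K * real n + 1) * d" using d by (simp add: distrib_right)
        also have "\<dots> = e" using Kn by (simp add: d_def)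
        finally show "dist (G (\<lambda>l. ?Y m l s) i) (G (\<lambda>l. X l s) i) < e" .
      qed
    qed
    then obtain I J where IJ: "\<And>m. ((\<lambda>s. G (\<lambda>l. ?Y m l s) i) has_integral I m) {a..t}"
        "((\<lambda>s. G (\<lambda>l. X l s) i) has_integral J) {a..t}" "I \<longlonglongrightarrow> J"
      by (rule uniform_limit_integral)
         (auto intro!: lipschitz_field_continuous[OF G i] continuous_on_subset[OF Yc sub])
    have "(\<lambda>m. ?Y (Suc m) i t) = (\<lambda>m. x i + I m)" using integral_unique[OF IJ(1)] by simp
    moreover have "(\<lambda>m. x i + I m) \<longlonglongrightarrow> x i + J" by (intro tendsto_intros IJ(3))
    moreover have "(\<lambda>m. ?Y (Suc m) i t) \<longlonglongrightarrow> X i t" using tendsto_uniform_limitI[OF ul[OF i] t] by (rule LIMSEQ_Suc)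
    ultimately have "X i t = x i + J" using LIMSEQ_unique by metis
    then show ?thesis using integral_unique[OF IJ(2)] by simp
  qed
  show ?thesis
  proof (rule that[of X])
    show "X i a = x i" if "i \<in> {1..n}" "a \<le> b" for i using Xeq[OF that(1), of a] that(2) by simp
    fix i t assume i: "i \<in> {1..n}" and t: "t \<in> {a<..<b}"
    have "continuous_on {a..b} (\<lambda>s. G (\<lambda>l. X l s) i)" by (rule lipschitz_field_continuous[OF G i Xc])
    from integral_has_real_derivative[OF this, of t] t
    have "((\<lambda>u. integral {a..u} (\<lambda>s. G (\<lambda>l. X l s) i)) has_real_derivative G (\<lambda>l. X l t) i) (at t within {a..b})" by simp
    then have "DERIV (\<lambda>u. integral {a..u} (\<lambda>s. G (\<lambda>l. X l s) i)) t :> G (\<lambda>l. X l t) i"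
      using t by (simp add: at_within_Icc_at)
    then have "DERIV (\<lambda>u. x i + integral {a..u} (\<lambda>s. G (\<lambda>l. X l s) i)) t :> G (\<lambda>l. X l t) i"
      by (rule DERIV_cong[OF DERIV_add[OF DERIV_const]]) simp
    then show "DERIV (X i) t :> G (\<lambda>l. X l t) i"
      by (rule has_field_derivative_transform_within_open[of _ _ _ "{a<..<b}"]) (use t Xeq[OF i] in auto)
  qed (rule Xc)
qed

text \<open>Gronwall with the squared Euclidean distance, which is differentiable, times a decaying
  exponential. Cauchy-Schwarz converts the sum in the Lipschitz condition and contributes the factor
  \<open>real n\<close> in \<open>c\<close>.\<close>

lemma ode_unique:
  assumes G: "lipschitz_field n K G" and X: "\<And>i. i \<in> {1..n} \<Longrightarrow> continuous_on {a..b} (X i)"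
      "\<And>i t. i \<in> {1..n} \<Longrightarrow> t \<in> {a<..<b} \<Longrightarrow> DERIV (X i) t :> G (\<lambda>l. X l t) i"
    and Y: "\<And>i. i \<in> {1..n} \<Longrightarrow> continuous_on {a..b} (Y i)"
      "\<And>i t. i \<in> {1..n} \<Longrightarrow> t \<in> {a<..<b} \<Longrightarrow> DERIV (Y i) t :> G (\<lambda>l. Y l t) i"
    and init: "\<And>i. i \<in> {1..n} \<Longrightarrow> X i a = Y i a" and i: "i \<in> {1..n}" and t: "t \<in> {a..b}"
  shows "X i t = Y i t"
proof -
  define P where "P = (\<lambda>t. \<Sum>i\<in>{1..n}. (X i t - Y i t)\<^sup>2)"
  define c where "c = 2 * K * real n"
  define Q where "Q = (\<lambda>t. exp (- (c * t)) * P t)"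
  have K: "0 \<le> K" using G by (simp add: lipschitz_field_def)
  have "Q t \<le> Q a"
  proof (rule DERIV_nonpos_imp_decreasing_open[where f=Q and a=a and b=t])
    show "a \<le> t" using t by simp
    show "continuous_on {a..t} Q"
      unfolding Q_def P_def by (intro continuous_intros continuous_on_subset[OF X(1)] continuous_on_subset[OF Y(1)]) (use t in auto)
    fix s assume s: "a < s" "s < t"
    then have s': "s \<in> {a<..<b}" using t by auto
    define d where "d = (\<lambda>i. X i s - Y i s)"
    define g where "g = (\<lambda>i. G (\<lambda>l. X l s) i - G (\<lambda>l. Y l s) i)"
    have dP: "DERIV P s :> (\<Sum>i\<in>{1..n}. 2 * d i * g i)" unfolding P_def
    proof (rule DERIV_sum)
      fix i assume i: "i \<in> {1..n}"
      have "DERIV (\<lambda>t. X i t - Y i t) s :> g i" unfolding g_def by (intro DERIV_diff X(2)[OF i s'] Y(2)[OF i s'])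
      from DERIV_power[OF this, of 2] show "DERIV (\<lambda>t. (X i t - Y i t)\<^sup>2) s :> 2 * d i * g i"
        by (simp add: d_def mult_ac)
    qed
    have dE: "DERIV (\<lambda>t. exp (- (c * t))) s :> exp (- (c * s)) * (- c)" by (auto intro!: derivative_eq_intros)
    have dQ: "DERIV Q s :> exp (- (c * s)) * ((\<Sum>i\<in>{1..n}. 2 * d i * g i) - c * P s)"
      unfolding Q_def by (rule DERIV_cong[OF DERIV_mult[OF dE dP]]) (simp add: algebra_simps)
    have "(\<Sum>i\<in>{1..n}. 2 * d i * g i) \<le> (\<Sum>i\<in>{1..n}. 2 * \<bar>d i\<bar> * (K * (\<Sum>l\<in>{1..n}. \<bar>d l\<bar>)))"
    proof (rule sum_mono)
      fix i assume i: "i \<in> {1..n}"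
      have "2 * d i * g i \<le> 2 * (\<bar>d i\<bar> * \<bar>g i\<bar>)" using abs_ge_self[of "d i * g i"] by (simp add: abs_mult)
      also have "\<dots> \<le> 2 * (\<bar>d i\<bar> * (K * (\<Sum>l\<in>{1..n}. \<bar>d l\<bar>)))"
        using lipschitz_fieldD[OF G i, of "\<lambda>l. X l s" "\<lambda>l. Y l s"] unfolding g_def d_def
        by (intro mult_left_mono) auto
      finally show "2 * d i * g i \<le> 2 * \<bar>d i\<bar> * (K * (\<Sum>l\<in>{1..n}. \<bar>d l\<bar>))" by (simp only: mult_ac)
    qed
    also have "\<dots> = 2 * K * (\<Sum>l\<in>{1..n}. \<bar>d l\<bar> * 1)\<^sup>2"
    proof -
      have "(\<Sum>i\<in>{1..n}. 2 * \<bar>d i\<bar> * (K * S)) = 2 * K * S * (\<Sum>i\<in>{1..n}. \<bar>d i\<bar>)" for S :: real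
        unfolding sum_distrib_left by (intro sum.cong refl) (simp add: mult_ac)
      note eq = this
      show ?thesis unfolding eq by (simp add: power2_eq_square)
    qed
    also have "\<dots> \<le> 2 * K * ((\<Sum>l\<in>{1..n}. \<bar>d l\<bar>\<^sup>2) * (\<Sum>l\<in>{1..n}. 1\<^sup>2))"
      using K by (intro mult_left_mono Cauchy_Schwarz_ineq_sum) auto
    also have "\<dots> = c * P s" by (simp add: c_def P_def d_def)
    finally have "exp (- (c * s)) * ((\<Sum>i\<in>{1..n}. 2 * d i * g i) - c * P s) \<le> 0" by (intro mult_nonneg_nonpos) auto
    with dQ show "\<exists>y. DERIV Q s :> y \<and> y \<le> 0" by blast
  qed
  also have "Q a = 0" using init by (simp add: Q_def P_def)
  finally have "P t \<le> 0" by (simp add: Q_def mult_le_0_iff)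
  moreover have "0 \<le> P t" unfolding P_def by (intro sum_nonneg) auto
  ultimately have "P t = 0" by simp
  then have "(X i t - Y i t)\<^sup>2 = 0" unfolding P_def using i by (subst (asm) sum_nonneg_eq_0_iff) auto
  then show ?thesis by simp
qed

text \<open>If the bound failed at \<open>t\<close>, then after the last earlier time with
  \<open>c \<le> g\<close> the function would stay below the level, hence be nondecreasing up to
  \<open>t\<close>.\<close>

lemma barrier:
  fixes g :: "real \<Rightarrow> real"
  assumes gc: "continuous_on {a..b} g" and init: "c \<le> g a"
    and d: "\<And>t. t \<in> {a<..<b} \<Longrightarrow> g t \<le> c \<Longrightarrow> \<exists>D. DERIV g t :> D \<and> 0 \<le> D" and t: "t \<in> {a..b}"
  shows "c \<le> g t"
proof (rule ccontr)
  assume neg: "\<not> c \<le> g t"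
  define S where "S = {s\<in>{a..t}. c \<le> g s}"
  have cl: "closed S" unfolding S_def
    by (intro continuous_on_closed_Collect_le continuous_on_const continuous_on_subset[OF gc] closed_atLeastAtMost) (use t in auto)
  have aS: "a \<in> S" using t init by (auto simp: S_def)
  have bdd: "bdd_above S" by (auto simp: S_def intro!: bdd_aboveI[of _ t])
  define m where "m = Sup S"
  have mS: "m \<in> S" unfolding m_def using closed_contains_Sup[OF _ bdd cl] aS by auto
  then have m: "a \<le> m" "m \<le> t" "c \<le> g m" by (auto simp: S_def)
  have "g m \<le> g t"
  proof (rule DERIV_nonneg_imp_increasing_open[OF m(2)])
    fix s assume s: "m < s" "s < t"
    have "s \<notin> S" using cSup_upper[OF _ bdd, of s] s unfolding m_def by auto
    then have "g s \<le> c" using s m by (auto simp: S_def)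
    then show "\<exists>y. DERIV g s :> y \<and> 0 \<le> y" using d[of s] s m t by auto
  qed (rule continuous_on_subset[OF gc], use m t in auto)
  with m neg show False by simp
qed

section \<open>Existence and uniqueness of a stage\<close>

text \<open>The density of a cell of mass \<open>m i\<close> as a function of the positions, with the gap cut off below at
  \<open>m i / M\<close> and above at \<open>\<Gamma>\<close>. Since a density at the maximal value \<open>M\<close> cannot grow, the cut-off is
  never active along solutions, but it makes the right-hand side globally Lipschitz. Only cells of zero
  mass can collapse.\<close>

definition clamped_density :: "nat \<Rightarrow> (nat \<Rightarrow> real) \<Rightarrow> real \<Rightarrow> real \<Rightarrow> (nat \<Rightarrow> real) \<Rightarrow> nat \<Rightarrow> real" where
  "clamped_density n m M \<Gamma> z i =
     (if i \<in> {1..<n} then m i / max (m i / M) (min \<Gamma> (z (Suc i) - z i)) else 0)"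

lemma clamped_density_props:
  assumes m: "\<And>i. 0 \<le> m i" and M: "0 < M" and \<Gamma>: "0 < \<Gamma>"
  shows "0 \<le> clamped_density n m M \<Gamma> z i" "clamped_density n m M \<Gamma> z i \<le> M"
proof -
  show "0 \<le> clamped_density n m M \<Gamma> z i"
    using m[of i] M by (auto simp: clamped_density_def intro!: divide_nonneg_nonneg simp: le_max_iff_disj)
  show "clamped_density n m M \<Gamma> z i \<le> M"
  proof (cases "i \<in> {1..<n} \<and> 0 < m i")
    case True then have "m i / max (m i / M) (min \<Gamma> (z (Suc i) - z i)) \<le> m i / (m i / M)"
      using M by (intro divide_left_mono) (auto intro!: mult_pos_pos simp: less_max_iff_disj)
    then show ?thesis using True by (simp add: clamped_density_def)
  next
    case False then have "clamped_density n m M \<Gamma> z i = 0" using m[of i] by (auto simp: clamped_density_def)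
    then show ?thesis using M by simp
  qed
qed

text \<open>The dichotomy suits \<open>Vel\<close>: the density is either identically 0, so that
  this argument never varies, or bounded away from vacuum, where \<open>Vel\<close> is Lipschitz.
  The constant \<open>M\<^sup>2 / m i\<close> stems from the lower bound \<open>m i / M\<close> for
  the clamped gap.\<close>

lemma clamped_density_lipschitz:
  assumes m: "\<And>i. 0 \<le> m i" and M: "0 < M" and \<Gamma>: "0 < \<Gamma>"
  obtains (zero) "\<And>z. clamped_density n m M \<Gamma> z i = 0"
  | (pos) d K where "0 < d" "\<And>z. d \<le> clamped_density n m M \<Gamma> z i" "0 \<le> K"
      "\<And>z z'. \<bar>clamped_density n m M \<Gamma> z i - clamped_density n m M \<Gamma> z' i\<bar> \<le> K * (\<Sum>l\<in>{1..n}. \<bar>z l - z' l\<bar>)"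
proof (cases "i \<in> {1..<n} \<and> 0 < m i")
  case False then have "clamped_density n m M \<Gamma> z i = 0" for z using m[of i] by (auto simp: clamped_density_def)
  then show ?thesis by (rule zero)
next
  case True then have i: "i \<in> {1..<n}" and mi: "0 < m i" by auto
  define c where "c = (\<lambda>z. max (m i / M) (min \<Gamma> (z (Suc i) - z i)) :: real)"
  have eq: "clamped_density n m M \<Gamma> z i = m i / c z" for z using i by (simp add: clamped_density_def c_def)
  have c1: "m i / M \<le> c z" for z by (simp add: c_def)
  have c0: "0 < c z" for z using c1[of z] mi M by (smt (verit) divide_pos_pos)
  have c2: "c z \<le> max (m i / M) \<Gamma>" for z by (simp add: c_def)
  define G where "G = max (m i / M) \<Gamma>"
  have G: "0 < G" using \<Gamma> by (simp add: G_def)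
  show ?thesis
  proof (rule pos[of "m i / G" "M\<^sup>2 / m i"])
    show "0 < m i / G" using mi G by simp
    show "m i / G \<le> clamped_density n m M \<Gamma> z i" for z
      unfolding eq using c2[of z] c0[of z] mi G by (intro divide_left_mono) (auto simp: G_def)
    show "0 \<le> M\<^sup>2 / m i" using mi by simp
    fix z z' :: "nat \<Rightarrow> real"
    have cl: "\<bar>c z - c z'\<bar> \<le> (\<Sum>l\<in>{1..n}. \<bar>z l - z' l\<bar>)"
    proof -
      have "\<bar>c z - c z'\<bar> \<le> \<bar>z (Suc i) - z' (Suc i)\<bar> + \<bar>z i - z' i\<bar>" unfolding c_def by linarith
      also have "\<dots> = (\<Sum>l\<in>{i, Suc i}. \<bar>z l - z' l\<bar>)" by simp
      also have "\<dots> \<le> (\<Sum>l\<in>{1..n}. \<bar>z l - z' l\<bar>)" using i by (intro sum_mono2) auto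
      finally show ?thesis .
    qed
    have inv: "1 / c z \<le> M / m i" for z
    proof -
      have "1 / c z \<le> 1 / (m i / M)" using c1[of z] c0[of z] mi M by (intro divide_left_mono) auto
      then show ?thesis by simp
    qed
    have "m i / c z - m i / c z' = m i * (c z' - c z) * (1 / c z) * (1 / c z')"
      using c0[of z] c0[of z'] by (simp add: field_simps)
    also have "\<bar>\<dots>\<bar> = (m i * \<bar>c z - c z'\<bar>) * (1 / c z) * (1 / c z')"
      using c0[of z] c0[of z'] mi by (simp add: abs_mult abs_minus_commute)
    also have "\<dots> \<le> (m i * \<bar>c z - c z'\<bar>) * (M / m i) * (M / m i)"
      using inv[of z] inv[of z'] c0[of z] c0[of z'] mi M by (intro mult_mono) auto
    also have "\<dots> = M\<^sup>2 / m i * \<bar>c z - c z'\<bar>" using mi by (simp add: power2_eq_square)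
    also have "\<dots> \<le> M\<^sup>2 / m i * (\<Sum>l\<in>{1..n}. \<bar>z l - z' l\<bar>)" using cl mi by (intro mult_left_mono) auto
    finally show "\<bar>clamped_density n m M \<Gamma> z i - clamped_density n m M \<Gamma> z' i\<bar> \<le> M\<^sup>2 / m i * (\<Sum>l\<in>{1..n}. \<bar>z l - z' l\<bar>)"
      unfolding eq .
  qed
qed

section \<open>The Lipschitz equation behind a stage\<close>

context flux
begin

text \<open>The two arguments of \<open>Vel\<close> are varied one after the other, with bounds that
  are uniform in the argument held fixed.\<close>

lemma clamped_field_lipschitz:
  assumes m: "\<And>i. 0 \<le> m i" and M: "0 < M" and \<Gamma>: "0 < \<Gamma>"
  obtains K where "lipschitz_field n K (\<lambda>z. particle_vel f (clamped_density n m M \<Gamma> z))"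
proof -
  let ?D = "clamped_density n m M \<Gamma>"
  let ?S = "\<lambda>z z'. \<Sum>l\<in>{1..n}. \<bar>z l - z' l\<bar> :: real"
  have "\<exists>K\<ge>0. \<forall>z z'. \<bar>particle_vel f (?D z) i - particle_vel f (?D z') i\<bar> \<le> K * ?S z z'" for i
  proof -
    have R: "\<exists>K\<ge>0. \<forall>z z' vl. \<bar>Vel f vl (?D z i) - Vel f vl (?D z' i)\<bar> \<le> K * ?S z z'"
    proof (cases rule: clamped_density_lipschitz[where n=n and m=m and M=M and \<Gamma>=\<Gamma> and i=i, OF m M \<Gamma>])
      case 1 then show ?thesis by (intro exI[of _ 0]) simp
    next
      case (2 d K) show ?thesis
      proof (intro exI[of _ "2 * L / d * K"] conjI allI)
        show "0 \<le> 2 * L / d * K" using 2 L_nonneg by simp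
        fix z z' vl
        have "\<bar>Vel f vl (?D z i) - Vel f vl (?D z' i)\<bar> \<le> 2 * L / d * \<bar>?D z i - ?D z' i\<bar>"
          using 2 by (intro Vel_lip_right) auto
        also have "\<dots> \<le> 2 * L / d * (K * ?S z z')" using 2 L_nonneg by (intro mult_left_mono) auto
        finally show "\<bar>Vel f vl (?D z i) - Vel f vl (?D z' i)\<bar> \<le> 2 * L / d * K * ?S z z'" by (simp only: mult.assoc)
      qed
    qed
    have Lf: "\<exists>K\<ge>0. \<forall>z z' vr. \<bar>Vel f (?D z (i - 1)) vr - Vel f (?D z' (i - 1)) vr\<bar> \<le> K * ?S z z'"
    proof (cases rule: clamped_density_lipschitz[where n=n and m=m and M=M and \<Gamma>=\<Gamma> and i="i - 1", OF m M \<Gamma>])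
      case 1 then show ?thesis by (intro exI[of _ 0]) simp
    next
      case (2 d K) show ?thesis
      proof (intro exI[of _ "2 * L / d * K"] conjI allI)
        show "0 \<le> 2 * L / d * K" using 2 L_nonneg by simp
        fix z z' vr
        have "\<bar>Vel f (?D z (i - 1)) vr - Vel f (?D z' (i - 1)) vr\<bar> \<le> 2 * L / d * \<bar>?D z (i - 1) - ?D z' (i - 1)\<bar>"
          using 2 by (intro Vel_lip_left) auto
        also have "\<dots> \<le> 2 * L / d * (K * ?S z z')" using 2 L_nonneg by (intro mult_left_mono) auto
        finally show "\<bar>Vel f (?D z (i - 1)) vr - Vel f (?D z' (i - 1)) vr\<bar> \<le> 2 * L / d * K * ?S z z'" by (simp only: mult.assoc)
      qed
    qed
    obtain K1 where K1: "0 \<le> K1" "\<And>z z' vl. \<bar>Vel f vl (?D z i) - Vel f vl (?D z' i)\<bar> \<le> K1 * ?S z z'" using R by blast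
    obtain K2 where K2: "0 \<le> K2" "\<And>z z' vr. \<bar>Vel f (?D z (i - 1)) vr - Vel f (?D z' (i - 1)) vr\<bar> \<le> K2 * ?S z z'" using Lf by blast
    show ?thesis
    proof (intro exI[of _ "K1 + K2"] conjI allI)
      fix z z'
      have "\<bar>particle_vel f (?D z) i - particle_vel f (?D z') i\<bar>
          \<le> \<bar>Vel f (?D z (i - 1)) (?D z i) - Vel f (?D z' (i - 1)) (?D z i)\<bar>
           + \<bar>Vel f (?D z' (i - 1)) (?D z i) - Vel f (?D z' (i - 1)) (?D z' i)\<bar>"
        unfolding particle_vel_def by linarith
      also have "\<dots> \<le> K2 * ?S z z' + K1 * ?S z z'" by (intro add_mono K1 K2)
      finally show "\<bar>particle_vel f (?D z) i - particle_vel f (?D z') i\<bar> \<le> (K1 + K2) * ?S z z'"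
        by (simp add: distrib_right)
    qed (use K1 K2 in simp)
  qed
  then obtain KK where KK: "\<And>i. 0 \<le> KK i"
    "\<And>i z z'. \<bar>particle_vel f (?D z) i - particle_vel f (?D z') i\<bar> \<le> KK i * ?S z z'" by metis
  have "lipschitz_field n (\<Sum>i\<in>{1..n}. KK i) (\<lambda>z. particle_vel f (?D z))" unfolding lipschitz_field_def
  proof (intro conjI ballI allI)
    show "0 \<le> (\<Sum>i\<in>{1..n}. KK i)" using KK(1) by (intro sum_nonneg) auto
    fix i z z' assume i: "i \<in> {1..n}"
    have "\<bar>particle_vel f (?D z) i - particle_vel f (?D z') i\<bar> \<le> KK i * ?S z z'" by (rule KK(2))
    also have "\<dots> \<le> (\<Sum>i\<in>{1..n}. KK i) * ?S z z'"
      using i KK(1) by (intro mult_right_mono member_le_sum sum_nonneg) auto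
    finally show "\<bar>particle_vel f (?D z) i - particle_vel f (?D z') i\<bar> \<le> (\<Sum>i\<in>{1..n}. KK i) * ?S z z'" .
  qed
  then show ?thesis by (rule that)
qed

text \<open>The scale of the cut-off in the equation solved by a stage that starts from \<open>x\<close>, \<open>d\<close> and lasts at
  most \<open>h\<close>.\<close>

definition gap_bound :: "nat \<Rightarrow> (nat \<Rightarrow> real) \<Rightarrow> real \<Rightarrow> real" where
  "gap_bound n x h = (\<Sum>i\<in>{1..<n}. \<bar>x (Suc i) - x i\<bar>) + 2 * L * h + 1"

text \<open>Densities are bounded by the total jump, as cell 0 is vacuum; the 1 makes the maximal
  density positive also if all densities vanish.\<close>

definition stage_field :: "nat \<Rightarrow> (nat \<Rightarrow> real) \<Rightarrow> (nat \<Rightarrow> real) \<Rightarrow> real \<Rightarrow> (nat \<Rightarrow> real) \<Rightarrow> nat \<Rightarrow> real" where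
  "stage_field n x d h z = clamped_density n (\<lambda>i. if i \<in> {1..<n} then d i * (x (Suc i) - x i) else 0)
     (total_jump n d + 1) (gap_bound n x h) z"

lemma gap_bound_pos: "0 \<le> h \<Longrightarrow> 0 < gap_bound n x h"
  unfolding gap_bound_def using L_nonneg by (intro add_nonneg_pos add_nonneg_nonneg sum_nonneg) auto

lemma config_mass_nonneg:
  assumes "config n x d"
  shows "0 \<le> (if i \<in> {1..<n} then d i * (x (Suc i) - x i) else 0)"
proof (cases "i \<in> {1..<n}")
  case True then have "0 \<le> d i" "x i < x (Suc i)" using assms by (auto simp: config_def)
  with True show ?thesis by simp
next
  case False then show ?thesis by (simp only: if_False)
qed

lemma stage_field_lipschitz:
  assumes "config n x d" "0 \<le> h"
  obtains K where "lipschitz_field n K (\<lambda>z. particle_vel f (stage_field n x d h z))"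
proof -
  have "0 < total_jump n d + 1" using total_jump_nonneg[of n d] by linarith
  note M = this
  obtain K where "lipschitz_field n K (\<lambda>z. particle_vel f (clamped_density n
      (\<lambda>i. if i \<in> {1..<n} then d i * (x (Suc i) - x i) else 0) (total_jump n d + 1) (gap_bound n x h) z))"
    by (rule clamped_field_lipschitz, rule config_mass_nonneg[OF assms(1)], rule M, rule gap_bound_pos[OF assms(2)])
  then show ?thesis by (intro that) (simp only: stage_field_def)
qed

lemma stage_field_eq:
  assumes c: "config n x d" and i: "i \<in> {1..<n}"
    and lo: "d i * (x (Suc i) - x i) \<le> (total_jump n d + 1) * (z (Suc i) - z i)"
    and hi: "z (Suc i) - z i \<le> gap_bound n x h" and pos: "0 < z (Suc i) - z i"
  shows "stage_field n x d h z i = (x (Suc i) - x i) / (z (Suc i) - z i) * d i"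
proof -
  have M: "0 < total_jump n d + 1" using total_jump_nonneg[of n d] by linarith
  have "d i * (x (Suc i) - x i) / (total_jump n d + 1) \<le> z (Suc i) - z i"
    using lo M by (simp add: pos_divide_le_eq mult.commute)
  then have "max (d i * (x (Suc i) - x i) / (total_jump n d + 1)) (min (gap_bound n x h) (z (Suc i) - z i)) = z (Suc i) - z i"
    using hi by simp
  then show ?thesis using i by (simp add: stage_field_def clamped_density_def)
qed

end

section \<open>Uniqueness of a stage\<close>

context stage_flow
begin

lemma gap_upper:
  assumes i: "i \<in> {1..<n}" and t: "t \<in> {a..b}"
  shows "\<xi> (Suc i) t - \<xi> i t \<le> (\<xi> (Suc i) a - \<xi> i a) + 2 * L * (t - a)"
proof -
  have "\<xi> (Suc i) t - \<xi> i t - 2 * L * t \<le> \<xi> (Suc i) a - \<xi> i a - 2 * L * a"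
  proof (rule DERIV_nonpos_imp_decreasing_open[where f="\<lambda>t. \<xi> (Suc i) t - \<xi> i t - 2 * L * t" and a=a and b=t])
    show "a \<le> t" using t by simp
    show "continuous_on {a..t} (\<lambda>t. \<xi> (Suc i) t - \<xi> i t - 2 * L * t)"
      by (intro continuous_intros continuous_on_subset[OF cont]) (use i t in auto)
    fix s assume s: "a < s" "s < t"
    then have s': "s \<in> {a<..<b}" using t by auto
    let ?V = "particle_vel f (\<lambda>i. \<nu> i s)"
    have "DERIV (\<lambda>t. \<xi> (Suc i) t - \<xi> i t - 2 * L * t) s :> ?V (Suc i) - ?V i - 2 * L * 1"
      by (intro DERIV_diff der DERIV_cmult DERIV_ident) (use i s' in auto)
    moreover have "?V (Suc i) - ?V i - 2 * L * 1 \<le> 0"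
      using particle_vel_bound[of "\<lambda>i. \<nu> i s" i] particle_vel_bound[of "\<lambda>i. \<nu> i s" "Suc i"] by linarith
    ultimately show "\<exists>y. DERIV (\<lambda>t. \<xi> (Suc i) t - \<xi> i t - 2 * L * t) s :> y \<and> y \<le> 0" by blast
  qed
  then show ?thesis by (simp add: algebra_simps)
qed

lemma initial_config: "config n (\<lambda>i. \<xi> i a) (\<lambda>i. \<nu> i a)" using conf[of a] ab by simp

lemma gap_le_bound:
  assumes i: "i \<in> {1..<n}" and t: "t \<in> {a..b}" and h: "b - a \<le> h"
  shows "\<xi> (Suc i) t - \<xi> i t \<le> gap_bound n (\<lambda>i. \<xi> i a) h"
proof -
  have "\<xi> (Suc i) a - \<xi> i a \<le> (\<Sum>i\<in>{1..<n}. \<bar>\<xi> (Suc i) a - \<xi> i a\<bar>)"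
    using member_le_sum[of i "{1..<n}" "\<lambda>i. \<bar>\<xi> (Suc i) a - \<xi> i a\<bar>"] i by auto
  moreover have "2 * L * (t - a) \<le> 2 * L * h" using t h L_nonneg by (intro mult_left_mono) auto
  ultimately show ?thesis using gap_upper[OF i t] unfolding gap_bound_def by linarith
qed

text \<open>Densities stay below the initial total jump and gaps grow at speed at most
  \<open>2 * L\<close>, so neither cut-off changes anything. Every stage thus solves one globally
  Lipschitz equation, which makes it unique.\<close>

lemma solves_stage_field:
  assumes h: "b - a \<le> h" and i: "i \<in> {1..n}" and t: "t \<in> {a<..<b}"
  shows "DERIV (\<xi> i) t :> particle_vel f (stage_field n (\<lambda>i. \<xi> i a) (\<lambda>i. \<nu> i a) h (\<lambda>i. \<xi> i t)) i"
proof -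
  have eq: "stage_field n (\<lambda>i. \<xi> i a) (\<lambda>i. \<nu> i a) h (\<lambda>i. \<xi> i t) k = \<nu> k t" if "k \<le> n" for k
  proof (cases "k \<in> {1..<n}")
    case True have tab: "t \<in> {a..<b}" using t by auto
    have g: "0 < \<xi> (Suc k) t - \<xi> k t" using gap_pos[OF True tab] by simp
    have "\<nu> k t \<le> total_jump n (\<lambda>i. \<nu> i t)"
      by (rule le_total_jump) (use conf[OF tab] that in \<open>auto simp: config_def\<close>)
    also have "\<dots> \<le> total_jump n (\<lambda>i. \<nu> i a)" by (rule total_jump_decreasing) (use t in auto)
    finally have "\<nu> k t * (\<xi> (Suc k) t - \<xi> k t) \<le> (total_jump n (\<lambda>i. \<nu> i a) + 1) * (\<xi> (Suc k) t - \<xi> k t)"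
      using g by (intro mult_right_mono) auto
    then have "stage_field n (\<lambda>i. \<xi> i a) (\<lambda>i. \<nu> i a) h (\<lambda>i. \<xi> i t) k
        = (\<xi> (Suc k) a - \<xi> k a) / (\<xi> (Suc k) t - \<xi> k t) * \<nu> k a" unfolding mass[OF True tab]
      by (intro stage_field_eq[OF initial_config True] gap_le_bound[OF True _ h]) (use g t in auto)
    then show ?thesis using dens'[OF True tab] by simp
  next
    case False
    then show ?thesis using dens_ends[OF that False, of t] t by (auto simp: stage_field_def clamped_density_def)
  qed
  have "particle_vel f (stage_field n (\<lambda>i. \<xi> i a) (\<lambda>i. \<nu> i a) h (\<lambda>i. \<xi> i t)) i = particle_vel f (\<lambda>i. \<nu> i t) i"
  proof -
    have "i - 1 \<le> n" "i \<le> n" using i by auto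
    then show ?thesis unfolding particle_vel_def by (simp only: eq)
  qed
  with der[OF i t] show ?thesis by simp
qed

end

lemma (in flux) stage_unique:
  assumes S1: "stage_flow f L n \<xi> \<nu> a b" and S2: "stage_flow f L n \<xi>' \<nu>' a b'" and bb: "b \<le> b'"
    and init: "\<And>i. i \<in> {1..n} \<Longrightarrow> \<xi> i a = \<xi>' i a" "\<And>i. i \<le> n \<Longrightarrow> \<nu> i a = \<nu>' i a" and i: "i \<in> {1..n}" and t: "t \<in> {a..b}"
  shows "\<xi> i t = \<xi>' i t"
proof -
  interpret A: stage_flow f L n \<xi> \<nu> a b by fact
  interpret B: stage_flow f L n \<xi>' \<nu>' a b' by fact
  \<comment> \<open>A common time horizon, so that both stages solve the same equation.\<close>
  define h where "h = b' - a"
  have h: "b - a \<le> h" "b' - a \<le> h" "0 \<le> h" using bb B.ab by (auto simp: h_def)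
  have same: "stage_field n (\<lambda>i. \<xi> i a) (\<lambda>i. \<nu> i a) h = stage_field n (\<lambda>i. \<xi>' i a) (\<lambda>i. \<nu>' i a) h"
  proof -
    have 1: "total_jump n (\<lambda>i. \<nu> i a) = total_jump n (\<lambda>i. \<nu>' i a)"
      unfolding total_jump_def by (intro sum.cong) (auto simp: init(2))
    have 2: "gap_bound n (\<lambda>i. \<xi> i a) h = gap_bound n (\<lambda>i. \<xi>' i a) h"
    proof -
      have "(\<Sum>i\<in>{1..<n}. \<bar>\<xi> (Suc i) a - \<xi> i a\<bar>) = (\<Sum>i\<in>{1..<n}. \<bar>\<xi>' (Suc i) a - \<xi>' i a\<bar>)"
        by (intro sum.cong) (auto simp: init(1))
      then show ?thesis by (simp add: gap_bound_def)
    qed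
    have 3: "(\<lambda>i. if i \<in> {1..<n} then \<nu> i a * (\<xi> (Suc i) a - \<xi> i a) else 0)
      = (\<lambda>i. if i \<in> {1..<n} then \<nu>' i a * (\<xi>' (Suc i) a - \<xi>' i a) else 0)" by (rule ext) (auto simp: init)
    show ?thesis by (rule ext) (simp only: stage_field_def 1 2 3)
  qed
  obtain K where K: "lipschitz_field n K (\<lambda>z. particle_vel f (stage_field n (\<lambda>i. \<xi> i a) (\<lambda>i. \<nu> i a) h z))"
    using stage_field_lipschitz[OF A.initial_config h(3)] by blast
  show ?thesis
  proof (rule ode_unique[OF K, where X=\<xi> and Y=\<xi>' and a=a and b=b])
    show "continuous_on {a..b} (\<xi>' i)" if "i \<in> {1..n}" for i
      by (rule continuous_on_subset[OF B.cont[OF that]]) (use bb in auto)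
    show "DERIV (\<xi>' i) t :> particle_vel f (stage_field n (\<lambda>i. \<xi> i a) (\<lambda>i. \<nu> i a) h (\<lambda>l. \<xi>' l t)) i"
      if "i \<in> {1..n}" "t \<in> {a<..<b}" for i t
      unfolding same by (rule B.solves_stage_field[OF h(2) that(1)]) (use that(2) bb in auto)
    show "DERIV (\<xi> i) t :> particle_vel f (stage_field n (\<lambda>i. \<xi> i a) (\<lambda>i. \<nu> i a) h (\<lambda>l. \<xi> l t)) i"
      if "i \<in> {1..n}" "t \<in> {a<..<b}" for i t by (rule A.solves_stage_field[OF h(1) that])
  qed (use A.cont init(1) i t in auto)
qed

lemma config_cong:
  assumes "config n x d" "\<And>i. i \<in> {1..n} \<Longrightarrow> x' i = x i" "\<And>i. i \<le> n \<Longrightarrow> d' i = d i"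
  shows "config n x' d'" using assms by (auto simp: config_def)

section \<open>Existence of a stage\<close>

context flux
begin

text \<open>The clamped equation is solved on all of \<open>{a..T}\<close>, past any collision, and
  \<open>b\<close> is the first time at which a gap closes, or \<open>T\<close>. Before
  \<open>b\<close> the clamped densities are the true ones; for cells of zero mass both are
  0.\<close>

lemma stage_exists:
  assumes c: "config n x d" and aT: "a < T"
  obtains b \<xi> \<nu> where "b \<le> T" "stage_flow f L n \<xi> \<nu> a b"
    "\<And>i. i \<in> {1..n} \<Longrightarrow> \<xi> i a = x i" "\<And>i. i \<le> n \<Longrightarrow> \<nu> i a = d i" "\<And>t. \<nu> 0 t = 0 \<and> \<nu> n t = 0"
    "b = T \<or> (\<exists>i\<in>{1..<n}. \<xi> i b = \<xi> (Suc i) b)" "\<And>i. i \<in> survivors n (\<lambda>i. \<xi> i b) \<Longrightarrow> (\<nu> i \<longlongrightarrow> \<nu> i b) (at_left b)"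
proof -
  define h where "h = T - a"
  have h: "0 \<le> h" using aT by (simp add: h_def)
  define M where "M = total_jump n d + 1"
  have M: "0 < M" using total_jump_nonneg[of n d] by (simp add: M_def)
  define m where "m = (\<lambda>i. if i \<in> {1..<n} then d i * (x (Suc i) - x i) else 0)"
  define \<Gamma> where "\<Gamma> = gap_bound n x h"
  have \<Gamma>: "0 < \<Gamma>" unfolding \<Gamma>_def by (rule gap_bound_pos[OF h])
  have mnn: "0 \<le> m i" for i unfolding m_def by (rule config_mass_nonneg[OF c])
  have n: "1 \<le> n" "d 0 = 0" "d n = 0" using c by (auto simp: config_def)
  have gap0: "x i < x (Suc i)" "0 \<le> d i" if "i \<in> {1..<n}" for i using c that by (auto simp: config_def)
  have dM: "d i \<le> M" if "i \<le> n" for i using le_total_jump[of d i n] n(2) that by (simp add: M_def)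
  let ?G = "\<lambda>z. particle_vel f (clamped_density n m M \<Gamma> z)"
  obtain K where K: "lipschitz_field n K ?G" by (rule clamped_field_lipschitz, rule mnn, rule M, rule \<Gamma>)
  obtain \<xi> where X: "\<And>i. i \<in> {1..n} \<Longrightarrow> continuous_on {a..T} (\<xi> i)" "\<And>i. i \<in> {1..n} \<Longrightarrow> a \<le> T \<Longrightarrow> \<xi> i a = x i"
    "\<And>i t. i \<in> {1..n} \<Longrightarrow> t \<in> {a<..<T} \<Longrightarrow> DERIV (\<xi> i) t :> ?G (\<lambda>l. \<xi> l t) i" using ode_exists[OF K, of a T x] by blast
  have X0: "\<xi> i a = x i" if "i \<in> {1..n}" for i using X(2)[OF that] aT by simp
  define g where "g = (\<lambda>i t. \<xi> (Suc i) t - \<xi> i t)"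
  have gc: "continuous_on {a..T} (g i)" if "i \<in> {1..<n}" for i
    unfolding g_def using that by (intro continuous_on_diff X(1)) auto
  have g0: "0 < g i a" if "i \<in> {1..<n}" for i using gap0[OF that] X0[of i] X0[of "Suc i"] that by (simp add: g_def)
  have gd: "DERIV (g i) t :> ?G (\<lambda>l. \<xi> l t) (Suc i) - ?G (\<lambda>l. \<xi> l t) i" if "i \<in> {1..<n}" "t \<in> {a<..<T}" for i t
    unfolding g_def using that by (intro DERIV_diff X(3)) auto
  note cd = clamped_density_props[OF mnn M \<Gamma>, of n]
  \<comment> \<open>At or below the threshold the clamped density is the maximal value
    \<open>M\<close>, so the velocities on the left and right of the cell are at most and at least
    \<open>vel f M\<close>, and the gap cannot shrink.\<close>
  have lower: "m i / M \<le> g i t" if i: "i \<in> {1..<n}" and pos: "0 < m i" and t: "t \<in> {a..T}" for i t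
  proof (rule barrier[OF gc[OF i] _ _ t])
    have "m i / M \<le> x (Suc i) - x i"
    proof -
      have "d i * (x (Suc i) - x i) \<le> M * (x (Suc i) - x i)"
        using dM[of i] gap0[OF i] i by (intro mult_right_mono) auto
      then show ?thesis using i M by (simp add: m_def pos_divide_le_eq mult.commute)
    qed
    then show "m i / M \<le> g i a" using X0[of i] X0[of "Suc i"] i by (simp add: g_def)
    fix s assume s: "s \<in> {a<..<T}" and le: "g i s \<le> m i / M"
    let ?D = "clamped_density n m M \<Gamma> (\<lambda>l. \<xi> l s)"
    have "min \<Gamma> (g i s) \<le> m i / M" using le by simp
    then have "max (m i / M) (min \<Gamma> (g i s)) = m i / M" by simp
    then have DM: "?D i = M" using i pos M by (simp add: clamped_density_def g_def)
    have "vel f M \<le> ?G (\<lambda>l. \<xi> l s) (Suc i)" unfolding particle_vel_def using DM cd(2) by (intro Vel_ge) auto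
    moreover have "?G (\<lambda>l. \<xi> l s) i \<le> vel f M" unfolding particle_vel_def DM using cd(2) by (intro Vel_le) auto
    ultimately show "\<exists>D. DERIV (g i) s :> D \<and> 0 \<le> D"
      using gd[OF i s] by (intro exI[of _ "?G (\<lambda>l. \<xi> l s) (Suc i) - ?G (\<lambda>l. \<xi> l s) i"]) auto
  qed
  have upper: "g i t \<le> \<Gamma>" if i: "i \<in> {1..<n}" and t: "t \<in> {a..T}" for i t
  proof -
    have "g i t - 2 * L * t \<le> g i a - 2 * L * a"
    proof (rule DERIV_nonpos_imp_decreasing_open[where f="\<lambda>t. g i t - 2 * L * t" and a=a and b=t])
      show "a \<le> t" using t by simp
      show "continuous_on {a..t} (\<lambda>t. g i t - 2 * L * t)"
        by (intro continuous_intros continuous_on_subset[OF gc[OF i]]) (use t in auto)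
      fix s assume s: "a < s" "s < t"
      then have s': "s \<in> {a<..<T}" using t by auto
      have "DERIV (\<lambda>t. g i t - 2 * L * t) s :> (?G (\<lambda>l. \<xi> l s) (Suc i) - ?G (\<lambda>l. \<xi> l s) i) - 2 * L * 1"
        by (intro DERIV_diff gd[OF i s'] DERIV_cmult DERIV_ident)
      moreover have "(?G (\<lambda>l. \<xi> l s) (Suc i) - ?G (\<lambda>l. \<xi> l s) i) - 2 * L * 1 \<le> 0"
        using particle_vel_bound[of "clamped_density n m M \<Gamma> (\<lambda>l. \<xi> l s)" i]
          particle_vel_bound[of "clamped_density n m M \<Gamma> (\<lambda>l. \<xi> l s)" "Suc i"] by linarith
      ultimately show "\<exists>y. DERIV (\<lambda>t. g i t - 2 * L * t) s :> y \<and> y \<le> 0" by blast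
    qed
    moreover have "g i a \<le> (\<Sum>i\<in>{1..<n}. \<bar>x (Suc i) - x i\<bar>)"
      using member_le_sum[of i "{1..<n}" "\<lambda>i. \<bar>x (Suc i) - x i\<bar>"] i X0[of i] X0[of "Suc i"] by (auto simp: g_def)
    moreover have "2 * L * (t - a) \<le> 2 * L * h" using t L_nonneg by (intro mult_left_mono) (auto simp: h_def)
    ultimately show ?thesis unfolding \<Gamma>_def gap_bound_def by (simp add: algebra_simps)
  qed
  \<comment> \<open>A closed set of times, so its infimum is attained if it is nonempty; the infimum
    is not \<open>a\<close>, since all initial gaps are positive.\<close>
  define Z where "Z = (\<Union>i\<in>{1..<n}. {t\<in>{a..T}. g i t \<le> 0})"
  have Zcl: "closed Z" unfolding Z_def
    by (intro closed_UN ballI continuous_on_closed_Collect_le gc continuous_on_const closed_atLeastAtMost) auto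
  define b where "b = (if Z = {} then T else Inf Z)"
  have Zbd: "bdd_below Z" by (auto simp: Z_def intro!: bdd_belowI[of _ a])
  have bZ: "b \<in> Z" if "Z \<noteq> {}" using closed_contains_Inf[OF that Zbd Zcl] that by (simp add: b_def)
  have bT: "b \<le> T" using bZ by (cases "Z = {}") (auto simp: b_def Z_def)
  have ab: "a < b"
  proof (cases "Z = {}")
    case True then show ?thesis using aT by (simp add: b_def)
  next
    case False from bZ[OF False] obtain i where i: "i \<in> {1..<n}" "b \<in> {a..T}" "g i b \<le> 0" by (auto simp: Z_def)
    then have "b \<noteq> a" using g0[OF i(1)] by auto
    with i show ?thesis by simp
  qed
  have gpos: "0 < g i t" if "i \<in> {1..<n}" "t \<in> {a..<b}" for i t
  proof (rule ccontr)
    assume "\<not> 0 < g i t"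
    then have "t \<in> {t\<in>{a..T}. g i t \<le> 0}" using that(2) bT by simp
    then have tZ: "t \<in> Z" unfolding Z_def by (rule UN_I[OF that(1)])
    then have "Inf Z \<le> t" using Zbd by (rule cInf_lower)
    moreover have "Z \<noteq> {}" using tZ by auto
    ultimately show False using that(2) by (simp add: b_def)
  qed
  have coll: "b = T \<or> (\<exists>i\<in>{1..<n}. \<xi> i b = \<xi> (Suc i) b)"
  proof (cases "Z = {}")
    case True then show ?thesis by (simp add: b_def)
  next
    case False from bZ[OF False] obtain i where i: "i \<in> {1..<n}" "b \<in> {a..T}" "g i b \<le> 0" by (auto simp: Z_def)
    have "continuous_on {a..b} (g i)" by (rule continuous_on_subset[OF gc[OF i(1)]]) (use bT in auto)
    then have "(g i \<longlongrightarrow> g i b) (at_left b)" using continuous_on_Icc_at_leftD[of a b "g i"] ab by blast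
    moreover have "eventually (\<lambda>t. 0 \<le> g i t) (at_left b)"
      using eventually_at_left_real[OF ab] by (rule eventually_mono) (use gpos[OF i(1)] in \<open>auto intro: less_imp_le\<close>)
    ultimately have "0 \<le> g i b" by (intro tendsto_lowerbound) auto
    with i show ?thesis by (auto simp: g_def)
  qed
  define \<nu> where "\<nu> = (\<lambda>i t. if i \<in> {1..<n} then (x (Suc i) - x i) / g i t * d i else 0)"
  have \<nu>m: "\<nu> i t = m i / g i t" if "i \<in> {1..<n}" for i t using that by (simp add: \<nu>_def m_def mult.commute)
  have \<nu>c: "clamped_density n m M \<Gamma> (\<lambda>l. \<xi> l t) i = \<nu> i t" if "t \<in> {a..<b}" for i t
  proof (cases "i \<in> {1..<n} \<and> 0 < m i")
    case True have t: "t \<in> {a..T}" using that bT by auto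
    have "max (m i / M) (min \<Gamma> (g i t)) = g i t" using lower[of i t] upper[of i t] True t by simp
    then show ?thesis using True \<nu>m by (simp add: clamped_density_def g_def)
  next
    case False then show ?thesis using mnn[of i] by (auto simp: clamped_density_def \<nu>_def m_def)
  qed
  have Gd: "?G (\<lambda>l. \<xi> l t) i = particle_vel f (\<lambda>i. \<nu> i t) i" if "t \<in> {a..<b}" for i t
    unfolding particle_vel_def by (simp only: \<nu>c[OF that])
  have \<nu>0: "\<nu> i a = d i" if "i \<le> n" for i
  proof (cases "i \<in> {1..<n}")
    case True then show ?thesis using gap0[OF True] X0[of i] X0[of "Suc i"] by (simp add: \<nu>_def g_def)
  next
    case False then show ?thesis using config_ends[OF c that False] by (auto simp: \<nu>_def)
  qed
  have flow: "stage_flow f L n \<xi> \<nu> a b"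
  proof (unfold_locales)
    show "config n (\<lambda>i. \<xi> i t) (\<lambda>i. \<nu> i t)" if t: "t \<in> {a..<b}" for t unfolding config_def
    proof (intro conjI ballI allI impI)
      show "\<xi> i t < \<xi> (Suc i) t" if "i \<in> {1..<n}" for i using gpos[OF that t] by (simp add: g_def)
      show "0 \<le> \<nu> i t" if "i \<le> n" for i
        using gpos[OF _ t, of i] gap0[of i] by (auto simp: \<nu>_def intro!: mult_nonneg_nonneg divide_nonneg_nonneg)
    qed (use n in \<open>auto simp: \<nu>_def\<close>)
    show "continuous_on {a..b} (\<xi> i)" if "i \<in> {1..n}" for i
      by (rule continuous_on_subset[OF X(1)[OF that]]) (use bT in auto)
    show "DERIV (\<xi> i) t :> particle_vel f (\<lambda>i. \<nu> i t) i" if "i \<in> {1..n}" "t \<in> {a<..<b}" for i t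
      using X(3)[OF that(1), of t] Gd[of t i] that bT by auto
    show "continuous_on {a<..<b} (\<lambda>t. particle_vel f (\<lambda>i. \<nu> i t) i)" if "i \<in> {1..n}" for i
    proof (rule continuous_on_eq)
      show "continuous_on {a<..<b} (\<lambda>t. ?G (\<lambda>l. \<xi> l t) i)"
        by (intro lipschitz_field_continuous[OF K that] continuous_on_subset[OF X(1)]) (use bT in auto)
    qed (use Gd in auto)
    show "\<nu> i t = (\<xi> (Suc i) a - \<xi> i a) / (\<xi> (Suc i) t - \<xi> i t) * \<nu> i a" if "i \<in> {1..<n}" "t \<in> {a<..<b}" for i t
      using that \<nu>0[of i] X0[of i] X0[of "Suc i"] by (simp add: \<nu>_def g_def)
  qed (rule ab)
  have dlim: "(\<nu> i \<longlongrightarrow> \<nu> i b) (at_left b)" if i: "i \<in> survivors n (\<lambda>i. \<xi> i b)" for i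
  proof (cases "i \<in> {1..<n}")
    case True have "g i b \<noteq> 0" using i True by (auto simp: survivors_def g_def)
    moreover have "(g i \<longlongrightarrow> g i b) (at_left b)"
    proof -
      have "continuous_on {a..b} (g i)" by (rule continuous_on_subset[OF gc[OF True]]) (use bT in auto)
      then show ?thesis using continuous_on_Icc_at_leftD[of a b "g i"] ab by blast
    qed
    ultimately have "((\<lambda>t. m i / g i t) \<longlongrightarrow> m i / g i b) (at_left b)" by (intro tendsto_intros)
    then show ?thesis by (simp only: \<nu>m[OF True, symmetric, abs_def])
  next
    case False then have "\<nu> i = (\<lambda>t. 0)" by (auto simp: \<nu>_def)
    then show ?thesis by simp
  qed
  show ?thesis by (rule that[OF bT flow X0 \<nu>0 _ coll dlim]) (auto simp: \<nu>_def)
qed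

end

section \<open>Runs of the particle scheme\<close>

abbreviation run_config :: "nat \<Rightarrow> nat set \<Rightarrow> (nat \<Rightarrow> real \<Rightarrow> real) \<Rightarrow> (nat \<Rightarrow> real \<Rightarrow> real) \<Rightarrow> real \<Rightarrow> bool" where
  "run_config N S X D t \<equiv> config (card S) (\<lambda>i. X (enum N S i) t) (\<lambda>i. D (enum N S i) t)"

text \<open>The fictitious particle \<open>N + 1\<close> sits at infinity, which is why the last
  particle always survives.\<close>

lemma pos_neq_iff:
  assumes v: "valid_index N S" and i: "1 \<le> i" "i \<le> card S"
  shows "pos N y (enum N S i) \<noteq> pos N y (enum N S (i + 1)) \<longleftrightarrow> i = card S \<or> y (enum N S i) \<noteq> y (enum N S (Suc i))"
proof -
  have pi: "enum N S i \<in> {1..N}" using enum_in[OF v i] v by (auto simp: valid_index_def)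
  then have p1: "pos N y (enum N S i) = ereal (y (enum N S i))" by (auto simp: pos_def)
  show ?thesis
  proof (cases "i = card S")
    case True then show ?thesis unfolding p1 by (simp add: pos_def)
  next
    case False
    then have "enum N S (Suc i) \<in> {1..N}" using enum_in[OF v, of "Suc i"] i v by (auto simp: valid_index_def)
    then have "pos N y (enum N S (Suc i)) = ereal (y (enum N S (Suc i)))" by (auto simp: pos_def)
    with False show ?thesis unfolding p1 by simp
  qed
qed

lemma survivor_set_eq:
  assumes v: "valid_index N S"
  shows "{enum N S i | i. 1 \<le> i \<and> i \<le> card S \<and> pos N y (enum N S i) \<noteq> pos N y (enum N S (i + 1))}
     = enum N S ` survivors (card S) (\<lambda>i. y (enum N S i))"
  using pos_neq_iff[OF v] by (auto simp: survivors_def image_def)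

context flux
begin

text \<open>Passage from original labels to consecutive numbers. Densities stay nonnegative inside
  the stage, since they are the initial ones times a quotient of two positive gaps.\<close>

lemma particle_stage_flow:
  assumes st: "particle_stage f T N X D a b S S'" and v: "valid_index N S" and c: "run_config N S X D a"
    and D0: "\<And>t. D 0 t = 0 \<and> D N t = 0"
  shows "stage_flow f L (card S) (\<lambda>i. X (enum N S i)) (\<lambda>i. D (enum N S i)) a b"
proof
  let ?p = "enum N S" and ?n = "card S"
  note st' = st[unfolded particle_stage_def Let_def]
  show ab: "a < b" using st' by blast
  have n: "1 \<le> ?n" by (rule valid_index_card[OF v])
  have pn: "?p ?n = N" by (rule enum_card[OF v])
  have dens: "D (?p i) t = (X (?p (Suc i)) a - X (?p i) a) / (X (?p (Suc i)) t - X (?p i) t) * D (?p i) a"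
    if "i \<in> {1..<?n}" "t \<in> {a<..<b}" for i t using st' that by (metis Suc_eq_plus1)
  then show "D (?p i) t = (X (?p (Suc i)) a - X (?p i) a) / (X (?p (Suc i)) t - X (?p i) t) * D (?p i) a"
    if "i \<in> {1..<?n}" "t \<in> {a<..<b}" for i t using that by blast
  have mono: "X (?p i) t < X (?p (Suc i)) t" if "i \<in> {1..<?n}" "t \<in> {a<..<b}" for i t
  proof -
    have "strict_mono_on {1..?n} (\<lambda>i. X (?p i) t)" using st' that(2) by blast
    then show ?thesis using that(1) by (auto simp: strict_mono_on_def)
  qed
  show "config ?n (\<lambda>i. X (?p i) t) (\<lambda>i. D (?p i) t)" if t: "t \<in> {a..<b}" for t
  proof (cases "t = a")
    case True then show ?thesis using c by simp
  next
    case False then have t': "t \<in> {a<..<b}" using t by auto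
    show ?thesis unfolding config_def
    proof (intro conjI ballI allI impI)
      show "D (?p 0) t = 0" "D (?p ?n) t = 0" using D0 pn by auto
      fix i assume i: "i \<le> ?n"
      show "0 \<le> D (?p i) t"
      proof (cases "i \<in> {1..<?n}")
        case True have "0 < X (?p (Suc i)) a - X (?p i) a" "0 \<le> D (?p i) a" using c True by (auto simp: config_def)
        then show ?thesis unfolding dens[OF True t'] using mono[OF True t'] by simp
      next
        case False then have "i = 0 \<or> i = ?n" using i by auto
        then show ?thesis using D0 pn by auto
      qed
    qed (use n mono t' in auto)
  qed
  show "continuous_on {a..b} (X (?p i))" if "i \<in> {1..?n}" for i using st' that by blast
  have der: "DERIV (X (?p i)) t :> particle_vel f (\<lambda>i. D (?p i) t) i" if "i \<in> {1..?n}" "t \<in> {a<..<b}" for i t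
    unfolding particle_vel_def using st' that by blast
  then show "DERIV (X (?p i)) t :> particle_vel f (\<lambda>i. D (?p i) t) i" if "i \<in> {1..?n}" "t \<in> {a<..<b}" for i t
    using that by blast
  show "continuous_on {a<..<b} (\<lambda>t. particle_vel f (\<lambda>i. D (?p i) t) i)" if i: "i \<in> {1..?n}" for i
  proof -
    \<comment> \<open>Continuity of the velocity is extracted from the C1 requirement on the
      positions, by uniqueness of derivatives.\<close>
    have "X (?p i) C1_differentiable_on {a<..<b}" using st' i by blast
    then obtain X' where X': "\<forall>t\<in>{a<..<b}. (X (?p i) has_vector_derivative X' t) (at t)" "continuous_on {a<..<b} X'"
      by (auto simp: C1_differentiable_on_def)
    have "X' t = particle_vel f (\<lambda>i. D (?p i) t) i" if "t \<in> {a<..<b}" for t using X'(1) der[OF i that] that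
      by (metis has_real_derivative_iff_has_vector_derivative vector_derivative_unique_at)
    then show ?thesis by (rule continuous_on_eq[OF X'(2)])
  qed
qed

lemma particle_stage_next:
  assumes st: "particle_stage f T N X D a b S S'" and v: "valid_index N S" and c: "run_config N S X D a"
    and D0: "\<And>t. D 0 t = 0 \<and> D N t = 0"
  defines "K \<equiv> survivors (card S) (\<lambda>i. X (enum N S i) b)"
  shows "S' = enum N S ` K" "valid_index N S'" "S' \<subseteq> S" "run_config N S' X D b" "card S' = card K"
    "\<And>i. i \<le> Suc (card K) \<Longrightarrow> enum N S' i = enum N S (enum (card S) K i)"
    "\<And>i. i \<in> K \<Longrightarrow> (D (enum N S i) \<longlongrightarrow> D (enum N S i) b) (at_left b)"
proof -
  interpret F: stage_flow f L "card S" "\<lambda>i. X (enum N S i)" "\<lambda>i. D (enum N S i)" a b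
    by (rule particle_stage_flow[OF st v c D0])
  note st' = st[unfolded particle_stage_def Let_def]
  show S': "S' = enum N S ` K" using st' survivor_set_eq[OF v, of "\<lambda>k. X k b"] unfolding K_def by argo
  have vK: "valid_index (card S) K" unfolding K_def by (rule survivors_valid[OF F.n_pos])
  note E = enum_image[OF v vK]
  show "valid_index N S'" "card S' = card K" unfolding S' by (rule E)+
  show Ei: "enum N S' i = enum N S (enum (card S) K i)" if "i \<le> Suc (card K)" for i
    unfolding S' by (rule E(2)[OF that])
  show "S' \<subseteq> S" unfolding S' K_def using enum_in[OF v] by (auto simp: survivors_def)
  show dl: "(D (enum N S i) \<longlongrightarrow> D (enum N S i) b) (at_left b)" if "i \<in> K" for i using st' that unfolding S' by blast
  have kept: "F.kept = K" by (simp add: F.kept_def K_def)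
  have "config (card K) (\<lambda>i. X (enum N S (enum (card S) K i)) b) (\<lambda>i. D (enum N S (enum (card S) K i)) b)"
    using F.kept_config[unfolded F.kept_enum_def kept] dl D0 enum_card[OF v] by simp
  then show "run_config N S' X D b" unfolding E(1)[folded S'] by (rule config_cong) (simp_all add: Ei)
qed

end

text \<open>A stage sees only the values on \<open>{a..b}\<close> of the particles in
  \<open>S\<close>, together with the vacuum density \<open>D 0\<close>. This permits gluing the
  stages of a run.\<close>

lemma particle_stage_cong:
  assumes st: "particle_stage f T N X D a b S S'" and v: "valid_index N S"
    and X: "\<And>k t. k \<in> S \<Longrightarrow> t \<in> {a..b} \<Longrightarrow> X' k t = X k t"
    and D: "\<And>k t. k \<in> S \<Longrightarrow> t \<in> {a..b} \<Longrightarrow> D' k t = D k t" and D0: "\<And>t. D' 0 t = D 0 t"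
  shows "particle_stage f T N X' D' a b S S'"
proof -
  let ?p = "enum N S" and ?n = "card S"
  note st' = st[unfolded particle_stage_def Let_def]
  have ab: "a < b" using st' by blast
  have pS: "?p i \<in> S" if "i \<in> {1..?n}" for i using enum_in[OF v] that by auto
  have Xp: "X' (?p i) t = X (?p i) t" if "i \<in> {1..?n}" "t \<in> {a..b}" for i t using X[OF pS] that by auto
  have Dp: "D' (?p i) t = D (?p i) t" if "i \<le> ?n" "t \<in> {a..b}" for i t
    using D[OF pS, of i t] D0 that by (cases "i = 0") auto
  have der: "DERIV (X' (?p i)) t :> c" if "DERIV (X (?p i)) t :> c" "i \<in> {1..?n}" "t \<in> {a<..<b}" for i c t
    by (rule has_field_derivative_transform_within_open[OF that(1), of "{a<..<b}"]) (use that Xp in auto)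
  show ?thesis unfolding particle_stage_def Let_def
  proof (intro conjI ballI)
    show "a < b" "b \<le> T" using st' by blast+
    show "continuous_on {a..b} (X' (?p i))" if i: "i \<in> {1..?n}" for i
    proof (rule continuous_on_eq)
      show "continuous_on {a..b} (X (?p i))" using st' i by blast
    qed (use Xp[OF i] in auto)
    show "X' (?p i) C1_differentiable_on {a<..<b}" if i: "i \<in> {1..?n}" for i
    proof -
      have "X (?p i) C1_differentiable_on {a<..<b}" using st' i by blast
      then obtain X1 where X1: "\<forall>t\<in>{a<..<b}. (X (?p i) has_vector_derivative X1 t) (at t)" "continuous_on {a<..<b} X1"
        by (auto simp: C1_differentiable_on_def)
      have "(X' (?p i) has_vector_derivative X1 t) (at t)" if "t \<in> {a<..<b}" for t
        using der[OF _ i that] X1(1) that by (simp add: has_real_derivative_iff_has_vector_derivative)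
      with X1(2) show ?thesis unfolding C1_differentiable_on_def by blast
    qed
    show "strict_mono_on {1..?n} (\<lambda>i. X' (?p i) t)" if t: "t \<in> {a<..<b}" for t
    proof -
      have "strict_mono_on {1..?n} (\<lambda>i. X (?p i) t)" using st' t by blast
      then show ?thesis using Xp t by (auto simp: strict_mono_on_def)
    qed
    show "DERIV (X' (?p i)) t :> Vel f (D' (?p (i - 1)) t) (D' (?p i) t)" if i: "i \<in> {1..?n}" and t: "t \<in> {a<..<b}" for i t
    proof -
      have "D' (?p (i - 1)) t = D (?p (i - 1)) t" "D' (?p i) t = D (?p i) t" by (rule Dp; use i t in auto)+
      moreover have "DERIV (X (?p i)) t :> Vel f (D (?p (i - 1)) t) (D (?p i) t)" using st' i t by blast
      ultimately show ?thesis using der[OF _ i t] by simp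
    qed
    show "D' (?p i) t = (X' (?p (i + 1)) a - X' (?p i) a) / (X' (?p (i + 1)) t - X' (?p i) t) * D' (?p i) a"
      if i: "i \<in> {1..<?n}" and t: "t \<in> {a<..<b}" for i t
    proof -
      have "D (?p i) t = (X (?p (i + 1)) a - X (?p i) a) / (X (?p (i + 1)) t - X (?p i) t) * D (?p i) a" using st' i t by blast
      moreover have "t \<in> {a..b}" "a \<in> {a..b}" "i \<in> {1..?n}" "i + 1 \<in> {1..?n}" "i \<le> ?n" using i t ab by auto
      ultimately show ?thesis by (simp only: Xp Dp)
    qed
    show "b = T \<or> (\<exists>i\<in>{1..<?n}. X' (?p i) b = X' (?p (i + 1)) b)"
    proof (cases "b = T")
      case False
      then obtain i where i: "i \<in> {1..<?n}" "X (?p i) b = X (?p (i + 1)) b" using st' by blast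
      then have "X' (?p i) b = X' (?p (i + 1)) b" using Xp[of i b] Xp[of "i + 1" b] ab by auto
      with i(1) show ?thesis by blast
    qed simp
    show "S' = {?p i | i. 1 \<le> i \<and> i \<le> ?n \<and> pos N (\<lambda>k. X' k b) (?p i) \<noteq> pos N (\<lambda>k. X' k b) (?p (i + 1))}"
    proof -
      have "survivors ?n (\<lambda>i. X' (?p i) b) = survivors ?n (\<lambda>i. X (?p i) b)"
        using Xp ab by (auto simp: survivors_def)
      then show ?thesis unfolding survivor_set_eq[OF v] using st' survivor_set_eq[OF v, of "\<lambda>k. X k b"] by simp
    qed
    show "(D' i \<longlongrightarrow> D' i b) (at_left b)" if i: "i \<in> S'" for i
    proof -
      have iS: "i \<in> S" using st' i pS by auto
      have "(D i \<longlongrightarrow> D i b) (at_left b)" using st' i by blast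
      then have "(D' i \<longlongrightarrow> D i b) (at_left b)"
        by (rule Lim_transform_eventually)
           (rule eventually_mono[OF eventually_at_left_real[OF ab]], use D[OF iS] in auto)
      then show ?thesis using D[OF iS, of b] ab by simp
    qed
  qed
qed

section \<open>Existence and uniqueness of runs\<close>

context flux
begin

lemma particle_stage_exists:
  assumes v: "valid_index N S" and c: "config (card S) (\<lambda>i. x (enum N S i)) (\<lambda>i. d (enum N S i))" and aT: "a < T"
  obtains b S' X D where "particle_stage f T N X D a b S S'"
    "\<And>k. k \<in> S \<Longrightarrow> X k a = x k \<and> D k a = d k" "\<And>t. D 0 t = 0 \<and> D N t = 0"
proof -
  let ?p = "enum N S" and ?n = "card S"
  obtain b \<xi> \<nu> where F: "b \<le> T" "stage_flow f L ?n \<xi> \<nu> a b"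
    "\<And>i. i \<in> {1..?n} \<Longrightarrow> \<xi> i a = x (?p i)" "\<And>i. i \<le> ?n \<Longrightarrow> \<nu> i a = d (?p i)" "\<And>t. \<nu> 0 t = 0 \<and> \<nu> ?n t = 0"
    "b = T \<or> (\<exists>i\<in>{1..<?n}. \<xi> i b = \<xi> (Suc i) b)" "\<And>i. i \<in> survivors ?n (\<lambda>i. \<xi> i b) \<Longrightarrow> (\<nu> i \<longlongrightarrow> \<nu> i b) (at_left b)"
    using stage_exists[OF c aT] by blast
  interpret F: stage_flow f L ?n \<xi> \<nu> a b by (rule F(2))
  \<comment> \<open>The stage is solved in consecutive numbers and relabelled. Labels outside
    \<open>S\<close> get density 0, which covers the outer cell 0.\<close>
  define idx where "idx = inv_into {1..?n} ?p"
  have inj: "inj_on ?p {1..?n}"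
  proof (rule inj_onI)
    fix i j assume "i \<in> {1..?n}" "j \<in> {1..?n}" "?p i = ?p j"
    then show "i = j" using enum_less[OF v, of i j] enum_less[OF v, of j i] by (cases i j rule: linorder_cases) auto
  qed
  have idx: "idx (?p i) = i" if "i \<in> {1..?n}" for i unfolding idx_def by (rule inv_into_f_f[OF inj that])
  have pS: "?p i \<in> S" if "i \<in> {1..?n}" for i using enum_in[OF v] that by auto
  have S0: "0 \<notin> S" using v by (auto simp: valid_index_def)
  define X where "X = (\<lambda>k. \<xi> (idx k))"
  define D where "D = (\<lambda>k t. if k \<in> S then \<nu> (idx k) t else 0)"
  have Xp: "X (?p i) = \<xi> i" if "i \<in> {1..?n}" for i using idx[OF that] by (simp add: X_def)
  have Dp: "D (?p i) = \<nu> i" if "i \<le> ?n" for i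
  proof (cases "i = 0")
    case True then show ?thesis using S0 F(5) by (auto simp: D_def)
  next
    case False then have "i \<in> {1..?n}" using that by auto
    then show ?thesis using idx pS by (auto simp: D_def)
  qed
  define S' where "S' = ?p ` survivors ?n (\<lambda>i. X (?p i) b)"
  have surv: "survivors ?n (\<lambda>i. X (?p i) b) = survivors ?n (\<lambda>i. \<xi> i b)" using Xp by (auto simp: survivors_def)
  have "particle_stage f T N X D a b S S'" unfolding particle_stage_def Let_def
  proof (intro conjI ballI)
    show "a < b" "b \<le> T" by (fact F.ab F(1))+
    show "continuous_on {a..b} (X (?p i))" if "i \<in> {1..?n}" for i unfolding Xp[OF that] by (rule F.cont[OF that])
    show "X (?p i) C1_differentiable_on {a<..<b}" if i: "i \<in> {1..?n}" for i
      unfolding Xp[OF i] C1_differentiable_on_def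
      by (intro exI[of _ "\<lambda>t. particle_vel f (\<lambda>i. \<nu> i t) i"] conjI ballI F.vcont[OF i])
         (use F.der[OF i] in \<open>simp add: has_real_derivative_iff_has_vector_derivative\<close>)
    show "strict_mono_on {1..?n} (\<lambda>i. X (?p i) t)" if t: "t \<in> {a<..<b}" for t
    proof (rule strict_mono_onI)
      fix i j assume ij: "i \<in> {1..?n}" "j \<in> {1..?n}" "i < j"
      have "\<xi> i t < \<xi> j t" by (rule config_less[OF F.conf]) (use ij t in auto)
      then show "X (?p i) t < X (?p j) t" using Xp ij by simp
    qed
    show "DERIV (X (?p i)) t :> Vel f (D (?p (i - 1)) t) (D (?p i) t)" if i: "i \<in> {1..?n}" and t: "t \<in> {a<..<b}" for i t
    proof -
      have "i - 1 \<le> ?n" "i \<le> ?n" using i by auto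
      then show ?thesis using F.der[OF i t] unfolding particle_vel_def by (simp only: Xp[OF i] Dp)
    qed
    show "D (?p i) t = (X (?p (i + 1)) a - X (?p i) a) / (X (?p (i + 1)) t - X (?p i) t) * D (?p i) a"
      if i: "i \<in> {1..<?n}" and t: "t \<in> {a<..<b}" for i t
    proof -
      have "i \<in> {1..?n}" "Suc i \<in> {1..?n}" "i \<le> ?n" using i by auto
      then show ?thesis using F.dens[OF i t] by (simp only: Xp Dp Suc_eq_plus1[symmetric])
    qed
    show "b = T \<or> (\<exists>i\<in>{1..<?n}. X (?p i) b = X (?p (i + 1)) b)"
    proof (cases "b = T")
      case False
      then obtain i where i: "i \<in> {1..<?n}" "\<xi> i b = \<xi> (Suc i) b" using F(6) by blast
      then have "X (?p i) b = X (?p (i + 1)) b" using Xp[of i] Xp[of "i + 1"] by auto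
      with i(1) show ?thesis by blast
    qed simp
    show "S' = {?p i | i. 1 \<le> i \<and> i \<le> ?n \<and> pos N (\<lambda>k. X k b) (?p i) \<noteq> pos N (\<lambda>k. X k b) (?p (i + 1))}"
      unfolding survivor_set_eq[OF v] S'_def ..
    show "(D k \<longlongrightarrow> D k b) (at_left b)" if "k \<in> S'" for k
    proof -
      from that obtain i where i: "k = ?p i" "i \<in> survivors ?n (\<lambda>i. \<xi> i b)" unfolding S'_def surv by auto
      have "i \<le> ?n" using i(2) by (auto simp: survivors_def)
      then show ?thesis using F(7)[OF i(2)] unfolding i(1) by (simp only: Dp)
    qed
  qed
  moreover have "X k a = x k \<and> D k a = d k" if kS: "k \<in> S" for k
  proof -
    obtain i where i: "1 \<le> i" "i \<le> ?n" "?p i = k" using enum_surj[OF v kS] by blast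
    then have "X k = \<xi> i" "D k = \<nu> i" using Xp[of i] Dp[of i] by auto
    then show ?thesis using F(3)[of i] F(4)[of i] i by auto
  qed
  moreover have "D 0 t = 0 \<and> D N t = 0" for t using Dp[of 0] Dp[of ?n] F(5) by (simp add: enum_card[OF v])
  ultimately show ?thesis using that by blast
qed

text \<open>Induction on the number of particles, as a stage that ends before \<open>T\<close>
  deletes at least one. The clauses on \<open>I j\<close> and on \<open>a \<le> \<tau> j\<close>
  record which labels and times the tail of a run uses; gluing depends on them.\<close>

lemma run_exists:
  assumes "valid_index N S" "config (card S) (\<lambda>i. x (enum N S i)) (\<lambda>i. d (enum N S i))" "a < T"
  shows "\<exists>J \<tau> I X D. \<tau> 0 = a \<and> \<tau> J = T \<and> I 0 = S \<and> (\<forall>k\<in>S. X k a = x k \<and> D k a = d k) \<and>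
     (\<forall>t. D 0 t = 0 \<and> D N t = 0) \<and>
     (\<forall>j<J. valid_index N (I j) \<and> I j \<subseteq> S \<and> a \<le> \<tau> j \<and> particle_stage f T N X D (\<tau> j) (\<tau> (Suc j)) (I j) (I (Suc j)))"
  using assms
proof (induction "card S" arbitrary: S x d a rule: less_induct)
  case less
  note v = less.prems(1) and c = less.prems(2)
  obtain b S' X1 D1 where st: "particle_stage f T N X1 D1 a b S S'"
    and init: "\<And>k. k \<in> S \<Longrightarrow> X1 k a = x k \<and> D1 k a = d k" and D0: "\<And>t. D1 0 t = 0 \<and> D1 N t = 0"
    by (rule particle_stage_exists[OF v c less.prems(3)]) (rule that)
  note st' = st[unfolded particle_stage_def Let_def]
  have ab: "a < b" "b \<le> T" using st' by blast+
  have n: "1 \<le> card S" by (rule valid_index_card[OF v])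
  have c1: "run_config N S X1 D1 a"
  proof (rule config_cong[OF c])
    show "X1 (enum N S i) a = x (enum N S i)" if "i \<in> {1..card S}" for i
      using init[of "enum N S i"] enum_in[OF v, of i] that by auto
    show "D1 (enum N S i) a = d (enum N S i)" if "i \<le> card S" for i
    proof (cases "i = 0")
      case True then show ?thesis using D0 c by (simp add: config_def)
    next
      case False then show ?thesis using init[of "enum N S i"] enum_in[OF v, of i] that by auto
    qed
  qed
  note nx = particle_stage_next[OF st v c1 D0]
  show ?case
  proof (cases "b = T")
    case True
    define \<tau> where "\<tau> = (\<lambda>j::nat. if j = 0 then a else T)"
    define I where "I = (\<lambda>j::nat. if j = 0 then S else S')"
    show ?thesis
      by (rule exI[of _ 1], rule exI[of _ \<tau>], rule exI[of _ I], rule exI[of _ X1], rule exI[of _ D1])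
         (use st True init D0 v in \<open>auto simp: \<tau>_def I_def\<close>)
  next
    case False then have bT: "b < T" using ab by simp
    have "card S' < card S"
    proof -
      obtain i where i: "i \<in> {1..<card S}" "X1 (enum N S i) b = X1 (enum N S (i + 1)) b" using st' False by blast
      then have "i \<notin> survivors (card S) (\<lambda>i. X1 (enum N S i) b)" by (auto simp: survivors_def)
      moreover have "survivors (card S) (\<lambda>i. X1 (enum N S i) b) \<subseteq> {1..card S}" by (auto simp: survivors_def)
      moreover have "i \<in> {1..card S}" using i(1) by auto
      ultimately have "survivors (card S) (\<lambda>i. X1 (enum N S i) b) \<subset> {1..card S}" by blast
      from psubset_card_mono[OF _ this] show ?thesis using nx(5) by simp
    qed
    from less.hyps[OF this nx(2) nx(4) bT]
    obtain J \<tau> I X2 D2 where R: "\<tau> 0 = b" "\<tau> J = T" "I 0 = S'" "\<forall>k\<in>S'. X2 k b = X1 k b \<and> D2 k b = D1 k b"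
      "\<forall>t. D2 0 t = 0 \<and> D2 N t = 0"
      "\<forall>j<J. valid_index N (I j) \<and> I j \<subseteq> S' \<and> b \<le> \<tau> j \<and> particle_stage f T N X2 D2 (\<tau> j) (\<tau> (Suc j)) (I j) (I (Suc j))"
      by (elim exE conjE) (rule that; assumption)
    \<comment> \<open>At the junction \<open>b\<close> both pieces agree for the survivors, so the
      later stages may be read off from \<open>X2\<close> and \<open>D2\<close> on closed time
      intervals.\<close>
    define X where "X = (\<lambda>k t. if t \<le> b then X1 k t else X2 k t)"
    define D where "D = (\<lambda>k t. if t \<le> b then D1 k t else D2 k t)"
    define \<tau>' where "\<tau>' = (\<lambda>j. case j of 0 \<Rightarrow> a | Suc j \<Rightarrow> \<tau> j)"
    define I' where "I' = (\<lambda>j. case j of 0 \<Rightarrow> S | Suc j \<Rightarrow> I j)"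
    have D0': "D 0 t = 0 \<and> D N t = 0" for t using D0 R(5) by (simp add: D_def)
    have stages: "valid_index N (I' j) \<and> I' j \<subseteq> S \<and> a \<le> \<tau>' j \<and> particle_stage f T N X D (\<tau>' j) (\<tau>' (Suc j)) (I' j) (I' (Suc j))"
      if "j < Suc J" for j
    proof (cases j)
      case 0 have "particle_stage f T N X D a b S S'"
        by (rule particle_stage_cong[OF st v]) (auto simp: X_def D_def D0 R(5))
      then show ?thesis using 0 v R(1,3) by (simp add: \<tau>'_def I'_def)
    next
      case (Suc i) then have i: "i < J" using that by simp
      note Ri = R(6)[rule_format, OF i]
      have "particle_stage f T N X D (\<tau> i) (\<tau> (Suc i)) (I i) (I (Suc i))"
      proof (rule particle_stage_cong)
        show "particle_stage f T N X2 D2 (\<tau> i) (\<tau> (Suc i)) (I i) (I (Suc i))" "valid_index N (I i)" using Ri by auto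
        fix k t assume kt: "k \<in> I i" "t \<in> {\<tau> i..\<tau> (Suc i)}"
        have k: "k \<in> S'" "b \<le> t" using Ri kt by auto
        show "X k t = X2 k t" using k R(4) by (auto simp: X_def)
        show "D k t = D2 k t" using k R(4) by (auto simp: D_def)
      qed (use D0' R(5) in simp)
      then show ?thesis using Suc Ri nx(3) ab by (auto simp: \<tau>'_def I'_def)
    qed
    show ?thesis
      by (rule exI[of _ "Suc J"], rule exI[of _ \<tau>'], rule exI[of _ I'], rule exI[of _ X], rule exI[of _ D])
         (use stages D0' R(2) init ab in \<open>auto simp: \<tau>'_def I'_def X_def D_def\<close>)
  qed
qed

text \<open>Both solutions agree as long as both stages last. If one ended earlier, its closed gap
  would occur inside the other stage, where gaps are positive. Survivor densities at
  \<open>b\<close> are fixed as left limits.\<close>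

lemma particle_stage_unique:
  assumes st: "particle_stage f T N X D a b S S'" and st2: "particle_stage f T N X2 D2 a b2 S S2"
    and v: "valid_index N S" and c: "run_config N S X D a"
    and D0: "\<And>t. D 0 t = 0 \<and> D N t = 0" and D02: "\<And>t. D2 0 t = 0 \<and> D2 N t = 0"
    and init: "\<And>k. k \<in> S \<Longrightarrow> X2 k a = X k a \<and> D2 k a = D k a"
  shows "b2 = b" "S2 = S'" "\<And>k t. k \<in> S \<Longrightarrow> t \<in> {a..b} \<Longrightarrow> X2 k t = X k t"
    "\<And>k t. k \<in> S \<Longrightarrow> t \<in> {a..<b} \<Longrightarrow> D2 k t = D k t" "\<And>k. k \<in> S' \<Longrightarrow> D2 k b = D k b"
proof -
  let ?p = "enum N S" and ?n = "card S"
  have pS: "?p i \<in> S" if "i \<in> {1..?n}" for i using enum_in[OF v] that by auto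
  have Dinit: "D2 (?p i) a = D (?p i) a" if "i \<le> ?n" for i
    using init[OF pS, of i] D0 D02 that by (cases "i = 0") auto
  have Xinit: "X2 (?p i) a = X (?p i) a" if "i \<in> {1..?n}" for i using init[OF pS[OF that]] by simp
  have c2: "run_config N S X2 D2 a" by (rule config_cong[OF c Xinit Dinit])
  note F = particle_stage_flow[OF st v c D0] and F2 = particle_stage_flow[OF st2 v c2 D02]
  interpret A: stage_flow f L ?n "\<lambda>i. X (?p i)" "\<lambda>i. D (?p i)" a b by (rule F)
  interpret B: stage_flow f L ?n "\<lambda>i. X2 (?p i)" "\<lambda>i. D2 (?p i)" a b2 by (rule F2)
  have Xeq: "X2 (?p i) t = X (?p i) t" if "i \<in> {1..?n}" "t \<in> {a..min b b2}" for i t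
  proof (cases "b \<le> b2")
    case True have "X (?p i) t = X2 (?p i) t"
      by (rule stage_unique[OF F F2 True _ _ that(1)]) (use Xinit Dinit that True in auto)
    then show ?thesis by simp
  next
    case False then show ?thesis by (intro stage_unique[OF F2 F _ _ _ that(1)]) (use Xinit Dinit that in auto)
  qed
  have coll: "b = T \<or> (\<exists>i\<in>{1..<?n}. X (?p i) b = X (?p (i + 1)) b)" "b \<le> T"
    using st[unfolded particle_stage_def Let_def] by blast+
  have coll2: "b2 = T \<or> (\<exists>i\<in>{1..<?n}. X2 (?p i) b2 = X2 (?p (i + 1)) b2)" "b2 \<le> T"
    using st2[unfolded particle_stage_def Let_def] by blast+
  show bb: "b2 = b"
  proof (cases b b2 rule: linorder_cases)
    case less
    then obtain i where i: "i \<in> {1..<?n}" "X (?p i) b = X (?p (i + 1)) b" using coll coll2 by auto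
    have "X2 (?p i) b = X2 (?p (Suc i)) b" using Xeq[of i b] Xeq[of "Suc i" b] i less A.ab by auto
    then show ?thesis using B.gap_pos[OF i(1), of b] less A.ab by auto
  next
    case greater
    then obtain i where i: "i \<in> {1..<?n}" "X2 (?p i) b2 = X2 (?p (i + 1)) b2" using coll coll2 by auto
    have "X (?p i) b2 = X (?p (Suc i)) b2" using Xeq[of i b2] Xeq[of "Suc i" b2] i greater B.ab by auto
    then show ?thesis using A.gap_pos[OF i(1), of b2] greater B.ab by auto
  qed simp
  have Xb: "X2 (?p i) t = X (?p i) t" if "i \<in> {1..?n}" "t \<in> {a..b}" for i t
    using Xeq[OF that(1), of t] that(2) bb by simp
  then show "X2 k t = X k t" if "k \<in> S" "t \<in> {a..b}" for k t
    using enum_surj[OF v that(1)] that(2) by (metis atLeastAtMost_iff)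
  have Db: "D2 (?p i) t = D (?p i) t" if i: "i \<in> {1..?n}" and t: "t \<in> {a..<b}" for i t
  proof (cases "i \<in> {1..<?n}")
    case True have t2: "t \<in> {a..<b2}" using t bb by simp
    show ?thesis
      using A.dens'[OF True t] B.dens'[OF True t2] Xb[of i t] Xb[of "Suc i" t] Xinit[of i] Xinit[of "Suc i"] Dinit[of i] True t
      by simp
  next
    case False then have "i = ?n" using i by auto
    then show ?thesis using D0 D02 by (simp add: enum_card[OF v])
  qed
  then show D_eq: "D2 k t = D k t" if "k \<in> S" "t \<in> {a..<b}" for k t
    using enum_surj[OF v that(1)] that(2) by (metis atLeastAtMost_iff)
  note nx = particle_stage_next[OF st v c D0] and nx2 = particle_stage_next[OF st2 v c2 D02]
  have "survivors ?n (\<lambda>i. X2 (?p i) b2) = survivors ?n (\<lambda>i. X (?p i) b)"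
    using Xb A.ab unfolding bb by (auto simp: survivors_def)
  then show SS: "S2 = S'" using nx(1) nx2(1) by simp
  show "D2 k b = D k b" if k: "k \<in> S'" for k
  proof -
    have kS: "k \<in> S" using nx(3) k by auto
    have l1: "(D k \<longlongrightarrow> D k b) (at_left b)" using st[unfolded particle_stage_def Let_def] k by blast
    have "(D2 k \<longlongrightarrow> D2 k b) (at_left b)" using st2[unfolded particle_stage_def Let_def] k unfolding SS bb by blast
    then have "(D k \<longlongrightarrow> D2 k b) (at_left b)"
      by (rule Lim_transform_eventually)
         (rule eventually_mono[OF eventually_at_left_real[OF A.ab]], use D_eq[OF kS] in auto)
    from tendsto_unique[OF _ this l1] show ?thesis by simp
  qed
qed

end

section \<open>Existence and uniqueness of the approximation\<close>

lemma initial_config: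
  assumes "integrable lborel u0" "AE x in lborel. 0 \<le> u0 x" "1 \<le> N" "strict_mono_on {1..N} x0"
  shows "config N x0 (initial_density u0 N x0)"
proof -
  have "x0 i < x0 (Suc i)" if "i \<in> {1..<N}" for i using strict_mono_onD[OF assms(4), of i "Suc i"] that by auto
  moreover have "0 \<le> initial_density u0 N x0 i" for i
  proof (cases "1 \<le> i \<and> i \<le> N - 1")
    case True have "x0 i < x0 (i + 1)" using strict_mono_onD[OF assms(4), of i "i + 1"] True by auto
    moreover have "0 \<le> (LBINT x:{x0 i<..<x0 (i + 1)}. u0 x)" unfolding set_lebesgue_integral_def
      by (rule integral_nonneg_AE) (use assms(2) in \<open>auto elim!: eventually_mono simp: indicator_def\<close>)
    ultimately show ?thesis using True by (simp add: initial_density_def)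
  qed (auto simp: initial_density_def)
  ultimately show ?thesis using assms(3) by (auto simp: config_def initial_density_def)
qed

lemma enum_full: "i \<le> Suc N \<Longrightarrow> enum N {1..N} i = i"
proof -
  have "sorted_list_of_set {1..N} = [1..<Suc N]"
    using sorted_list_of_set_range[of 1 "Suc N"] by (simp add: atLeastLessThanSuc_atLeastAtMost)
  then show "i \<le> Suc N \<Longrightarrow> enum N {1..N} i = i" by (auto simp: enum_def simp del: upt_Suc)
qed

text \<open>The defining formulas overlap at the particles, so existence rests on their agreement
  there: all of them give the velocity of the particle. The number of particles strictly to the left
  of \<open>x\<close> selects the cell.\<close>

lemma interpolated_field_exists:
  assumes c: "config (card S) (\<lambda>i. y (enum N S i)) (\<lambda>i. d (enum N S i))"
  shows "\<exists>A. interpolated_field f N S y d A"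
proof -
  let ?n = "card S"
  define \<xi> where "\<xi> = (\<lambda>i. y (enum N S i))"
  define \<nu> where "\<nu> = (\<lambda>i. d (enum N S i))"
  define m where "m = (\<lambda>x. card {i\<in>{1..?n}. \<xi> i < x})"
  define A where "A = (\<lambda>x. if m x = 0 then particle_vel f \<nu> 1 else if m x = ?n then particle_vel f \<nu> ?n
    else cell_field f \<xi> \<nu> (m x) x)"
  have c': "config ?n \<xi> \<nu>" using c by (simp add: \<xi>_def \<nu>_def)
  have n: "1 \<le> ?n" using c by (simp add: config_def)
  have mono: "\<xi> i \<le> \<xi> j" if "1 \<le> i" "i \<le> j" "j \<le> ?n" for i j
    using config_less[OF c', of i j] that by (cases "i = j") auto
  have m: "m x = k" if "k \<le> ?n" "1 \<le> k \<Longrightarrow> \<xi> k < x" "k < ?n \<Longrightarrow> x \<le> \<xi> (Suc k)" for k x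
  proof -
    have "{i\<in>{1..?n}. \<xi> i < x} = {1..k}"
    proof (intro set_eqI iffI)
      fix i assume i: "i \<in> {i\<in>{1..?n}. \<xi> i < x}"
      show "i \<in> {1..k}"
      proof (rule ccontr)
        assume "i \<notin> {1..k}"
        then have "\<xi> (Suc k) \<le> \<xi> i" "k < ?n" using i mono[of "Suc k" i] by auto
        then show False using that(3) i by auto
      qed
    next
      fix i assume i: "i \<in> {1..k}"
      then have "\<xi> i \<le> \<xi> k" "\<xi> k < x" using mono[of i k] that by auto
      then show "i \<in> {i\<in>{1..?n}. \<xi> i < x}" using i that(1) by auto
    qed
    then show ?thesis by (simp add: m_def)
  qed
  have left: "A x = particle_vel f \<nu> 1" if "x \<le> \<xi> 1" for x using m[of 0 x] that by (simp add: A_def)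
  have inner: "A x = cell_field f \<xi> \<nu> i x" if i: "i \<in> {1..<?n}" and x: "x \<in> {\<xi> i..\<xi> (Suc i)}" for i x
  proof (cases "x = \<xi> i")
    case True have lt: "\<xi> i < \<xi> (Suc i)" using c' i by (simp add: config_def)
    then have r: "cell_field f \<xi> \<nu> i x = particle_vel f \<nu> i" using True by (simp add: cell_field_def)
    show ?thesis
    proof (cases "i = 1")
      case True then show ?thesis using left[of x] \<open>x = \<xi> i\<close> r by simp
    next
      case False
      then obtain k where k: "i = Suc k" "1 \<le> k" using i by (cases i) auto
      have lt': "\<xi> k < \<xi> (Suc k)" using c' i k by (simp add: config_def)
      then have "m x = k" using m[of k x] i k True by auto
      then have "A x = cell_field f \<xi> \<nu> k x" using k i by (simp add: A_def)
      then show ?thesis using r lt' True k by (simp add: cell_field_def)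
    qed
  next
    case False then have "m x = i" using m[of i x] i x by auto
    then show ?thesis using i by (simp add: A_def)
  qed
  have right: "A x = particle_vel f \<nu> ?n" if "\<xi> ?n \<le> x" for x
  proof (cases "x = \<xi> ?n")
    case True show ?thesis
    proof (cases "?n = 1")
      case True then show ?thesis using left[of x] \<open>x = \<xi> ?n\<close> by simp
    next
      case False
      then obtain k where k: "?n = Suc k" "1 \<le> k" using n by (cases ?n) auto
      have lt': "\<xi> k < \<xi> (Suc k)" using c' k by (simp add: config_def)
      then show ?thesis using inner[of k x] True k by (simp add: cell_field_def)
    qed
  next
    case False then have "m x = ?n" using m[of ?n x] that by auto
    then show ?thesis using n by (simp add: A_def)
  qed
  have "interpolated_field f N S y d A" unfolding interpolated_field_def Let_def using left inner right
    by (auto simp: \<xi>_def \<nu>_def cell_field_def particle_vel_def)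
  then show ?thesis by (rule exI[of _ A])
qed

lemma step_profile_cong:
  assumes v: "valid_index N S" and "\<And>k. k \<in> S \<Longrightarrow> y' k = y k" "\<And>k. k \<in> S \<Longrightarrow> d' k = d k" "d' 0 = d 0"
  shows "step_profile N S y' d' x = step_profile N S y d x"
proof -
  have S: "enum N S i \<in> S" if "1 \<le> i" "i \<le> card S" for i using enum_in[OF v that] .
  have d: "d' (enum N S i) = d (enum N S i)" if "i \<le> card S" for i
    using S[of i] assms(3,4) that by (cases "i = 0") auto
  have p: "pos N y' (enum N S i) = pos N y (enum N S i)" if i: "i \<le> Suc (card S)" for i
  proof -
    consider "i = 0" | "i = Suc (card S)" | "1 \<le> i" "i \<le> card S" using i by linarith
    then show ?thesis
    proof cases
      case 3 then show ?thesis using S[OF 3] assms(2) by (simp add: pos_def)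
    qed (simp_all add: pos_def)
  qed
  show ?thesis unfolding step_profile_def by (rule sum.cong) (use d p in auto)
qed

section \<open>A complete run with its stage times\<close>

locale particle_system = flux f L for f :: "real \<Rightarrow> real" and L :: real +
  fixes u0 :: "real \<Rightarrow> real" and T :: real and N :: nat and x0 :: "nat \<Rightarrow> real" and J :: nat
    and \<tau> :: "nat \<Rightarrow> real" and I :: "nat \<Rightarrow> nat set" and X D :: "nat \<Rightarrow> real \<Rightarrow> real"
  assumes T_pos: "0 < T" and conf0: "config N x0 (initial_density u0 N x0)"
    and run: "particle_run f u0 T N x0 J \<tau> I X D"
begin

lemma D_ends: "D 0 t = 0 \<and> D N t = 0" using run unfolding particle_run_def by blast

lemma stage: "j < J \<Longrightarrow> particle_stage f T N X D (\<tau> j) (\<tau> (Suc j)) (I j) (I (Suc j))"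
  using run unfolding particle_run_def by blast

lemma tau_0: "\<tau> 0 = 0" and tau_J: "\<tau> J = T" and I_0: "I 0 = {1..N}" using run unfolding particle_run_def by blast+

lemma tau_step: "j < J \<Longrightarrow> \<tau> j < \<tau> (Suc j)" using stage unfolding particle_stage_def Let_def by blast

lemma tau_less: "i < j \<Longrightarrow> j \<le> J \<Longrightarrow> \<tau> i < \<tau> j"
proof (induction j)
  case (Suc j) then show ?case using tau_step[of j] by (cases "i = j") auto
qed simp

lemma tau_mono: "i \<le> j \<Longrightarrow> j \<le> J \<Longrightarrow> \<tau> i \<le> \<tau> j" using tau_less[of i j] by (cases "i = j") auto

lemma initial_stage: "valid_index N (I 0)" "k \<le> N \<Longrightarrow> D k 0 = initial_density u0 N x0 k" "k \<in> {1..N} \<Longrightarrow> X k 0 = x0 k"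
proof -
  have N: "1 \<le> N" using conf0 by (simp add: config_def)
  then show "valid_index N (I 0)" by (simp add: valid_index_def I_0)
  show "k \<in> {1..N} \<Longrightarrow> X k 0 = x0 k" using run unfolding particle_run_def by blast
  show "D k 0 = initial_density u0 N x0 k" if "k \<le> N"
  proof (cases "k = 0")
    case True then show ?thesis using D_ends by (simp add: initial_density_def)
  next
    case False then have "k \<in> {1..N}" using that by simp
    then show ?thesis using run unfolding particle_run_def by blast
  qed
qed

lemma stage_start: "j \<le> J \<Longrightarrow> valid_index N (I j) \<and> run_config N (I j) X D (\<tau> j)"
proof (induction j)
  case 0 have "card {1..N} = N" by simp
  then have "run_config N (I 0) X D 0"
    unfolding I_0 by (simp only:) (rule config_cong[OF conf0], auto simp: enum_full initial_stage simp del: One_nat_def)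
  then show ?case using initial_stage(1) tau_0 by simp
next
  case (Suc j) then have j: "j < J" "valid_index N (I j)" "run_config N (I j) X D (\<tau> j)" by auto
  show ?case using particle_stage_next(2,4)[OF stage[OF j(1)] j(2,3) D_ends] by blast
qed

lemma stage_valid: "j \<le> J \<Longrightarrow> valid_index N (I j)" using stage_start by blast

lemma flow: "j < J \<Longrightarrow> stage_flow f L (card (I j)) (\<lambda>i. X (enum N (I j) i)) (\<lambda>i. D (enum N (I j) i)) (\<tau> j) (\<tau> (Suc j))"
  using stage_start[of j] by (intro particle_stage_flow[OF stage _ _ D_ends]) auto

lemma stage_config: "j < J \<Longrightarrow> t \<in> {\<tau> j..<\<tau> (Suc j)} \<Longrightarrow> run_config N (I j) X D t" by (rule stage_flow.conf[OF flow])

abbreviation in_stage :: "nat \<Rightarrow> real \<Rightarrow> bool" where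
  "in_stage j t \<equiv> (if j < J then \<tau> j \<le> t \<and> t < \<tau> (Suc j) else t = T)"

text \<open>The index of the stage in progress as a function of time; at \<open>T\<close> it is
  \<open>J\<close>, which belongs to the final index set.\<close>

definition active :: "real \<Rightarrow> nat" where "active t = card {j\<in>{1..J}. \<tau> j \<le> t}"

lemma active_eq:
  assumes "in_stage j t" "j \<le> J"
  shows "active t = j"
proof -
  have "{k\<in>{1..J}. \<tau> k \<le> t} = {1..j}"
  proof (intro set_eqI iffI)
    fix k assume k: "k \<in> {k\<in>{1..J}. \<tau> k \<le> t}"
    show "k \<in> {1..j}"
    proof (rule ccontr)
      assume "k \<notin> {1..j}"
      then have "j < J" "\<tau> (Suc j) \<le> \<tau> k" using k tau_mono[of "Suc j" k] by auto
      then show False using assms(1) k by auto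
    qed
  next
    fix k assume k: "k \<in> {1..j}"
    then have "\<tau> k \<le> \<tau> j" using tau_mono[of k j] assms(2) by auto
    moreover have "\<tau> j \<le> t" using assms tau_J by (cases "j < J") auto
    ultimately show "k \<in> {k\<in>{1..J}. \<tau> k \<le> t}" using k assms(2) by auto
  qed
  then show ?thesis by (simp add: active_def)
qed

lemma active_range:
  assumes "t \<in> {0..T}"
  obtains j where "j \<le> J" "in_stage j t"
proof -
  have fin: "finite {j. j \<le> J \<and> \<tau> j \<le> t}" by simp
  have ne: "0 \<in> {j. j \<le> J \<and> \<tau> j \<le> t}" using tau_0 assms by simp
  define j where "j = Max {j. j \<le> J \<and> \<tau> j \<le> t}"
  have j: "j \<le> J" "\<tau> j \<le> t" using Max_in[OF fin] ne unfolding j_def by blast+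
  have "t < \<tau> (Suc j)" if "j < J"
  proof (rule ccontr)
    assume "\<not> t < \<tau> (Suc j)"
    then have "Suc j \<in> {j. j \<le> J \<and> \<tau> j \<le> t}" using that by auto
    then have "Suc j \<le> j" unfolding j_def by (rule Max_ge[OF fin])
    then show False by simp
  qed
  moreover have "t = T" if "\<not> j < J" using that j tau_J assms by (cases "j = J") auto
  ultimately have "in_stage j t" using j by auto
  then show thesis by (rule that[OF j(1)])
qed

lemma scheme_exists: "\<exists>v A. particle_scheme f u0 T N x0 v A"
proof -
  have c: "run_config N (I j) X D t" if "j \<le> J" "in_stage j t" for j t
  proof (cases "j < J")
    case True then show ?thesis using that(2) stage_config[OF True] by auto
  next
    case False then show ?thesis using that tau_J stage_start[of J] by auto
  qed
  define v where "v = (\<lambda>x t. step_profile N (I (active t)) (\<lambda>i. X i t) (\<lambda>i. D i t) x)"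
  define A where "A = (\<lambda>x t. (SOME A. interpolated_field f N (I (active t)) (\<lambda>i. X i t) (\<lambda>i. D i t) A) x)"
  have "interpolated_field f N (I j) (\<lambda>i. X i t) (\<lambda>i. D i t) (\<lambda>x. A x t)" if "j \<le> J" "in_stage j t" for j t
    using someI_ex[OF interpolated_field_exists[OF c[OF that]]] active_eq[OF that(2,1)] unfolding A_def by simp
  moreover have "v x t = step_profile N (I j) (\<lambda>i. X i t) (\<lambda>i. D i t) x" if "j \<le> J" "in_stage j t" for j t x
    using active_eq[OF that(2,1)] by (simp add: v_def)
  ultimately have "particle_scheme f u0 T N x0 v A" unfolding particle_scheme_def
    by (intro exI[of _ J] exI[of _ \<tau>] exI[of _ I] exI[of _ X] exI[of _ D] conjI run allI impI) auto
  then show ?thesis by blast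
qed

text \<open>Induction over the stages: agreement of the data at \<open>\<tau> j\<close> determines
  the next stage. Agreement at all earlier times is carried along, since the profile has to be
  unique at every time.\<close>

lemma run_unique:
  assumes B: "particle_system f L u0 T N x0 J2 \<tau>2 I2 X2 D2" and "j \<le> J"
  shows "j \<le> J2 \<and> \<tau>2 j = \<tau> j \<and> I2 j = I j \<and> (\<forall>k\<in>I j. X2 k (\<tau> j) = X k (\<tau> j) \<and> D2 k (\<tau> j) = D k (\<tau> j)) \<and>
     (\<forall>i<j. \<forall>k\<in>I i. (\<forall>t\<in>{\<tau> i..<\<tau> (Suc i)}. X2 k t = X k t \<and> D2 k t = D k t))" using assms(2)
proof (induction j)
  case 0
  interpret B: particle_system f L u0 T N x0 J2 \<tau>2 I2 X2 D2 by (rule B)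
  show ?case using tau_0 B.tau_0 I_0 B.I_0 initial_stage B.initial_stage by auto
next
  case (Suc j)
  interpret B: particle_system f L u0 T N x0 J2 \<tau>2 I2 X2 D2 by (rule B)
  have j: "j < J" using Suc.prems by simp
  then have IH: "j \<le> J2" "\<tau>2 j = \<tau> j" "I2 j = I j" "\<And>k. k \<in> I j \<Longrightarrow> X2 k (\<tau> j) = X k (\<tau> j) \<and> D2 k (\<tau> j) = D k (\<tau> j)"
    "\<And>i k t. i < j \<Longrightarrow> k \<in> I i \<Longrightarrow> t \<in> {\<tau> i..<\<tau> (Suc i)} \<Longrightarrow> X2 k t = X k t \<and> D2 k t = D k t" using Suc.IH by auto
  \<comment> \<open>The second run cannot stop at \<open>\<tau> j\<close>, as its last stage time is
    \<open>T\<close>.\<close>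
  have "\<tau> j < T" using tau_less[of j J] j tau_J by simp
  then have j2: "j < J2" using IH(1,2) B.tau_J by (cases "j = J2") auto
  note ss = stage_start[of j]
  have v: "valid_index N (I j)" "run_config N (I j) X D (\<tau> j)" using stage_start[of j] j by auto
  have st2: "particle_stage f T N X2 D2 (\<tau> j) (\<tau>2 (Suc j)) (I j) (I2 (Suc j))"
    using B.stage[OF j2] unfolding IH(2,3) .
  note U = particle_stage_unique[OF stage[OF j] st2 v D_ends B.D_ends IH(4)]
  have U3: "X2 k t = X k t" if "k \<in> I j" "t \<in> {\<tau> j..\<tau> (Suc j)}" for k t using U(3) that by blast
  have U4: "D2 k t = D k t" if "k \<in> I j" "t \<in> {\<tau> j..<\<tau> (Suc j)}" for k t using U(4) that by blast
  have U5: "D2 k (\<tau> (Suc j)) = D k (\<tau> (Suc j))" if "k \<in> I (Suc j)" for k using U(5) that by blast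
  have sub: "I (Suc j) \<subseteq> I j" by (rule particle_stage_next(3)[OF stage[OF j] v D_ends])
  show ?case
  proof (intro conjI ballI allI impI)
    show "Suc j \<le> J2" using j2 by simp
    show "\<tau>2 (Suc j) = \<tau> (Suc j)" "I2 (Suc j) = I (Suc j)" by (rule U(1), assumption) (rule U(2), assumption)
    show "X2 k (\<tau> (Suc j)) = X k (\<tau> (Suc j))" if "k \<in> I (Suc j)" for k
      using U3[of k "\<tau> (Suc j)"] sub that tau_step[OF j] by auto
    show "D2 k (\<tau> (Suc j)) = D k (\<tau> (Suc j))" if "k \<in> I (Suc j)" for k by (rule U5[OF that])
    show "X2 k t = X k t" if "i < Suc j" "k \<in> I i" "t \<in> {\<tau> i..<\<tau> (Suc i)}" for i k t
      using IH(5)[of i k t] U3[of k t] that by (cases "i = j") auto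
    show "D2 k t = D k t" if "i < Suc j" "k \<in> I i" "t \<in> {\<tau> i..<\<tau> (Suc i)}" for i k t
      using IH(5)[of i k t] U4[of k t] that by (cases "i = j") auto
  qed
qed

lemma profile_unique:
  assumes B: "particle_system f L u0 T N x0 J2 \<tau>2 I2 X2 D2" and v: "\<And>j t x. j \<le> J \<Longrightarrow> in_stage j t \<Longrightarrow>
      v x t = step_profile N (I j) (\<lambda>i. X i t) (\<lambda>i. D i t) x"
    and v2: "\<And>j t x. j \<le> J2 \<Longrightarrow> (if j < J2 then \<tau>2 j \<le> t \<and> t < \<tau>2 (Suc j) else t = T) \<Longrightarrow>
      v2 x t = step_profile N (I2 j) (\<lambda>i. X2 i t) (\<lambda>i. D2 i t) x" and t: "t \<in> {0..T}"
  shows "v x t = v2 x t"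
proof -
  interpret B: particle_system f L u0 T N x0 J2 \<tau>2 I2 X2 D2 by (rule B)
  have "J \<le> J2" using run_unique[OF B order_refl] by blast
  moreover have "J2 \<le> J" using B.run_unique[OF particle_system_axioms order_refl] by blast
  ultimately have J2: "J2 = J" by simp
  obtain j where j: "j \<le> J" "in_stage j t" by (rule active_range[OF t])
  have U: "\<tau>2 i = \<tau> i" "I2 i = I i" if "i \<le> J" for i using run_unique[OF B that] by blast+
  have j2: "j \<le> J2" "if j < J2 then \<tau>2 j \<le> t \<and> t < \<tau>2 (Suc j) else t = T"
    using j U[of j] U[of "Suc j"] J2 by (auto split: if_splits)
  have XD: "X2 k t = X k t \<and> D2 k t = D k t" if k: "k \<in> I j" for k
  proof (cases "j < J")
    case True then show ?thesis using run_unique[OF B order_refl] j k by auto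
  next
    case False then have "j = J" "t = \<tau> J" using j tau_J by auto
    then show ?thesis using run_unique[OF B order_refl] k by auto
  qed
  have "step_profile N (I2 j) (\<lambda>i. X2 i t) (\<lambda>i. D2 i t) x = step_profile N (I j) (\<lambda>i. X i t) (\<lambda>i. D i t) x"
    unfolding U(2)[OF j(1)] by (rule step_profile_cong[OF stage_valid[OF j(1)]]) (use XD D_ends B.D_ends in auto)
  then show ?thesis using v[OF j] v2[OF j2] by simp
qed

end

lemma (in flux) particle_run_exists:
  assumes "0 < T" "config N x0 (initial_density u0 N x0)"
  obtains J \<tau> I X D where "particle_run f u0 T N x0 J \<tau> I X D"
proof -
  have N: "1 \<le> N" using assms(2) by (simp add: config_def)
  have v: "valid_index N {1..N}" using N by (simp add: valid_index_def)
  have "card {1..N} = N" by simp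
  then have c: "config (card {1..N}) (\<lambda>i. x0 (enum N {1..N} i)) (\<lambda>i. initial_density u0 N x0 (enum N {1..N} i))"
    by (simp only:) (rule config_cong[OF assms(2)], auto simp: enum_full simp del: One_nat_def)
  obtain J \<tau> I X D where R: "\<tau> 0 = 0" "\<tau> J = T" "I 0 = {1..N}"
    "\<forall>k\<in>{1..N}. X k 0 = x0 k \<and> D k 0 = initial_density u0 N x0 k" "\<forall>t. D 0 t = 0 \<and> D N t = 0"
    "\<forall>j<J. valid_index N (I j) \<and> I j \<subseteq> {1..N} \<and> 0 \<le> \<tau> j \<and> particle_stage f T N X D (\<tau> j) (\<tau> (Suc j)) (I j) (I (Suc j))"
    using run_exists[OF v c assms(1)] by (elim exE conjE) (rule that; assumption)
  have "particle_run f u0 T N x0 J \<tau> I X D" unfolding particle_run_def using R by blast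
  then show ?thesis by (rule that)
qed

section \<open>Total variation of the cell averages\<close>

text \<open>Total variation is defined through C1 test functions. A Lipschitz \<psi> is approximated
  by its means \<open>\<phi> k\<close> over \<open>{x..x + h k}\<close>, whose derivatives are
  difference quotients: bounded by \<open>C\<close> and convergent to \<open>g\<close> outside the
  finite set \<open>F\<close>.\<close>

lemma variation_pairing_le:
  fixes \<psi> g :: "real \<Rightarrow> real"
  assumes u0: "integrable lborel u0" and bv: "finite_BV u0"
    and lip: "C-lipschitz_on UNIV \<psi>" and bd: "\<And>x. \<bar>\<psi> x\<bar> \<le> 1" and supp: "\<And>x. x \<notin> {p..r} \<Longrightarrow> \<psi> x = 0"
    and fin: "finite F" and der: "\<And>x. x \<notin> F \<Longrightarrow> DERIV \<psi> x :> g x" and g: "g \<in> borel_measurable borel"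
  shows "(LBINT x. u0 x * g x) \<le> total_var u0"
proof -
  have cont: "continuous_on UNIV \<psi>" by (rule lipschitz_on_continuous_on[OF lip])
  obtain G where G: "\<And>x. DERIV G x :> \<psi> x" using continuous_antiderivative[OF cont] by blast
  define h where "h = (\<lambda>k. inverse (real (Suc k)))"
  have h: "0 < h k" "h k \<le> 1" for k by (auto simp: h_def inverse_le_1_iff)
  define \<phi> where "\<phi> = (\<lambda>k x. (G (x + h k) - G x) / h k)"
  define q where "q = (\<lambda>k x. (\<psi> (x + h k) - \<psi> x) / h k)"
  have mv: "\<exists>z. x < z \<and> z < x + h k \<and> \<phi> k x = \<psi> z" for k x
  proof -
    obtain z where "x < z" "z < x + h k" "G (x + h k) - G x = (x + h k - x) * \<psi> z"
      using MVT2[of x "x + h k" G \<psi>] G h(1)[of k] by auto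
    then show ?thesis using h(1)[of k] by (intro exI[of _ z]) (simp add: \<phi>_def)
  qed
  have d\<phi>: "DERIV (\<phi> k) x :> q k x" for k x
  proof -
    have "DERIV (\<lambda>x. G (x + h k)) x :> \<psi> (x + h k)" using G[of "x + h k"] by (simp add: DERIV_shift)
    from DERIV_cdivide[OF DERIV_diff[OF this G[of x]]] show ?thesis unfolding \<phi>_def q_def .
  qed
  have q_cont: "continuous_on UNIV (q k)" for k unfolding q_def
    by (intro continuous_intros continuous_on_compose2[OF cont]) (use h(1)[of k] in auto)
  have le: "(LBINT x. u0 x * q k x) \<le> total_var u0" for k
  proof -
    have "\<phi> k C1_differentiable_on UNIV" unfolding C1_differentiable_on_def
      by (intro exI[of _ "q k"]) (use d\<phi> q_cont in \<open>auto simp: has_real_derivative_iff_has_vector_derivative\<close>)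
    moreover have "compact (closure {x. \<phi> k x \<noteq> 0})"
    proof -
      have "{x. \<phi> k x \<noteq> 0} \<subseteq> {p - 1..r}"
      proof
        fix x assume "x \<in> {x. \<phi> k x \<noteq> 0}"
        then obtain z where z: "x < z" "z < x + h k" "\<psi> z \<noteq> 0" using mv[of x k] by auto
        then have "z \<in> {p..r}" using supp by blast
        then show "x \<in> {p - 1..r}" using z h(2)[of k] by auto
      qed
      then have "bounded {x. \<phi> k x \<noteq> 0}" using bounded_subset bounded_closed_interval by blast
      then show ?thesis by (simp add: compact_closure)
    qed
    moreover have "\<bar>\<phi> k x\<bar> \<le> 1" for x using mv[of x k] bd by force
    moreover have "deriv (\<phi> k) x = q k x" for x by (rule DERIV_imp_deriv[OF d\<phi>])
    ultimately have "(LBINT x. u0 x * q k x) \<in> variation_pairings u0"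
      unfolding variation_pairings_def by (intro CollectI exI[of _ "\<phi> k"]) auto
    then show ?thesis using bv unfolding total_var_def finite_BV_def by (rule cSup_upper)
  qed
  have "(\<lambda>k. LBINT x. u0 x * q k x) \<longlonglongrightarrow> (LBINT x. u0 x * g x)"
  proof (rule integral_dominated_convergence)
    show "integrable lborel (\<lambda>x. C * \<bar>u0 x\<bar>)" using u0 by simp
    show "(\<lambda>x. u0 x * g x) \<in> borel_measurable lborel" using u0 g by simp
    show "(\<lambda>x. u0 x * q k x) \<in> borel_measurable lborel" for k
      using u0 borel_measurable_continuous_onI[OF q_cont[of k]] by simp
    show "AE x in lborel. norm (u0 x * q k x) \<le> C * \<bar>u0 x\<bar>" for k
    proof (rule AE_I2)
      fix x
      have "\<bar>\<psi> (x + h k) - \<psi> x\<bar> \<le> C * h k"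
        using lipschitz_onD[OF lip, of "x + h k" x] h(1)[of k] by (simp add: dist_real_def)
      then have "\<bar>q k x\<bar> \<le> C" using h(1)[of k] by (simp add: q_def abs_divide divide_le_eq)
      then show "norm (u0 x * q k x) \<le> C * \<bar>u0 x\<bar>"
        using mult_right_mono[of "\<bar>q k x\<bar>" C "\<bar>u0 x\<bar>"] by (simp add: abs_mult mult.commute)
    qed
    have "AE x in lborel. x \<notin> F" using finite_imp_null_set_lborel[OF fin] by (rule AE_not_in)
    then show "AE x in lborel. (\<lambda>k. u0 x * q k x) \<longlonglongrightarrow> u0 x * g x"
    proof (rule eventually_mono)
      fix x assume "x \<notin> F"
      then have "((\<lambda>e. (\<psi> (x + e) - \<psi> x) / e) \<longlongrightarrow> g x) (at 0)" using der by (simp add: DERIV_def)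
      moreover have "filterlim h (at 0) sequentially"
        by (rule filterlim_atI) (use LIMSEQ_inverse_real_of_nat h(1) in \<open>auto simp: h_def\<close>)
      ultimately have "(\<lambda>k. q k x) \<longlonglongrightarrow> g x" unfolding q_def by (rule filterlim_compose)
      then show "(\<lambda>k. u0 x * q k x) \<longlonglongrightarrow> u0 x * g x" by (rule tendsto_mult_left)
    qed
  qed
  from LIMSEQ_le_const2[OF this] le show ?thesis by blast
qed

section \<open>Piecewise linear test functions\<close>

definition ramp :: "real \<Rightarrow> real \<Rightarrow> real \<Rightarrow> real" where "ramp p q x = min 1 (max 0 ((x - p) / (q - p)))"

lemma ramp_left: "p < q \<Longrightarrow> x \<le> p \<Longrightarrow> ramp p q x = 0" by (simp add: ramp_def divide_nonpos_pos)

lemma ramp_right: "p < q \<Longrightarrow> q \<le> x \<Longrightarrow> ramp p q x = 1" by (simp add: ramp_def field_simps)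

lemma ramp_range: "0 \<le> ramp p q x" "ramp p q x \<le> 1" by (auto simp: ramp_def)

lemma ramp_lipschitz:
  assumes "p < q"
  shows "(1 / (q - p))-lipschitz_on UNIV (ramp p q)"
proof (rule lipschitz_onI)
  fix x y
  have "\<bar>ramp p q x - ramp p q y\<bar> \<le> \<bar>(x - p) / (q - p) - (y - p) / (q - p)\<bar>" unfolding ramp_def by linarith
  also have "\<dots> = 1 / (q - p) * \<bar>x - y\<bar>" using assms by (simp add: diff_divide_distrib[symmetric] abs_divide)
  finally show "dist (ramp p q x) (ramp p q y) \<le> 1 / (q - p) * dist x y" by (simp add: dist_real_def)
qed (use assms in simp)

lemma ramp_deriv:
  assumes "p < q" "x \<noteq> p" "x \<noteq> q"
  shows "DERIV (ramp p q) x :> indicator {p<..<q} x / (q - p)"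
proof -
  consider "x < p" | "p < x" "x < q" | "q < x" using assms by linarith
  then show ?thesis
  proof cases
    case 1 have "DERIV (ramp p q) x :> 0"
      by (rule has_field_derivative_transform_within_open[OF DERIV_const[of 0], of "{..<p}"]) (use 1 assms in \<open>auto simp: ramp_left\<close>)
    then show ?thesis using 1 by simp
  next
    case 2 have "DERIV (\<lambda>x. (x - p) / (q - p)) x :> 1 / (q - p)" using assms by (auto intro!: derivative_eq_intros)
    then have "DERIV (ramp p q) x :> 1 / (q - p)"
      by (rule has_field_derivative_transform_within_open[of _ _ _ "{p<..<q}"]) (use 2 assms in \<open>auto simp: ramp_def field_simps\<close>)
    then show ?thesis using 2 by simp
  next
    case 3 have "DERIV (ramp p q) x :> 0"
      by (rule has_field_derivative_transform_within_open[OF DERIV_const[of 1], of "{q<..}"]) (use 3 assms in \<open>auto simp: ramp_right\<close>)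
    then show ?thesis using 3 by simp
  qed
qed

text \<open>For increasing \<open>y\<close> and \<open>s 0 = 0\<close> this is the piecewise linear
  function with value \<open>s i\<close> at \<open>y i\<close>, constant outside the nodes.\<close>

definition interpolant :: "(nat \<Rightarrow> real) \<Rightarrow> (nat \<Rightarrow> real) \<Rightarrow> nat \<Rightarrow> real \<Rightarrow> real" where
  "interpolant y s n x = (\<Sum>i<n. (s (Suc i) - s i) * ramp (y i) (y (Suc i)) x)"

lemma interpolant_bounds:
  assumes y: "\<And>i. i < n \<Longrightarrow> y i < y (Suc i)" and s: "\<And>i. \<bar>s i\<bar> \<le> 1" "s 0 = 0"
  shows "\<bar>interpolant y s n x\<bar> \<le> 1 \<and> (y n \<le> x \<longrightarrow> interpolant y s n x = s n) \<and> (x \<le> y 0 \<longrightarrow> interpolant y s n x = 0)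
    \<and> y 0 \<le> y n" using y
proof (induction n)
  case 0 then show ?case using s by (simp add: interpolant_def)
next
  case (Suc n)
  let ?c = "ramp (y n) (y (Suc n)) x"
  have lt: "y n < y (Suc n)" using Suc.prems by simp
  have IH: "\<bar>interpolant y s n x\<bar> \<le> 1" "y n \<le> x \<Longrightarrow> interpolant y s n x = s n"
    "x \<le> y 0 \<Longrightarrow> interpolant y s n x = 0" "y 0 \<le> y n" using Suc by auto
  have step: "interpolant y s (Suc n) x = interpolant y s n x + (s (Suc n) - s n) * ?c"
    by (simp add: interpolant_def)
  show ?case
  proof (cases "x \<le> y n")
    case True then have "?c = 0" by (rule ramp_left[OF lt])
    then show ?thesis unfolding step using IH True lt by auto
  next
    case False then have e: "interpolant y s (Suc n) x = (1 - ?c) * s n + ?c * s (Suc n)"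
      unfolding step using IH(2) by (simp add: algebra_simps)
    have "\<bar>(1 - ?c) * s n\<bar> \<le> 1 - ?c" "\<bar>?c * s (Suc n)\<bar> \<le> ?c"
      using mult_left_mono[OF s(1)[of n], of "1 - ?c"] mult_left_mono[OF s(1)[of "Suc n"], of ?c] ramp_range[of "y n" "y (Suc n)" x]
      by (simp_all add: abs_mult)
    then have "\<bar>interpolant y s (Suc n) x\<bar> \<le> 1" unfolding e by linarith
    moreover have "interpolant y s (Suc n) x = s (Suc n)" if "y (Suc n) \<le> x"
      using ramp_right[OF lt that] unfolding e by simp
    ultimately show ?thesis using False IH(4) lt by auto
  qed
qed

text \<open>On a cell the interpolant has slope
  \<open>(s (Suc i) - s i) / (y (Suc i) - y i)\<close>, so pairing it with \<open>u0\<close>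
  produces cell averages. Nodal values of modulus at most 1 make it an admissible Lipschitz test
  function.\<close>

lemma cell_averages_variation:
  fixes u0 :: "real \<Rightarrow> real" and y s :: "nat \<Rightarrow> real"
  assumes u0: "integrable lborel u0" and bv: "finite_BV u0"
    and y: "\<And>i. i < n \<Longrightarrow> y i < y (Suc i)" and s: "\<And>i. \<bar>s i\<bar> \<le> 1" "s 0 = 0" "s n = 0"
  shows "(\<Sum>i<n. (s (Suc i) - s i) * (1 / (y (Suc i) - y i) * (LBINT x:{y i<..<y (Suc i)}. u0 x))) \<le> total_var u0"
proof -
  define g where "g = (\<lambda>x. \<Sum>i<n. (s (Suc i) - s i) * (indicator {y i<..<y (Suc i)} x / (y (Suc i) - y i)))"
  have "\<exists>C. C-lipschitz_on UNIV (interpolant y s m)" if "m \<le> n" for m using that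
  proof (induction m)
    case 0 then show ?case by (intro exI[of _ 0]) (simp add: interpolant_def lipschitz_on_constant)
  next
    case (Suc m)
    then obtain C where C: "C-lipschitz_on UNIV (interpolant y s m)" by auto
    have "(\<bar>s (Suc m) - s m\<bar> * (1 / (y (Suc m) - y m)))-lipschitz_on UNIV (\<lambda>x. (s (Suc m) - s m) * ramp (y m) (y (Suc m)) x)"
      by (rule lipschitz_on_cmult_real[OF ramp_lipschitz]) (use y Suc.prems in auto)
    from lipschitz_on_add[OF C this] show ?case by (auto simp: interpolant_def[abs_def])
  qed
  then obtain C where C: "C-lipschitz_on UNIV (interpolant y s n)" by blast
  note ib = interpolant_bounds[where y=y and s=s and n=n, OF y s(1,2)]
  have "(LBINT x. u0 x * g x) \<le> total_var u0"
  proof (rule variation_pairing_le[OF u0 bv C])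
    show "\<bar>interpolant y s n x\<bar> \<le> 1" for x using ib by blast
    show "interpolant y s n x = 0" if "x \<notin> {y 0..y n}" for x using ib[of x] that s(3) by auto
    show "finite (y ` {..n})" by simp
    show "DERIV (interpolant y s n) x :> g x" if x: "x \<notin> y ` {..n}" for x unfolding interpolant_def[abs_def] g_def
    proof (rule DERIV_sum)
      fix i assume i: "i \<in> {..<n}"
      have "DERIV (ramp (y i) (y (Suc i))) x :> indicator {y i<..<y (Suc i)} x / (y (Suc i) - y i)"
        by (rule ramp_deriv) (use i x y in auto)
      then show "((\<lambda>x. (s (Suc i) - s i) * ramp (y i) (y (Suc i)) x) has_real_derivative
          (s (Suc i) - s i) * (indicator {y i<..<y (Suc i)} x / (y (Suc i) - y i))) (at x)" by (rule DERIV_cmult)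
    qed
    show "g \<in> borel_measurable borel" unfolding g_def by measurable
  qed
  moreover have "(LBINT x. u0 x * g x) = (\<Sum>i<n. (s (Suc i) - s i) * (1 / (y (Suc i) - y i) * (LBINT x:{y i<..<y (Suc i)}. u0 x)))"
  proof -
    have int: "integrable lborel (\<lambda>x. indicator {y i<..<y (Suc i)} x * u0 x)" for i
      using integrable_mult_indicator[OF _ u0, of "{y i<..<y (Suc i)}"] by simp
    have "(LBINT x. u0 x * g x) = (LBINT x. (\<Sum>i<n. ((s (Suc i) - s i) / (y (Suc i) - y i)) * (indicator {y i<..<y (Suc i)} x * u0 x)))"
      unfolding g_def sum_distrib_left by (intro integral_cong sum.cong refl) simp
    also have "\<dots> = (\<Sum>i<n. (LBINT x. ((s (Suc i) - s i) / (y (Suc i) - y i)) * (indicator {y i<..<y (Suc i)} x * u0 x)))"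
      by (rule integral_sum) (use int in auto)
    finally show ?thesis by (simp add: set_lebesgue_integral_def)
  qed
  ultimately show ?thesis by simp
qed

text \<open>Duality, with the signs of the jumps as nodal values. The scheme puts density 0 in the
  outer cells, where duality needs averages: auxiliary outer cells of width \<open>R\<close> have
  averages of size at most \<open>M / R\<close>, which is negligible for large
  \<open>R\<close>.\<close>

lemma total_jump_initial:
  assumes u0: "integrable lborel u0" and bv: "finite_BV u0" and c: "config N x0 (initial_density u0 N x0)"
  shows "total_jump N (initial_density u0 N x0) \<le> total_var u0"
proof (rule field_le_epsilon)
  fix e :: real assume e: "0 < e"
  let ?d = "initial_density u0 N x0"
  define M where "M = (LBINT x. \<bar>u0 x\<bar>)"
  have M: "0 \<le> M" unfolding M_def by simp
  \<comment> \<open>The two auxiliary cells cost at most \<open>M / R\<close> each, which has to fit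
    into \<open>e\<close>; the 1 keeps \<open>R\<close> positive if \<open>M = 0\<close>.\<close>
  define R where "R = (2 * M + 1) / e"
  have R: "0 < R" "2 * M / R \<le> e" using e M by (auto simp: R_def field_simps)
  define y where "y = (\<lambda>i. if i = 0 then x0 1 - R else if i \<le> N then x0 i else x0 N + R)"
  \<comment> \<open>Minus the sign of the jump, because summation by parts moves the difference from
    \<open>s\<close> to the densities with a change of sign.\<close>
  define s where "s = (\<lambda>i. if 1 \<le> i \<and> i \<le> N then - sgn (?d i - ?d (i - 1)) else 0)"
  define m where "m = (\<lambda>i. 1 / (y (Suc i) - y i) * (LBINT x:{y i<..<y (Suc i)}. u0 x))"
  have N: "1 \<le> N" using c by (simp add: config_def)
  have ends: "?d 0 = 0" "?d N = 0" using c by (auto simp: config_def)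
  have y: "y i < y (Suc i)" if "i < Suc N" for i
    using c that R(1) N by (cases "i = N") (auto simp: y_def config_def)
  have s: "\<bar>s i\<bar> \<le> 1" for i by (simp add: s_def sgn_if)
  have "(\<Sum>i<Suc N. (s (Suc i) - s i) * m i) \<le> total_var u0"
    unfolding m_def by (rule cell_averages_variation[OF u0 bv]) (use y s in \<open>auto simp: s_def\<close>)
  moreover have mid: "m i = ?d i" if "1 \<le> i" "i < N" for i
    using that by (auto simp: m_def y_def initial_density_def)
  have small: "\<bar>m i\<bar> \<le> M / R" if "i = 0 \<or> i = N" for i
  proof -
    have len: "y (Suc i) - y i = R" using that N by (auto simp: y_def)
    have "\<bar>LBINT x:{y i<..<y (Suc i)}. u0 x\<bar> \<le> (LBINT x. \<bar>indicator {y i<..<y (Suc i)} x * u0 x\<bar>)"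
      unfolding set_lebesgue_integral_def by (simp add: integral_abs_bound)
    also have "\<dots> \<le> M" unfolding M_def by (rule integral_mono') (use u0 in \<open>auto simp: indicator_def\<close>)
    finally show ?thesis unfolding m_def len using R(1) by (simp add: abs_mult field_simps)
  qed
  have "(\<Sum>i<Suc N. (s (Suc i) - s i) * ?d i) - (\<Sum>i<Suc N. (s (Suc i) - s i) * m i) \<le> 2 * M / R"
  proof -
    obtain K where K: "N = Suc K" using N by (cases N) auto
    have eq: "(\<Sum>i<K. (s (Suc (Suc i)) - s (Suc i)) * m (Suc i)) = (\<Sum>i<K. (s (Suc (Suc i)) - s (Suc i)) * ?d (Suc i))"
      by (rule sum.cong) (use mid K in auto)
    have split: "(\<Sum>i<Suc N. h i) = h 0 + (\<Sum>i<K. h (Suc i)) + h N" for h :: "nat \<Rightarrow> real"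
      unfolding K sum.lessThan_Suc_shift[of h "Suc K"] by simp
    have sb: "\<bar>s (Suc i) - s i\<bar> \<le> 1" if "i = 0 \<or> i = N" for i using that s[of 1] s[of N] by (auto simp: s_def)
    have "\<bar>(s (Suc i) - s i) * m i\<bar> \<le> M / R" if "i = 0 \<or> i = N" for i
      using mult_mono[OF sb[OF that] small[OF that]] by (simp add: abs_mult)
    from this[of 0] this[of N] show ?thesis unfolding split eq ends by (simp add: abs_le_iff)
  qed
  moreover have "(\<Sum>i<Suc N. (s (Suc i) - s i) * ?d i) = total_jump N ?d"
  proof -
    have "(\<Sum>i<Suc N. (s (Suc i) - s i) * ?d i) = (\<Sum>i\<le>N. ?d i * (s (Suc i) - s i))"
      by (simp add: lessThan_Suc_atMost mult.commute)
    also have "\<dots> = (\<Sum>i<N. s (Suc i) * (?d i - ?d (Suc i)))" unfolding sum_by_parts by (simp add: ends)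
    also have "\<dots> = total_jump N ?d" unfolding total_jump_def by (rule sum.cong) (auto simp: s_def sgn_if)
    finally show ?thesis .
  qed
  ultimately show "total_jump N ?d \<le> total_var u0 + e" using R(2) by linarith
qed

section \<open>The flux error of the approximation\<close>

lemma cell_locate:
  fixes \<xi> :: "nat \<Rightarrow> real"
  assumes "\<And>i. i \<in> {1..n} \<Longrightarrow> x \<noteq> \<xi> i"
  obtains m where "m \<le> n" "1 \<le> m \<Longrightarrow> \<xi> m < x" "m < n \<Longrightarrow> x < \<xi> (Suc m)"
proof -
  have "\<exists>m\<le>n. (1 \<le> m \<longrightarrow> \<xi> m < x) \<and> (m < n \<longrightarrow> x < \<xi> (Suc m))" using assms
  proof (induction n)
    case (Suc n)
    then obtain m where m: "m \<le> n" "1 \<le> m \<longrightarrow> \<xi> m < x" "m < n \<longrightarrow> x < \<xi> (Suc m)" by auto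
    show ?case
    proof (cases "x < \<xi> (Suc n)")
      case True then have "m < Suc n \<longrightarrow> x < \<xi> (Suc m)" using m by (cases "m = n") auto
      then show ?thesis using m by (intro exI[of _ m]) auto
    next
      case False then have "\<xi> (Suc n) < x" using Suc.prems[of "Suc n"] by auto
      then show ?thesis by (intro exI[of _ "Suc n"]) auto
    qed
  qed simp
  then show ?thesis using that by blast
qed

lemma config_order:
  assumes c: "config n \<xi> \<nu>" and m: "m \<le> n" "1 \<le> m \<Longrightarrow> \<xi> m < x" "m < n \<Longrightarrow> x < \<xi> (Suc m)" and i: "i \<in> {1..n}"
  shows "\<xi> i < x \<longleftrightarrow> i \<le> m" "x < \<xi> i \<longleftrightarrow> m < i"
proof -
  have "\<xi> i < x" if "i \<le> m" using config_less[OF c, of i m] m that i by (cases "i = m") auto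
  moreover have "x < \<xi> i" if "m < i" using config_less[OF c, of "Suc m" i] m that i by (cases "i = Suc m") auto
  ultimately show "\<xi> i < x \<longleftrightarrow> i \<le> m" "x < \<xi> i \<longleftrightarrow> m < i" by (meson not_less order_less_asym)+
qed

lemma jump_profile_eq:
  assumes c: "config n \<xi> \<nu>" and m: "m \<le> n" "1 \<le> m \<Longrightarrow> \<xi> m < x" "m < n \<Longrightarrow> x < \<xi> (Suc m)"
  shows "jump_profile n \<xi> \<nu> x = \<nu> m"
proof -
  have "jump_profile n \<xi> \<nu> x = (\<Sum>l<n. if l < m then \<nu> (Suc l) - \<nu> l else 0)" unfolding jump_profile_def
    by (rule sum.cong) (use config_order(1)[OF c m] in \<open>auto simp: Suc_le_eq\<close>)
  also have "\<dots> = (\<Sum>l<m. \<nu> (Suc l) - \<nu> l)" by (rule sum.mono_neutral_cong_right) (use m in auto)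
  also have "\<dots> = \<nu> m" using c by (simp add: sum_lessThan_telescope config_def)
  finally show ?thesis .
qed

lemma step_profile_eq:
  assumes v: "valid_index N S" and c: "config (card S) (\<lambda>i. y (enum N S i)) (\<lambda>i. d (enum N S i))"
    and m: "m \<le> card S" "1 \<le> m \<Longrightarrow> y (enum N S m) < x" "m < card S \<Longrightarrow> x < y (enum N S (Suc m))"
  shows "step_profile N S y d x = d (enum N S m)"
proof -
  note o = config_order[OF c m]
  have inner: "pos N y (enum N S i) = ereal (y (enum N S i))" if "1 \<le> i" "i \<le> card S" for i
    using enum_in[OF v that] v by (auto simp: pos_def valid_index_def)
  have left: "pos N y (enum N S i) < ereal x \<longleftrightarrow> i \<le> m" if "i \<le> card S" for i
  proof (cases "i = 0")
    case False then show ?thesis using inner[of i] o(1)[of i] that by simp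
  qed (simp add: pos_def)
  have right: "ereal x < pos N y (enum N S (i + 1)) \<longleftrightarrow> m \<le> i" if "i \<le> card S" for i
  proof (cases "i = card S")
    case False then show ?thesis using inner[of "Suc i"] o(2)[of "Suc i"] that by (simp add: less_Suc_eq_le)
  qed (use m(1) in \<open>simp add: pos_def\<close>)
  have "step_profile N S y d x = (\<Sum>i=0..card S. if i = m then d (enum N S m) else 0)" unfolding step_profile_def
    by (rule sum.cong) (use left right in \<open>auto simp: indicator_def\<close>)
  then show ?thesis using m(1) by simp
qed

lemma step_profile_at_particle:
  assumes v: "valid_index N S" and c: "config (card S) (\<lambda>i. y (enum N S i)) (\<lambda>i. d (enum N S i))"
    and k: "k \<in> {1..card S}" and x: "x = y (enum N S k)"
  shows "step_profile N S y d x = 0"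
proof -
  have inner: "pos N y (enum N S i) = ereal (y (enum N S i))" if "1 \<le> i" "i \<le> card S" for i
    using enum_in[OF v that] v by (auto simp: pos_def valid_index_def)
  have left: "k \<le> i" if "i \<in> {1..card S}" "x \<le> y (enum N S i)" for i
    using config_less[OF c, of i k] k that x by (cases "i < k") auto
  have right: "i \<le> k" if "i \<in> {1..card S}" "y (enum N S i) \<le> x" for i
    using config_less[OF c, of k i] k that x by (cases "k < i") auto
  have "indicator {pos N y (enum N S i)<..<pos N y (enum N S (i + 1))} (ereal x) = (0::real)" if i: "i \<in> {0..card S}" for i
  proof (cases "i < k")
    case True then have "i + 1 \<in> {1..card S}" using k by auto
    moreover have "y (enum N S (i + 1)) \<le> x"
      using config_less[OF c, of "i + 1" k] True k x by (cases "i + 1 = k") auto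
    ultimately show ?thesis using inner[of "i + 1"] by (simp add: indicator_def)
  next
    case False then have "i \<in> {1..card S}" using i k by auto
    moreover have "x \<le> y (enum N S i)" using config_less[OF c, of k i] False k i x by (cases "i = k") auto
    ultimately show ?thesis using inner[of i] by (simp add: indicator_def)
  qed
  then show ?thesis unfolding step_profile_def by (simp add: sum.neutral)
qed

text \<open>With open cells the flux error agrees with \<open>|A v - f(v)|\<close> at the particle positions as well,
  where \<open>v\<close> vanishes.\<close>

definition open_error :: "(real \<Rightarrow> real) \<Rightarrow> nat \<Rightarrow> (nat \<Rightarrow> real) \<Rightarrow> (nat \<Rightarrow> real) \<Rightarrow> real \<Rightarrow> real" where
  "open_error f n \<xi> \<nu> x =
     (\<Sum>i\<in>{1..<n}. \<bar>cell_field f \<xi> \<nu> i x * \<nu> i - f (\<nu> i)\<bar> * indicator {\<xi> i<..<\<xi> (Suc i)} x)"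

lemma open_error_AE: "AE x in lborel. open_error f n \<xi> \<nu> x = flux_error f n \<xi> \<nu> x"
proof -
  have "AE x in lborel. x \<notin> \<xi> ` {1..n}" by (rule AE_not_in[OF finite_imp_null_set_lborel]) simp
  then show ?thesis
  proof (rule eventually_mono)
    fix x assume x: "x \<notin> \<xi> ` {1..n}"
    show "open_error f n \<xi> \<nu> x = flux_error f n \<xi> \<nu> x" unfolding open_error_def flux_error_def
      by (rule sum.cong) (use x in \<open>auto simp: indicator_def\<close>)
  qed
qed

lemma open_error_measurable [measurable]: "open_error f n \<xi> \<nu> \<in> borel_measurable borel"
proof -
  have "cell_field f \<xi> \<nu> i \<in> borel_measurable borel" for i
    by (rule borel_measurable_continuous_onI[OF cell_field_continuous])
  note [measurable] = this
  show ?thesis unfolding open_error_def[abs_def] by measurable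
qed

lemma open_error_nonneg: "0 \<le> open_error f n \<xi> \<nu> x" unfolding open_error_def by (intro sum_nonneg) auto

lemma open_error_integral:
  "integrable lborel (open_error f n \<xi> \<nu>)" "(LBINT x. open_error f n \<xi> \<nu> x) = (LBINT x. flux_error f n \<xi> \<nu> x)"
proof -
  have m: "open_error f n \<xi> \<nu> \<in> borel_measurable lborel" by simp
  have m2: "flux_error f n \<xi> \<nu> \<in> borel_measurable lborel" using flux_error_integrable by (rule borel_measurable_integrable)
  show "integrable lborel (open_error f n \<xi> \<nu>)"
    using integrable_cong_AE[OF m m2 open_error_AE] flux_error_integrable by simp
  show "(LBINT x. open_error f n \<xi> \<nu> x) = (LBINT x. flux_error f n \<xi> \<nu> x)"
    by (rule integral_cong_AE[OF m m2 open_error_AE])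
qed

text \<open>An identity at every point and not only almost everywhere, so that joint measurability
  in space and time is inherited from \<open>open_error\<close>. In the outer cells and at the
  particles both sides are 0.\<close>

lemma (in flux) scheme_error_eq:
  assumes v: "valid_index N S" and c: "config (card S) (\<lambda>i. y (enum N S i)) (\<lambda>i. d (enum N S i))"
    and A: "interpolated_field f N S y d A"
  shows "\<bar>A x * step_profile N S y d x - f (step_profile N S y d x)\<bar>
    = open_error f (card S) (\<lambda>i. y (enum N S i)) (\<lambda>i. d (enum N S i)) x"
proof (cases "\<exists>k\<in>{1..card S}. x = y (enum N S k)")
  case True
  then obtain k where k: "k \<in> {1..card S}" "x = y (enum N S k)" by blast
  have "open_error f (card S) (\<lambda>i. y (enum N S i)) (\<lambda>i. d (enum N S i)) x = 0" unfolding open_error_def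
  proof (rule sum.neutral, rule ballI)
    fix i assume i: "i \<in> {1..<card S}"
    have "x \<notin> {y (enum N S i)<..<y (enum N S (Suc i))}"
    proof (cases "k \<le> i")
      case True then show ?thesis using config_less[OF c, of k i] k i by (cases "k = i") auto
    next
      case False then show ?thesis using config_less[OF c, of "Suc i" k] k i by (cases "k = Suc i") auto
    qed
    then show "\<bar>cell_field f (\<lambda>i. y (enum N S i)) (\<lambda>i. d (enum N S i)) i x * d (enum N S i) - f (d (enum N S i))\<bar>
        * indicator {y (enum N S i)<..<y (enum N S (Suc i))} x = 0" by simp
  qed
  then show ?thesis using step_profile_at_particle[OF v c k] f0 by simp
next
  case False
  let ?\<xi> = "\<lambda>i. y (enum N S i)" and ?\<nu> = "\<lambda>i. d (enum N S i)"
  obtain m where m: "m \<le> card S" "1 \<le> m \<Longrightarrow> ?\<xi> m < x" "m < card S \<Longrightarrow> x < ?\<xi> (Suc m)"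
    by (rule cell_locate[of "card S" x ?\<xi>]) (use False in auto)
  have sp: "step_profile N S y d x = ?\<nu> m" by (rule step_profile_eq[OF v c]) (use m in auto)
  have "open_error f (card S) ?\<xi> ?\<nu> x
      = (\<Sum>i\<in>{1..<card S}. if i = m then \<bar>cell_field f ?\<xi> ?\<nu> m x * ?\<nu> m - f (?\<nu> m)\<bar> else 0)" unfolding open_error_def
  proof (rule sum.cong)
    fix i assume i: "i \<in> {1..<card S}"
    have "x \<in> {?\<xi> i<..<?\<xi> (Suc i)} \<longleftrightarrow> i = m"
      using config_order[OF c m, of i] config_order[OF c m, of "Suc i"] i by auto
    then show "\<bar>cell_field f ?\<xi> ?\<nu> i x * ?\<nu> i - f (?\<nu> i)\<bar> * indicator {?\<xi> i<..<?\<xi> (Suc i)} x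
        = (if i = m then \<bar>cell_field f ?\<xi> ?\<nu> m x * ?\<nu> m - f (?\<nu> m)\<bar> else 0)" by (simp add: indicator_def)
  qed simp
  also have "\<dots> = (if m \<in> {1..<card S} then \<bar>cell_field f ?\<xi> ?\<nu> m x * ?\<nu> m - f (?\<nu> m)\<bar> else 0)" by simp
  also have "\<dots> = \<bar>A x * ?\<nu> m - f (?\<nu> m)\<bar>"
  proof (cases "m \<in> {1..<card S}")
    case True then have "x \<in> {?\<xi> m..?\<xi> (Suc m)}" using m by auto
    then have "A x = cell_field f ?\<xi> ?\<nu> m x"
      using A True unfolding interpolated_field_def Let_def cell_field_def particle_vel_def by auto
    then show ?thesis using True by simp
  next
    case False then have "m = 0 \<or> m = card S" using m(1) by auto
    then have "?\<nu> m = 0" using c by (auto simp: config_def)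
    then show ?thesis using False f0 by simp
  qed
  finally show ?thesis unfolding sp by simp
qed

section \<open>Integration of the flux error over a space-time strip\<close>

context stage_flow
begin

abbreviation error_density :: "real \<times> real \<Rightarrow> real" where
  "error_density z \<equiv> open_error f n (\<lambda>i. \<xi> i (snd z)) (\<lambda>i. \<nu> i (snd z)) (fst z)"

text \<open>The time set \<open>B\<close> is the open stage, possibly with its left endpoint: later
  stages own their starting time, while time 0 lies outside the domain of integration.\<close>

lemma restricted_measurable:
  fixes g :: "real \<Rightarrow> real"
  assumes B: "B \<in> sets borel" "B \<subseteq> {a..<b}" "{a<..<b} \<subseteq> B" and g: "continuous_on {a<..<b} g"
  shows "(\<lambda>t. indicator B t * g t) \<in> borel_measurable borel"
proof -
  have "(\<lambda>t. indicator {a<..<b} t *\<^sub>R g t) \<in> borel_measurable borel"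
    by (rule borel_measurable_continuous_on_indicator[OF _ g]) simp
  then have "(\<lambda>t. indicator {a<..<b} t * g t + indicator (B \<inter> {a}) t * g a) \<in> borel_measurable borel"
    using B(1) by simp
  moreover have "indicator B t * g t = indicator {a<..<b} t * g t + indicator (B \<inter> {a}) t * g a" for t
    using B(2,3) by (cases "t = a"; cases "t \<in> B") (auto simp: indicator_def)
  ultimately show ?thesis by simp
qed

lemma strip_measurable:
  assumes B: "B \<in> sets borel" "B \<subseteq> {a..<b}" "{a<..<b} \<subseteq> B"
  shows "(\<lambda>z. indicator B (snd z) * error_density z) \<in> borel_measurable (borel \<Otimes>\<^sub>M borel)"
proof -
  \<comment> \<open>Cutting off in time makes the coefficients Borel on the whole line; outside the
    stage nothing is known about them.\<close>
  define \<xi>' where "\<xi>' = (\<lambda>i t. indicator B t * \<xi> i t)"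
  define \<nu>' where "\<nu>' = (\<lambda>i t. indicator B t * \<nu> i t)"
  define V where "V = (\<lambda>i t. indicator B t * particle_vel f (\<lambda>i. \<nu> i t) i)"
  let ?e = "\<lambda>i z. if snd z \<in> B \<and> \<xi>' i (snd z) < fst z \<and> fst z < \<xi>' (Suc i) (snd z) then
      \<bar>((\<xi>' (Suc i) (snd z) - fst z) / (\<xi>' (Suc i) (snd z) - \<xi>' i (snd z)) * V i (snd z)
        + (fst z - \<xi>' i (snd z)) / (\<xi>' (Suc i) (snd z) - \<xi>' i (snd z)) * V (Suc i) (snd z)) * \<nu>' i (snd z) - f (\<nu>' i (snd z))\<bar>
      else 0"
  have "\<xi>' i \<in> borel_measurable borel" if "i \<in> {1..n}" for i
    unfolding \<xi>'_def by (rule restricted_measurable[OF B continuous_on_subset[OF cont[OF that]]]) auto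
  moreover have "\<nu>' i \<in> borel_measurable borel" if "i \<le> n" for i
    unfolding \<nu>'_def by (rule restricted_measurable[OF B continuous_on_subset[OF cont_dens[OF that]]]) auto
  moreover have "V i \<in> borel_measurable borel" if "i \<in> {1..n}" for i
    unfolding V_def by (rule restricted_measurable[OF B vcont[OF that]])
  moreover have "f \<in> borel_measurable borel"
    by (rule borel_measurable_continuous_onI[OF lipschitz_on_continuous_on[OF lip]])
  moreover note B(1)
  ultimately have M: "?e i \<in> borel_measurable (borel \<Otimes>\<^sub>M borel)" if i: "i \<in> {1..<n}" for i
  proof -
    have [measurable]: "\<xi>' i \<in> borel_measurable borel" "\<xi>' (Suc i) \<in> borel_measurable borel"
      "\<nu>' i \<in> borel_measurable borel" "V i \<in> borel_measurable borel" "V (Suc i) \<in> borel_measurable borel"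
      "f \<in> borel_measurable borel" "B \<in> sets borel" using \<open>\<And>i. i \<in> {1..n} \<Longrightarrow> \<xi>' i \<in> borel_measurable borel\<close>
        \<open>\<And>i. i \<le> n \<Longrightarrow> \<nu>' i \<in> borel_measurable borel\<close> \<open>\<And>i. i \<in> {1..n} \<Longrightarrow> V i \<in> borel_measurable borel\<close>
        \<open>f \<in> borel_measurable borel\<close> B(1) i by auto
    show ?thesis by measurable
  qed
  have eq: "indicator B (snd z) * error_density z =
      (\<Sum>i\<in>{1..<n}. ?e i z)" for z
  proof (cases "snd z \<in> B")
    case True then have p: "\<xi>' i (snd z) = \<xi> i (snd z)" "\<nu>' i (snd z) = \<nu> i (snd z)"
      "V i (snd z) = particle_vel f (\<lambda>i. \<nu> i (snd z)) i" for i by (simp_all add: \<xi>'_def \<nu>'_def V_def)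
    have "error_density z = (\<Sum>i\<in>{1..<n}. ?e i z)"
      unfolding open_error_def p cell_field_def by (rule sum.cong) (simp_all add: indicator_def True)
    then show ?thesis using True by simp
  qed simp
  show ?thesis unfolding eq by (rule borel_measurable_sum[OF M])
qed

lemma strip_integral:
  assumes B: "B \<in> sets borel" "B \<subseteq> {a..<b}" "{a<..<b} \<subseteq> B"
  shows "integrable lborel (\<lambda>z. indicator B (snd z) * error_density z)"
    "(LBINT z. indicator B (snd z) * error_density z) = (LBINT t:{a<..<b}. stage_error t)"
proof -
  let ?F = "\<lambda>z. indicator B (snd z) * error_density z"
  have m: "?F \<in> borel_measurable (lborel \<Otimes>\<^sub>M lborel)"
    using strip_measurable[OF B] by (simp add: measurable_lborel2 cong: measurable_cong_sets sets_pair_measure_cong)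
  have m': "(\<lambda>(t, x). ?F (x, t)) \<in> borel_measurable (lborel \<Otimes>\<^sub>M lborel)"
    using measurable_pair_swap[OF m] by (simp add: case_prod_beta)
  have inner: "(LBINT x. ?F (x, t)) = indicator B t * stage_error t" for t
    by (simp add: stage_error_def open_error_integral)
  have AEB: "AE t in lborel. indicator B t * stage_error t = indicator {a<..<b} t * stage_error t"
  proof -
    have "AE t in lborel. t \<noteq> a" by (rule AE_lborel_singleton)
    then show ?thesis by (rule eventually_mono) (use B(2,3) in \<open>auto simp: indicator_def\<close>)
  qed
  have im: "(\<lambda>t. indicator B t * stage_error t) \<in> borel_measurable lborel"
    using lborel.borel_measurable_lebesgue_integral[OF m'] by (simp add: stage_error_def open_error_integral)
  have sm: "(\<lambda>t. indicator {a<..<b} t * stage_error t) \<in> borel_measurable lborel"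
    and si: "integrable lborel (\<lambda>t. indicator {a<..<b} t * stage_error t)"
    using stage_error_integrable by (auto simp: set_integrable_def)
  have Ii: "integrable lborel (\<lambda>t. indicator B t * stage_error t)" using integrable_cong_AE[OF im sm AEB] si by simp
  have nn: "norm (?F (x, t)) = ?F (x, t)" for x t using open_error_nonneg by (simp add: indicator_def)
  have "integrable (lborel \<Otimes>\<^sub>M lborel) (\<lambda>(t, x). ?F (x, t))"
  proof (rule lborel_pair.Fubini_integrable[OF m'])
    show "integrable lborel (\<lambda>t. LBINT x. norm (case (t, x) of (t, x) \<Rightarrow> ?F (x, t)))"
      using Ii unfolding split nn inner .
    show "AE t in lborel. integrable lborel (\<lambda>x. case (t, x) of (t, x) \<Rightarrow> ?F (x, t))"
      by (rule AE_I2) (simp add: open_error_integral)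
  qed
  then have P: "integrable (lborel \<Otimes>\<^sub>M lborel) ?F" using lborel_pair.integrable_product_swap_iff[of ?F] by simp
  then show "integrable lborel ?F" by (simp add: lborel_prod)
  have "(LBINT z. ?F z) = (LBINT t. LBINT x. ?F (x, t))"
  proof -
    have "case_prod (\<lambda>x t. ?F (x, t)) = ?F" by (rule ext) (simp add: case_prod_beta)
    with lborel_pair.integral_snd[of "\<lambda>x t. ?F (x, t)"] P show ?thesis by (simp only: lborel_prod)
  qed
  also have "\<dots> = (LBINT t. indicator B t * stage_error t)" unfolding inner ..
  also have "\<dots> = (LBINT t. indicator {a<..<b} t * stage_error t)" by (rule integral_cong_AE[OF im sm AEB])
  finally show "(LBINT z. ?F z) = (LBINT t:{a<..<b}. stage_error t)" by (simp add: set_lebesgue_integral_def)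
qed

end

context particle_system
begin

abbreviation stage_loss :: "nat \<Rightarrow> real" where "stage_loss j \<equiv> (LBINT t:{\<tau> j<..<\<tau> (Suc j)}.
     stage_flow.stage_error f (card (I j)) (\<lambda>i. X (enum N (I j) i)) (\<lambda>i. D (enum N (I j) i)) t)"

text \<open>Every time in the open interval lies in exactly one of the sets \<open>B j\<close>, so
  the integrand is a finite sum of strip integrands, each of which is integrable.\<close>

lemma scheme_error:
  assumes v: "\<And>j t x. j < J \<Longrightarrow> \<tau> j \<le> t \<Longrightarrow> t < \<tau> (Suc j) \<Longrightarrow> v x t = step_profile N (I j) (\<lambda>i. X i t) (\<lambda>i. D i t) x"
    and A: "\<And>j t. j < J \<Longrightarrow> \<tau> j \<le> t \<Longrightarrow> t < \<tau> (Suc j) \<Longrightarrow> interpolated_field f N (I j) (\<lambda>i. X i t) (\<lambda>i. D i t) (\<lambda>x. A x t)"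
  shows "(LBINT z:UNIV \<times> {0<..<T}. \<bar>A (fst z) (snd z) * v (fst z) (snd z) - f (v (fst z) (snd z))\<bar>) = (\<Sum>j<J. stage_loss j)"
proof -
  \<comment> \<open>The intersection with the positive times removes time 0 from the first
    stage.\<close>
  define B where "B = (\<lambda>j. {\<tau> j..<\<tau> (Suc j)} \<inter> {0<..})"
  define e where "e = (\<lambda>j z. open_error f (card (I j)) (\<lambda>i. X (enum N (I j) i) (snd z)) (\<lambda>i. D (enum N (I j) i) (snd z)) (fst z))"
  have B: "B j \<in> sets borel" "B j \<subseteq> {\<tau> j..<\<tau> (Suc j)}" "{\<tau> j<..<\<tau> (Suc j)} \<subseteq> B j" if "j < J" for j
    using tau_mono[of 0 j] tau_0 that by (auto simp: B_def)
  have S: "integrable lborel (\<lambda>z. indicator (B j) (snd z) * e j z)"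
    "(LBINT z. indicator (B j) (snd z) * e j z) = stage_loss j" if "j < J" for j
    unfolding e_def using stage_flow.strip_integral[OF flow[OF that] B[OF that]] by blast+
  have "indicator (UNIV \<times> {0<..<T}) z *\<^sub>R \<bar>A (fst z) (snd z) * v (fst z) (snd z) - f (v (fst z) (snd z))\<bar>
      = (\<Sum>j<J. indicator (B j) (snd z) * e j z)" for z
  proof (cases "snd z \<in> {0<..<T}")
    case False have "snd z \<notin> B j" if "j < J" for j
      using False tau_mono[of "Suc j" J] that tau_J by (auto simp: B_def)
    then show ?thesis using False by (auto simp: indicator_def)
  next
    case True then have "snd z \<in> {0..T}" by auto
    then obtain j where j: "j \<le> J" "if j < J then \<tau> j \<le> snd z \<and> snd z < \<tau> (Suc j) else snd z = T"
      by (rule active_range)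
    have jJ: "j < J" "\<tau> j \<le> snd z" "snd z < \<tau> (Suc j)" using j True by (auto split: if_splits)
    have only: "snd z \<in> B i \<longleftrightarrow> i = j" if "i < J" for i
    proof
      assume "snd z \<in> B i"
      then have "active (snd z) = i" using that by (intro active_eq) (auto simp: B_def)
      moreover have "active (snd z) = j" by (rule active_eq[OF j(2,1)])
      ultimately show "i = j" by simp
    qed (use jJ True in \<open>auto simp: B_def\<close>)
    have "(\<Sum>i<J. indicator (B i) (snd z) * e i z) = (\<Sum>i<J. if i = j then e j z else 0)"
      by (rule sum.cong) (use only in \<open>auto simp: indicator_def\<close>)
    also have "\<dots> = e j z" using jJ(1) by simp
    also have "\<dots> = \<bar>A (fst z) (snd z) * v (fst z) (snd z) - f (v (fst z) (snd z))\<bar>" unfolding e_def v[OF jJ]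
      by (rule scheme_error_eq[symmetric, OF stage_valid[OF j(1)] stage_config[OF jJ(1)] A[OF jJ]]) (use jJ in auto)
    finally show ?thesis using True by (simp add: indicator_def mem_Times_iff)
  qed
  then have "(LBINT z:UNIV \<times> {0<..<T}. \<bar>A (fst z) (snd z) * v (fst z) (snd z) - f (v (fst z) (snd z))\<bar>)
      = (LBINT z. (\<Sum>j<J. indicator (B j) (snd z) * e j z))"
    unfolding set_lebesgue_integral_def by (intro integral_cong) auto
  also have "\<dots> = (\<Sum>j<J. (LBINT z. indicator (B j) (snd z) * e j z))"
    by (rule integral_sum) (use S(1) in auto)
  also have "\<dots> = (\<Sum>j<J. stage_loss j)" by (rule sum.cong) (use S(2) in auto)
  finally show ?thesis .
qed

end

section \<open>The error estimate\<close>

lemma enum_beyond: "card S < i \<Longrightarrow> enum N S i = Suc N" by (simp add: enum_def)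

lemma step_profile_AE:
  assumes v: "valid_index N S" and c: "config (card S) (\<lambda>i. y (enum N S i)) (\<lambda>i. d (enum N S i))"
  shows "AE x in lborel. step_profile N S y d x = jump_profile (card S) (\<lambda>i. y (enum N S i)) (\<lambda>i. d (enum N S i)) x"
proof -
  let ?\<xi> = "\<lambda>i. y (enum N S i)" and ?\<nu> = "\<lambda>i. d (enum N S i)"
  have "AE x in lborel. x \<notin> ?\<xi> ` {1..card S}" by (rule AE_not_in[OF finite_imp_null_set_lborel]) simp
  then show ?thesis
  proof (rule eventually_mono)
    fix x assume "x \<notin> ?\<xi> ` {1..card S}"
    then obtain m where m: "m \<le> card S" "1 \<le> m \<Longrightarrow> ?\<xi> m < x" "m < card S \<Longrightarrow> x < ?\<xi> (Suc m)"
      by (rule_tac cell_locate[of "card S" x ?\<xi>]) auto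
    have "step_profile N S y d x = ?\<nu> m" by (rule step_profile_eq[OF v c]) (use m in auto)
    moreover have "jump_profile (card S) ?\<xi> ?\<nu> x = ?\<nu> m" by (rule jump_profile_eq[OF c]) (use m in auto)
    ultimately show "step_profile N S y d x = jump_profile (card S) ?\<xi> ?\<nu> x" by simp
  qed
qed

lemma step_profile_measurable: "step_profile N S y d \<in> borel_measurable borel"
  unfolding step_profile_def[abs_def] by measurable

lemma step_profile_L1:
  assumes v: "valid_index N S" and c: "config (card S) (\<lambda>i. y (enum N S i)) (\<lambda>i. d (enum N S i))" and w: "integrable lborel w"
  shows "(LBINT x. \<bar>step_profile N S y d x - w x\<bar>)
    = (LBINT x. \<bar>jump_profile (card S) (\<lambda>i. y (enum N S i)) (\<lambda>i. d (enum N S i)) x - w x\<bar>)"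
proof (rule integral_cong_AE)
  have [measurable]: "w \<in> borel_measurable lborel" using w by simp
  note step_profile_measurable[measurable]
  show "(\<lambda>x. \<bar>step_profile N S y d x - w x\<bar>) \<in> borel_measurable lborel" by measurable
  have [measurable]: "jump_profile n \<xi> \<nu> \<in> borel_measurable borel" for n \<xi> \<nu>
    unfolding jump_profile_def[abs_def] by measurable
  show "(\<lambda>x. \<bar>jump_profile (card S) (\<lambda>i. y (enum N S i)) (\<lambda>i. d (enum N S i)) x - w x\<bar>) \<in> borel_measurable lborel"
    by measurable
  show "AE x in lborel. \<bar>step_profile N S y d x - w x\<bar> = \<bar>jump_profile (card S) (\<lambda>i. y (enum N S i)) (\<lambda>i. d (enum N S i)) x - w x\<bar>"
    using step_profile_AE[OF v c] by (rule eventually_mono) simp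
qed

lemma initial_profile_eq: "initial_profile u0 N x0 x = step_profile N {1..N} x0 (initial_density u0 N x0) x"
proof -
  have "card {1..N} = N" by simp
  then show ?thesis unfolding initial_profile_def step_profile_def
    by (simp only:) (rule sum.cong, simp_all add: enum_full del: One_nat_def)
qed

context particle_system
begin

text \<open>The stage estimates are chained through the collisions. The initial datum enters at
  \<open>j = 0\<close>, where the entropy inequality at time 0 replaces \<open>w\<close> by
  \<open>u0\<close>.\<close>

lemma run_estimate:
  assumes cmp: "comparison W om om' r f L u0 T u w"
  defines "sd \<equiv> \<lambda>j. kernel.smoothed_dist W (card (I j)) (\<lambda>i. X (enum N (I j) i) (\<tau> j)) (\<lambda>i. D (enum N (I j) i) (\<tau> j))"
  shows "j \<le> J \<Longrightarrow> sd j (\<lambda>y. w y (\<tau> j)) \<le> sd 0 u0 + (LBINT z. \<bar>om' z\<bar>) * (\<Sum>i<j. stage_loss i)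
    \<and> total_jump (card (I j)) (\<lambda>i. D (enum N (I j) i) (\<tau> j)) \<le> total_jump (card (I 0)) (\<lambda>i. D (enum N (I 0) i) 0)"
proof (induction j)
  case 0
  interpret C: comparison W om om' r f L u0 T u w by (rule cmp)
  have "run_config N (I 0) X D 0" using stage_start[of 0] tau_0 by simp
  from C.frozen_config_inequality(2)[OF this] show ?case by (simp add: sd_def tau_0)
next
  case (Suc j) then have j: "j < J" by simp
  let ?n = "card (I j)" and ?p = "enum N (I j)"
  interpret C: comparison W om om' r f L u0 T u w by (rule cmp)
  interpret S: stage_comparison W om om' r f L u0 T u w ?n "\<lambda>i. X (?p i)" "\<lambda>i. D (?p i)" "\<tau> j" "\<tau> (Suc j)"
    by (intro stage_comparison.intro stage_comparison_axioms.intro cmp flow[OF j])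
       (use tau_mono[of 0 j] tau_mono[of "Suc j" J] tau_0 tau_J j in auto)
  have v: "valid_index N (I j)" "run_config N (I j) X D (\<tau> j)" using stage_start[of j] j by auto
  note nx = particle_stage_next[OF stage[OF j] v D_ends]
  have K: "S.kept = survivors ?n (\<lambda>i. X (?p i) (\<tau> (Suc j)))" by (simp add: S.kept_def)
  have lim: "(D (?p i) \<longlongrightarrow> D (?p i) (\<tau> (Suc j))) (at_left (\<tau> (Suc j)))" if "i \<in> S.kept" for i
    using nx(7) that K by simp
  have ends: "D (?p 0) (\<tau> (Suc j)) = 0" "D (?p ?n) (\<tau> (Suc j)) = 0"
    using D_ends by (simp_all add: enum_card[OF v(1)])
  have cK: "card (I (Suc j)) = card S.kept" using nx(5) K by simp
  have pK: "enum N (I (Suc j)) i = ?p (S.kept_enum i)" for i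
  proof (cases "i \<le> card S.kept")
    case True then show ?thesis using nx(6)[of i] K by (simp add: S.kept_enum_def)
  next
    case False then have "enum N (I (Suc j)) i = Suc N" "S.kept_enum i = Suc ?n"
      using cK by (simp_all add: S.kept_enum_def enum_beyond)
    then show ?thesis by simp
  qed
  have "sd (Suc j) (\<lambda>y. w y (\<tau> (Suc j))) \<le> sd j (\<lambda>y. w y (\<tau> j)) + (LBINT z. \<bar>om' z\<bar>) * stage_loss j"
    using S.collision_estimate[OF lim ends] unfolding sd_def pK cK S.om'_norm_def .
  moreover have "total_jump (card (I (Suc j))) (\<lambda>i. D (enum N (I (Suc j)) i) (\<tau> (Suc j))) \<le> total_jump ?n (\<lambda>i. D (?p i) (\<tau> j))"
    using S.kept_total_jump[OF lim ends] unfolding pK cK .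
  ultimately show ?case using Suc.IH j by (simp add: algebra_simps)
qed

text \<open>The cost of smoothing is governed by the variation of the densities at both ends.
  Initially it is at most that of \<open>u0\<close> because cell averaging does not increase it, and
  finally because neither stages nor collisions do.\<close>

lemma regularised_error:
  fixes v A :: "real \<Rightarrow> real \<Rightarrow> real"
  assumes data: "entropy_data f L u0 T u w" and bv: "finite_BV u0" and e: "0 < e"
    and v: "\<And>j t x. j \<le> J \<Longrightarrow> in_stage j t \<Longrightarrow>
      v x t = step_profile N (I j) (\<lambda>i. X i t) (\<lambda>i. D i t) x"
  shows "(LBINT x. \<bar>v x T - w x T\<bar>)
    \<le> (LBINT x. \<bar>initial_profile u0 N x0 x - u0 x\<bar>) + 2 * e * total_var u0 + (\<Sum>j<J. stage_loss j) / e"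
proof -
  obtain W om om' r where W: "kernel W om om' r" and M: "(LBINT z. \<bar>om' z\<bar>) \<le> 1 / e"
    and \<alpha>: "(LBINT z. kernel_tail W z) \<le> e" using kernel_exists[OF e] by (elim exE conjE) (rule that)
  interpret K: kernel W om om' r by (rule W)
  interpret E: entropy_data f L u0 T u w by (rule data)
  have cmp: "comparison W om om' r f L u0 T u w" by (intro comparison.intro kernel_flux.intro W data flux_axioms)
  let ?V = "\<lambda>j. jump_profile (card (I j)) (\<lambda>i. X (enum N (I j) i) (\<tau> j)) (\<lambda>i. D (enum N (I j) i) (\<tau> j))"
  let ?sd = "\<lambda>j. K.smoothed_dist (card (I j)) (\<lambda>i. X (enum N (I j) i) (\<tau> j)) (\<lambda>i. D (enum N (I j) i) (\<tau> j))"
  let ?\<alpha> = "LBINT z. kernel_tail W z"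
  let ?TV = "\<lambda>j. total_jump (card (I j)) (\<lambda>i. D (enum N (I j) i) (\<tau> j))"
  let ?E = "\<Sum>j<J. stage_loss j"
  have c: "valid_index N (I j) \<and> run_config N (I j) X D (\<tau> j)" if "j \<le> J" for j using stage_start[OF that] .
  have E0: "0 \<le> ?E"
  proof (rule sum_nonneg)
    fix j assume "j \<in> {..<J}"
    then interpret F: stage_flow f L "card (I j)" "\<lambda>i. X (enum N (I j) i)" "\<lambda>i. D (enum N (I j) i)" "\<tau> j" "\<tau> (Suc j)"
      by (intro flow) simp
    show "0 \<le> stage_loss j"
      unfolding set_lebesgue_integral_def by (rule integral_nonneg) (simp add: F.stage_error_nonneg)
  qed
  have card0: "card (I 0) = N" by (simp add: I_0)
  have D0: "D (enum N (I 0) i) (\<tau> 0) = initial_density u0 N x0 i" if "i \<le> N" for i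
    using that by (simp add: I_0 enum_full tau_0 initial_stage(2) del: One_nat_def)
  have TV0: "?TV 0 \<le> total_var u0"
  proof -
    have "?TV 0 = total_jump N (initial_density u0 N x0)"
      unfolding total_jump_def card0 using D0 by (intro sum.cong) auto
    then show ?thesis using total_jump_initial[OF E.u0_int bv conf0] by simp
  qed
  have wT: "integrable lborel (\<lambda>x. w x T)" by (rule E.w_int) (use T_pos in simp)
  have \<alpha>0: "0 \<le> ?\<alpha>" by (rule integral_nonneg) (use K.W_nonneg K.W_le_1 in \<open>auto simp: kernel_tail_def\<close>)
  have run: "?sd J (\<lambda>y. w y (\<tau> J)) \<le> ?sd 0 u0 + (LBINT z. \<bar>om' z\<bar>) * ?E" "?TV J \<le> ?TV 0"
    using run_estimate[OF cmp order_refl] by (simp_all add: tau_0)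
  have TVJ: "?\<alpha> * ?TV J \<le> e * total_var u0" using \<alpha> \<alpha>0 run(2) TV0 total_jump_nonneg by (intro mult_mono) auto
  have TV0': "?\<alpha> * ?TV 0 \<le> e * total_var u0" using \<alpha> \<alpha>0 TV0 total_jump_nonneg by (intro mult_mono) auto
  have ME: "(LBINT z. \<bar>om' z\<bar>) * ?E \<le> ?E / e" using mult_right_mono[OF M E0] by simp
  have "(LBINT x. \<bar>v x T - w x T\<bar>) = (LBINT x. \<bar>?V J x - w x T\<bar>)"
  proof -
    have "v x T = step_profile N (I J) (\<lambda>i. X i (\<tau> J)) (\<lambda>i. D i (\<tau> J)) x" for x using v[of J T x] tau_J by simp
    then show ?thesis using step_profile_L1[OF _ _ wT, of N "I J" "\<lambda>i. X i (\<tau> J)" "\<lambda>i. D i (\<tau> J)"] c[of J] by simp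
  qed
  also have "\<dots> \<le> ?sd J (\<lambda>y. w y (\<tau> J)) + ?\<alpha> * ?TV J"
    using K.smoothed_dist_vs_L1[OF conjunct2[OF c[OF order_refl]] wT] by (simp add: tau_J abs_le_iff)
  also have "\<dots> \<le> ?sd 0 u0 + ?E / e + e * total_var u0" using run(1) ME TVJ by linarith
  also have "?sd 0 u0 \<le> (LBINT x. \<bar>?V 0 x - u0 x\<bar>) + e * total_var u0"
    using K.smoothed_dist_vs_L1[OF conjunct2[OF c[of 0]] E.u0_int] TV0' by (simp add: abs_le_iff)
  also have "(LBINT x. \<bar>?V 0 x - u0 x\<bar>) = (LBINT x. \<bar>initial_profile u0 N x0 x - u0 x\<bar>)"
  proof -
    have "initial_profile u0 N x0 x = step_profile N (I 0) (\<lambda>i. X i (\<tau> 0)) (\<lambda>i. D i (\<tau> 0)) x" for x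
    proof -
      have N: "1 \<le> N" using conf0 by (simp add: config_def)
      show ?thesis unfolding initial_profile_eq I_0[symmetric] tau_0
        by (rule step_profile_cong[symmetric, OF initial_stage(1)]) (use N in \<open>auto simp: I_0 initial_stage\<close>)
    qed
    then show ?thesis
      using step_profile_L1[OF _ _ E.u0_int, of N "I 0" "\<lambda>i. X i (\<tau> 0)" "\<lambda>i. D i (\<tau> 0)"] c[of 0] by simp
  qed
  finally show ?thesis by (simp add: algebra_simps)
qed

end

text \<open>The minimum of the right-hand side over \<open>e\<close> is attained at \<open>e = sqrt (E / (2 V))\<close>.\<close>

lemma optimise_regularisation:
  fixes a b V E :: real
  assumes le: "\<And>e. 0 < e \<Longrightarrow> a \<le> b + 2 * e * V + E / e" and V: "0 \<le> V" and E: "0 \<le> E"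
  shows "a \<le> b + 2 * sqrt (2 * V * E)"
proof -
  consider "V = 0" | "E = 0" | "0 < V" "0 < E" using V E by linarith
  then show ?thesis
  proof cases
    \<comment> \<open>Without variation, the width of the kernel may be sent to infinity.\<close>
    case 1 have "a \<le> b"
    proof (rule field_le_epsilon)
      fix e :: real assume e: "0 < e"
      have "E / ((E + 1) / e) \<le> e" using e E by (simp add: field_simps)
      moreover have "a \<le> b + E / ((E + 1) / e)" using le[of "(E + 1) / e"] e E 1 by simp
      ultimately show "a \<le> b + e" by linarith
    qed
    then show ?thesis using 1 by simp
  next
    \<comment> \<open>Without flux error, the width of the kernel may be sent to 0; the 1 keeps the
      divisor positive.\<close>
    case 2 have "a \<le> b"
    proof (rule field_le_epsilon)
      fix e :: real assume e: "0 < e"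
      have "2 * (e / (2 * V + 1)) * V \<le> e" using e V by (simp add: field_simps)
      moreover have "a \<le> b + 2 * (e / (2 * V + 1)) * V" using le[of "e / (2 * V + 1)"] e V 2 by simp
      ultimately show "a \<le> b + e" by linarith
    qed
    then show ?thesis using 2 by simp
  next
    case 3
    define e where "e = sqrt (E / (2 * V))"
    have e: "0 < e" "e * e = E / (2 * V)" using 3 by (auto simp: e_def)
    have "sqrt (2 * V * E) = 2 * e * V"
      by (rule real_sqrt_unique) (use e 3 in \<open>auto simp: power2_eq_square field_simps\<close>)
    moreover have "E / e = 2 * e * V" using e 3 by (simp add: field_simps)
    ultimately show ?thesis using le[OF e(1)] by linarith
  qed
qed

theorem theorem1p1:
  fixes f u0 :: "real \<Rightarrow> real" and T :: real and N :: nat and x0 :: "nat \<Rightarrow> real"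
  assumes "T > 0"
    and "\<exists>L. L-lipschitz_on UNIV f" and "f 0 = 0" and "f differentiable (at 0)"
    and "integrable lborel u0" and "finite_BV u0" and "AE x in lborel. 0 \<le> u0 x"
    and "N \<ge> 1" and "strict_mono_on {1..N} x0"
  shows "(\<exists>v A. particle_scheme f u0 T N x0 v A) \<and>
    (\<forall>v A v' A'. particle_scheme f u0 T N x0 v A \<and> particle_scheme f u0 T N x0 v' A'
       \<longrightarrow> (\<forall>x. \<forall>t\<in>{0..T}. v x t = v' x t)) \<and>
    (\<forall>v A u w. particle_scheme f u0 T N x0 v A \<and>
       entropy_solution f u0 T u \<and> L1_continuous_representative T u w \<longrightarrow>
       (LINT x|lborel. \<bar>v x T - w x T\<bar>)
       \<le> (LINT x|lborel. \<bar>initial_profile u0 N x0 x - u0 x\<bar>)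
         + 2 * sqrt (2 * total_var u0 *
             (LINT z:UNIV \<times> {0<..<T}|lborel.
                \<bar>A (fst z) (snd z) * v (fst z) (snd z) - f (v (fst z) (snd z))\<bar>)))"
proof -
  obtain L where L: "L-lipschitz_on UNIV f" using assms(2) by blast
  interpret F: flux f L by unfold_locales (use L assms in auto)
  have conf: "config N x0 (initial_density u0 N x0)" by (rule initial_config) (use assms in auto)
  have sys: "particle_system f L u0 T N x0 J \<tau> I X D" if "particle_run f u0 T N x0 J \<tau> I X D" for J \<tau> I X D
    by (intro particle_system.intro particle_system_axioms.intro F.flux_axioms assms(1) conf that)
  show ?thesis
  proof (intro conjI allI impI)
    obtain J \<tau> I X D where "particle_run f u0 T N x0 J \<tau> I X D" by (rule F.particle_run_exists[OF assms(1) conf])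
    then show "\<exists>v A. particle_scheme f u0 T N x0 v A" by (rule particle_system.scheme_exists[OF sys])
  next
    fix v A v' A' x
    assume *: "particle_scheme f u0 T N x0 v A \<and> particle_scheme f u0 T N x0 v' A'"
    show "\<forall>t\<in>{0..T}. v x t = v' x t"
    proof
      fix t assume t: "t \<in> {0..T}"
      from * obtain J \<tau> I X D J2 \<tau>2 I2 X2 D2
        where R: "particle_run f u0 T N x0 J \<tau> I X D" "particle_run f u0 T N x0 J2 \<tau>2 I2 X2 D2"
          and v: "\<forall>j\<le>J. \<forall>t. (if j < J then \<tau> j \<le> t \<and> t < \<tau> (Suc j) else t = T) \<longrightarrow>
            (\<forall>x. v x t = step_profile N (I j) (\<lambda>i. X i t) (\<lambda>i. D i t) x) \<and>
             interpolated_field f N (I j) (\<lambda>i. X i t) (\<lambda>i. D i t) (\<lambda>x. A x t)"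
          and v': "\<forall>j\<le>J2. \<forall>t. (if j < J2 then \<tau>2 j \<le> t \<and> t < \<tau>2 (Suc j) else t = T) \<longrightarrow>
            (\<forall>x. v' x t = step_profile N (I2 j) (\<lambda>i. X2 i t) (\<lambda>i. D2 i t) x) \<and>
             interpolated_field f N (I2 j) (\<lambda>i. X2 i t) (\<lambda>i. D2 i t) (\<lambda>x. A' x t)"
        unfolding particle_scheme_def by (elim exE conjE) (rule that; assumption)
      show "v x t = v' x t"
      proof (rule particle_system.profile_unique[where v=v and ?v2.0=v' and x=x and t=t, OF sys[OF R(1)] sys[OF R(2)] _ _ t])
        show "v x t = step_profile N (I j) (\<lambda>i. X i t) (\<lambda>i. D i t) x"
          if "j \<le> J" "if j < J then \<tau> j \<le> t \<and> t < \<tau> (Suc j) else t = T" for j t x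
          by (rule spec[OF conjunct1[OF mp[OF spec[OF mp[OF spec[OF v, of j] that(1)], of t] that(2)]], of x])
        show "v' x t = step_profile N (I2 j) (\<lambda>i. X2 i t) (\<lambda>i. D2 i t) x"
          if "j \<le> J2" "if j < J2 then \<tau>2 j \<le> t \<and> t < \<tau>2 (Suc j) else t = T" for j t x
          by (rule spec[OF conjunct1[OF mp[OF spec[OF mp[OF spec[OF v', of j] that(1)], of t] that(2)]], of x])
      qed
    qed
  next
    fix v A u w
    assume *: "particle_scheme f u0 T N x0 v A \<and> entropy_solution f u0 T u \<and> L1_continuous_representative T u w"
    then obtain J \<tau> I X D where R: "particle_run f u0 T N x0 J \<tau> I X D"
      and vA: "\<forall>j\<le>J. \<forall>t. (if j < J then \<tau> j \<le> t \<and> t < \<tau> (Suc j) else t = T) \<longrightarrow>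
            (\<forall>x. v x t = step_profile N (I j) (\<lambda>i. X i t) (\<lambda>i. D i t) x) \<and>
             interpolated_field f N (I j) (\<lambda>i. X i t) (\<lambda>i. D i t) (\<lambda>x. A x t)"
      unfolding particle_scheme_def by (elim exE conjE) (rule that; assumption)
    interpret P: particle_system f L u0 T N x0 J \<tau> I X D by (rule sys[OF R])
    have data: "entropy_data f L u0 T u w"
      using * assms by (intro entropy_data.intro entropy_data_axioms.intro F.flux_axioms) auto
    have v: "v x t = step_profile N (I j) (\<lambda>i. X i t) (\<lambda>i. D i t) x"
      if "j \<le> J" "if j < J then \<tau> j \<le> t \<and> t < \<tau> (Suc j) else t = T" for j t x
      by (rule spec[OF conjunct1[OF mp[OF spec[OF mp[OF spec[OF vA, of j] that(1)], of t] that(2)]], of x])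
    have v': "v x t = step_profile N (I j) (\<lambda>i. X i t) (\<lambda>i. D i t) x" if "j < J" "\<tau> j \<le> t" "t < \<tau> (Suc j)" for j t x
      by (rule v) (use that in auto)
    have A: "interpolated_field f N (I j) (\<lambda>i. X i t) (\<lambda>i. D i t) (\<lambda>x. A x t)" if "j < J" "\<tau> j \<le> t" "t < \<tau> (Suc j)" for j t
    proof -
      have j: "j \<le> J" "if j < J then \<tau> j \<le> t \<and> t < \<tau> (Suc j) else t = T" using that by auto
      show ?thesis by (rule conjunct2[OF mp[OF spec[OF mp[OF spec[OF vA, of j] j(1)], of t] j(2)]])
    qed
    let ?E = "LBINT z:UNIV \<times> {0<..<T}. \<bar>A (fst z) (snd z) * v (fst z) (snd z) - f (v (fst z) (snd z))\<bar>"
    have E: "?E = (\<Sum>j<J. P.stage_loss j)" by (rule P.scheme_error[OF v' A])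
    show "(LBINT x. \<bar>v x T - w x T\<bar>) \<le> (LBINT x. \<bar>initial_profile u0 N x0 x - u0 x\<bar>) + 2 * sqrt (2 * total_var u0 * ?E)"
    proof (rule optimise_regularisation)
      show "(LBINT x. \<bar>v x T - w x T\<bar>)
          \<le> (LBINT x. \<bar>initial_profile u0 N x0 x - u0 x\<bar>) + 2 * e * total_var u0 + ?E / e" if "0 < e" for e
        unfolding E by (rule P.regularised_error[OF data assms(6) that v])
      \<comment> \<open>The variation dominates the total jump of the initial densities, which is a
        sum of moduli.\<close>
      show "0 \<le> total_var u0"
        using total_jump_initial[OF assms(5,6) conf] total_jump_nonneg[of N] by (rule order_trans[rotated])
      show "0 \<le> ?E" unfolding set_lebesgue_integral_def by (rule integral_nonneg) simp
    qed
  qed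
qed

end
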